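(* Let $\mathcal H$, $f$ (with non-smooth point $n_f$) and $J$ satisfy all the assumptions listed in the context. Let $\bar\ell$ be a local optimum of the optimal control problem (P) with associated state $(\bar q,\bar\varphi)=S(\bar\ell)\in H^1_0(0,T;L^2(\Omega))\times L^2(0,T;H^1(\Omega))$, and put $\bar z:=-\beta(\bar q-\bar\varphi)-(f\circ\mathcal H)(\bar q)$. Then there exist adjoint states $\xi\in H^1_T(0,T;L^2(\Omega))$ and $w\in L^2(0,T;H^1(\Omega))$ and multipliers $\lambda\in L^\infty(0,T;L^2(\Omega))$ and $\mu\in L^\infty(0,T;L^2(\Omega))$ such that $$-\dot\xi-\beta(w-\lambda)+\mathcal H'(\bar q)^\star(\mu)=\partial_q j(\bar q,\bar\varphi)\ \text{ in }L^2(0,T;L^2(\Omega)),\qquad\xi(T)=0,$$ $$-\alpha\Delta w+\beta(w-\lambda)=\partial_\varphi j(\bar q,\bar\varphi)\ \text{ in }L^2(0,T;H^1(\Omega)^* ),$$ $$\lambda(t,x)=\tfrac1\epsilon\chi_{\{\bar z>0\}}(t,x)\,\xi(t,x)\ \text{ a.e. where }\bar z(t,x)\neq0,$$ $$\mu(t,x)=f'(\mathcal H(\bar q)(t,x))\,\lambda(t,x)\ \text{ a.e. where }\mathcal H(\bar q)(t,x)\neq n_f,$$ $$(w,\delta\ell)_{L^2(0,T;L^2(\Omega))}+(\bar\ell,\delta\ell)_{H^1(0,T;L^2(\Omega))}=0\quad\forall\,\delta\ell\in H^1(0,T;L^2(\Omega)).$$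
   Context: Setting: $T>0$; $\Omega\subset\mathbb R^N$, $N\in\{2,3\}$, is a bounded Lipschitz domain; $\alpha,\beta,\epsilon>0$ are constants ($\epsilon$ is the viscosity parameter, unrelated to the regularization parameter $\varepsilon$ below). $\Delta:H^1(\Omega)\to H^1(\Omega)^*$ is given by $\langle\Delta\eta,\psi\rangle=-\int_\Omega\nabla\eta\cdot\nabla\psi\,dx$. $\max(x):=\max\{x,0\}$. Scalar functions also denote their Nemytskii operators. $H^1_0(0,T;X)=\{z\in H^1(0,T;X):z(0)=0\}$, $H^1_T(0,T;X)=\{z\in H^1(0,T;X):z(T)=0\}$. A dot is the time derivative, $\chi_M$ a characteristic function, $A^\star$ the (Hilbert space) adjoint of a bounded linear operator $A$ on $L^2(0,T;L^2(\Omega))$. Assumptions on $\mathcal H$: (a) $\mathcal H:L^2(0,T;L^2(\Omega))\to L^2(0,T;L^2(\Omega))$ and there is $L_{\mathcal H}>0$ with $\|\mathcal H(q_1)(t)-\mathcal H(q_2)(t)\|_{L^2(\Omega)}\le L_{\mathcal H}\int_0^t\|q_1(s)-q_2(s)\|_{L^2(\Omega)}ds$ a.e. in $(0,T)$ for all $q_1,q_2$; (b) $\mathcal H$ is Gâteaux differentiable on $L^2(0,T;L^2(\Omega))$, with derivative $q\mapsto\mathcal H'(q)$ continuous on $H^1(0,T;L^2(\Omega))$; (c) $\mathcal H$ maps $L^2(0,T;L^\infty(\Omega))$ to itself and $\|\mathcal H(q_1)(t)-\mathcal H(q_2)(t)\|_{L^\infty(\Omega)}\le\widehat L_{\mathcal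 H}\int_0^t\|q_1(s)-q_2(s)\|_{L^\infty(\Omega)}ds$ a.e. in $(0,T)$ for all $q_1,q_2\in L^2(0,T;L^\infty(\Omega))$, with some $\widehat L_{\mathcal H}>0$. Assumptions on $f:\mathbb R\to\mathbb R$: $f$ is Lipschitz continuous with constant $L_f>0$, directionally differentiable, and has a single non-differentiable point $n_f\in\mathbb R$. For every $\varepsilon>0$ there is a continuously differentiable $f_\varepsilon:\mathbb R\to\mathbb R$ such that: $|f_\varepsilon(v)-f(v)|\le C\varepsilon$ for all $v\in\mathbb R$ with $C>0$ independent of $\varepsilon$; $f_\varepsilon$ is Lipschitz with constant $\hat L_f>0$ independent of $\varepsilon$; for every $\delta>0$, $f_\varepsilon'\to f'$ uniformly on $(-\infty,n_f-\delta]\cup[n_f+\delta,\infty)$ as $\varepsilon\searrow0$. State system: for every $\ell\in L^2(0,T;H^1(\Omega)^* )$ there is a unique $(q,\varphi)=:S(\ell)\in H^1_0(0,T;L^2(\Omega))\times L^2(0,T;H^1(\Omega))$ such that, a.e. in $(0,T)$, $\dot q(t)=\frac1\epsilon\max(-\beta(q(t)-\varphi(t))-(f\circ\mathcal H)(q)(t))$ in $L^2(\Omega)$, $q(0)=0$, and $-\alpha\Delta\varphi(t)+\beta\varphi(t)=\beta q(t)+\ell(t)$ in $H^1(\Omega)^*$. Problem (P): minimize $J(S(\ell),\ell)$ over $\ell\in H^1(0,T;L^2(\Omega))$, where $J(q,\varphi,\ell)=j(q,\varphi)+\frac12\|\ell\|^2_{H^1(0,T;L^2(\Omega))}$ and $j:L^2(0,T;L^2(\Omega))\times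 L^2(0,T;H^1(\Omega))\to\mathbb R$ is continuously Fréchet differentiable. Local optimality is with respect to the $H^1(0,T;L^2(\Omega))$-norm. *)

theory Defs
  imports "HOL-Analysis.Analysis" "HOL-Probability.Essential_Supremum"
begin

text \<open>
  Elements of Lebesgue, Sobolev and Bochner spaces are represented by functions, and equality in
  such a space is equality up to a null set. A time-dependent function is a curried function
  \<open>u t x\<close>; as \<open>u t\<close> is determined only up to a null set in \<open>\<Omega>\<close>, for almost every \<open>t\<close>, statements
  that hold almost everywhere in space-time are written as "for a.e. \<open>t\<close>, for a.e. \<open>x\<close>", which
  does not depend on the representatives.
\<close>

section \<open>Function spaces on the domain\<close>

definition lipschitz_domain :: "'a::euclidean_space set \<Rightarrow> bool" where
  "lipschitz_domain \<Omega> \<longleftrightarrow> open \<Omega> \<and> connected \<Omega> \<and> \<Omega> \<noteq> {} \<and>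
     (\<forall>p\<in>frontier \<Omega>. \<exists>r>0. \<exists>e \<gamma> L. norm e = 1 \<and> L-lipschitz_on {y. y \<bullet> e = 0} \<gamma> \<and>
        \<Omega> \<inter> ball p r = {y \<in> ball p r. \<gamma> (y - (y \<bullet> e) *\<^sub>R e) < y \<bullet> e})"

text \<open>A function is of class \<open>C\<^sup>k\<^sup>+\<^sup>1\<close> iff it is differentiable with partial derivatives of class
  \<open>C\<^sup>k\<close>.\<close>

primrec C_class :: "nat \<Rightarrow> ('a::euclidean_space \<Rightarrow> real) \<Rightarrow> bool" where
  "C_class 0 f = continuous_on UNIV f"
| "C_class (Suc k) f = ((\<forall>x. f differentiable (at x)) \<and>
     (\<forall>b\<in>Basis. C_class k (\<lambda>x. frechet_derivative f (at x) b)))"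

definition test_function :: "'a::euclidean_space set \<Rightarrow> ('a \<Rightarrow> real) \<Rightarrow> bool" where
  "test_function U \<phi> \<longleftrightarrow> (\<forall>k. C_class k \<phi>) \<and>
     compact (closure {x. \<phi> x \<noteq> 0}) \<and> closure {x. \<phi> x \<noteq> 0} \<subseteq> U"

text \<open>A space of real functions on \<open>'x\<close> with a seminorm. Besides function spaces on the domain this
  covers the dual space of \<open>H\<^sup>1\<close>, whose elements are functionals on functions.\<close>

datatype 'x nspace = NSpace (elems: "('x \<Rightarrow> real) set") (nrm: "('x \<Rightarrow> real) \<Rightarrow> real")

definition L2 :: "'a::euclidean_space set \<Rightarrow> 'a nspace" where
  "L2 \<Omega> = NSpace
     {u \<in> borel_measurable (lebesgue_on \<Omega>). integrable (lebesgue_on \<Omega>) (\<lambda>x. (u x)\<^sup>2)}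
     (\<lambda>u. sqrt (LINT x|lebesgue_on \<Omega>. (u x)\<^sup>2))"

definition Linf :: "'a::euclidean_space set \<Rightarrow> 'a nspace" where
  "Linf \<Omega> = NSpace
     {u \<in> borel_measurable (lebesgue_on \<Omega>). esssup (lebesgue_on \<Omega>) (\<lambda>x. ereal \<bar>u x\<bar>) < \<infinity>}
     (\<lambda>u. real_of_ereal (esssup (lebesgue_on \<Omega>) (\<lambda>x. ereal \<bar>u x\<bar>)))"

definition is_weak_grad :: "'a::euclidean_space set \<Rightarrow> ('a \<Rightarrow> real) \<Rightarrow> ('a \<Rightarrow> 'a) \<Rightarrow> bool" where
  "is_weak_grad \<Omega> u g \<longleftrightarrow> (\<forall>b\<in>Basis. (\<lambda>x. g x \<bullet> b) \<in> elems (L2 \<Omega>) \<and>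
     (\<forall>\<phi>. test_function \<Omega> \<phi> \<longrightarrow>
        (LINT x|lebesgue_on \<Omega>. u x * frechet_derivative \<phi> (at x) b) =
        - (LINT x|lebesgue_on \<Omega>. (g x \<bullet> b) * \<phi> x)))"

definition weak_grad :: "'a::euclidean_space set \<Rightarrow> ('a \<Rightarrow> real) \<Rightarrow> 'a \<Rightarrow> 'a" where
  "weak_grad \<Omega> u = (SOME g. is_weak_grad \<Omega> u g)"

definition H1 :: "'a::euclidean_space set \<Rightarrow> 'a nspace" where
  "H1 \<Omega> = NSpace
     {u \<in> elems (L2 \<Omega>). \<exists>g. is_weak_grad \<Omega> u g}
     (\<lambda>u. sqrt ((LINT x|lebesgue_on \<Omega>. (u x)\<^sup>2) +
                (LINT x|lebesgue_on \<Omega>. (norm (weak_grad \<Omega> u x))\<^sup>2)))"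

definition dual :: "'x nspace \<Rightarrow> ('x \<Rightarrow> real) nspace" where
  "dual X = NSpace
     {F. (\<forall>u\<in>elems X. \<forall>v\<in>elems X. F (\<lambda>x. u x + v x) = F u + F v) \<and>
         (\<forall>c. \<forall>u\<in>elems X. F (\<lambda>x. c * u x) = c * F u) \<and>
         (\<exists>C. \<forall>u\<in>elems X. \<bar>F u\<bar> \<le> C * nrm X u)}
     (\<lambda>F. Sup {\<bar>F u\<bar> | u. u \<in> elems X \<and> nrm X u \<le> 1})"

text \<open>The embedding of \<open>L\<^sup>2(\<Omega>)\<close> into the dual space of \<open>H\<^sup>1(\<Omega>)\<close>.\<close>

definition emb :: "'a::euclidean_space set \<Rightarrow> ('a \<Rightarrow> real) \<Rightarrow> ('a \<Rightarrow> real) \<Rightarrow> real" where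
  "emb \<Omega> u = (\<lambda>\<psi>. LINT x|lebesgue_on \<Omega>. u x * \<psi> x)"

definition laplacian :: "'a::euclidean_space set \<Rightarrow> ('a \<Rightarrow> real) \<Rightarrow> ('a \<Rightarrow> real) \<Rightarrow> real" where
  "laplacian \<Omega> \<eta> = (\<lambda>\<psi>. - (LINT x|lebesgue_on \<Omega>. weak_grad \<Omega> \<eta> x \<bullet> weak_grad \<Omega> \<psi> x))"


section \<open>Bochner spaces on the time interval\<close>

abbreviation tm :: "real \<Rightarrow> real measure" where
  "tm T \<equiv> lebesgue_on {0<..<T}"

text \<open>\<open>s\<close> is an \<open>X\<close>-valued simple function on \<open>(0,T)\<close> with integral \<open>J\<close>. The library's Bochner
  integral is not applicable: it needs separable Banach space types.\<close>

definition simple_int :: "real \<Rightarrow> 'x nspace \<Rightarrow> (real \<Rightarrow> 'x \<Rightarrow> real) \<Rightarrow> ('x \<Rightarrow> real) \<Rightarrow> bool" where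
  "simple_int T X s J \<longleftrightarrow> (\<exists>(m::nat) E y.
     (\<forall>k<m. E k \<in> sets lebesgue \<and> E k \<subseteq> {0<..<T} \<and> y k \<in> elems X) \<and>
     s = (\<lambda>t x. \<Sum>k<m. indicator (E k) t * y k x) \<and>
     J = (\<lambda>x. \<Sum>k<m. measure lebesgue (E k) * y k x))"

definition strongly_meas :: "real \<Rightarrow> 'x nspace \<Rightarrow> (real \<Rightarrow> 'x \<Rightarrow> real) \<Rightarrow> bool" where
  "strongly_meas T X u \<longleftrightarrow> (AE t in tm T. u t \<in> elems X) \<and>
     (\<exists>s. (\<forall>n::nat. \<exists>J. simple_int T X (s n) J) \<and>
          (AE t in tm T. (\<lambda>n. nrm X (\<lambda>x. u t x - s n t x)) \<longlonglongrightarrow> 0))"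

definition has_bochner_int :: "real \<Rightarrow> 'x nspace \<Rightarrow> (real \<Rightarrow> 'x \<Rightarrow> real) \<Rightarrow> ('x \<Rightarrow> real) \<Rightarrow> bool" where
  "has_bochner_int T X u I \<longleftrightarrow> strongly_meas T X u \<and> I \<in> elems X \<and>
     (\<exists>s J. (\<forall>n::nat. simple_int T X (s n) (J n) \<and>
                 integrable (tm T) (\<lambda>t. nrm X (\<lambda>x. u t x - s n t x))) \<and>
            (\<lambda>n. LINT t|tm T. nrm X (\<lambda>x. u t x - s n t x)) \<longlonglongrightarrow> 0 \<and>
            (\<lambda>n. nrm X (\<lambda>x. J n x - I x)) \<longlonglongrightarrow> 0)"

definition BL2 :: "real \<Rightarrow> 'x nspace \<Rightarrow> (real \<Rightarrow> 'x \<Rightarrow> real) set" where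
  "BL2 T X = {u. strongly_meas T X u \<and> integrable (tm T) (\<lambda>t. (nrm X (u t))\<^sup>2)}"

definition nrm_BL2 :: "real \<Rightarrow> 'x nspace \<Rightarrow> (real \<Rightarrow> 'x \<Rightarrow> real) \<Rightarrow> real" where
  "nrm_BL2 T X u = sqrt (LINT t|tm T. (nrm X (u t))\<^sup>2)"

definition BLinf :: "real \<Rightarrow> 'x nspace \<Rightarrow> (real \<Rightarrow> 'x \<Rightarrow> real) set" where
  "BLinf T X = {u. strongly_meas T X u \<and> esssup (tm T) (\<lambda>t. ereal (nrm X (u t))) < \<infinity>}"

definition is_weak_dt :: "real \<Rightarrow> 'x nspace \<Rightarrow> (real \<Rightarrow> 'x \<Rightarrow> real) \<Rightarrow> (real \<Rightarrow> 'x \<Rightarrow> real) \<Rightarrow> bool" where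
  "is_weak_dt T X u v \<longleftrightarrow> v \<in> BL2 T X \<and>
     (\<forall>\<phi>. test_function {0<..<T} \<phi> \<longrightarrow>
        (\<exists>I. has_bochner_int T X (\<lambda>t x. deriv \<phi> t * u t x) I \<and>
             has_bochner_int T X (\<lambda>t x. - (\<phi> t * v t x)) I))"

definition weak_dt :: "real \<Rightarrow> 'x nspace \<Rightarrow> (real \<Rightarrow> 'x \<Rightarrow> real) \<Rightarrow> real \<Rightarrow> 'x \<Rightarrow> real" where
  "weak_dt T X u = (SOME v. is_weak_dt T X u v)"

definition BH1 :: "real \<Rightarrow> 'x nspace \<Rightarrow> (real \<Rightarrow> 'x \<Rightarrow> real) set" where
  "BH1 T X = {u \<in> BL2 T X. \<exists>v. is_weak_dt T X u v}"

definition nrm_BH1 :: "real \<Rightarrow> 'x nspace \<Rightarrow> (real \<Rightarrow> 'x \<Rightarrow> real) \<Rightarrow> real" where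
  "nrm_BH1 T X u = sqrt ((nrm_BL2 T X u)\<^sup>2 + (nrm_BL2 T X (weak_dt T X u))\<^sup>2)"

text \<open>The elements of \<open>H\<^sup>1(0,T;X)\<close> that vanish at time \<open>\<tau> \<in> [0,T]\<close>; point values are those of the
  continuous representative.\<close>

definition BH1_van :: "real \<Rightarrow> real \<Rightarrow> 'x nspace \<Rightarrow> (real \<Rightarrow> 'x \<Rightarrow> real) set" where
  "BH1_van \<tau> T X = {u \<in> BH1 T X. \<exists>c.
     (\<forall>t\<in>{0..T}. c t \<in> elems X \<and> ((\<lambda>s. nrm X (\<lambda>x. c s x - c t x)) \<longlongrightarrow> 0) (at t within {0..T})) \<and>
     (AE t in tm T. nrm X (\<lambda>x. u t x - c t x) = 0) \<and> nrm X (c \<tau>) = 0}"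

definition ip_L2L2 :: "real \<Rightarrow> 'a::euclidean_space set \<Rightarrow>
    (real \<Rightarrow> 'a \<Rightarrow> real) \<Rightarrow> (real \<Rightarrow> 'a \<Rightarrow> real) \<Rightarrow> real" where
  "ip_L2L2 T \<Omega> u v = (LINT t|tm T. LINT x|lebesgue_on \<Omega>. u t x * v t x)"

definition ip_H1L2 :: "real \<Rightarrow> 'a::euclidean_space set \<Rightarrow>
    (real \<Rightarrow> 'a \<Rightarrow> real) \<Rightarrow> (real \<Rightarrow> 'a \<Rightarrow> real) \<Rightarrow> real" where
  "ip_H1L2 T \<Omega> u v = ip_L2L2 T \<Omega> u v + ip_L2L2 T \<Omega> (weak_dt T (L2 \<Omega>) u) (weak_dt T (L2 \<Omega>) v)"


section \<open>Bounded operators and derivatives\<close>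

text \<open>Operators act on representatives, hence they are linear up to null sets only.\<close>

definition bounded_op :: "real \<Rightarrow> 'x nspace \<Rightarrow> ((real \<Rightarrow> 'x \<Rightarrow> real) \<Rightarrow> (real \<Rightarrow> 'x \<Rightarrow> real)) \<Rightarrow> bool" where
  "bounded_op T X A \<longleftrightarrow>
     (\<forall>u\<in>BL2 T X. A u \<in> BL2 T X) \<and>
     (\<forall>u\<in>BL2 T X. \<forall>v\<in>BL2 T X.
        nrm_BL2 T X (\<lambda>t x. A (\<lambda>t x. u t x + v t x) t x - (A u t x + A v t x)) = 0) \<and>
     (\<forall>c. \<forall>u\<in>BL2 T X. nrm_BL2 T X (\<lambda>t x. A (\<lambda>t x. c * u t x) t x - c * A u t x) = 0) \<and>
     (\<exists>C. \<forall>u\<in>BL2 T X. nrm_BL2 T X (A u) \<le> C * nrm_BL2 T X u)"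

definition hilbert_adjoint :: "real \<Rightarrow> 'a::euclidean_space set \<Rightarrow>
    ((real \<Rightarrow> 'a \<Rightarrow> real) \<Rightarrow> (real \<Rightarrow> 'a \<Rightarrow> real)) \<Rightarrow> (real \<Rightarrow> 'a \<Rightarrow> real) \<Rightarrow> (real \<Rightarrow> 'a \<Rightarrow> real)" where
  "hilbert_adjoint T \<Omega> A v = (SOME w. w \<in> BL2 T (L2 \<Omega>) \<and>
     (\<forall>u\<in>BL2 T (L2 \<Omega>). ip_L2L2 T \<Omega> (A u) v = ip_L2L2 T \<Omega> u w))"

definition gateaux_deriv :: "real \<Rightarrow> 'x nspace \<Rightarrow> ((real \<Rightarrow> 'x \<Rightarrow> real) \<Rightarrow> (real \<Rightarrow> 'x \<Rightarrow> real)) \<Rightarrow>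
    ((real \<Rightarrow> 'x \<Rightarrow> real) \<Rightarrow> (real \<Rightarrow> 'x \<Rightarrow> real) \<Rightarrow> (real \<Rightarrow> 'x \<Rightarrow> real)) \<Rightarrow> bool" where
  "gateaux_deriv T X H dH \<longleftrightarrow> (\<forall>q\<in>BL2 T X. bounded_op T X (dH q) \<and>
     (\<forall>h\<in>BL2 T X.
        ((\<lambda>\<tau>. nrm_BL2 T X (\<lambda>t x. (H (\<lambda>t x. q t x + \<tau> * h t x) t x - H q t x) / \<tau> - dH q h t x))
           \<longlongrightarrow> 0) (at 0)))"

text \<open>Continuity of \<open>q \<mapsto> dH q\<close> from \<open>H\<^sup>1(0,T;X)\<close> to the bounded operators on \<open>L\<^sup>2(0,T;X)\<close> with the
  operator norm.\<close>

definition cont_op_on_H1 :: "real \<Rightarrow> 'x nspace \<Rightarrow>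
    ((real \<Rightarrow> 'x \<Rightarrow> real) \<Rightarrow> (real \<Rightarrow> 'x \<Rightarrow> real) \<Rightarrow> (real \<Rightarrow> 'x \<Rightarrow> real)) \<Rightarrow> bool" where
  "cont_op_on_H1 T X dH \<longleftrightarrow> (\<forall>q\<in>BH1 T X. \<forall>e>0. \<exists>d>0. \<forall>q'\<in>BH1 T X.
     nrm_BH1 T X (\<lambda>t x. q' t x - q t x) < d \<longrightarrow>
     (\<forall>h\<in>BL2 T X. nrm_BL2 T X (\<lambda>t x. dH q' h t x - dH q h t x) \<le> e * nrm_BL2 T X h))"

text \<open>\<open>dj q \<phi>\<close> is the derivative at \<open>(q, \<phi>)\<close>; the product space carries the sum norm.\<close>

definition cont_frechet :: "real \<Rightarrow> 'x nspace \<Rightarrow> 'y nspace \<Rightarrow>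
    ((real \<Rightarrow> 'x \<Rightarrow> real) \<Rightarrow> (real \<Rightarrow> 'y \<Rightarrow> real) \<Rightarrow> real) \<Rightarrow>
    ((real \<Rightarrow> 'x \<Rightarrow> real) \<Rightarrow> (real \<Rightarrow> 'y \<Rightarrow> real) \<Rightarrow> (real \<Rightarrow> 'x \<Rightarrow> real) \<Rightarrow> (real \<Rightarrow> 'y \<Rightarrow> real) \<Rightarrow> real) \<Rightarrow> bool" where
  "cont_frechet T X Y j dj \<longleftrightarrow> (\<forall>q\<in>BL2 T X. \<forall>\<phi>\<in>BL2 T Y.
     (\<forall>a. \<forall>h\<in>BL2 T X. \<forall>h'\<in>BL2 T X. \<forall>\<psi>\<in>BL2 T Y. \<forall>\<psi>'\<in>BL2 T Y.
        dj q \<phi> (\<lambda>t x. a * h t x + h' t x) (\<lambda>t y. a * \<psi> t y + \<psi>' t y) =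
        a * dj q \<phi> h \<psi> + dj q \<phi> h' \<psi>') \<and>
     (\<exists>C. \<forall>h\<in>BL2 T X. \<forall>\<psi>\<in>BL2 T Y. \<bar>dj q \<phi> h \<psi>\<bar> \<le> C * (nrm_BL2 T X h + nrm_BL2 T Y \<psi>)) \<and>
     (\<forall>e>0. \<exists>d>0. \<forall>h\<in>BL2 T X. \<forall>\<psi>\<in>BL2 T Y. nrm_BL2 T X h + nrm_BL2 T Y \<psi> < d \<longrightarrow>
        \<bar>j (\<lambda>t x. q t x + h t x) (\<lambda>t y. \<phi> t y + \<psi> t y) - j q \<phi> - dj q \<phi> h \<psi>\<bar>
          \<le> e * (nrm_BL2 T X h + nrm_BL2 T Y \<psi>)) \<and>
     (\<forall>e>0. \<exists>d>0. \<forall>q'\<in>BL2 T X. \<forall>\<phi>'\<in>BL2 T Y.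
        nrm_BL2 T X (\<lambda>t x. q' t x - q t x) + nrm_BL2 T Y (\<lambda>t y. \<phi>' t y - \<phi> t y) < d \<longrightarrow>
        (\<forall>h\<in>BL2 T X. \<forall>\<psi>\<in>BL2 T Y.
           \<bar>dj q' \<phi>' h \<psi> - dj q \<phi> h \<psi>\<bar> \<le> e * (nrm_BL2 T X h + nrm_BL2 T Y \<psi>))))"

text \<open>Identification of functionals on \<open>L\<^sup>2(0,T;L\<^sup>2(\<Omega>))\<close> and \<open>L\<^sup>2(0,T;H\<^sup>1(\<Omega>))\<close> with elements of
  \<open>L\<^sup>2(0,T;L\<^sup>2(\<Omega>))\<close> and \<open>L\<^sup>2(0,T;H\<^sup>1(\<Omega>)\<^sup>*)\<close>.\<close>

definition represents_L2L2 :: "real \<Rightarrow> 'a::euclidean_space set \<Rightarrow>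
    (real \<Rightarrow> 'a \<Rightarrow> real) \<Rightarrow> ((real \<Rightarrow> 'a \<Rightarrow> real) \<Rightarrow> real) \<Rightarrow> bool" where
  "represents_L2L2 T \<Omega> g F \<longleftrightarrow> g \<in> BL2 T (L2 \<Omega>) \<and> (\<forall>h\<in>BL2 T (L2 \<Omega>). F h = ip_L2L2 T \<Omega> g h)"

definition represents_L2H1 :: "real \<Rightarrow> 'a::euclidean_space set \<Rightarrow>
    (real \<Rightarrow> ('a \<Rightarrow> real) \<Rightarrow> real) \<Rightarrow> ((real \<Rightarrow> 'a \<Rightarrow> real) \<Rightarrow> real) \<Rightarrow> bool" where
  "represents_L2H1 T \<Omega> G F \<longleftrightarrow> G \<in> BL2 T (dual (H1 \<Omega>)) \<and>
     (\<forall>\<psi>\<in>BL2 T (H1 \<Omega>). F \<psi> = (LINT t|tm T. G t (\<psi> t)))"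


section \<open>The optimal control problem\<close>

definition history_operator :: "real \<Rightarrow> 'a::euclidean_space set \<Rightarrow>
    ((real \<Rightarrow> 'a \<Rightarrow> real) \<Rightarrow> (real \<Rightarrow> 'a \<Rightarrow> real)) \<Rightarrow>
    ((real \<Rightarrow> 'a \<Rightarrow> real) \<Rightarrow> (real \<Rightarrow> 'a \<Rightarrow> real) \<Rightarrow> (real \<Rightarrow> 'a \<Rightarrow> real)) \<Rightarrow> bool" where
  "history_operator T \<Omega> H dH \<longleftrightarrow>
     (\<forall>X\<in>{L2 \<Omega>, Linf \<Omega>}.
        (\<forall>q\<in>BL2 T X. H q \<in> BL2 T X) \<and>
        (\<exists>L>0. \<forall>q1\<in>BL2 T X. \<forall>q2\<in>BL2 T X. AE t in tm T.
           nrm X (\<lambda>x. H q1 t x - H q2 t x)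
             \<le> L * (LINT s|lebesgue_on {0<..<t}. nrm X (\<lambda>x. q1 s x - q2 s x)))) \<and>
     gateaux_deriv T (L2 \<Omega>) H dH \<and> cont_op_on_H1 T (L2 \<Omega>) dH"

definition nonsmooth_function :: "(real \<Rightarrow> real) \<Rightarrow> real \<Rightarrow> bool" where
  "nonsmooth_function f nf \<longleftrightarrow>
     (\<exists>L>0. L-lipschitz_on UNIV f) \<and>
     (\<forall>v h. \<exists>l. ((\<lambda>\<tau>. (f (v + \<tau> * h) - f v) / \<tau>) \<longlongrightarrow> l) (at_right 0)) \<and>
     (\<forall>v. f differentiable (at v) \<longleftrightarrow> v \<noteq> nf) \<and>
     (\<exists>fe. \<exists>C>0. \<exists>L>0.
        (\<forall>\<epsilon>>0. fe \<epsilon> C1_differentiable_on UNIV \<and> (\<forall>v. \<bar>fe \<epsilon> v - f v\<bar> \<le> C * \<epsilon>) \<and>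
                L-lipschitz_on UNIV (fe \<epsilon>)) \<and>
        (\<forall>\<delta>>0. uniform_limit ({..nf - \<delta>} \<union> {nf + \<delta>..}) (\<lambda>\<epsilon>. deriv (fe \<epsilon>)) (deriv f) (at_right 0)))"

definition driving_force :: "real \<Rightarrow> (real \<Rightarrow> real) \<Rightarrow>
    ((real \<Rightarrow> 'a \<Rightarrow> real) \<Rightarrow> (real \<Rightarrow> 'a \<Rightarrow> real)) \<Rightarrow>
    (real \<Rightarrow> 'a \<Rightarrow> real) \<Rightarrow> (real \<Rightarrow> 'a \<Rightarrow> real) \<Rightarrow> real \<Rightarrow> 'a \<Rightarrow> real" where
  "driving_force \<beta> f H q \<phi> = (\<lambda>t x. - \<beta> * (q t x - \<phi> t x) - f (H q t x))"

definition is_state :: "real \<Rightarrow> 'a::euclidean_space set \<Rightarrow> real \<Rightarrow> real \<Rightarrow> real \<Rightarrow> (real \<Rightarrow> real) \<Rightarrow>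
    ((real \<Rightarrow> 'a \<Rightarrow> real) \<Rightarrow> (real \<Rightarrow> 'a \<Rightarrow> real)) \<Rightarrow> (real \<Rightarrow> ('a \<Rightarrow> real) \<Rightarrow> real) \<Rightarrow>
    (real \<Rightarrow> 'a \<Rightarrow> real) \<times> (real \<Rightarrow> 'a \<Rightarrow> real) \<Rightarrow> bool" where
  "is_state T \<Omega> \<alpha> \<beta> \<epsilon> f H l = (\<lambda>(q, \<phi>).
     q \<in> BH1_van 0 T (L2 \<Omega>) \<and> \<phi> \<in> BL2 T (H1 \<Omega>) \<and>
     (AE t in tm T. AE x in lebesgue_on \<Omega>.
        weak_dt T (L2 \<Omega>) q t x = 1 / \<epsilon> * max (driving_force \<beta> f H q \<phi> t x) 0) \<and>
     (AE t in tm T. \<forall>\<psi>\<in>elems (H1 \<Omega>).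
        - \<alpha> * laplacian \<Omega> (\<phi> t) \<psi> + \<beta> * emb \<Omega> (\<phi> t) \<psi> = \<beta> * emb \<Omega> (q t) \<psi> + l t \<psi>))"

text \<open>The state is unique up to null sets, so only the representative is a matter of choice.\<close>

definition solution_op :: "real \<Rightarrow> 'a::euclidean_space set \<Rightarrow> real \<Rightarrow> real \<Rightarrow> real \<Rightarrow> (real \<Rightarrow> real) \<Rightarrow>
    ((real \<Rightarrow> 'a \<Rightarrow> real) \<Rightarrow> (real \<Rightarrow> 'a \<Rightarrow> real)) \<Rightarrow> (real \<Rightarrow> ('a \<Rightarrow> real) \<Rightarrow> real) \<Rightarrow>
    (real \<Rightarrow> 'a \<Rightarrow> real) \<times> (real \<Rightarrow> 'a \<Rightarrow> real)" where
  "solution_op T \<Omega> \<alpha> \<beta> \<epsilon> f H l = (SOME s. is_state T \<Omega> \<alpha> \<beta> \<epsilon> f H l s)"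

definition objective :: "real \<Rightarrow> 'a::euclidean_space set \<Rightarrow>
    ((real \<Rightarrow> 'a \<Rightarrow> real) \<Rightarrow> (real \<Rightarrow> 'a \<Rightarrow> real) \<Rightarrow> real) \<Rightarrow>
    (real \<Rightarrow> 'a \<Rightarrow> real) \<times> (real \<Rightarrow> 'a \<Rightarrow> real) \<Rightarrow> (real \<Rightarrow> 'a \<Rightarrow> real) \<Rightarrow> real" where
  "objective T \<Omega> j = (\<lambda>(q, \<phi>) l. j q \<phi> + 1 / 2 * (nrm_BH1 T (L2 \<Omega>) l)\<^sup>2)"

definition local_optimum :: "real \<Rightarrow> 'a::euclidean_space set \<Rightarrow> real \<Rightarrow> real \<Rightarrow> real \<Rightarrow> (real \<Rightarrow> real) \<Rightarrow>
    ((real \<Rightarrow> 'a \<Rightarrow> real) \<Rightarrow> (real \<Rightarrow> 'a \<Rightarrow> real)) \<Rightarrow>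
    ((real \<Rightarrow> 'a \<Rightarrow> real) \<Rightarrow> (real \<Rightarrow> 'a \<Rightarrow> real) \<Rightarrow> real) \<Rightarrow> (real \<Rightarrow> 'a \<Rightarrow> real) \<Rightarrow> bool" where
  "local_optimum T \<Omega> \<alpha> \<beta> \<epsilon> f H j lb \<longleftrightarrow> lb \<in> BH1 T (L2 \<Omega>) \<and>
     (\<exists>r>0. \<forall>l\<in>BH1 T (L2 \<Omega>). nrm_BH1 T (L2 \<Omega>) (\<lambda>t x. l t x - lb t x) < r \<longrightarrow>
        objective T \<Omega> j (solution_op T \<Omega> \<alpha> \<beta> \<epsilon> f H (\<lambda>t. emb \<Omega> (lb t))) lb
          \<le> objective T \<Omega> j (solution_op T \<Omega> \<alpha> \<beta> \<epsilon> f H (\<lambda>t. emb \<Omega> (l t))) l)"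

end

theory Submission
 imports Defs
begin

text \<open>Eliminating \<open>\<phi>\<close> by the elliptic solution operator turns the state system into a fixed point equation for
 \<open>q\<close> that is contractive in an exponentially weighted norm of \<open>L\<^sup>2(0,T;L\<^sup>2(\<Omega>))\<close>. Local optimality bounds the
 directional derivative of the objective from below by \<open>- C\<close> times the norm of the residual of the linearised
 equation, for every direction \<open>u\<close> of the driving force and every direction of the control. By Hahn-Banach the
 residual has a multiplier \<open>\<lambda>\<close>, and what remains is a variational inequality in \<open>u\<close>. Directions supported in
 \<open>{z < 0}\<close> and \<open>{z > 0}\<close> determine \<open>\<lambda>\<close> there, where \<open>max\<close> acts linearly. On \<open>{H q = nf}\<close> the derivative of \<open>f\<close> is only
 dominated by a seminorm of \<open>L\<^sup>1(0,T;L\<^sup>2)\<close>, and Hahn-Banach yields \<open>\<mu>\<close> in the dual \<open>L\<^sup>\<infinity>(0,T;L\<^sup>2)\<close>. No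
 regularisation of \<open>f\<close> is involved.\<close>

class hilb = real_inner + banach + second_countable_topology
instance euclidean_space \<subseteq> hilb ..
instance prod :: (hilb, hilb) hilb ..

abbreviation ae_lebesgue (binder "AEL " 10) where "ae_lebesgue P \<equiv> AE x in lebesgue. P x"
abbreviation int_lebesgue (binder "LL " 60) where "int_lebesgue h \<equiv> LINT x|lebesgue. h x"
abbreviation "ind \<equiv> indicator"
lemmas ind_def = indicator_def
abbreviation "meas \<equiv> borel_measurable lebesgue"
abbreviation "pd b h x \<equiv> frechet_derivative h (at x) b"
notation scaleR (infixr "*:" 75)
abbreviation lim_seq (infixr "---->" 60) where "X ----> l \<equiv> X \<longlonglongrightarrow> l"

definition sq_int :: "('d::euclidean_space=>'b::hilb)=>bool"
 where "sq_int f \<longleftrightarrow> f\<in>meas \<and> integrable lebesgue (%x. (norm (f x))^2)"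

lemma sq_intD [measurable_dest]: "sq_int f ==> f\<in>meas"
 and sq_int_integrable: "sq_int f ==> integrable lebesgue (%x. (norm (f x))^2)"
 by (auto simp: sq_int_def)

lemma sq_int_bound:
 assumes f: "f\<in>meas" and g: "sq_int g"
  and le: "AEL x. norm (f x)\<le>C * norm (g x)"
 shows "sq_int f"
 unfolding sq_int_def
proof (intro conjI f)
 show "integrable lebesgue (%x. (norm (f x))^2)"
 proof (rule Bochner_Integration.integrable_bound)
  show "integrable lebesgue (%x. C^2 * (norm (g x))^2)"
   using sq_int_integrable[OF g] by simp
  show "AEL x. norm ((norm (f x))^2)\<le>norm (C^2 * (norm (g x))^2)"
   using le by eventually_elim (simp add: power_mult_distrib[symmetric] power_mono)
 qed (use f in measurable)
qed

lemma sq_int_cong_AE: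
 assumes "f\<in>meas" "sq_int g" "AEL x. f x = g x"
 shows "sq_int f"
 using assms(3) by (intro sq_int_bound[OF assms(1,2), of 1]) auto

lemma sq_int_zero [simp]: "sq_int (%x. 0)"
 by (simp add: sq_int_def)

lemma sq_int_scaleR: "sq_int f ==> sq_int (%x. c *: f x)"
 by (rule sq_int_bound[where g=f and C="\<bar>c\<bar>"]) (auto dest: sq_intD)

lemma sq_int_norm: "sq_int f ==> sq_int (%x. norm (f x))"
 by (rule sq_int_bound[where g=f and C=1]) (auto dest: sq_intD)

lemma sq_int_add:
 assumes f: "sq_int f" and g: "sq_int g"
 shows "sq_int (%x. f x + g x)"
proof -
 have [measurable]: "f\<in>meas" "g\<in>meas"
  using f g by (auto dest: sq_intD)
 have le: "(norm (f x + g x))^2\<le>2 * (norm (f x))^2 + 2 * (norm (g x))^2" for x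
 proof -
  have "(norm (f x + g x))^2\<le>(norm (f x) + norm (g x))^2"
   by (intro power_mono norm_triangle_ineq) simp
  also have "...\<le>2 * (norm (f x))^2 + 2 * (norm (g x))^2"
   using sum_squares_bound[of "norm (f x)" "norm (g x)"] by (simp add: power2_sum)
  finally show ?thesis .
 qed
 have "integrable lebesgue (%x. (norm (f x + g x))^2)"
 proof (rule Bochner_Integration.integrable_bound)
  show "integrable lebesgue (%x. 2 * (norm (f x))^2 + 2 * (norm (g x))^2)"
   using sq_int_integrable[OF f] sq_int_integrable[OF g] by simp
 qed (use le in auto)
 thus ?thesis by (simp add: sq_int_def)
qed

lemma sq_int_diff: "sq_int f ==> sq_int g ==> sq_int (%x. f x - g x)"
 using sq_int_add[of f "%x. (-1) *: g x"] sq_int_scaleR[of g "-1"] by simp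

lemma integrable_norm_mult:
 assumes f: "sq_int f" and g: "sq_int g"
 shows "integrable lebesgue (%x. norm (f x) * norm (g x))"
proof (rule Bochner_Integration.integrable_bound)
 have [measurable]: "f\<in>meas" "g\<in>meas"
  using f g by (auto dest: sq_intD)
 show "integrable lebesgue (%x. (norm (f x))^2 + (norm (g x))^2)"
  using sq_int_integrable[OF f] sq_int_integrable[OF g] by simp
 show "(%x. norm (f x) * norm (g x))\<in>meas" by measurable
 have "2 * (norm (f x) * norm (g x))\<le>(norm (f x))^2 + (norm (g x))^2" for x
  using sum_squares_bound[of "norm (f x)" "norm (g x)"] by simp
 moreover have "0\<le>norm (f x) * norm (g x)" for x by simp
 ultimately show "AEL x. norm (norm (f x) * norm (g x))\<le>norm ((norm (f x))^2 + (norm (g x))^2)"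
  by (intro AE_I2) (smt (verit) real_norm_def)
qed

lemma integrable_inner_sq:
 assumes f: "sq_int f" and g: "sq_int g"
 shows "integrable lebesgue (%x. inner (f x) (g x))"
proof (rule Bochner_Integration.integrable_bound[OF integrable_norm_mult[OF f g]])
 have [measurable]: "f\<in>meas" "g\<in>meas"
  using f g by (auto dest: sq_intD)
 show "(%x. inner (f x) (g x))\<in>meas" by measurable
qed (use Cauchy_Schwarz_ineq2 in auto)

definition canon :: "('d::euclidean_space=>'b::hilb)=>'d=>'b"
 where "canon f = (SOME g. sq_int g \<and> (AEL x. g x = f x))"

lemma canon:
 assumes "sq_int f"
 shows "sq_int (canon f)" "AEL x. canon f x = f x"
proof -
 have "sq_int (canon f) \<and> (AEL x. canon f x = f x)"
  unfolding canon_def by (rule someI[where x=f]) (simp add: assms)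
 thus "sq_int (canon f)" "AEL x. canon f x = f x" by auto
qed

lemma canon_cong:
 assumes "AEL x. f x = g x"
 shows "canon f = canon g"
proof -
 have "(AEL x. h x = f x) \<longleftrightarrow> (AEL x. h x = g x)" for h :: "'a=>'b"
  by (rule eventually_subst) (use assms in eventually_elim, auto)
 thus ?thesis unfolding canon_def by simp
qed

text \<open>The elements of \<open>L^2(\<real>\<^sup>d; 'b)\<close> are represented by one chosen function per class.\<close>

typedef (overloaded) ('d, 'b) lp2 =
 "{f :: 'd::euclidean_space=>'b::hilb. sq_int f \<and> canon f = f}"
 morphisms ap Abs_lp2
proof
 show "canon (%x. 0)\<in>{f. sq_int f \<and> canon f = f}"
  using canon[OF sq_int_zero] canon_cong[OF canon(2)[OF sq_int_zero]] by auto
qed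

definition mk :: "('d::euclidean_space=>'b::hilb)=>('d, 'b) lp2"
 where "mk f = Abs_lp2 (canon (if sq_int f then f else (%x. 0)))"

lemma sq_int_ap [simp]: "sq_int (ap F)"
 using ap[of F] by simp

lemma ap_measurable [measurable, simp]: "ap F\<in>meas"
 by (rule sq_intD) simp

lemma ap_mk: "sq_int f ==> AEL x. ap (mk f) x = f x"
 using canon[of f] canon_cong[OF canon(2)[of f]] by (simp add: mk_def Abs_lp2_inverse)

lemma lp2_eqI: "(AEL x. ap F x = ap G x) ==> F = G"
 using canon_cong[of "ap F" "ap G"] ap[of F] ap[of G] by (simp add: ap_inject)

lemma lp2_eq_iff: "F = G \<longleftrightarrow> (AEL x. ap F x = ap G x)"
 using lp2_eqI by auto

lemma mk_ap [simp]: "mk (ap F) = F"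
 by (rule lp2_eqI) (rule ap_mk, simp)

instantiation lp2 :: (euclidean_space, hilb) real_inner
begin

definition zero_lp2 :: "('a,'b) lp2" where "zero_lp2 = mk (%x. 0)"
definition plus_lp2 :: "('a,'b) lp2=>('a,'b) lp2=>('a,'b) lp2" where "F + G = mk (%x. ap F x + ap G x)"
definition minus_lp2 :: "('a,'b) lp2=>('a,'b) lp2=>('a,'b) lp2" where "F - G = mk (%x. ap F x - ap G x)"
definition uminus_lp2 :: "('a,'b) lp2=>('a,'b) lp2" where "- F = mk (%x. - ap F x)"
definition scaleR_lp2 :: "real=>('a,'b) lp2=>('a,'b) lp2" where "c *: F = mk (%x. c *: ap F x)"
definition inner_lp2 :: "('a,'b) lp2=>('a,'b) lp2=>real"
 where "inner (F :: ('a,'b) lp2) G = (LL x. inner (ap F x) (ap G x))"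
definition norm_lp2 :: "('a,'b) lp2=>real" where "norm (F :: ('a,'b) lp2) = sqrt (inner F F)"
definition sgn_lp2 :: "('a,'b) lp2=>('a,'b) lp2" where "sgn (F :: ('a,'b) lp2) = inverse (norm F) *: F"
definition dist_lp2 :: "('a,'b) lp2=>('a,'b) lp2=>real" where "dist (F :: ('a,'b) lp2) G = norm (F - G)"
definition uniformity_lp2 :: "(('a,'b) lp2 \<times> ('a,'b) lp2) filter"
 where "uniformity_lp2 = (INF e\<in>{0 <..}. principal {(x, y). dist x y < e})"
definition open_lp2 :: "('a,'b) lp2 set=>bool"
 where "open_lp2 U = (\<forall>x\<in>U. eventually (%(x', y). x' = x --> y\<in>U) uniformity)"

lemma ap_zero: "AEL x. ap (0 :: ('a,'b) lp2) x = 0"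
 unfolding zero_lp2_def by (rule ap_mk) simp

lemma ap_add: "AEL x. ap (F + G :: ('a,'b) lp2) x = ap F x + ap G x"
 unfolding plus_lp2_def by (rule ap_mk) (simp add: sq_int_add)

lemma ap_diff: "AEL x. ap (F - G :: ('a,'b) lp2) x = ap F x - ap G x"
 unfolding minus_lp2_def by (rule ap_mk) (simp add: sq_int_diff)

lemma ap_uminus: "AEL x. ap (- F :: ('a,'b) lp2) x = - ap F x"
 unfolding uminus_lp2_def using sq_int_scaleR[of "ap F" "-1"] by (intro ap_mk) simp

lemma ap_scaleR: "AEL x. ap (c *: F :: ('a,'b) lp2) x = c *: ap F x"
 unfolding scaleR_lp2_def by (rule ap_mk) (simp add: sq_int_scaleR)

instance
proof
 fix F G K :: "('a,'b) lp2" and a b :: real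
 show "F + G + K = F + (G + K)"
  by (rule lp2_eqI) (use ap_add[of "F+G" K] ap_add[of F G] ap_add[of F "G+K"] ap_add[of G K] in
    eventually_elim, simp add: algebra_simps)
 show "F + G = G + F"
  by (simp add: plus_lp2_def add.commute)
 show "0 + F = F"
  by (rule lp2_eqI) (use ap_add[of 0 F] ap_zero in eventually_elim, simp)
 show "- F + F = 0"
  by (rule lp2_eqI) (use ap_add[of "-F" F] ap_uminus[of F] ap_zero in eventually_elim, simp)
 show "F - G = F + - G"
  by (rule lp2_eqI) (use ap_add[of F "-G"] ap_uminus[of G] ap_diff[of F G] in eventually_elim, simp)
 show "a *: (F + G) = a *: F + a *: G"
  by (rule lp2_eqI) (use ap_scaleR[of a "F+G"] ap_add[of F G] ap_add[of "a *: F" "a *: G"]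
    ap_scaleR[of a F] ap_scaleR[of a G] in eventually_elim, simp add: algebra_simps)
 show "(a + b) *: F = a *: F + b *: F"
  by (rule lp2_eqI) (use ap_scaleR[of "a+b" F] ap_add[of "a *: F" "b *: F"]
    ap_scaleR[of a F] ap_scaleR[of b F] in eventually_elim, simp add: algebra_simps)
 show "a *: b *: F = (a * b) *: F"
  by (rule lp2_eqI) (use ap_scaleR[of a "b *: F"] ap_scaleR[of b F] ap_scaleR[of "a*b" F] in
    eventually_elim, simp)
 show "1 *: F = F"
  by (rule lp2_eqI) (use ap_scaleR[of 1 F] in eventually_elim, simp)
 show "inner F G = inner G F"
  by (simp add: inner_lp2_def inner_commute)
 show "inner (F + G) K = inner F K + inner G K"
 proof -
  have "inner (F + G) K = (LL x. inner (ap F x) (ap K x) + inner (ap G x) (ap K x))"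
   unfolding inner_lp2_def by (rule integral_cong_AE)
    (measurable, use ap_add[of F G] in eventually_elim, simp add: inner_add_left)
  thus ?thesis by (simp add: inner_lp2_def integrable_inner_sq)
 qed
 show "inner (a *: F) G = a * inner F G"
 proof -
  have "inner (a *: F) G = (LL x. a * inner (ap F x) (ap G x))"
   unfolding inner_lp2_def by (rule integral_cong_AE)
    (measurable, use ap_scaleR[of a F] in eventually_elim, simp)
  thus ?thesis by (simp add: inner_lp2_def)
 qed
 show "0\<le>inner F F"
  by (simp add: inner_lp2_def)
 show "inner F F = 0 \<longleftrightarrow> F = 0"
 proof -
  have "inner F F = 0 \<longleftrightarrow> (AEL x. inner (ap F x) (ap F x) = 0)"
   unfolding inner_lp2_def by (rule integral_nonneg_eq_0_iff_AE) (auto simp: integrable_inner_sq)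
  also have "... \<longleftrightarrow> (AEL x. ap F x = ap 0 x)"
   by (rule eventually_subst) (use ap_zero in eventually_elim, simp)
  finally show ?thesis by (simp add: lp2_eq_iff)
 qed
qed (simp_all add: norm_lp2_def sgn_lp2_def dist_lp2_def uniformity_lp2_def open_lp2_def)

end

lemma norm_lp2_square: "(norm F)^2 = (LL x. (norm (ap F x))^2)" for F :: "('d::euclidean_space, 'b::hilb) lp2"
 by (simp add: power2_norm_eq_inner inner_lp2_def)

lemma norm_mk_square: "sq_int f ==> (norm (mk f))^2 = (LL x. (norm (f x))^2)"
 unfolding norm_lp2_square
 by (rule integral_cong_AE) (auto dest: sq_intD ap_mk)

lemma norm_mk_le:
 assumes f: "sq_int f" and c: "c\<ge>0" and le: "AEL x. norm (f x)\<le>c * norm (ap G x)"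
 shows "norm (mk f)\<le>c * norm G"
proof (rule power2_le_imp_le)
 have "(norm (mk f))^2\<le>(LL x. c^2 * (norm (ap G x))^2)"
  unfolding norm_mk_square[OF f]
 proof (rule integral_mono_AE)
  show "integrable lebesgue (%x. c^2 * (norm (ap G x))^2)" by (simp add: sq_int_integrable)
  show "AEL x. (norm (f x))^2\<le>c^2 * (norm (ap G x))^2"
   using le by eventually_elim (simp add: power_mult_distrib[symmetric] power_mono)
 qed (simp add: sq_int_integrable f)
 thus "(norm (mk f))^2\<le>(c * norm G)^2"
  by (simp add: norm_lp2_square power_mult_distrib)
qed (use c in simp)

lemma norm_ap_le:
 assumes c: "c\<ge>0" and le: "AEL x. norm (ap F x)\<le>c * norm (ap G x)"
 shows "norm F\<le>c * norm G"
 using norm_mk_le[OF sq_int_ap c le] by simp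

lemma norm_ap_le2:
 assumes c: "b\<ge>0" "c\<ge>0"
  and le: "AEL x. norm (ap F x)\<le>b * norm (ap G x) + c * norm (ap K x)"
 shows "norm F\<le>b * norm G + c * norm K"
proof -
 define n where "n = (%G :: ('a, 'b) lp2. mk (%x. norm (ap G x)))"
 have apn: "AEL x. ap (n G) x = norm (ap G x)" for G
  unfolding n_def by (rule ap_mk) (simp add: sq_int_norm)
 have nn: "norm (n G) = norm G" for G
  using norm_mk_square[of "%x. norm (ap G x)"]
  by (simp add: n_def sq_int_norm norm_lp2_square[symmetric])
 define k' where "k' = mk (%x. norm (ap K x))"
 have k': "AEL x. ap k' x = norm (ap K x)"
  unfolding k'_def by (rule ap_mk) (simp add: sq_int_norm)
 have nk: "norm k' = norm K"
  using norm_mk_square[of "%x. norm (ap K x)"]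
  by (simp add: k'_def sq_int_norm norm_lp2_square[symmetric])
 define g' where "g' = mk (%x. norm (ap G x))"
 have g': "AEL x. ap g' x = norm (ap G x)"
  unfolding g'_def by (rule ap_mk) (simp add: sq_int_norm)
 have ng: "norm g' = norm G"
  using norm_mk_square[of "%x. norm (ap G x)"]
  by (simp add: g'_def sq_int_norm norm_lp2_square[symmetric])
 have "norm F = norm (mk (%x. norm (ap F x)))"
  using norm_mk_square[of "%x. norm (ap F x)"]
  by (simp add: sq_int_norm norm_lp2_square[symmetric])
 also have "...\<le>1 * norm (b *: g' + c *: k')"
  by (rule norm_mk_le) (simp_all add: sq_int_norm, use le g' k' ap_add[of "b *: g'" "c *: k'"]
    ap_scaleR[of b g'] ap_scaleR[of c k'] in eventually_elim, simp)
 also have "...\<le>b * norm G + c * norm K"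
  using norm_triangle_ineq[of "b *: g'" "c *: k'"] c by (simp add: ng nk)
 finally show ?thesis .
qed

lemma integrable_norm_sq_ap: "integrable lebesgue (%x. (norm (ap F x))^2)"
 by (simp add: sq_int_integrable)

lemma lp2_dominated_convergence:
 fixes g :: "'d::euclidean_space=>'c::hilb"
  and h :: "'d=>'b::hilb"
 assumes g: "sq_int g" and f: "!!n::nat. f n\<in>meas" "h\<in>meas"
  and le: "!!n. AEL x. norm (f n x)\<le>norm (g x)"
  and lim: "AEL x. (%n. f n x) ----> h x"
 shows "sq_int h" "(%n. mk (f n)) ----> mk h"
proof -
 have sf: "sq_int (f n)" for n
  by (rule sq_int_bound[OF f(1) g, of _ 1]) (use le in simp)
 have leA: "AEL x. \<forall>n. norm (f n x)\<le>norm (g x)"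
  using le by (simp add: AE_all_countable)
 have leh: "AEL x. norm (h x)\<le>norm (g x)"
  using lim leA
 proof eventually_elim
  case (elim x)
  have "(%n. norm (f n x)) ----> norm (h x)" using elim(1) by (rule tendsto_norm)
  thus ?case by (rule LIMSEQ_le_const2) (intro exI[of _ 0] allI impI elim(2)[rule_format])
 qed
 thus sh: "sq_int h"
  by (intro sq_int_bound[OF f(2) g, of 1]) simp
 have "(%n. LL x. (norm (f n x - h x))^2) ----> integral\<^sup>L lebesgue (%x::'d. 0::real)"
 proof (rule integral_dominated_convergence[where w="%x. 4 * (norm (g x))^2"])
  show "integrable lebesgue (%x. 4 * (norm (g x))^2)"
   using sq_int_integrable[OF g] by simp
  show "AEL x. (%n. (norm (f n x - h x))^2) ----> 0"
   using lim
  proof eventually_elim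
   case (elim x)
   hence "(%n. (norm (f n x - h x))^2) ----> (norm (h x - h x))^2"
    by (intro tendsto_intros)
   thus ?case by simp
  qed
  show "AEL x. norm ((norm (f n x - h x))^2)\<le>4 * (norm (g x))^2" for n
   using le[of n] leh
  proof eventually_elim
   case (elim x)
   have "norm (f n x - h x)\<le>2 * norm (g x)"
    using norm_triangle_ineq4[of "f n x" "h x"] elim by linarith
   hence "(norm (f n x - h x))^2\<le>(2 * norm (g x))^2"
    by (intro power_mono) auto
   thus ?case by simp
  qed
 qed (use f in measurable)
 moreover have "(LL x. (norm (f n x - h x))^2) = (norm (mk (f n) - mk h))^2" for n
  unfolding norm_lp2_square
 proof (rule integral_cong_AE)
  show "AEL x. (norm (f n x - h x))^2 = (norm (ap (mk (f n) - mk h) x))^2"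
   using ap_diff[of "mk (f n)" "mk h"] ap_mk[OF sf[of n]] ap_mk[OF sh] by eventually_elim simp
 qed (use f in measurable)
 ultimately have "(%n. (norm (mk (f n) - mk h))^2) ----> 0" by simp
 hence "(%n. sqrt ((norm (mk (f n) - mk h))^2)) ----> sqrt 0" by (rule tendsto_real_sqrt)
 hence "(%n. norm (mk (f n) - mk h)) ----> 0" by simp
 thus "(%n. mk (f n)) ----> mk h"
  using LIM_zero_iff tendsto_norm_zero_iff by blast
qed

instance lp2 :: (euclidean_space, hilb) complete_space
proof
 fix X :: "nat=>('a,'b) lp2"
 assume X: "Cauchy X"
 have "\<forall>k. \<exists>N. \<forall>m\<ge>N. \<forall>n\<ge>N. norm (X m - X n) < (1/4)^k"
  using X by (auto simp: Cauchy_iff)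
 then obtain N where N: "!!k m n. m\<ge>N k ==> n\<ge>N k ==> norm (X m - X n) < (1/4)^k"
  by metis
 define r where "r k = (\<Sum>i\<le>k. N i) + k" for k
 have rN: "r m\<ge>N k" if "m\<ge>k" for m k
  unfolding r_def using that by (intro trans_le_add1 member_le_sum) auto
 have rk: "r k\<ge>k" for k by (simp add: r_def)
 define f where "f k = ap (X (r k))" for k
 have [measurable]: "f k\<in>meas" for k by (simp add: f_def)
 have nf: "(\<integral>\<^sup>+x. ennreal ((norm (f m x - f k x))^2) \<partial>lebesgue) = ennreal ((norm (X (r m) - X (r k)))^2)" for m k
 proof -
  have "(norm (X (r m) - X (r k)))^2 = (LL x. (norm (f m x - f k x))^2)"
   unfolding norm_lp2_square f_def
   by (rule integral_cong_AE) (measurable, use ap_diff[of "X (r m)" "X (r k)"] in eventually_elim, simp)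
  thus ?thesis
   by (subst nn_integral_eq_integral) (auto simp: f_def sq_int_integrable sq_int_diff)
 qed
 have "(\<integral>\<^sup>+x. (\<Sum>k. ennreal (4^k * (norm (f (Suc k) x - f k x))^2)) \<partial>lebesgue)
   = (\<Sum>k. \<integral>\<^sup>+x. ennreal (4^k * (norm (f (Suc k) x - f k x))^2) \<partial>lebesgue)"
  by (rule nn_integral_suminf) measurable
 also have "...\<le>(\<Sum>k. ennreal ((1/4)^k))"
 proof (intro suminf_le summableI)
  fix k
  have "(\<integral>\<^sup>+x. ennreal (4^k * (norm (f (Suc k) x - f k x))^2) \<partial>lebesgue)
    = ennreal (4^k) * (\<integral>\<^sup>+x. ennreal ((norm (f (Suc k) x - f k x))^2) \<partial>lebesgue)"
   by (subst nn_integral_cmult[symmetric]) (auto simp: ennreal_mult)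
  also have "... = ennreal (4^k * (norm (X (r (Suc k)) - X (r k)))^2)"
   by (simp add: nf ennreal_mult)
  also have "...\<le>ennreal (4^k * ((1/4)^k)^2)"
   by (intro ennreal_leI mult_left_mono power_mono less_imp_le[OF N] rN) auto
  also have "4^k * ((1/4)^k)^2 = (1/4::real)^k"
   by (simp add: power2_eq_square power_one_over)
  finally show "(\<integral>\<^sup>+x. ennreal (4^k * (norm (f (Suc k) x - f k x))^2) \<partial>lebesgue)\<le>ennreal ((1/4)^k)" .
 qed
 also have "... = ennreal (\<Sum>k. (1/4)^k)"
  by (rule suminf_ennreal2) (auto intro: summable_geometric)
 also have "... < \<infinity>" by simp
 finally have fin: "(\<integral>\<^sup>+x. (\<Sum>k. ennreal (4^k * (norm (f (Suc k) x - f k x))^2)) \<partial>lebesgue)\<noteq>\<infinity>" by simp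
 have "AEL x. (\<Sum>k. ennreal (4^k * (norm (f (Suc k) x - f k x))^2))\<noteq>\<infinity>"
  by (rule nn_integral_PInf_AE[OF _ fin]) measurable
 hence conv: "AEL x. convergent (%k. f k x)"
 proof eventually_elim
  case (elim x)
  have s: "summable (%k. 4^k * (norm (f (Suc k) x - f k x))^2)"
   by (rule summable_suminf_not_top) (use elim in auto)
  have "Bseq (%k. 4^k * (norm (f (Suc k) x - f k x))^2)"
   by (rule convergent_imp_Bseq, rule convergentI, rule summable_LIMSEQ_zero, rule s)
  then obtain B where B: "!!k. norm (4^k * (norm (f (Suc k) x - f k x))^2)\<le>B"
   by (fastforce simp: Bseq_def)
  have "B\<ge>0" using B[of 0] norm_ge_zero order_trans by blast
  have bd: "norm (f (Suc k) x - f k x)\<le>sqrt B * (1/2)^k" for k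
  proof (rule power2_le_imp_le)
   have e: "((1/2::real)^k)^2 = (1/4)^k"
    by (simp add: power2_eq_square power_mult_distrib[symmetric])
   have "(norm (f (Suc k) x - f k x))^2 = (1/4)^k * (4^k * (norm (f (Suc k) x - f k x))^2)"
    by (simp add: power_one_over)
   also have "...\<le>(1/4)^k * B"
    using B[of k] by (intro mult_left_mono) auto
   finally show "(norm (f (Suc k) x - f k x))^2\<le>(sqrt B * (1/2)^k)^2"
    using \<open>B\<ge>0\<close> by (simp add: power_mult_distrib e mult.commute)
  qed (use \<open>B\<ge>0\<close> in simp)
  have "summable (%k. f (Suc k) x - f k x)"
   by (rule summable_comparison_test'[where g="%k. sqrt B * (1/2)^k" and N=0])
    (use bd in \<open>auto intro: summable_mult summable_geometric\<close>)
  hence "convergent (%n. \<Sum>k<n. f (Suc k) x - f k x)"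
   by (simp add: summable_iff_convergent)
  hence "convergent (%n. f n x - f 0 x)" unfolding sum_lessThan_telescope[of "%k. f k x"] .
  hence "convergent (%n. (f n x - f 0 x) + f 0 x)"
   by (rule convergent_add) (simp add: convergent_const)
  thus ?case by simp
 qed
 define h where "h x = lim (%k. f k x)" for x
 have [measurable]: "h\<in>meas"
  unfolding h_def by (rule borel_measurable_lim_metric) measurable
 have close: "sq_int h \<and> norm (mk h - X (r k))\<le>(1/4)^k" for k
 proof -
  have "(\<integral>\<^sup>+x. ennreal ((norm (h x - f k x))^2) \<partial>lebesgue)
    = (\<integral>\<^sup>+x. liminf (%m. ennreal ((norm (f m x - f k x))^2)) \<partial>lebesgue)"
  proof (rule nn_integral_cong_AE)
   show "AEL x. ennreal ((norm (h x - f k x))^2) = liminf (%m. ennreal ((norm (f m x - f k x))^2))"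
    using conv
   proof eventually_elim
    case (elim x)
    hence "(%m. f m x) ----> h x" by (simp add: h_def convergent_LIMSEQ_iff)
    hence "(%m. ennreal ((norm (f m x - f k x))^2)) ----> ennreal ((norm (h x - f k x))^2)"
     by (intro tendsto_ennrealI tendsto_intros)
    thus ?case by (intro lim_imp_Liminf[symmetric]) auto
   qed
  qed
  also have "...\<le>liminf (%m. \<integral>\<^sup>+x. ennreal ((norm (f m x - f k x))^2) \<partial>lebesgue)"
   by (rule nn_integral_liminf) measurable
  also have "...\<le>ennreal (((1/4)^k)^2)"
  proof (rule Liminf_le)
   show "\<forall>\<^sub>F m in sequentially. (\<integral>\<^sup>+x. ennreal ((norm (f m x - f k x))^2) \<partial>lebesgue)\<le>ennreal (((1/4)^k)^2)"
    using eventually_ge_at_top[of k]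
    by eventually_elim (simp only: nf, intro ennreal_leI power_mono less_imp_le[OF N] rN, auto)
  qed simp
  finally have le: "(\<integral>\<^sup>+x. ennreal ((norm (h x - f k x))^2) \<partial>lebesgue)\<le>ennreal (((1/4)^k)^2)" .
  have int: "integrable lebesgue (%x. (norm (h x - f k x))^2)"
   by (rule integrableI_bounded) (measurable, use le in \<open>auto simp: top_unique intro: le_less_trans\<close>)
  have d: "sq_int (%x. h x - f k x)" using int by (simp add: sq_int_def)
  have "sq_int (%x. (h x - f k x) + f k x)"
   by (rule sq_int_add[OF d]) (simp add: f_def)
  hence sh: "sq_int h" by simp
  have "(norm (mk h - X (r k)))^2 = (LL x. (norm (h x - f k x))^2)"
   unfolding norm_lp2_square by (rule integral_cong_AE)
    (measurable, use ap_diff[of "mk h" "X (r k)"] ap_mk[OF sh] in eventually_elim, simp add: f_def)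
  also have "ennreal ...\<le>ennreal (((1/4)^k)^2)"
   using le by (subst nn_integral_eq_integral[symmetric, OF int]) auto
  finally have "(norm (mk h - X (r k)))^2\<le>((1/4)^k)^2"
   by (simp add: ennreal_le_iff)
  hence "norm (mk h - X (r k))\<le>(1/4)^k"
   by (rule power2_le_imp_le) simp
  with sh show ?thesis by simp
 qed
 have "X ----> mk h"
 proof (rule LIMSEQ_I)
  fix e :: real assume "e > 0"
  obtain k where k: "(1/4::real)^k < e / 2"
   using real_arch_pow_inv[of "e/2" "1/4"] \<open>e > 0\<close> by auto
  have "norm (X n - mk h) < e" if "n\<ge>N k" for n
  proof -
   have "norm (X n - mk h)\<le>norm (X n - X (r k)) + norm (mk h - X (r k))"
    using norm_triangle_ineq4[of "X n - X (r k)" "mk h - X (r k)"] by simp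
   also have "norm (X n - X (r k)) < (1/4)^k" using N that rN by auto
   finally show ?thesis using close[of k] k by linarith
  qed
  thus "\<exists>no. \<forall>n\<ge>no. norm (X n - mk h) < e" by blast
 qed
 thus "convergent X" by (rule convergentI)
qed

lemma ex_orthogonal_projection:
 fixes V :: "'a::{real_inner,complete_space} set"
 assumes V: "subspace V" "closed V"
 shows "\<exists>y\<in>V. \<forall>v\<in>V. inner (x - y) v = 0"
proof -
 define d where "d = Inf ((%y. (norm (x - y))^2) ` V)"
 have ne: "V\<noteq>{}" using subspace_0[OF V(1)] by auto
 have bdd: "bdd_below ((%y. (norm (x - y))^2) ` V)" by (rule bdd_belowI[of _ 0]) auto
 have dle: "d\<le>(norm (x - y))^2" if "y\<in>V" for y
  unfolding d_def by (rule cInf_lower) (use that bdd in auto)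
 have "\<exists>y\<in>V. (norm (x - y))^2 < d + e" if "e > 0" for e
  using cInf_lessD[of "(%y. (norm (x - y))^2) ` V" "d + e"] ne that unfolding d_def by auto
 hence "\<exists>y\<in>V. (norm (x - y))^2 < d + inverse (real (Suc n))" for n by simp
 then obtain Y where Y: "!!n. Y n\<in>V" "!!n. (norm (x - Y n))^2 < d + inverse (real (Suc n))"
  by metis
 have par: "(norm (Y m - Y n))^2\<le>2 * inverse (real (Suc m)) + 2 * inverse (real (Suc n))" for m n
 proof -
  have "(1/2) *: (Y m + Y n)\<in>V" by (intro subspace_scale subspace_add V Y)
  from dle[OF this] have "4 * d\<le>(norm (2 *: x - (Y m + Y n)))^2"
  proof -
   have "2 *: x - (Y m + Y n) = 2 *: (x - (1/2) *: (Y m + Y n))" by (simp add: algebra_simps)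
   hence "(norm (2 *: x - (Y m + Y n)))^2 = 4 * (norm (x - (1/2) *: (Y m + Y n)))^2"
    by (simp add: power_mult_distrib)
   thus ?thesis using dle[OF \<open>(1/2) *: (Y m + Y n)\<in>V\<close>] by simp
  qed
  moreover have "(norm (Y m - Y n))^2 + (norm (2 *: x - (Y m + Y n)))^2
    = 2 * (norm (x - Y m))^2 + 2 * (norm (x - Y n))^2"
   by (simp add: power2_norm_eq_inner algebra_simps inner_commute)
  ultimately show ?thesis using Y(2)[of m] Y(2)[of n] by linarith
 qed
 have "Cauchy Y"
 proof (rule CauchyI)
  fix e :: real assume e: "e > 0"
  obtain N where N: "inverse (real (Suc N)) < e^2 / 4"
   using reals_Archimedean[of "e^2 / 4"] e by auto
  have "norm (Y m - Y n) < e" if "m\<ge>N" "n\<ge>N" for m n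
  proof (rule power2_less_imp_less)
   have "inverse (real (Suc m))\<le>inverse (real (Suc N))" "inverse (real (Suc n))\<le>inverse (real (Suc N))"
    using that by (auto intro!: le_imp_inverse_le)
   thus "(norm (Y m - Y n))^2 < e^2" using par[of m n] N by linarith
  qed (use e in simp)
  thus "\<exists>M. \<forall>m\<ge>M. \<forall>n\<ge>M. norm (Y m - Y n) < e" by blast
 qed
 then obtain y where y: "Y ----> y" using Cauchy_convergent convergent_def by blast
 have yV: "y\<in>V" using closed_sequentially[OF V(2)] Y(1) y by blast
 have "(%n. (norm (x - Y n))^2) ----> (norm (x - y))^2" by (intro tendsto_intros y)
 moreover have "(%n. d + inverse (real (Suc n))) ----> d + 0"
  by (intro tendsto_intros LIMSEQ_inverse_real_of_nat)
 ultimately have yd: "(norm (x - y))^2\<le>d"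
  using LIMSEQ_le[of "%n. (norm (x - Y n))^2" "(norm (x - y))^2" "%n. d + inverse (real (Suc n))" "d + 0"]
   less_imp_le[OF Y(2)] by auto
 have "inner (x - y) v = 0" if v: "v\<in>V" for v
 proof (cases "v = 0")
  case False
  define t where "t = inner (x - y) v / inner v v"
  have "y + t *: v\<in>V" by (intro subspace_add subspace_scale V yV v)
  from dle[OF this] yd have "(norm (x - y))^2\<le>(norm (x - (y + t *: v)))^2" by (rule order_trans[rotated])
  also have "... = (norm (x - y))^2 - 2 * t * inner (x - y) v + t * (t * inner v v)"
   by (simp add: power2_norm_eq_inner algebra_simps inner_commute)
  finally have "2 * t * inner (x - y) v\<le>t * (t * inner v v)" by simp
  moreover have "t * inner v v = inner (x - y) v" using False by (simp add: t_def)
  ultimately have "2 * t * inner (x - y) v\<le>t * inner (x - y) v" by simp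
  hence "(inner (x - y) v)^2 / inner v v\<le>0" by (simp add: t_def power2_eq_square)
  thus ?thesis using False by (simp add: divide_le_0_iff)
    (metis inner_ge_zero inner_eq_zero_iff less_le not_less power2_eq_iff_nonneg zero_eq_power2)
 qed simp
 thus ?thesis using yV by blast
qed

definition proj :: "'a::{real_inner,complete_space} set=>'a=>'a"
 where "proj V x = (SOME y. y\<in>V \<and> (\<forall>v\<in>V. inner (x - y) v = 0))"

context
 fixes V :: "'a::{real_inner,complete_space} set"
 assumes V: "subspace V" "closed V"
begin

lemma proj_in: "proj V x\<in>V" and proj_orth: "v\<in>V ==> inner (x - proj V x) v = 0"
proof -
 have "proj V x\<in>V \<and> (\<forall>v\<in>V. inner (x - proj V x) v = 0)"
  unfolding proj_def by (rule someI_ex) (use ex_orthogonal_projection[OF V] in blast)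
 thus "proj V x\<in>V" "v\<in>V ==> inner (x - proj V x) v = 0" by auto
qed

lemma proj_inner: "v\<in>V ==> inner (proj V x) v = inner x v"
 using proj_orth[of v x] by (simp add: inner_diff_left)

lemma proj_unique:
 assumes "y\<in>V" "!!v. v\<in>V ==> inner y v = inner x v"
 shows "proj V x = y"
proof -
 have "proj V x - y\<in>V" by (intro subspace_diff V proj_in assms)
 hence "inner (proj V x - y) (proj V x - y) = 0"
  using proj_inner[of "proj V x - y" x] assms(2)[of "proj V x - y"] by (simp add: inner_diff_left)
 thus ?thesis by simp
qed

lemma proj_id: "x\<in>V ==> proj V x = x"
 by (rule proj_unique) auto

lemma proj_selfadjoint: "inner (proj V x) y = inner x (proj V y)"
 by (metis proj_inner proj_in inner_commute)

lemma proj_norm_le: "norm (proj V x)\<le>norm x"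
proof -
 have "(norm (proj V x))^2 = inner x (proj V x)"
  by (simp add: power2_norm_eq_inner proj_inner proj_in)
 also have "...\<le>norm x * norm (proj V x)" by (rule norm_cauchy_schwarz)
 finally show ?thesis by (cases "proj V x = 0") (auto simp: power2_eq_square)
qed

lemma bounded_linear_proj: "bounded_linear (proj V)"
proof (rule bounded_linear_intro[where K=1])
 show "proj V (x + y) = proj V x + proj V y" for x y
  by (rule proj_unique) (auto simp: inner_add_left proj_inner intro: subspace_add V proj_in)
 show "proj V (r *: x) = r *: proj V x" for r x
  by (rule proj_unique) (auto simp: proj_inner intro: subspace_scale V proj_in)
qed (simp add: proj_norm_le)

end

lemma riesz_representation:
 fixes f :: "'a::{real_inner,complete_space}=>real"
 assumes f: "bounded_linear f"
 shows "\<exists>g. \<forall>x. f x = inner g x"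
proof (cases "\<forall>x. f x = 0")
 case False
 interpret bounded_linear f by (fact f)
 obtain x0 where x0: "f x0\<noteq>0" using False by auto
 define V where "V = {x. f x = 0}"
 have sV: "subspace V" by (auto simp: V_def subspace_def add scale)
 have cV: "closed V"
  unfolding V_def by (intro closed_Collect_eq continuous_on continuous_on_const) (use continuous_on_id in auto)
 define z where "z = x0 - proj V x0"
 have fz: "f z = f x0" using proj_in[OF sV cV, of x0] by (simp add: z_def diff V_def)
 have z0: "z\<noteq>0" using fz x0 by (auto simp: zero)
 have "f x = inner ((f z / inner z z) *: z) x" for x
 proof -
  have "x - (f x / f z) *: z\<in>V" using fz x0 by (simp add: V_def diff scale)
  hence "inner z (x - (f x / f z) *: z) = 0"
   unfolding z_def by (rule proj_orth[OF sV cV])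
  hence "inner z x = f x / f z * inner z z" by (simp add: inner_diff_right)
  thus ?thesis using z0 fz x0 by simp
 qed
 thus ?thesis by blast
qed (use exI[of _ 0] in auto)

lemma subspace_closure:
 fixes S :: "'a::real_normed_vector set"
 assumes S: "subspace S"
 shows "subspace (closure S)"
 unfolding subspace_def
proof (intro conjI ballI allI)
 show "0\<in>closure S" using closure_subset subspace_0[OF S] by blast
 fix x y assume "x\<in>closure S" "y\<in>closure S"
 then obtain X Y where "!!n. X n\<in>S" "X ----> x" "!!n. Y n\<in>S" "Y ----> y"
  unfolding closure_sequential by blast
 thus "x + y\<in>closure S"
  unfolding closure_sequential by (intro exI[of _ "%n. X n + Y n"]) (auto intro: subspace_add[OF S] tendsto_add)
next
 fix c x assume "x\<in>closure S"
 then obtain X where "!!n. X n\<in>S" "X ----> x"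
  unfolding closure_sequential by blast
 thus "c *: x\<in>closure S"
  unfolding closure_sequential by (intro exI[of _ "%n. c *: X n"]) (auto intro: subspace_scale[OF S] tendsto_intros)
qed

lemma in_closure_if_orthogonal_trivial:
 fixes S R :: "'a::{real_inner,complete_space} set"
 assumes S: "subspace S" and SR: "S\<subseteq>R" and R: "subspace R" "closed R"
  and triv: "!!u. u\<in>R ==> (!!s. s\<in>S ==> inner u s = 0) ==> u = 0"
  and y: "y\<in>R"
 shows "y\<in>closure S"
proof -
 have cs: "subspace (closure S)" "closed (closure S)" using S by (auto intro: subspace_closure)
 have sub: "closure S\<subseteq>R" using SR R(2) by (simp add: closure_minimal)
 have "y - proj (closure S) y = 0"
 proof (rule triv)
  show "y - proj (closure S) y\<in>R"
   using proj_in[OF cs, of y] sub by (intro subspace_diff R y) auto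
  show "inner (y - proj (closure S) y) s = 0" if "s\<in>S" for s
   by (rule proj_orth[OF cs]) (use that closure_subset in auto)
 qed
 thus ?thesis using proj_in[OF cs, of y] by simp
qed

lemma hahn_banach:
 fixes \<Phi> :: "'u::real_vector=>real" and h :: "'u=>'y::real_vector"
 assumes lin: "linear \<Phi>" "linear h" and S: "subspace S"
  and p_add: "!!x y. p (x + y)\<le>p x + p y"
  and p_scale: "!!t x. t > 0 ==> p (t *: x) = t * p x"
  and le: "!!u. u\<in>S ==> \<Phi> u\<le>p (h u)"
 shows "\<exists>m. linear m \<and> (\<forall>u\<in>S. m (h u) = \<Phi> u) \<and> (\<forall>y. m y\<le>p y)"
proof -
 define G0 where "G0 = (%u. (h u, \<Phi> u)) ` S"
 define A where "A = {G. subspace G \<and> G0\<subseteq>G \<and> (\<forall>y a. (y, a)\<in>G --> a\<le>p y)}"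
 have "linear (%u. (h u, \<Phi> u))"
  using lin by (auto simp: linear_iff)
 hence "subspace G0" unfolding G0_def by (rule linear_subspace_image) (rule S)
 hence G0A: "G0\<in>A" using le by (auto simp: A_def G0_def)
 have "\<exists>M\<in>A. \<forall>X\<in>A. M\<subseteq>X --> X = M"
 proof (rule subset_Zorn)
  fix C assume C: "subset.chain A C"
  show "\<exists>U\<in>A. \<forall>X\<in>C. X\<subseteq>U"
  proof (cases "C = {}")
   case True thus ?thesis using G0A by blast
  next
   case False
   have CA: "!!X. X\<in>C ==> X\<in>A" and tot: "!!X Y. X\<in>C ==> Y\<in>C ==> X\<subseteq>Y \<or> Y\<subseteq>X"
    using C by (auto simp: subset_chain_def)
   have "subspace (\<Union>C)"
    unfolding subspace_def
   proof (intro conjI ballI allI)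
    show "0\<in>\<Union>C" using False CA subspace_0 by (fastforce simp: A_def)
    fix x y assume "x\<in>\<Union>C" "y\<in>\<Union>C"
    then obtain X Y where "X\<in>C" "Y\<in>C" "x\<in>X" "y\<in>Y" by auto
    then obtain Z where "Z\<in>C" "x\<in>Z" "y\<in>Z" using tot by blast
    thus "x + y\<in>\<Union>C" using CA by (auto simp: A_def intro!: subspace_add bexI[of _ Z])
   next
    fix c x assume "x\<in>\<Union>C"
    thus "c *: x\<in>\<Union>C" using CA by (auto simp: A_def intro: subspace_scale)
   qed
   moreover have "G0\<subseteq>\<Union>C" using False CA by (fastforce simp: A_def)
   ultimately have "\<Union>C\<in>A" using CA by (auto simp: A_def)
   thus ?thesis by blast
  qed
 qed
 then obtain G where G: "G\<in>A" and max: "!!X. X\<in>A ==> G\<subseteq>X ==> X = G" by blast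
 have sG: "subspace G" and G0G: "G0\<subseteq>G" and Gp: "!!y a. (y, a)\<in>G ==> a\<le>p y"
  using G by (auto simp: A_def)
 have p0: "p 0 = 0" using p_scale[of 2 0] by simp
 have addG: "(y + y', a + a')\<in>G" if "(y, a)\<in>G" "(y', a')\<in>G" for y y' a a'
  using subspace_add[OF sG that] by simp
 have scG: "(t *: y, t * a)\<in>G" if "(y, a)\<in>G" for y a t
  using subspace_scale[OF sG that, of t] by simp
 have ex: "\<exists>a. (y0, a)\<in>G" for y0
 proof (rule ccontr)
  assume no: "\<nexists>a. (y0, a)\<in>G"
  have key: "a - p (y - y0)\<le>p (y' + y0) - a'" if "(y, a)\<in>G" "(y', a')\<in>G" for y a y' a'
  proof -
   have "a + a'\<le>p ((y - y0) + (y' + y0))" using Gp[OF addG[OF that]] by simp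
   also have "...\<le>p (y - y0) + p (y' + y0)" by (rule p_add)
   finally show ?thesis by simp
  qed
  define c where "c = Sup {a - p (y - y0) | y a. (y, a)\<in>G}"
  have zG: "(0, 0)\<in>G" using subspace_0[OF sG] by (simp add: zero_prod_def)
  have c1: "a - p (y - y0)\<le>c" if "(y, a)\<in>G" for y a
   unfolding c_def by (rule cSup_upper) (use that key[OF _ zG] in \<open>auto intro!: bdd_aboveI\<close>)
  have c2: "c\<le>p (y' + y0) - a'" if "(y', a')\<in>G" for y' a'
   unfolding c_def by (rule cSup_least) (use that key zG in auto)
  define G' where "G' = {(y + t *: y0, a + t * c) | y a t. (y, a)\<in>G}"
  have "subspace G'"
   unfolding subspace_def
  proof (intro conjI ballI allI)
   show "0\<in>G'" using zG unfolding G'_def zero_prod_def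
    by (auto intro!: exI[of _ 0])
   fix u v assume "u\<in>G'" "v\<in>G'"
   then obtain y a t y' a' t' where *: "u = (y + t *: y0, a + t * c)" "(y, a)\<in>G"
    "v = (y' + t' *: y0, a' + t' * c)" "(y', a')\<in>G" unfolding G'_def by auto
   have "u + v = ((y + y') + (t + t') *: y0, (a + a') + (t + t') * c)"
    by (simp add: * algebra_simps)
   thus "u + v\<in>G'" using addG[OF *(2,4)] unfolding G'_def by blast
  next
   fix r u assume "u\<in>G'"
   then obtain y a t where *: "u = (y + t *: y0, a + t * c)" "(y, a)\<in>G" unfolding G'_def by auto
   have "r *: u = (r *: y + (r * t) *: y0, r * a + (r * t) * c)"
    by (simp add: * algebra_simps)
   thus "r *: u\<in>G'" using scG[OF *(2)] unfolding G'_def by blast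
  qed
  moreover have GG': "G\<subseteq>G'"
  proof (clarify)
   fix y a assume "(y, a)\<in>G"
   moreover have "(y, a) = (y + 0 *: y0, a + 0 * c)" by simp
   ultimately show "(y, a)\<in>G'" unfolding G'_def by blast
  qed
  moreover have "b\<le>p z" if zb: "(z, b)\<in>G'" for z b
  proof -
   obtain y a t where z: "z = y + t *: y0" "b = a + t * c" and ya: "(y, a)\<in>G"
    using zb unfolding G'_def by auto
   consider "t = 0" | "t > 0" | "t < 0" by linarith
   thus ?thesis
   proof cases
    case 1 thus ?thesis using Gp[OF ya] z by simp
   next
    case 2
    have "c\<le>p ((1/t) *: y + y0) - (1/t) * a" by (rule c2[OF scG[OF ya]])
    hence "t * c\<le>t * (p ((1/t) *: y + y0) - (1/t) * a)" using 2 by (intro mult_left_mono) auto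
    also have "... = p (t *: ((1/t) *: y + y0)) - a" using 2 unfolding p_scale[OF 2] by (simp add: algebra_simps)
    also have "t *: ((1/t) *: y + y0) = z" using 2 z by (simp add: algebra_simps)
    finally show ?thesis using z by simp
   next
    case 3
    define s where "s = - t"
    have s: "s > 0" using 3 by (simp add: s_def)
    have "(1/s) * a - p ((1/s) *: y - y0)\<le>c" by (rule c1[OF scG[OF ya]])
    hence "s * ((1/s) * a - p ((1/s) *: y - y0))\<le>s * c" using s by (intro mult_left_mono) auto
    moreover have "s * ((1/s) * a - p ((1/s) *: y - y0)) = a - p (s *: ((1/s) *: y - y0))"
     using s unfolding p_scale[OF s] by (simp add: algebra_simps)
    moreover have "s *: ((1/s) *: y - y0) = z" using s z by (simp add: algebra_simps s_def)
    ultimately show ?thesis using z by (simp add: s_def)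
   qed
  qed
  ultimately have "G'\<in>A" using G0G by (auto simp: A_def)
  hence "G' = G" using max GG' by blast
  moreover have "(0 + 1 *: y0, 0 + 1 * c)\<in>G'" unfolding G'_def using zG by blast
  hence "(y0, c)\<in>G'" by simp
  ultimately show False using no by blast
 qed
 have uniq: "a = b" if "(y, a)\<in>G" "(y, b)\<in>G" for y a b
 proof -
  have "(0, a - b)\<in>G" "(0, b - a)\<in>G"
   using subspace_diff[OF sG that] subspace_diff[OF sG that(2,1)] by simp_all
  hence "a - b\<le>0" "b - a\<le>0" using Gp p0 by metis+
  thus ?thesis by simp
 qed
 define m where "m y = (SOME a. (y, a)\<in>G)" for y
 have mG: "(y, m y)\<in>G" for y unfolding m_def using ex[of y] by (rule someI_ex)
 have "linear m"
  unfolding linear_iff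
 proof (intro conjI allI)
  show "m (x + y) = m x + m y" for x y by (rule uniq[OF mG addG[OF mG mG]])
  show "m (c *: x) = c *: m x" for c x using uniq[OF mG scG[OF mG]] by simp
 qed
 moreover have "m (h u) = \<Phi> u" if "u\<in>S" for u
  by (rule uniq[OF mG]) (use G0G that in \<open>auto simp: G0_def\<close>)
 ultimately show ?thesis using Gp[OF mG] by blast
qed

section \<open>Test functions\<close>

lemma C_class_SucD: "C_class (Suc k) f ==> C_class k f"
proof (induction k arbitrary: f)
 case 0
 thus ?case
  by (auto simp: continuous_on_eq_continuous_at intro: differentiable_imp_continuous_within)
next
 case (Suc k)
 hence "\<forall>x. f differentiable (at x)"
  and "\<forall>b\<in>Basis. C_class (Suc k) (%x. pd b f x)"
  using C_class.simps(2)[of "Suc k" f] by blast+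
 with Suc.IH show ?case using C_class.simps(2)[of k f] by blast
qed

lemma C_class_SucI:
 assumes "!!x. (f has_derivative f' x) (at x)" "!!b. b\<in>Basis ==> C_class k (%x. f' x b)"
 shows "C_class (Suc k) f"
proof -
 have "frechet_derivative f (at x) = f' x" for x
  using frechet_derivative_at[OF assms(1)[of x]] by simp
 thus ?thesis using assms by (auto simp: differentiable_def)
qed

lemma C_class_SucE:
 assumes "C_class (Suc k) f"
 obtains f' where "!!x. (f has_derivative f' x) (at x)" "!!b. b\<in>Basis ==> C_class k (%x. f' x b)"
proof
 show "(f has_derivative frechet_derivative f (at x)) (at x)" for x
  using assms by (simp add: frechet_derivative_works)
 show "b\<in>Basis ==> C_class k (%x. pd b f x)" for b
  using assms by simp
qed

lemma C_class_const: "C_class k (%x. c)"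
proof (induction k arbitrary: c)
 case (Suc k)
 show ?case by (rule C_class_SucI[where f'="%x h. 0"]) (auto intro: Suc)
qed simp

lemma C_class_add: "C_class k f ==> C_class k g ==> C_class k (%x. f x + g x)"
proof (induction k arbitrary: f g)
 case (Suc k)
 obtain f' where f': "!!x. (f has_derivative f' x) (at x)" "!!b. b\<in>Basis ==> C_class k (%x. f' x b)"
  using C_class_SucE[OF Suc.prems(1)] by blast
 obtain g' where g': "!!x. (g has_derivative g' x) (at x)" "!!b. b\<in>Basis ==> C_class k (%x. g' x b)"
  using C_class_SucE[OF Suc.prems(2)] by blast
 show ?case
  by (rule C_class_SucI[where f'="%x h. f' x h + g' x h"])
   (intro has_derivative_add f' g', intro Suc.IH f' g')
qed (simp add: continuous_on_add)

lemma C_class_mult: "C_class k f ==> C_class k g ==> C_class k (%x. f x * g x)"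
proof (induction k arbitrary: f g)
 case (Suc k)
 obtain f' where f': "!!x. (f has_derivative f' x) (at x)" "!!b. b\<in>Basis ==> C_class k (%x. f' x b)"
  using C_class_SucE[OF Suc.prems(1)] by blast
 obtain g' where g': "!!x. (g has_derivative g' x) (at x)" "!!b. b\<in>Basis ==> C_class k (%x. g' x b)"
  using C_class_SucE[OF Suc.prems(2)] by blast
 note k = C_class_SucD[OF Suc.prems(1)] C_class_SucD[OF Suc.prems(2)]
 show ?case
  by (rule C_class_SucI[where f'="%x h. f x * g' x h + f' x h * g x"])
   (intro has_derivative_mult f' g', intro C_class_add Suc.IH f' g' k)
qed (simp add: continuous_on_mult)

lemma C_class_exp: "C_class k f ==> C_class k (%x. exp (f x))"
proof (induction k arbitrary: f)
 case (Suc k)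
 obtain f' where f': "!!x. (f has_derivative f' x) (at x)" "!!b. b\<in>Basis ==> C_class k (%x. f' x b)"
  using C_class_SucE[OF Suc.prems] by blast
 show ?case
 proof (rule C_class_SucI[where f'="%x h. exp (f x) * f' x h"])
  show "((%x. exp (f x)) has_derivative (%h. exp (f x) * f' x h)) (at x)" for x
   using has_derivative_exp[OF f'(1)[of x]] by (simp add: mult.commute)
  show "b\<in>Basis ==> C_class k (%x. exp (f x) * f' x b)" for b
   by (intro C_class_mult Suc.IH C_class_SucD[OF Suc.prems] f')
 qed
qed (simp add: continuous_on_exp)

lemma C_class_cmult: "C_class k f ==> C_class k (%x. c * f x)"
 by (intro C_class_mult C_class_const)

lemma C_class_diff: "C_class k f ==> C_class k g ==> C_class k (%x. f x - g x)"
 using C_class_add[of k f "%x. (-1) * g x"] C_class_cmult[of k g "-1"] by simp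

lemma C_class_prod: "finite I ==> (!!i. i\<in>I ==> C_class k (f i)) ==> C_class k (%x. \<Prod>i\<in>I. f i x)"
 by (induction I rule: finite_induct) (auto intro: C_class_const C_class_mult simp del: C_class.simps)

lemma C_class_continuous: "C_class k f ==> continuous_on S f"
proof (induction k)
 case 0 thus ?case by (auto intro: continuous_on_subset)
next
 case (Suc k) show ?case by (rule Suc.IH[OF C_class_SucD[OF Suc.prems]])
qed

text \<open>The family \<open>s\<^sup>-\<^sup>m exp(-1/s)\<close> is closed under differentiation up to linear combinations.\<close>

definition flat :: "nat=>real=>real"
 where "flat m s = (if s > 0 then inverse s ^ m * exp (- inverse s) else 0)"

lemma flat_bound: "\<bar>flat m s\<bar>\<le>real (Suc m) ^ Suc m * \<bar>s\<bar>"
proof (cases "s > 0")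
 case False
 hence "flat m s = 0" by (simp add: flat_def)
 moreover have "0\<le>real (Suc m) ^ Suc m * \<bar>s\<bar>" by (intro mult_nonneg_nonneg zero_le_power) auto
 ultimately show ?thesis by simp
next
 case True
 define u where "u = inverse s"
 have u: "u > 0" using True by (simp add: u_def)
 have "(u / real (Suc m)) ^ Suc m\<le>(1 + u / real (Suc m)) ^ Suc m"
  using u by (intro power_mono) auto
 also have "...\<le>exp u"
  using u by (intro exp_ge_one_plus_x_over_n_power_n) auto
 finally have "u ^ Suc m / real (Suc m) ^ Suc m\<le>exp u"
  by (simp only: power_divide)
 hence "u ^ Suc m\<le>real (Suc m) ^ Suc m * exp u"
  by (subst (asm) pos_divide_le_eq) (auto simp del: power_Suc simp: mult.commute)
 hence "u ^ Suc m * exp (- u)\<le>real (Suc m) ^ Suc m * exp u * exp (- u)"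
  by (intro mult_right_mono) auto
 also have "... = real (Suc m) ^ Suc m"
  by (simp only: mult.assoc exp_minus_inverse mult_1_right)
 finally have "s * (u ^ Suc m * exp (- u))\<le>s * real (Suc m) ^ Suc m"
  using True by (intro mult_left_mono) auto
 moreover have "s * (u ^ Suc m * exp (- u)) = flat m s"
  using True by (simp add: flat_def u_def)
 moreover have "0\<le>flat m s" using True by (simp add: flat_def)
 ultimately have "\<bar>flat m s\<bar>\<le>s * real (Suc m) ^ Suc m" by linarith
 thus ?thesis using True by (simp only: abs_of_pos mult.commute)
qed

lemma flat_has_derivative: "(flat m has_real_derivative (flat (m + 2) s - real m * flat (m + 1) s)) (at s)"
proof -
 consider "s > 0" | "s < 0" | "s = 0" by linarith
 thus ?thesis
 proof cases
  case 1
  have "((%s. inverse s ^ m * exp (- inverse s)) has_real_derivative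
    (real m * inverse s ^ (m - Suc 0) * (- (inverse s)\<^sup>2) * exp (- inverse s)
     + inverse s ^ m * (exp (- inverse s) * (inverse s)^2))) (at s)"
   using 1 by (auto intro!: derivative_eq_intros simp: power2_eq_square)
  moreover have "real m * inverse s ^ (m - Suc 0) * (- (inverse s)\<^sup>2) * exp (- inverse s)
     + inverse s ^ m * (exp (- inverse s) * (inverse s)^2) = flat (m + 2) s - real m * flat (m + 1) s"
   using 1 by (cases m) (auto simp: flat_def algebra_simps power2_eq_square)
  ultimately have "((%s. inverse s ^ m * exp (- inverse s)) has_real_derivative
    (flat (m + 2) s - real m * flat (m + 1) s)) (at s)" by simp
  thus ?thesis
   by (rule DERIV_cong_ev[THEN iffD1, rotated -1, OF _ refl _ refl])
    (use 1 eventually_nhds_in_open[of "{0<..}" s] in \<open>auto elim!: eventually_mono simp: flat_def\<close>)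
 next
  case 2
  have "((%s. 0) has_real_derivative (flat (m + 2) s - real m * flat (m + 1) s)) (at s)"
   using 2 by (simp add: flat_def)
  thus ?thesis
   by (rule DERIV_cong_ev[THEN iffD1, rotated -1, OF _ refl _ refl])
    (use 2 eventually_nhds_in_open[of "{..<0}" s] in \<open>auto elim!: eventually_mono simp: flat_def\<close>)
 next
  case 3
  have q: "(flat m (0 + h) - flat m 0) / h = flat (Suc m) h" for h
   by (simp add: flat_def field_simps)
  have "((%h. flat (Suc m) h) \<longlongrightarrow> 0) (at 0)"
  proof (rule Lim_null_comparison)
   show "\<forall>\<^sub>F h in at 0. norm (flat (Suc m) h)\<le>real (Suc (Suc m)) ^ Suc (Suc m) * \<bar>h\<bar>"
    using flat_bound[of "Suc m"] by (intro always_eventually) (simp del: power_Suc)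
   show "((%h. real (Suc (Suc m)) ^ Suc (Suc m) * \<bar>h\<bar>) \<longlongrightarrow> (0::real)) (at 0)"
    by (auto intro!: tendsto_eq_intros simp del: power_Suc)
  qed
  moreover have "flat k 0 = 0" for k by (simp add: flat_def)
  ultimately show ?thesis unfolding 3 DERIV_def q by simp
 qed
qed

lemma C_class_flat: "C_class k (%x. flat m (\<sigma> * (x\<bullet>b) + ta))"
proof (induction k arbitrary: m)
 case 0
 have "continuous_on UNIV (flat m)"
  using flat_has_derivative by (intro continuous_at_imp_continuous_on ballI DERIV_isCont)
 thus ?case
  by (auto intro!: continuous_on_compose2[of UNIV "flat m"] continuous_intros)
next
 case (Suc k)
 show ?case
 proof (rule C_class_SucI[where f'="%x h. (flat (m + 2) (\<sigma> * (x\<bullet>b) + ta) - real m * flat (m + 1) (\<sigma> * (x\<bullet>b) + ta)) * (\<sigma> * (h\<bullet>b))"])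
  fix x :: 'a
  show "((%x. flat m (\<sigma> * (x\<bullet>b) + ta)) has_derivative
    (%h. (flat (m + 2) (\<sigma> * (x\<bullet>b) + ta) - real m * flat (m + 1) (\<sigma> * (x\<bullet>b) + ta)) * (\<sigma> * (h\<bullet>b)))) (at x)"
  proof (rule has_derivative_compose[where g="flat m" and f="%x. \<sigma> * (x\<bullet>b) + ta" and f'="%h. \<sigma> * (h\<bullet>b)"])
   show "((%x. \<sigma> * (x\<bullet>b) + ta) has_derivative (%h. \<sigma> * (h\<bullet>b))) (at x)"
    by (auto intro!: derivative_eq_intros)
   show "(flat m has_derivative (*) (flat (m + 2) (\<sigma> * (x\<bullet>b) + ta) - real m * flat (m + 1) (\<sigma> * (x\<bullet>b) + ta)))
     (at (\<sigma> * (x\<bullet>b) + ta))"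
    using flat_has_derivative unfolding has_field_derivative_def .
  qed
 next
  fix h :: 'a
  have "C_class k (%x. (flat (m + 2) (\<sigma> * (x\<bullet>b) + ta) - real m * flat (m + 1) (\<sigma> * (x\<bullet>b) + ta)))"
   by (intro C_class_diff C_class_cmult Suc)
  from C_class_mult[OF this C_class_const]
  show "C_class k (%x. (flat (m + 2) (\<sigma> * (x\<bullet>b) + ta) - real m * flat (m + 1) (\<sigma> * (x\<bullet>b) + ta)) * (\<sigma> * (h\<bullet>b)))" .
 qed
qed

definition bump :: "'a::euclidean_space=>'a=>'a=>real"
 where "bump a c x = (\<Prod>b\<in>Basis. flat 0 (1 * (x\<bullet>b) + (- (a\<bullet>b))) * flat 0 ((-1) * (x\<bullet>b) + c\<bullet>b))"

lemma C_class_bump: "C_class k (bump a c)"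
 unfolding bump_def by (intro C_class_prod C_class_mult C_class_flat) simp

lemma bump_pos: "x\<in>box a c ==> bump a c x > 0"
 unfolding bump_def by (intro prod_pos mult_pos_pos) (simp_all add: mem_box flat_def)

lemma bump_zero:
 assumes "x\<notin>box a c"
 shows "bump a c x = 0"
proof -
 obtain b where b: "b\<in>Basis" "x\<bullet>b\<le>a\<bullet>b \<or> c\<bullet>b\<le>x\<bullet>b"
  using assms by (auto simp: mem_box not_less)
 hence "flat 0 (1 * (x\<bullet>b) + (- (a\<bullet>b))) * flat 0 ((-1) * (x\<bullet>b) + c\<bullet>b) = 0"
  by (elim disjE) (simp_all add: flat_def)
 thus ?thesis unfolding bump_def using b(1) by (intro prod_zero) auto
qed

definition box_approx :: "nat=>'a::euclidean_space=>'a=>'a=>real"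
 where "box_approx n a c x = 1 - exp (- real n * bump a c x)"

lemma test_function_box_approx:
 assumes "cbox a c\<subseteq>U"
 shows "test_function U (box_approx n a c)"
proof -
 have "{x. box_approx n a c x\<noteq>0}\<subseteq>cbox a c"
 proof
  fix x assume "x\<in>{x. box_approx n a c x\<noteq>0}"
  hence "bump a c x\<noteq>0" by (auto simp: box_approx_def)
  hence "x\<in>box a c" using bump_zero by blast
  thus "x\<in>cbox a c" using box_subset_cbox by blast
 qed
 hence sub: "closure {x. box_approx n a c x\<noteq>0}\<subseteq>cbox a c"
  by (rule closure_minimal) (rule closed_cbox)
 have "compact (cbox a c\<inter>closure {x. box_approx n a c x\<noteq>0})"
  by (intro compact_Int_closed) auto
 hence "compact (closure {x. box_approx n a c x\<noteq>0})"
  using sub by (simp add: Int_absorb1)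
 moreover have "C_class k (box_approx n a c)" for k
  unfolding box_approx_def by (intro C_class_diff C_class_const C_class_exp C_class_cmult C_class_bump)
 ultimately show ?thesis
  unfolding test_function_def using assms sub by (intro conjI allI) auto
qed

lemma box_approx_bound: "\<bar>box_approx n a c x\<bar>\<le>ind (cbox a c) x"
proof (cases "x\<in>box a c")
 case True
 hence x: "x\<in>cbox a c" using box_subset_cbox by blast
 define e where "e = exp (- real n * bump a c x)"
 have "- real n * bump a c x\<le>0" using bump_pos[OF True] by simp
 hence "e\<le>1" "0\<le>e" unfolding e_def exp_le_one_iff by auto
 moreover have "box_approx n a c x = 1 - e" by (simp only: box_approx_def e_def)
 ultimately show ?thesis using x by simp
next
 case False
 thus ?thesis unfolding box_approx_def by (subst bump_zero) auto
qed

lemma box_approx_lim: "(%n. box_approx n a c x) ----> ind (box a c) x"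
proof (cases "x\<in>box a c")
 case True
 have "exp (- real n * bump a c x) = exp (- bump a c x) ^ n" for n
  using exp_of_nat_mult[of n "- bump a c x"] by simp
 hence "box_approx n a c x = 1 - exp (- bump a c x) ^ n" for n
  by (simp only: box_approx_def)
 moreover have "(%n. exp (- bump a c x) ^ n) ----> 0"
 proof (rule LIMSEQ_power_zero)
  have "exp (- bump a c x) < 1" using bump_pos[OF True] by (subst exp_less_one_iff) simp
  thus "norm (exp (- bump a c x)) < 1" by (simp only: real_norm_def abs_exp_cancel)
 qed
 hence "(%n. 1 - exp (- bump a c x) ^ n) ----> 1 - 0" by (intro tendsto_diff tendsto_const)
 ultimately show ?thesis using True by simp
next
 case False
 thus ?thesis unfolding box_approx_def by (subst bump_zero) auto
qed

lemma borel_eq_cbox: "borel = sigma UNIV (range (%(a, b). cbox a b :: 'a::euclidean_space set))"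
  (is "_ = ?SIGMA")
proof (rule borel_eq_sigmaI1[OF borel_def])
 fix M :: "'a set" assume "M\<in>{S. open S}"
 hence "open M" by simp
 show "M\<in>?SIGMA"
  apply (subst open_UNION_cbox[OF \<open>open M\<close>])
  apply (safe intro!: sets.countable_UN' countable_PiE countable_Collect)
  apply (auto intro: countable_rat)
  done
qed auto

lemma AE_zero_if_box:
 fixes f :: "'a::euclidean_space=>real"
 assumes U: "open U"
  and int: "!!a b. cbox a b\<subseteq>U ==> set_integrable lebesgue (cbox a b) f"
  and zero: "!!a b. cbox a b\<subseteq>U ==> (LINT x:cbox a b|lebesgue. f x) = 0"
 shows "AEL x. x\<in>U --> f x = 0"
proof -
 have box0: "AEL x. x\<in>cbox a b --> f x = 0" if sub: "cbox a b\<subseteq>U" for a b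
 proof -
  define g where "g x = ind (cbox a b) x *: f x" for x
  have gi: "integrable lebesgue g" using int[OF sub] unfolding g_def set_integrable_def .
  then obtain g' where g': "g'\<in>borel_measurable lborel" "AE x in lborel. g x = g' x"
   using completion_ex_borel_measurable_real[of g lborel] by auto
  have [measurable]: "g'\<in>borel_measurable borel" using g'(1) by simp
  have aeL: "AEL x. g x = g' x" by (rule AE_completion) (rule g'(2))
  have gi': "integrable lebesgue g'"
   by (rule integrable_cong_AE_imp[OF gi]) (use aeL in \<open>auto intro: measurable_completion elim: eventually_mono\<close>)
  hence gi'': "integrable lborel g'" by (simp add: integrable_completion)
  have int': "(LINT x:A|lborel. g' x) = (LINT x:A|lebesgue. g x)" if "A\<in>sets borel" for A
  proof -
   have "(LINT x:A|lborel. g' x) = (LINT x:A|lebesgue. g' x)"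
    unfolding set_lebesgue_integral_def using that by (subst integral_completion) auto
   also have "... = (LINT x:A|lebesgue. g x)"
    unfolding set_lebesgue_integral_def
   proof (rule integral_cong_AE)
    have [measurable]: "A\<in>sets lebesgue" "g\<in>meas" "g'\<in>meas"
     using that gi gi' by auto
    show "(%x. indicat_real A x *: g' x)\<in>meas"
     "(%x. indicat_real A x *: g x)\<in>meas" by measurable
    show "AEL x. indicat_real A x *: g' x = indicat_real A x *: g x"
     using aeL by eventually_elim simp
   qed
   finally show ?thesis .
  qed
  have bx: "(LINT x:cbox c d|lebesgue. g x) = 0" for c d
  proof -
   obtain u v where uv: "cbox a b\<inter>cbox c d = cbox u v" using Int_interval[of a b c d] by blast
   have "(LINT x:cbox c d|lebesgue. g x) = (LINT x:cbox u v|lebesgue. f x)"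
    unfolding set_lebesgue_integral_def g_def uv[symmetric]
    by (intro Bochner_Integration.integral_cong) (auto simp: ind_def)
   also have "... = 0" using uv sub by (intro zero) auto
   finally show ?thesis .
  qed
  have "(LINT x:A|lborel. g' x) = 0" if "A\<in>sets lborel" for A
  proof -
   have sg: "A\<in>sigma_sets UNIV (range (%(a, b). cbox a b))"
   proof -
    have "sets (borel :: 'a measure) = sigma_sets UNIV (range (%(a, b). cbox a b))"
     by (simp add: borel_eq_cbox)
    thus ?thesis using that by simp
   qed
   have istab: "Int_stable (range (%(a, b). cbox a b) :: 'a set set)"
   proof (rule Int_stableI)
    fix X Y :: "'a set"
    assume "X\<in>range (%(a, b). cbox a b)" "Y\<in>range (%(a, b). cbox a b)"
    then obtain p q u v where "X = cbox p q" "Y = cbox u v" by auto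
    thus "X\<inter>Y\<in>range (%(a, b). cbox a b)" using Int_interval[of p q u v] by auto
   qed
   show ?thesis
   proof (rule sigma_sets_induct_disjoint[where P="%A. (LINT x:A|lborel. g' x) = 0", OF istab _ sg])
    show "(LINT x:A|lborel. g' x) = 0" if "A\<in>range (%(a, b). cbox a b)" for A
     using that bx by (auto simp: int')
    show "(LINT x:UNIV - A|lborel. g' x) = 0"
     if A: "A\<in>sigma_sets UNIV (range (%(a, b). cbox a b))" and "(LINT x:A|lborel. g' x) = 0" for A
    proof -
     have Ab: "A\<in>sets borel" using A by (simp add: borel_eq_cbox)
     have "(LINT x:UNIV - A|lborel. g' x) = (LINT x|lborel. g' x) - (LINT x:A|lborel. g' x)"
      unfolding set_lebesgue_integral_def using integrable_mult_indicator[of A lborel g'] Ab gi''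
      by (subst Bochner_Integration.integral_diff[symmetric])
       (auto intro!: Bochner_Integration.integral_cong simp: ind_def simp del: Bochner_Integration.integral_diff)
     also have "(LINT x|lborel. g' x) = (LINT x:UNIV|lborel. g' x)"
      by (simp add: set_lebesgue_integral_def)
     also have "... = (LINT x:cbox a b|lebesgue. g x)"
      by (subst int', simp) (auto simp: set_lebesgue_integral_def g_def ind_def intro!: Bochner_Integration.integral_cong)
     finally show ?thesis using that bx by simp
    qed
    show "(LINT x:(\<Union>i. A i)|lborel. g' x) = 0"
     if dj: "disjoint_family A" and A: "range A\<subseteq>sigma_sets UNIV (range (%(a, b). cbox a b))"
      and 0: "!!i::nat. (LINT x:A i|lborel. g' x) = 0" for A
    proof -
     have Ab: "A i\<in>sets borel" for i using A by (auto simp: borel_eq_cbox)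
     have "set_integrable lborel (\<Union>i. A i) g'"
      unfolding set_integrable_def using Ab gi'' by (intro integrable_mult_indicator) auto
     hence "(LINT x:(\<Union>i. A i)|lborel. g' x) = (\<Sum>i. LINT x:A i|lborel. g' x)"
      using Ab dj by (intro lebesgue_integral_countable_add) (auto simp: disjoint_family_on_def)
     thus ?thesis using 0 by simp
    qed
   qed (auto simp: set_lebesgue_integral_def)
  qed
  hence "AE x in lborel. g' x = 0" by (intro sigma_finite_measure.density_zero[OF sigma_finite_lborel] gi'')
  hence "AEL x. g' x = 0" by (rule AE_completion)
  with aeL show ?thesis by eventually_elim (auto simp: g_def)
 qed
 obtain D :: "'a set set" where D: "countable D" "!!X. X\<in>D ==> X\<subseteq>U \<and> (\<exists>a b. X = cbox a b)" "\<Union>D = U"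
 proof
  define I :: "('a=>real \<times> real) set" where "I = {f\<in>Basis \<rightarrow>\<^sub>E \<rat> \<times> \<rat>.
   cbox (\<Sum>i\<in>Basis. fst (f i) *: i) (\<Sum>i\<in>Basis. snd (f i) *: i)\<subseteq>U}"
  let ?D = "(%f. cbox (\<Sum>i\<in>Basis. fst (f i) *: i) (\<Sum>i\<in>Basis. snd (f i) *: i) :: 'a set) ` I"
  have "countable I" unfolding I_def
   by (intro countable_Collect countable_PiE countable_SIGMA countable_rat) auto
  thus "countable ?D" by simp
  show "!!X. X\<in>?D ==> X\<subseteq>U \<and> (\<exists>a b. X = cbox a b)" by (auto simp: I_def)
  show "\<Union>?D = U" using open_UNION_cbox[OF U] unfolding I_def by simp
 qed
 have "AEL x. \<forall>X\<in>D. x\<in>X --> f x = 0"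
 proof (rule AE_ball_countable')
  fix X assume "X\<in>D"
  with D(2) obtain a b where "X = cbox a b" "cbox a b\<subseteq>U" by metis
  with box0 show "AEL x. x\<in>X --> f x = 0" by simp
 qed (rule D)
 thus ?thesis
 proof eventually_elim
  case (elim x)
  show ?case
  proof
   assume "x\<in>U"
   then obtain X where "X\<in>D" "x\<in>X" using D(3) by auto
   with elim show "f x = 0" by blast
  qed
 qed
qed

lemma AE_zero_if_test:
 fixes f :: "'a::euclidean_space=>real"
 assumes U: "open U"
  and int: "!!a b. cbox a b\<subseteq>U ==> set_integrable lebesgue (cbox a b) f"
  and zero: "!!ph. test_function U ph ==> (LL x. f x * ph x) = 0"
 shows "AEL x. x\<in>U --> f x = 0"
proof (rule AE_zero_if_box[OF U int])
 fix a b assume sub: "cbox a b\<subseteq>U"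
 have ae: "AEL x. x\<notin>cbox a b - box a b"
  using negligible_frontier_interval[of a b] by (intro AE_not_in) (simp add: negligible_iff_null_sets)
 have fi: "integrable lebesgue (%x. ind (cbox a b) x *: f x)"
  using int[OF sub] by (simp add: set_integrable_def)
 have m: "box_approx n a b\<in>meas" for n
 proof (rule measurable_completion, simp, rule borel_measurable_continuous_onI, rule C_class_continuous)
  show "C_class 0 (box_approx n a b)"
   using test_function_box_approx[OF sub, of n] unfolding test_function_def by blast
 qed
 have eq: "f x * box_approx n a b x = (ind (cbox a b) x *: f x) * box_approx n a b x" for x n
  using box_approx_bound[of n a b x] by (auto simp: ind_def split: if_splits)
 have "(%n. LL x. f x * box_approx n a b x)
   ----> (LL x. ind (cbox a b) x *: f x)"
 proof (rule integral_dominated_convergence[where w="%x. norm (ind (cbox a b) x *: f x)"])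
  show "AEL x. (%n. f x * box_approx n a b x) ----> ind (cbox a b) x *: f x"
   using ae
  proof eventually_elim
   case (elim x)
   have "(%n. (ind (cbox a b) x *: f x) * box_approx n a b x)
     ----> (ind (cbox a b) x *: f x) * ind (box a b) x"
    by (intro tendsto_intros box_approx_lim)
   also have "(ind (cbox a b) x *: f x) * ind (box a b) x = ind (cbox a b) x *: f x"
    using elim by (auto simp: ind_def)
   finally show ?case unfolding eq .
  qed
  show "AEL x. norm (f x * box_approx n a b x)\<le>norm (ind (cbox a b) x *: f x)" for n
  proof (rule AE_I2)
   fix x
   have "\<bar>box_approx n a b x\<bar>\<le>1" by (rule order_trans[OF box_approx_bound indicator_le_1])
   thus "norm (f x * box_approx n a b x)\<le>norm (ind (cbox a b) x *: f x)"
    unfolding eq norm_mult by (intro mult_right_le_one_le) auto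
  qed
  show "(%x. f x * box_approx n a b x)\<in>meas" for n
   unfolding eq using fi m by (intro borel_measurable_times) auto
 qed (use fi in auto)
 hence "(%n. 0) ----> (LL x. ind (cbox a b) x *: f x)"
  by (simp add: zero test_function_box_approx[OF sub])
 thus "(LINT x:cbox a b|lebesgue. f x) = 0"
  unfolding set_lebesgue_integral_def by (simp add: LIMSEQ_const_iff)
qed auto

section \<open>Separability\<close>

definition cell :: "'d::euclidean_space \<times> 'd \<times> 'b=>('d, 'b::hilb) lp2"
 where "cell = (%(a, b, c). mk (%x. ind (cbox a b) x *: c))"

lemma sq_int_indicator: "A\<in>lmeasurable ==> sq_int (%x. ind A x *: c)"
proof -
 assume A: "A\<in>lmeasurable"
 have "(norm (ind A x *: c))^2 = ind A x *: (norm c)^2" for x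
  by (auto simp: ind_def)
 moreover have "integrable lebesgue (%x. ind A x *: (norm c)^2)"
  using A by (intro integrable_scaleR_left) (simp add: lmeasurable_iff_integrable)
 moreover have "(%x. ind A x *: c)\<in>meas"
  using A by (intro borel_measurable_scaleR borel_measurable_indicator borel_measurable_const) (simp add: fmeasurableD)
 ultimately show ?thesis by (simp only: sq_int_def)
qed

lemma inner_cell: "inner F (cell (a, b, c)) = (LINT x:cbox a b|lebesgue. inner (ap F x) c)"
proof -
 have "inner F (cell (a, b, c)) = (LL x. inner (ap F x) (ap (cell (a, b, c)) x))"
  by (rule inner_lp2_def)
 also have "... = (LL x. inner (ap F x) (ind (cbox a b) x *: c))"
 proof (rule integral_cong_AE)
  show "(%x. inner (ap F x) (ind (cbox a b) x *: c))\<in>meas"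
   by (rule borel_measurable_integrable[OF integrable_inner_sq]) (simp_all add: sq_int_indicator)
  show "AEL x. inner (ap F x) (ap (cell (a, b, c)) x) = inner (ap F x) (ind (cbox a b) x *: c)"
   unfolding cell_def using ap_mk[OF sq_int_indicator[of "cbox a b" c]]
   by simp (elim eventually_mono, simp)
 qed simp
 finally show ?thesis by (simp add: set_lebesgue_integral_def)
qed

lemma zero_if_inner_dense_zero:
 fixes v :: "'b::real_inner"
 assumes "!!X::'b set. open X ==> X\<noteq>{} ==> \<exists>d\<in>D. d\<in>X" and z: "!!d. d\<in>D ==> inner v d = 0"
 shows "v = 0"
proof (rule ccontr)
 assume "v\<noteq>0"
 have "open {d. 0 < inner v d}" by (intro open_Collect_less continuous_intros)
 moreover have "v\<in>{d. 0 < inner v d}" using \<open>v\<noteq>0\<close> by simp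
 ultimately obtain d where "d\<in>D" "0 < inner v d" using assms(1)[of "{d. 0 < inner v d}"] by blast
 thus False using z by simp
qed

lemma AE_zero_if_inner_zero:
 fixes f :: "'d=>'b::{real_inner,second_countable_topology}"
 assumes "!!c. AE x in M. P x --> inner (f x) c = 0"
 shows "AE x in M. P x --> f x = 0"
proof -
 obtain D :: "'b set" where D: "countable D" "!!X. open X ==> X\<noteq>{} ==> \<exists>d\<in>D. d\<in>X"
  using countable_dense_exists by metis
 have "AE x in M. \<forall>d\<in>D. P x --> inner (f x) d = 0"
  by (rule AE_ball_countable'[OF assms D(1)])
 thus ?thesis
 proof eventually_elim
  case (elim x)
  show ?case using zero_if_inner_dense_zero[OF D(2), of "f x"] elim by blast
 qed
qed

lemma eq_zero_if_orthogonal_cells: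
 assumes "!!q. inner F (cell q) = 0"
 shows "F = 0"
proof -
 have "AEL x. x\<in>UNIV --> ap F x = 0"
 proof (rule AE_zero_if_inner_zero, rule AE_zero_if_box)
  fix c a b
  show "(LINT x:cbox a b|lebesgue. inner (ap F x) c) = 0" using inner_cell[of F a b c] assms by simp
  have "integrable lebesgue (%x. inner (ap F x) (ind (cbox a b) x *: c))"
   by (rule integrable_inner_sq) (simp_all add: sq_int_indicator)
  thus "set_integrable lebesgue (cbox a b) (%x. inner (ap F x) c)"
   by (simp add: set_integrable_def)
 qed simp
 hence "AEL x. ap F x = ap 0 x" using ap_zero by eventually_elim simp
 thus ?thesis by (rule lp2_eqI)
qed

lemma indicator_cbox_tendsto:
 fixes a b x :: "'a::euclidean_space"
 assumes a: "A ----> a" and b: "B ----> b" and x: "x\<notin>cbox a b - box a b"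
 shows "(%n. ind (cbox (A n) (B n)) x :: real) ----> ind (cbox a b) x"
proof (cases "x\<in>box a b")
 case True
 have "\<forall>i\<in>Basis. \<forall>\<^sub>F n in sequentially. A n\<bullet>i\<le>x\<bullet>i \<and> x\<bullet>i\<le>B n\<bullet>i"
 proof
  fix i :: 'a assume "i\<in>Basis"
  hence "a\<bullet>i < x\<bullet>i" "x\<bullet>i < b\<bullet>i" using True by (auto simp: mem_box)
  hence "\<forall>\<^sub>F n in sequentially. A n\<bullet>i < x\<bullet>i" "\<forall>\<^sub>F n in sequentially. x\<bullet>i < B n\<bullet>i"
   using order_tendstoD(2)[OF tendsto_inner[OF a tendsto_const]] order_tendstoD(1)[OF tendsto_inner[OF b tendsto_const]]
   by blast+
  thus "\<forall>\<^sub>F n in sequentially. A n\<bullet>i\<le>x\<bullet>i \<and> x\<bullet>i\<le>B n\<bullet>i" by eventually_elim simp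
 qed
 hence "\<forall>\<^sub>F n in sequentially. \<forall>i\<in>Basis. A n\<bullet>i\<le>x\<bullet>i \<and> x\<bullet>i\<le>B n\<bullet>i"
  by (intro eventually_ball_finite) auto
 hence "\<forall>\<^sub>F n in sequentially. ind (cbox (A n) (B n)) x = (ind (cbox a b) x :: real)"
  by eventually_elim (use True box_subset_cbox[of a b] in \<open>auto simp: mem_box ind_def\<close>)
 thus ?thesis by (rule tendsto_eventually)
next
 case False
 hence "x\<notin>cbox a b" using x by blast
 then obtain i where i: "i\<in>Basis" and "x\<bullet>i < a\<bullet>i \<or> b\<bullet>i < x\<bullet>i"
  by (auto simp: mem_box not_le)
 hence "\<forall>\<^sub>F n in sequentially. x\<bullet>i < A n\<bullet>i \<or> B n\<bullet>i < x\<bullet>i"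
  using order_tendstoD(1)[OF tendsto_inner[OF a tendsto_const], of "x\<bullet>i" i]
   order_tendstoD(2)[OF tendsto_inner[OF b tendsto_const], of i "x\<bullet>i"]
  by (auto elim: eventually_mono)
 hence "\<forall>\<^sub>F n in sequentially. ind (cbox (A n) (B n)) x = (ind (cbox a b) x :: real)"
 proof eventually_elim
  case (elim n)
  hence "x\<notin>cbox (A n) (B n)" using i by (auto simp: mem_box not_le intro!: bexI[of _ i])
  thus ?case using \<open>x\<notin>cbox a b\<close> by simp
 qed
 thus ?thesis by (rule tendsto_eventually)
qed

lemma cell_tendsto:
 assumes q: "Q ----> q"
 shows "(%n. cell (Q n)) ----> cell q"
proof -
 obtain a b c where qe: "q = (a, b, c)" by (cases q)
 define A B C where "A = (%n. fst (Q n))" and "B = (%n. fst (snd (Q n)))" and "C = (%n. snd (snd (Q n)))"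
 have Qe: "Q n = (A n, B n, C n)" for n by (simp add: A_def B_def C_def)
 have A: "A ----> a" and B: "B ----> b" and C: "C ----> c"
  using tendsto_fst[OF q] tendsto_fst[OF tendsto_snd[OF q]] tendsto_snd[OF tendsto_snd[OF q]]
  by (simp_all add: qe A_def B_def C_def)
 obtain M1 where M1: "!!n. norm (A n)\<le>M1" using convergent_imp_Bseq[OF convergentI[OF A]] unfolding Bseq_def by blast
 obtain M2 where M2: "!!n. norm (B n)\<le>M2" using convergent_imp_Bseq[OF convergentI[OF B]] unfolding Bseq_def by blast
 obtain M3 where M3: "!!n. norm (C n)\<le>M3" using convergent_imp_Bseq[OF convergentI[OF C]] unfolding Bseq_def by blast
 define M where "M = max M1 M2"
 define R where "R = (\<Sum>i\<in>(Basis::'a set). M)"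
 have sub: "cbox (A n) (B n)\<subseteq>cball 0 R" for n
 proof
  fix x assume x: "x\<in>cbox (A n) (B n)"
  have "norm x\<le>(\<Sum>i\<in>Basis. \<bar>x\<bullet>i\<bar>)" by (rule norm_le_l1)
  also have "...\<le>R" unfolding R_def
  proof (rule sum_mono)
   fix i :: 'a assume i: "i\<in>Basis"
   have "\<bar>A n\<bullet>i\<bar>\<le>M" "\<bar>B n\<bullet>i\<bar>\<le>M"
    using Basis_le_norm[OF i, of "A n"] Basis_le_norm[OF i, of "B n"] M1[of n] M2[of n] by (auto simp: M_def)
   moreover have "A n\<bullet>i\<le>x\<bullet>i" "x\<bullet>i\<le>B n\<bullet>i" using x i by (auto simp: mem_box)
   ultimately show "\<bar>x\<bullet>i\<bar>\<le>M" by linarith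
  qed
  finally show "x\<in>cball 0 R" by simp
 qed
 have g: "sq_int (%x. ind (cball 0 R :: 'a set) x *: M3)" by (rule sq_int_indicator) simp
 have "(%n. mk (%x. ind (cbox (A n) (B n)) x *: C n)) ----> mk (%x. ind (cbox a b) x *: c)"
 proof (rule lp2_dominated_convergence(2)[OF g])
  have M3n: "0\<le>M3" using M3[of 0] norm_ge_zero order_trans by blast
  show "AEL x. norm (ind (cbox (A n) (B n)) x *: C n)\<le>norm (ind (cball 0 R :: 'a set) x *: M3)" for n
   using sub[of n] M3[of n] M3n by (intro AE_I2) (auto simp: ind_def)
  have "AEL x. x\<notin>cbox a b - box a b"
   using negligible_frontier_interval[of a b] by (intro AE_not_in) (simp add: negligible_iff_null_sets)
  thus "AEL x. (%n. ind (cbox (A n) (B n)) x *: C n) ----> ind (cbox a b) x *: c"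
   by eventually_elim (intro tendsto_scaleR indicator_cbox_tendsto A B C)
  show "(%x. ind (cbox (A n) (B n)) x *: C n)\<in>meas" for n
   by (rule sq_intD[OF sq_int_indicator]) simp
  show "(%x. ind (cbox a b) x *: c)\<in>meas"
   by (rule sq_intD[OF sq_int_indicator]) simp
 qed
 thus ?thesis by (simp add: cell_def qe Qe)
qed

lemma scaleR_cell: "r *: cell (a, b, c) = cell (a, b, r *: c)"
proof (rule lp2_eqI)
 have s: "sq_int (%x. ind (cbox a b) x *: c)" for c by (rule sq_int_indicator) simp
 show "AEL x. ap (r *: cell (a, b, c)) x = ap (cell (a, b, r *: c)) x"
  using ap_scaleR[of r "cell (a, b, c)"] ap_mk[OF s[of c]] ap_mk[OF s[of "r *: c"]]
  unfolding cell_def by eventually_elim simp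
qed

lemma lp2_separable:
 "\<exists>T :: ('d::euclidean_space, 'b::hilb) lp2 set. countable T \<and> closure T = UNIV"
proof -
 obtain D :: "('d \<times> 'd \<times> 'b) set" where D: "countable D" "!!X. open X ==> X\<noteq>{} ==> \<exists>d\<in>D. d\<in>X"
  using countable_dense_exists by metis
 define T :: "('d, 'b) lp2 set" where "T = (%xs. sum_list (map cell xs)) ` lists D"
 have cT: "countable T" unfolding T_def using D(1) by (intro countable_image countable_lists)
 have addT: "x + y\<in>T" if "x\<in>T" "y\<in>T" for x y
 proof -
  obtain xs ys where "xs\<in>lists D" "x = sum_list (map cell xs)" "ys\<in>lists D" "y = sum_list (map cell ys)"
   using \<open>x\<in>T\<close> \<open>y\<in>T\<close> unfolding T_def by blast
  hence "x + y = sum_list (map cell (xs @ ys))" "xs @ ys\<in>lists D" by auto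
  thus ?thesis unfolding T_def by blast
 qed
 have addC: "x + y\<in>closure T" if xy: "x\<in>closure T" "y\<in>closure T" for x y
 proof -
  obtain X Y where "!!n. X n\<in>T" "X ----> x" "!!n. Y n\<in>T" "Y ----> y"
   using xy unfolding closure_sequential by blast
  thus ?thesis
   unfolding closure_sequential by (intro exI[of _ "%n. X n + Y n"]) (auto intro: addT tendsto_add)
 qed
 have cellC: "cell q\<in>closure T" for q
 proof -
  have "q\<in>closure D" unfolding closure_iff_nhds_not_empty using D(2) by fastforce
  then obtain Q where Q: "!!n. Q n\<in>D" "Q ----> q" unfolding closure_sequential by blast
  have "cell (Q n) = sum_list (map cell [Q n])" for n by simp
  hence "cell (Q n)\<in>T" for n
   unfolding T_def using Q(1) by (intro image_eqI[of _ _ "[Q n]"]) auto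
  thus ?thesis
   unfolding closure_sequential using cell_tendsto[OF Q(2)] by (intro exI[of _ "%n. cell (Q n)"] conjI allI)
 qed
 have zT: "0\<in>T" unfolding T_def by (rule image_eqI[of _ _ "[]"]) auto
 have scT: "r *: sum_list (map cell xs)\<in>closure T" for r and xs :: "('d \<times> 'd \<times> 'b) list"
 proof (induction xs)
  case Nil thus ?case using zT closure_subset[of T] by auto
 next
  case (Cons q xs)
  obtain a b c where q: "q = (a, b, c)" by (cases q)
  show ?case by (simp add: scaleR_add_right q scaleR_cell) (intro addC cellC Cons)
 qed
 have sub: "subspace (closure T)"
  unfolding subspace_def
 proof (intro conjI ballI allI)
  show "0\<in>closure T" using zT closure_subset by blast
  fix r x assume "x\<in>closure T"
  then obtain X where X: "!!n. X n\<in>T" "X ----> x" unfolding closure_sequential by blast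
  have "r *: X n\<in>closure T" for n 
  proof -
   obtain xs where "X n = sum_list (map cell xs)" using X(1)[of n] unfolding T_def by blast
   thus ?thesis using scT[of r xs] by simp
  qed
  moreover have "(%n. r *: X n) ----> r *: x" using X(2) by (intro tendsto_intros)
  ultimately show "r *: x\<in>closure T" 
   by (rule closed_sequentially[where f="%n. r *: X n", OF closed_closure])
 qed (rule addC)
 have "y\<in>closure (closure T)" for y
 proof (rule in_closure_if_orthogonal_trivial[OF sub subset_UNIV subspace_UNIV closed_UNIV _ UNIV_I])
  fix u :: "('d, 'b) lp2" assume "!!s. s\<in>closure T ==> inner u s = 0"
  hence "inner u (cell q) = 0" for q using cellC by blast
  thus "u = 0" by (rule eq_zero_if_orthogonal_cells)
 qed
 thus ?thesis using cT by auto
qed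

instance lp2 :: (euclidean_space, hilb) second_countable_topology
proof
 obtain T :: "('a, 'b) lp2 set" where T: "countable T" "closure T = UNIV" using lp2_separable by blast
 define B where "B = (%(y, n). ball y (inverse (real (Suc n)))) ` (T \<times> UNIV)"
 have "topological_basis B"
 proof (rule topological_basisI)
  show "open X" if "X\<in>B" for X using that by (auto simp: B_def)
  fix O' and x :: "('a, 'b) lp2" assume "open O'" "x\<in>O'"
  then obtain e where e: "e > 0" "ball x e\<subseteq>O'" using open_contains_ball by blast
  obtain n where n: "inverse (real (Suc n)) < e / 2" using reals_Archimedean[of "e / 2"] e by auto
  have "x\<in>closure T" using T by simp
  then obtain y where y: "y\<in>T" "dist y x < inverse (real (Suc n))"
   unfolding closure_approachable by (metis inverse_positive_iff_positive of_nat_0_less_iff zero_less_Suc)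
  have "ball y (inverse (real (Suc n)))\<subseteq>ball x e"
  proof
   fix z assume "z\<in>ball y (inverse (real (Suc n)))"
   hence "dist y z < inverse (real (Suc n))" by simp
   moreover have "dist x z\<le>dist y x + dist y z" by (metis dist_commute dist_triangle2 add.commute)
   ultimately show "z\<in>ball x e" using y n by simp
  qed
  moreover have "x\<in>ball y (inverse (real (Suc n)))" using y by simp
  ultimately show "\<exists>B'\<in>B. x\<in>B' \<and> B'\<subseteq>O'"
   using e y unfolding B_def by (intro bexI[of _ "ball y (inverse (real (Suc n)))"]) auto
 qed
 moreover have "countable B" unfolding B_def using T by (intro countable_image countable_SIGMA) auto
 ultimately show "\<exists>B::('a, 'b) lp2 set set. countable B \<and> open = generate_topology B"
  using topological_basis_imp_subbasis by blast
qed

section \<open>Integration by parts and the lemma of du Bois-Reymond\<close>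

lemma support_ballE:
 assumes "compact (closure {x :: 'a::euclidean_space. ph x\<noteq>(0::real)})"
 obtains R where "!!x. x\<notin>cball 0 R ==> ph x = 0"
proof -
 obtain R where "\<forall>x\<in>closure {x. ph x\<noteq>0}. norm x\<le>R"
  using compact_imp_bounded[OF assms] unfolding bounded_iff by blast
 hence "closure {x. ph x\<noteq>0}\<subseteq>cball 0 R" by auto
 hence "!!x. x\<notin>cball 0 R ==> ph x = 0" using closure_subset[of "{x. ph x\<noteq>0}"] by blast
 thus thesis by (rule that)
qed

lemma integrable_lborel_continuous_support:
 fixes f :: "'a::euclidean_space=>real"
 assumes f: "continuous_on UNIV f" and 0: "!!x. x\<notin>cball 0 R ==> f x = 0"
 shows "integrable lborel f"
proof -
 have "integrable lborel (%x. ind (cball 0 R) x *: f x)"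
  by (rule borel_integrable_compact) (use f continuous_on_subset in auto)
 moreover have "(%x. ind (cball 0 R) x *: f x) = f" using 0 by (force simp: ind_def)
 ultimately show ?thesis by simp
qed

lemma frechet_derivative_zero_outside:
 fixes ps :: "'a::euclidean_space=>real"
 assumes "!!y. y\<notin>K ==> ps y = 0" "closed K" "x\<notin>K"
 shows "pd b ps x = 0"
proof -
 have "((%y. 0) has_derivative (%h. 0)) (at x)" by (rule has_derivative_const)
 hence "(ps has_derivative (%h. 0)) (at x)"
  by (rule has_derivative_transform_within_open[of _ _ _ _ "- K"]) (use assms in auto)
 from frechet_derivative_at[OF this] show ?thesis by (metis (full_types))
qed

lemma integral_derivative_zero:
 fixes ps :: "'a::euclidean_space=>real"
 assumes C: "C_class (Suc 0) ps" and R: "!!x. x\<notin>cball 0 R ==> ps x = 0" and b: "b\<in>Basis"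
 shows "(LINT x|lborel. pd b ps x) = 0"
proof -
 define D where "D x = pd b ps x" for x
 have cD: "continuous_on UNIV D" using C b by (simp add: D_def[abs_def])
 have cps: "continuous_on UNIV ps" by (rule C_class_continuous[OF C])
 have D0: "D x = 0" if "x\<notin>cball 0 R" for x
  unfolding D_def by (rule frechet_derivative_zero_outside[OF R _ that]) auto
 have "bounded (D ` cball 0 R)"
  by (intro compact_imp_bounded compact_continuous_image continuous_on_subset[OF cD]) auto
 then obtain M where M: "M > 0" "!!x. x\<in>cball 0 R ==> \<bar>D x\<bar>\<le>M"
  unfolding bounded_pos by auto
 have DM: "\<bar>D x\<bar>\<le>M" for x using M D0[of x] by (cases "x\<in>cball 0 R") auto
 have der: "((%t. ps (x + t *: b)) has_real_derivative D (x + t *: b)) (at t)" for x t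
 proof -
  let ?L = "frechet_derivative ps (at (x + t *: b))"
  have "(ps has_derivative ?L) (at (x + t *: b))"
   using C by (simp add: frechet_derivative_works)
  moreover have "((%t. x + t *: b) has_derivative (%s. s *: b)) (at t)"
   by (auto intro!: derivative_eq_intros)
  ultimately have d: "((%t. ps (x + t *: b)) has_derivative (%s. ?L (s *: b))) (at t)"
   using has_derivative_compose by blast
  have "linear ?L" using C by (simp add: linear_frechet_derivative)
  hence "(%s. ?L (s *: b)) = (*) (D (x + t *: b))"
   by (simp add: linear_scale D_def mult.commute fun_eq_iff)
  with d show ?thesis by (simp add: has_field_derivative_def)
 qed
 define h where "h n = inverse (real (Suc n))" for n
 have h0: "h n > 0" "h n\<le>1" for n by (auto simp: h_def inverse_le_1_iff)
 have hl: "h ----> 0" unfolding h_def by (rule LIMSEQ_inverse_real_of_nat)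
 define d where "d n x = (ps (x + h n *: b) - ps x) / h n" for n x
 have lim: "(%n. d n x) ----> D x" for x
 proof -
  have "((%k. (ps (x + (0 + k) *: b) - ps (x + 0 *: b)) / k) \<longlongrightarrow> D (x + 0 *: b)) (at 0)"
   using der[of x 0] unfolding DERIV_def .
  moreover have "filterlim h (at 0) sequentially"
   using hl h0(1) by (auto simp: filterlim_at less_imp_neq[symmetric] intro!: always_eventually)
  ultimately have "(%n. (ps (x + (0 + h n) *: b) - ps (x + 0 *: b)) / h n) ----> D (x + 0 *: b)"
   by (rule filterlim_compose)
  thus ?thesis by (simp add: d_def)
 qed
 have bnd: "\<bar>d n x\<bar>\<le>ind (cball 0 (R + 1)) x * M" for n x
 proof (cases "x\<in>cball 0 (R + 1)")
  case False
  have "norm x\<le>norm (x + h n *: b) + norm (h n *: b)"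
   using norm_triangle_ineq4[of "x + h n *: b" "h n *: b"] by simp
  moreover have "norm (h n *: b)\<le>1" using h0[of n] b by simp
  ultimately have "x + h n *: b\<notin>cball 0 R" "x\<notin>cball 0 R" using False by auto
  hence "d n x = 0" using R by (simp add: d_def)
  thus ?thesis using M(1) by (simp add: ind_def)
 next
  case True
  obtain z where "ps (x + h n *: b) - ps (x + 0 *: b) = (h n - 0) * D (x + z *: b)"
   using MVT2[of 0 "h n" "%t. ps (x + t *: b)" "%t. D (x + t *: b)"] der h0 by blast
  hence "d n x = D (x + z *: b)" using h0(1)[of n] by (simp add: d_def)
  thus ?thesis using DM True by simp
 qed
 have ips: "integrable lborel ps" by (rule integrable_lborel_continuous_support[OF cps R])
 have tr: "integrable lborel (%x. ps (x + c))" "(LINT x|lborel. ps (x + c)) = (LINT x|lborel. ps x)" for c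
 proof -
  have m: "ps\<in>borel_measurable borel" using cps by (rule borel_measurable_continuous_onI)
  have "integrable (distr lborel borel ((+) c)) ps" using ips by (simp add: lborel_distr_plus)
  thus "integrable lborel (%x. ps (x + c))" using m by (simp add: integrable_distr_eq add.commute)
  have "(LINT x|lborel. ps x) = (LINT x|distr lborel borel ((+) c). ps x)" by (simp add: lborel_distr_plus)
  also have "... = (LINT x|lborel. ps (x + c))" using m by (simp add: integral_distr add.commute)
  finally show "(LINT x|lborel. ps (x + c)) = (LINT x|lborel. ps x)" by simp
 qed
 have "(LINT x|lborel. d n x) = 0" for n
  unfolding d_def using tr ips by simp
 moreover have "(%n. LINT x|lborel. d n x) ----> (LINT x|lborel. D x)"
 proof (rule integral_dominated_convergence[where w="%x. ind (cball 0 (R + 1)) x * M"])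
  show "D\<in>borel_measurable lborel" using borel_measurable_continuous_onI[OF cD] by simp
  show "d n\<in>borel_measurable lborel" for n
   unfolding d_def[abs_def] using tr(1) ips by (intro borel_measurable_divide borel_measurable_diff) auto
  show "integrable lborel (%x::'a. ind (cball 0 (R + 1)) x * M :: real)"
   using emeasure_bounded_finite[of "cball (0::'a) (R + 1)"]
   by (intro integrable_mult_left integrable_real_indicator) auto
 qed (use lim bnd in auto)
 ultimately have "(%n. 0) ----> (LINT x|lborel. D x)" by simp
 thus ?thesis by (simp add: D_def LIMSEQ_const_iff)
qed

lemma testD:
 assumes "test_function U ph"
 shows "C_class k ph" "continuous_on S ph" "ph\<in>meas" "x\<notin>U ==> ph x = 0"
  "ph differentiable (at x)" "!!b. b\<in>Basis ==> continuous_on S (%x. pd b ph x)"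
  "!!b. x\<notin>U ==> pd b ph x = 0"
proof -
 have C: "C_class k ph" for k using assms by (simp add: test_function_def)
 thus "C_class k ph" "continuous_on S ph" using C_class_continuous by blast+
 have "continuous_on UNIV ph" using C C_class_continuous by blast
 thus "ph\<in>meas"
  by (intro measurable_completion) (simp add: borel_measurable_continuous_onI)
 have cl: "closure {x. ph x\<noteq>0}\<subseteq>U" using assms by (simp add: test_function_def)
 thus "x\<notin>U ==> ph x = 0" using closure_subset[of "{x. ph x\<noteq>0}"] by blast
 show "ph differentiable (at x)" using C[of "Suc 0"] by simp
 show "continuous_on S (%x. pd b ph x)" if "b\<in>Basis" for b
  using C_class_continuous[of 0 "%x. pd b ph x" S] C[of "Suc 0"] that by simp
 show "pd b ph x = 0" if "x\<notin>U" for b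
  by (rule frechet_derivative_zero_outside[of "closure {x. ph x\<noteq>0}"])
   (use that cl closure_subset[of "{x. ph x\<noteq>0}"] in auto)
qed

lemma test_function_bounds:
 assumes t: "test_function U ph" and b: "b\<in>Basis"
 obtains M where "!!x. \<bar>ph x\<bar>\<le>M" "!!x. \<bar>pd b ph x\<bar>\<le>M"
proof -
 have c: "compact (closure {x. ph x\<noteq>0})" using t by (simp add: test_function_def)
 have bd: "bounded (f ` closure {x. ph x\<noteq>0})" if "continuous_on UNIV f" for f :: "'a=>real"
  by (intro compact_imp_bounded compact_continuous_image continuous_on_subset[OF that] c) auto
 obtain M1 where M1: "!!x. x\<in>closure {x. ph x\<noteq>0} ==> \<bar>ph x\<bar>\<le>M1"
  using bd[OF testD(2)[OF t]] unfolding bounded_iff by auto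
 obtain M2 where M2: "!!x. x\<in>closure {x. ph x\<noteq>0} ==> \<bar>pd b ph x\<bar>\<le>M2"
  using bd[OF testD(6)[OF t b]] unfolding bounded_iff by auto
 have z: "ph x = 0 \<and> pd b ph x = 0" if x: "x\<notin>closure {x. ph x\<noteq>0}" for x
 proof
  show "ph x = 0" using x closure_subset[of "{x. ph x\<noteq>0}"] by blast
  show "pd b ph x = 0"
   by (rule frechet_derivative_zero_outside[of "closure {x. ph x\<noteq>0}"])
    (use x closure_subset[of "{x. ph x\<noteq>0}"] in auto)
 qed
 show thesis
 proof (rule that[of "max 0 (max M1 M2)"])
  show "\<bar>ph x\<bar>\<le>max 0 (max M1 M2)" for x using M1[of x] z[of x] by (cases "x\<in>closure {x. ph x\<noteq>0}") auto
  show "\<bar>pd b ph x\<bar>\<le>max 0 (max M1 M2)" for x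
   using M2[of x] z[of x] by (cases "x\<in>closure {x. ph x\<noteq>0}") auto
 qed
qed

lemma test_function_integrable:
 assumes t: "test_function U ph" and g: "continuous_on UNIV g"
 shows "integrable lborel (%x. ph x * g x)"
proof -
 obtain R where R: "!!x. x\<notin>cball 0 R ==> ph x = 0"
  using t support_ballE by (metis test_function_def)
 show ?thesis
  by (rule integrable_lborel_continuous_support[of _ R])
   (use R in \<open>auto intro!: continuous_on_mult testD(2)[OF t] g\<close>)
qed

lemma test_function_ibp:
 assumes ph: "test_function U ph" and \<eta>: "test_function V \<eta>" and b: "b\<in>Basis"
 shows "(LINT x|lborel. ph x * pd b \<eta> x) = - (LINT x|lborel. pd b ph x * \<eta> x)"
proof -
 obtain R where R: "!!x. x\<notin>cball 0 R ==> ph x = 0"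
  using ph support_ballE by (metis test_function_def)
 have d: "((%x. ph x * \<eta> x) has_derivative (%h. ph x * pd h \<eta> x + pd h ph x * \<eta> x)) (at x)" for x
  using testD(5)[OF ph, of x] testD(5)[OF \<eta>, of x]
  by (intro has_derivative_mult) (auto simp: frechet_derivative_works)
 have "(LINT x|lborel. frechet_derivative (%x. ph x * \<eta> x) (at x) b) = 0"
  by (rule integral_derivative_zero[of _ R]) (use R b in \<open>auto intro!: C_class_mult testD(1)[OF ph] testD(1)[OF \<eta>] simp del: C_class.simps\<close>)
 moreover have "frechet_derivative (%x. ph x * \<eta> x) (at x) b
   = ph x * pd b \<eta> x + \<eta> x * pd b ph x" for x
  using frechet_derivative_at[OF d[of x], symmetric] by (simp add: mult.commute)
 moreover have "integrable lborel (%x. ph x * pd b \<eta> x)"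
  by (intro test_function_integrable[OF ph] testD(6)[OF \<eta>] b)
 moreover have "integrable lborel (%x. \<eta> x * pd b ph x)"
  by (intro test_function_integrable[OF \<eta>] testD(6)[OF ph] b)
 ultimately show ?thesis by (simp add: mult.commute)
qed

lemma test_function_lincomb:
 assumes ph: "test_function U ph" and \<eta>: "test_function U \<eta>"
 shows "test_function U (%x. ph x + c * \<eta> x)"
proof -
 let ?K = "closure {x. ph x\<noteq>0}\<union>closure {x. \<eta> x\<noteq>0}"
 have K: "compact ?K" "?K\<subseteq>U" using ph \<eta> by (auto simp: test_function_def)
 have "{x. ph x + c * \<eta> x\<noteq>0}\<subseteq>?K"
  using closure_subset[of "{x. ph x\<noteq>0}"] closure_subset[of "{x. \<eta> x\<noteq>0}"] by fastforce
 hence sub: "closure {x. ph x + c * \<eta> x\<noteq>0}\<subseteq>?K"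
  by (rule closure_minimal) auto
 hence "compact (closure {x. ph x + c * \<eta> x\<noteq>0})"
  using compact_Int_closed[OF K(1) closed_closure, of "{x. ph x + c * \<eta> x\<noteq>0}"] by (simp add: Int_absorb1)
 thus ?thesis
  using sub K(2) ph \<eta> unfolding test_function_def by (auto intro!: C_class_add C_class_cmult)
qed

lemma deriv_test_function:
 fixes ph :: "real=>real"
 assumes "test_function U ph"
 shows "(ph has_real_derivative deriv ph t) (at t)" "deriv ph t = pd 1 ph t"
proof -
 have d: "(ph has_derivative frechet_derivative ph (at t)) (at t)"
  using testD(5)[OF assms, of t] by (simp add: frechet_derivative_works)
 have "linear (frechet_derivative ph (at t))"
  using testD(5)[OF assms, of t] by (rule linear_frechet_derivative)
 hence "frechet_derivative ph (at t) (s *: 1) = s *: pd 1 ph t" for s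
  by (rule linear_scale)
 hence "frechet_derivative ph (at t) = (*) (pd 1 ph t)"
  by (intro ext) (metis mult.commute mult.right_neutral real_scaleR_def)
 hence "(ph has_real_derivative pd 1 ph t) (at t)"
  using d unfolding has_field_derivative_def by metis
 thus "(ph has_real_derivative deriv ph t) (at t)" "deriv ph t = pd 1 ph t"
  using DERIV_imp_deriv by force+
qed

lemma ex_antiderivative:
 assumes ps: "test_function {0<..<T} ps" and 0: "(LINT x|lborel. ps x) = 0"
 shows "\<exists>\<Phi>. test_function {0<..<T} \<Phi> \<and> deriv \<Phi> = ps"
proof -
 let ?K = "closure {x. ps x\<noteq>0}"
 have K: "compact ?K" "?K\<subseteq>{0<..<T}" using ps by (auto simp: test_function_def)
 have c: "continuous_on S ps" for S by (rule testD(2)[OF ps])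
 obtain F where F: "!!x. (F has_real_derivative ps x) (at x)"
  using einterval_antiderivative[of "-\<infinity>" "\<infinity>" ps] c[of UNIV]
  by (auto simp: continuous_on_eq_continuous_at has_real_derivative_iff_has_vector_derivative)
 show ?thesis
 proof (cases "?K = {}")
  case True
  hence "ps = (%x. 0)" by (auto simp: fun_eq_iff)
  moreover have "deriv (%x. 0 :: real) = (%x. 0)" by (simp add: fun_eq_iff)
  ultimately have "deriv ps = ps" by simp
  thus ?thesis using ps by blast
 next
  case False
  obtain a where a: "a\<in>?K" "!!x. x\<in>?K ==> a\<le>x" using compact_attains_inf[OF K(1) False] by blast
  obtain b where b: "b\<in>?K" "!!x. x\<in>?K ==> x\<le>b" using compact_attains_sup[OF K(1) False] by blast
  have ab: "0 < a" "a\<le>b" "b < T" using a b K(2) by auto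
  have z: "ps x = 0" if "x < a \<or> x > b" for x
   using a(2)[of x] b(2)[of x] that closure_subset[of "{x. ps x\<noteq>0}"] by fastforce
  define \<Phi> where "\<Phi> x = F x - F a" for x
  have D\<Phi>: "(\<Phi> has_real_derivative ps x) (at x)" for x
   unfolding \<Phi>_def[abs_def] using F[of x] by (auto intro!: derivative_eq_intros)
  have l: "\<Phi> x = 0" if "x\<le>a" for x
  proof (cases "x = a")
   case False
   hence "\<exists>s. x < s \<and> s < a \<and> \<Phi> a - \<Phi> x = (a - x) * ps s"
    using that by (intro MVT2 D\<Phi>) auto
   then obtain s where "x < s" "s < a" "\<Phi> a - \<Phi> x = (a - x) * ps s" by blast
   thus ?thesis using z[of s] by (simp add: \<Phi>_def)
  qed (simp add: \<Phi>_def)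
  have "(LINT x|lborel. ind {a..b} x *: ps x) = \<Phi> b - \<Phi> a"
   using D\<Phi> by (intro integral_FTC_Icc[OF ab(2) _ c])
    (auto simp: has_real_derivative_iff_has_vector_derivative[symmetric] intro: has_field_derivative_at_within)
  moreover have "(%x. ind {a..b} x *: ps x) = ps" using z by (force simp: ind_def)
  ultimately have \<Phi>b: "\<Phi> b = 0" using 0 by (simp add: \<Phi>_def)
  have r: "\<Phi> x = 0" if "x\<ge>b" for x
  proof (cases "x = b")
   case False
   hence "\<exists>s. b < s \<and> s < x \<and> \<Phi> x - \<Phi> b = (x - b) * ps s"
    using that by (intro MVT2 D\<Phi>) auto
   then obtain s where "b < s" "s < x" "\<Phi> x - \<Phi> b = (x - b) * ps s" by blast
   thus ?thesis using z[of s] \<Phi>b by simp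
  qed (simp add: \<Phi>b)
  have "C_class (Suc k) \<Phi>" for k
  proof (rule C_class_SucI[where f'="%x h. ps x * h"])
   show "(\<Phi> has_derivative (%h. ps x * h)) (at x)" for x
    using D\<Phi>[of x] by (simp add: has_field_derivative_def)
   show "b\<in>Basis ==> C_class k (%x. ps x * b)" for b
    by (intro C_class_mult C_class_const testD(1)[OF ps])
  qed
  hence C: "C_class k \<Phi>" for k using C_class_SucD by blast
  have "{x. \<Phi> x\<noteq>0}\<subseteq>{a..b}"
  proof
   fix x assume "x\<in>{x. \<Phi> x\<noteq>0}"
   hence "\<not> x\<le>a" "\<not> b\<le>x" using l r by blast+
   thus "x\<in>{a..b}" by simp
  qed
  hence sub: "closure {x. \<Phi> x\<noteq>0}\<subseteq>{a..b}" by (rule closure_minimal) simp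
  hence "compact (closure {x. \<Phi> x\<noteq>0})"
   using compact_Int_closed[OF compact_Icc closed_closure, of a b "{x. \<Phi> x\<noteq>0}"] by (simp add: Int_absorb1)
  moreover have "{a..b}\<subseteq>{0<..<T}" using ab by auto
  ultimately have "test_function {0<..<T} \<Phi>" using sub C unfolding test_function_def by blast
  moreover have "deriv \<Phi> = ps" using D\<Phi> DERIV_imp_deriv by blast
  ultimately show ?thesis by blast
 qed
qed

lemma integrable_times_test:
 fixes f :: "'a::euclidean_space=>real"
 assumes f: "integrable lebesgue f" and t: "test_function U ph"
 shows "integrable lebesgue (%x. f x * ph x)"
proof -
 obtain b :: 'a where b: "b\<in>Basis" using nonempty_Basis by blast
 obtain M where M: "!!x. \<bar>ph x\<bar>\<le>M" using test_function_bounds[OF t b] by metis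
 show ?thesis
 proof (rule Bochner_Integration.integrable_bound)
  show "integrable lebesgue (%x. M * f x)" using f by simp
  show "(%x. f x * ph x)\<in>meas"
   using borel_measurable_integrable[OF f] testD(3)[OF t] by (rule borel_measurable_times)
  have "0\<le>M" using M[of undefined] by linarith
  thus "AEL x. norm (f x * ph x)\<le>norm (M * f x)"
   using M by (intro AE_I2) (simp add: abs_mult, subst mult.commute, simp add: mult_right_mono)
 qed
qed

lemma du_Bois_Reymond:
 fixes f :: "real=>real"
 assumes f: "integrable lebesgue f" and T: "T > 0"
  and z: "!!ph. test_function {0<..<T} ph ==> (LL t. f t * deriv ph t) = 0"
 shows "\<exists>c. AEL t. t\<in>{0<..<T} --> f t = c"
proof -
 have leb: "(LL t. ph t) = (LINT t|lborel. ph t)" if "test_function U ph" for U and ph :: "real=>real"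
  using testD(2)[OF that, of UNIV] by (intro integral_completion) (simp add: borel_measurable_continuous_onI)
 have il: "integrable lborel ph" if "test_function U ph" for U and ph :: "real=>real"
  using test_function_integrable[OF that continuous_on_const[of UNIV 1]] by simp
 have il': "integrable lebesgue ph" if "test_function U ph" for U and ph :: "real=>real"
  using il[OF that] testD(2)[OF that, of UNIV]
  by (subst integrable_completion) (auto simp: borel_measurable_continuous_onI)
 obtain \<theta> where \<theta>: "test_function {0<..<T} \<theta>" "(LINT t|lborel. \<theta> t)\<noteq>0"
 proof (rule ccontr)
  assume no: "\<not> thesis"
  have "AEL t. t\<in>{0<..<T} --> (1::real) = 0"
  proof (rule AE_zero_if_test)
   show "set_integrable lebesgue (cbox a b) (%t::real. 1::real)" for a b
    by (simp add: set_integrable_def lmeasurable_iff_integrable[symmetric])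
   show "(LL t. 1 * ph t) = 0" if "test_function {0<..<T} ph" for ph
    using no that[THEN leb] that \<open>!!\<theta>. test_function {0<..<T} \<theta> ==> (LINT t|lborel. \<theta> t)\<noteq>0 ==> thesis\<close> by auto
  qed auto
  hence "AEL t. t\<notin>{0<..<T}" by simp
  hence "{0<..<T}\<in>null_sets lebesgue" by (subst (asm) AE_iff_null_sets[symmetric]) auto
  hence "emeasure lebesgue {0<..<T} = 0" by auto
  thus False using T by simp
 qed
 define m where "m = (LINT t|lborel. \<theta> t)"
 define c where "c = (LL t. f t * \<theta> t) / m"
 have "AEL t. t\<in>{0<..<T} --> f t - c = 0"
 proof (rule AE_zero_if_test)
  show "set_integrable lebesgue (cbox a b) (%t. f t - c)" for a b
   by (intro set_integral_diff integrable_mult_indicator[OF _ f, folded set_integrable_def])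
    (simp_all add: set_integrable_def lmeasurable_iff_integrable[symmetric])
  fix ph assume ph: "test_function {0<..<T} ph"
  define r where "r = - (LINT t|lborel. ph t) / m"
  have t: "test_function {0<..<T} (%t. ph t + r * \<theta> t)" by (rule test_function_lincomb[OF ph \<theta>(1)])
  have "(LINT t|lborel. ph t + r * \<theta> t) = 0"
   using il[OF ph] il[OF \<theta>(1)] \<theta>(2) by (simp add: r_def m_def)
  then obtain \<Phi> where \<Phi>: "test_function {0<..<T} \<Phi>" "deriv \<Phi> = (%t. ph t + r * \<theta> t)"
   using ex_antiderivative[OF t] by blast
  have i1: "integrable lebesgue (%t. f t * ph t)" and i2: "integrable lebesgue (%t. f t * \<theta> t)"
   by (rule integrable_times_test[OF f ph], rule integrable_times_test[OF f \<theta>(1)])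
  have "0 = (LL t. f t * ph t + r * (f t * \<theta> t))"
   using z[OF \<Phi>(1)] by (simp add: \<Phi>(2) algebra_simps)
  also have "... = (LL t. f t * ph t) + r * (LL t. f t * \<theta> t)"
   using i1 i2 by simp
  also have "r * (LL t. f t * \<theta> t) = - c * (LL t. ph t)"
   by (simp add: r_def c_def leb[OF ph])
  finally have "(LL t. f t * ph t) - c * (LL t. ph t) = 0" by simp
  thus "(LL t. (f t - c) * ph t) = 0"
   using i1 il'[OF ph] by (simp add: left_diff_distrib)
 qed auto
 thus ?thesis by (intro exI[of _ c]) simp
qed

section \<open>Operators on vector-valued functions of time\<close>

lemma interval_in_sets_lebesgue [measurable, simp]:
 "{a<..<b::real}\<in>sets lebesgue" "{a..b::real}\<in>sets lebesgue" "{(a::real)<..}\<in>sets lebesgue"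
 by (rule sets_completionI_sets, simp)+

lemma norm_mk_norm:
 assumes "sq_int f"
 shows "norm (mk (%x. norm (f x))) = norm (mk f)"
proof (rule power2_eq_imp_eq)
 show "(norm (mk (%x. norm (f x))))^2 = (norm (mk f))^2"
  unfolding norm_mk_square[OF assms] norm_mk_square[OF sq_int_norm[OF assms]] by simp
qed simp_all

lemma lp2_Cauchy_Schwarz:
 fixes f :: "'d::euclidean_space=>'b::hilb"
  and g :: "'d=>'c::hilb"
 assumes f: "sq_int f" and g: "sq_int g"
 shows "(LL x. norm (f x) * norm (g x))\<le>norm (mk f) * norm (mk g)"
proof -
 let ?f = "mk (%x. norm (f x))" and ?g = "mk (%x. norm (g x))"
 have "inner ?f ?g = (LL x. norm (f x) * norm (g x))"
  unfolding inner_lp2_def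
 proof (rule integral_cong_AE)
  show "AEL x. inner (ap ?f x) (ap ?g x) = norm (f x) * norm (g x)"
   using ap_mk[OF sq_int_norm[OF f]] ap_mk[OF sq_int_norm[OF g]] by eventually_elim simp
  show "(%x. norm (f x) * norm (g x))\<in>meas"
   using sq_intD[OF f] sq_intD[OF g] by measurable
 qed simp
 thus ?thesis
  using norm_cauchy_schwarz[of ?f ?g] by (simp add: norm_mk_norm f g)
qed

lemma integrable_indicator_sq:
 assumes f: "sq_int f" and A: "A\<in>lmeasurable"
 shows "integrable lebesgue (%x. ind A x *: f x)"
proof (rule Bochner_Integration.integrable_bound)
 have s: "sq_int (%x. ind A x *: (1::real))" by (rule sq_int_indicator[OF A])
 show "integrable lebesgue (%x. norm (ind A x *: (1::real)) * norm (f x))"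
  by (rule integrable_norm_mult[OF s f])
 show "(%x. ind A x *: f x)\<in>meas"
  using sq_intD[OF f] A by (intro borel_measurable_scaleR borel_measurable_indicator) (auto simp: fmeasurableD)
qed auto

lemma norm_mk_indicator:
 assumes "A\<in>lmeasurable"
 shows "norm (mk (%x. ind A x *: (1::real))) = sqrt (measure lebesgue A)"
proof -
 have e: "(norm (ind A x *: (1::real)))^2 = ind A x" for x by (simp add: ind_def)
 have "(norm (mk (%x. ind A x *: (1::real))))^2 = measure lebesgue A"
  using norm_mk_square[OF sq_int_indicator[OF assms, of "1::real"]] assms unfolding e
  by (simp add: fmeasurableD)
 thus ?thesis by (metis norm_ge_zero real_sqrt_unique)
qed

lemma norm_mk_indicator' [simp]:
 "A\<in>lmeasurable ==> norm (mk (ind A :: _=>real)) = sqrt (measure lebesgue A)"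
 using norm_mk_indicator[of A] by simp

lemma L1_le_L2:
 assumes A: "A\<in>lmeasurable"
 shows "(LL x. ind A x * norm (ap U x))\<le>sqrt (measure lebesgue A) * norm U"
proof -
 have "(LL x. norm (ind A x *: (1::real)) * norm (ap U x))\<le>norm (mk (%x. ind A x *: (1::real))) * norm (mk (ap U))"
  by (rule lp2_Cauchy_Schwarz[OF sq_int_indicator[OF A]]) simp
 thus ?thesis using A by simp
qed

lemma integrable_indicator_norm:
 assumes A: "A\<in>lmeasurable"
 shows "integrable lebesgue (%x. ind A x * norm (ap U x))"
 using integrable_indicator_sq[OF sq_int_norm[OF sq_int_ap[of U]] A] by simp

lemma sq_int_bounded_on:
 assumes f: "f\<in>meas" and A: "A\<in>lmeasurable"
  and le: "AEL x. norm (f x)\<le>ind A x * C"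
 shows "sq_int f"
 by (rule sq_int_bound[OF f sq_int_indicator[OF A, of C], of 1])
  (use le in eventually_elim, auto simp: ind_def split: if_splits)

definition mulop :: "('d=>real)=>('d::euclidean_space, 'b::hilb) lp2=>('d, 'b) lp2"
 where "mulop h F = mk (%x. h x *: ap F x)"

lemma
 assumes h: "h\<in>meas" and M: "!!x. \<bar>h x\<bar>\<le>M"
 shows sq_int_mulop: "sq_int (%x. h x *: ap F x)"
  and ap_mulop: "AEL x. ap (mulop h F) x = h x *: ap F x"
  and norm_mulop_le: "norm (mulop h F)\<le>M * norm F"
  and inner_mulop: "inner (mulop h F) G = inner F (mulop h G)"
  and bounded_linear_mulop: "bounded_linear (mulop h)"
proof -
 have s: "sq_int (%x. h x *: ap F x)" for F
  by (rule sq_int_bound[of _ "ap F" M]) (use h M in \<open>auto intro!: borel_measurable_scaleR mult_right_mono\<close>)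
 thus "sq_int (%x. h x *: ap F x)" .
 have a: "AEL x. ap (mulop h F) x = h x *: ap F x" for F
  unfolding mulop_def by (rule ap_mk[OF s])
 thus "AEL x. ap (mulop h F) x = h x *: ap F x" .
 have M0: "M\<ge>0" using M[of undefined] by linarith
 have n: "norm (mulop h F)\<le>M * norm F" for F
  unfolding mulop_def by (rule norm_mk_le[OF s M0]) (use M in \<open>auto intro!: mult_right_mono\<close>)
 thus "norm (mulop h F)\<le>M * norm F" .
 have "(LL x. inner (ap (mulop h F) x) (ap G x)) = (LL x. inner (ap F x) (ap (mulop h G) x))"
  by (rule integral_cong_AE) (simp, simp, use a[of F] a[of G] in eventually_elim, simp)
 thus "inner (mulop h F) G = inner F (mulop h G)" by (simp add: inner_lp2_def)
 show "bounded_linear (mulop h)"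
 proof (rule bounded_linear_intro[where K=M])
  show "mulop h (F + G) = mulop h F + mulop h G" for F G
   by (rule lp2_eqI) (use a[of "F + G"] a[of F] a[of G] ap_add[of F G] ap_add[of "mulop h F" "mulop h G"]
     in eventually_elim, simp add: scaleR_add_right)
  show "mulop h (r *: F) = r *: mulop h F" for r F
   by (rule lp2_eqI) (use a[of "r *: F"] a[of F] ap_scaleR[of r F] ap_scaleR[of r "mulop h F"]
     in eventually_elim, simp)
 qed (use n in \<open>simp add: mult.commute\<close>)
qed

definition ptw :: "('b=>'c)=>('d::euclidean_space, 'b::hilb) lp2
  =>('d, 'c::hilb) lp2"
 where "ptw A F = mk (%x. A (ap F x))"

lemma
 fixes A :: "'b::hilb=>'c::hilb"
  and F :: "('d::euclidean_space, 'b) lp2"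
 assumes A: "bounded_linear A"
 shows sq_int_ptw: "sq_int (%x. A (ap F x))"
  and ap_ptw: "AEL x. ap (ptw A F) x = A (ap F x)"
  and bounded_linear_ptw: "bounded_linear (ptw A :: ('d, 'b) lp2=>_)"
proof -
 interpret bounded_linear A by (fact A)
 obtain M where M: "M > 0" "!!x. norm (A x)\<le>norm x * M" using pos_bounded by blast
 have s: "sq_int (%x. A (ap F x))" for F :: "('d, 'b) lp2"
 proof (rule sq_int_bound[of _ "ap F" M])
  show "(%x. A (ap F x))\<in>meas"
   by (rule borel_measurable_continuous_on[of A]) (auto intro!: continuous_on continuous_intros)
 qed (use M in \<open>auto simp: mult.commute\<close>)
 show "sq_int (%x. A (ap F x))" by (rule s)
 have a: "AEL x. ap (ptw A F) x = A (ap F x)" for F :: "('d, 'b) lp2"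
  unfolding ptw_def by (rule ap_mk[OF s])
 show "AEL x. ap (ptw A F) x = A (ap F x)" by (rule a)
 show "bounded_linear (ptw A :: ('d, 'b) lp2=>_)"
 proof (rule bounded_linear_intro[where K=M])
  show "ptw A (F + G) = ptw A F + ptw A G" for F G :: "('d, 'b) lp2"
   by (rule lp2_eqI) (use a[of "F + G"] a[of F] a[of G] ap_add[of F G] ap_add[of "ptw A F" "ptw A G"]
     in eventually_elim, simp add: add)
  show "ptw A (r *: F) = r *: ptw A F" for r and F :: "('d, 'b) lp2"
   by (rule lp2_eqI) (use a[of "r *: F"] a[of F] ap_scaleR[of r F] ap_scaleR[of r "ptw A F"]
     in eventually_elim, simp add: scaleR)
  show "norm (ptw A F)\<le>norm F * M" for F :: "('d, 'b) lp2"
   using norm_mk_le[OF s, of M F F] M by (simp add: ptw_def mult.commute)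
 qed
qed

lemma inner_ptw:
 assumes A: "bounded_linear A" and B: "bounded_linear B" and AB: "!!u v. inner (A u) v = inner u (B v)"
 shows "inner (ptw A F) G = inner F (ptw B G)"
 unfolding inner_lp2_def
 by (rule integral_cong_AE) (simp, simp, use ap_ptw[OF A, of F] ap_ptw[OF B, of G] in eventually_elim, simp add: AB)

lemma borel_measurable_ptw_comp:
 assumes "bounded_linear A" "f\<in>borel_measurable M"
 shows "(%x. A (f x))\<in>borel_measurable M"
 by (rule borel_measurable_continuous_on[OF _ assms(2)])
  (simp add: linear_continuous_on[OF assms(1)])

definition prim :: "(real, 'b::hilb) lp2=>real=>'b"
 where "prim U t = (LL s. ind {0<..<t} s *: ap U s)"

definition nprim :: "(real, 'b::hilb) lp2=>real=>real"
 where "nprim U t = (LL s. ind {0<..<t} s * norm (ap U s))"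

lemma norm_prim_le: "norm (prim U t)\<le>nprim U t"
 unfolding prim_def nprim_def
 by (rule order_trans[OF integral_norm_bound]) simp

lemma nprim_nonneg: "0\<le>nprim U t"
 unfolding nprim_def by (rule integral_nonneg_AE) simp

lemma nprim_le_norm: "nprim U t\<le>sqrt \<bar>t\<bar> * norm U"
proof -
 have "measure lebesgue {0<..<t}\<le>\<bar>t\<bar>" by (cases "t > 0") auto
 hence "sqrt (measure lebesgue {0<..<t}) * norm U\<le>sqrt \<bar>t\<bar> * norm U"
  by (intro mult_right_mono) auto
 thus ?thesis
  unfolding nprim_def using L1_le_L2[of "{0<..<t}" U] by (rule order_trans[rotated]) simp
qed

lemma nprim_mono: "s\<le>t ==> nprim U s\<le>nprim U t"
 unfolding nprim_def
proof (rule integral_mono_AE)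
 assume "s\<le>t"
 hence "ind {0<..<s} r\<le>(ind {0<..<t} r :: real)" for r by (simp add: ind_def)
 thus "AEL r. ind {0<..<s} r * norm (ap U r)\<le>ind {0<..<t} r * norm (ap U r)"
  by (intro AE_I2 mult_right_mono) auto
qed (rule integrable_indicator_norm, simp)+

lemma prim_diff_le:
 assumes "s\<le>t"
 shows "norm (prim U t - prim U s)\<le>sqrt (t - s) * norm U"
proof -
 define D where "D = {0<..<t} - {0<..<s}"
 have D: "D\<in>lmeasurable" unfolding D_def by (intro fmeasurable.Diff) auto
 have "prim U t - prim U s = (LL r. ind D r *: ap U r)"
 proof -
  have i: "integrable lebesgue (%r. ind {0<..<t} r *: ap U r)" for t :: real
   by (rule integrable_indicator_sq) simp_all
  have "(%r. ind {0<..<t} r *: ap U r - ind {0<..<s} r *: ap U r) = (%r. ind D r *: ap U r)"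
   using assms by (auto simp: D_def ind_def fun_eq_iff)
  thus ?thesis
   unfolding prim_def using Bochner_Integration.integral_diff[OF i i, of t s] by simp
 qed
 hence "norm (prim U t - prim U s)\<le>(LL r. norm (ind D r *: ap U r))"
  using integral_norm_bound[of lebesgue "%r. ind D r *: ap U r"] by simp
 also have "... = (LL r. ind D r * norm (ap U r))" by simp
 also have "...\<le>sqrt (measure lebesgue D) * norm U" by (rule L1_le_L2[OF D])
 also have "measure lebesgue D\<le>measure lebesgue {s..t}"
 proof (rule measure_mono_fmeasurable)
  show "D\<subseteq>{s..t}" unfolding D_def by auto
 qed (use D in \<open>auto simp: fmeasurableD\<close>)
 hence "sqrt (measure lebesgue D) * norm U\<le>sqrt (t - s) * norm U"
  using assms by (intro mult_right_mono) auto
 finally show ?thesis by simp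
qed

lemma continuous_on_prim: "continuous_on S (prim U)"
proof -
 have "isCont (prim U) s" for s
  unfolding isCont_def
 proof (rule LIM_zero_cancel, rule Lim_null_comparison)
  show "\<forall>\<^sub>F t in at s. norm (prim U t - prim U s)\<le>sqrt \<bar>t - s\<bar> * norm U"
  proof (intro always_eventually allI)
   fix t show "norm (prim U t - prim U s)\<le>sqrt \<bar>t - s\<bar> * norm U"
    using prim_diff_le[of s t U] prim_diff_le[of t s U] by (cases "s\<le>t") (auto simp: norm_minus_commute)
  qed
  show "((%t. sqrt \<bar>t - s\<bar> * norm U) \<longlongrightarrow> 0) (at s)"
   by (auto intro!: tendsto_eq_intros)
 qed
 thus ?thesis by (simp add: continuous_at_imp_continuous_on)
qed

lemma prim_measurable [measurable]: "prim U\<in>meas"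
 by (rule measurable_completion) (simp add: borel_measurable_continuous_onI continuous_on_prim)

lemma prim_add: "prim (U + V) t = prim U t + prim V t"
proof -
 have "prim (U + V) t = (LL s. ind {0<..<t} s *: ap U s + ind {0<..<t} s *: ap V s)"
  unfolding prim_def
  by (rule integral_cong_AE) (simp, simp, use ap_add[of U V] in eventually_elim, simp add: scaleR_add_right)
 thus ?thesis by (simp add: prim_def integrable_indicator_sq)
qed

lemma prim_scaleR: "prim (c *: U) t = c *: prim U t"
proof -
 have "prim (c *: U) t = (LL s. c *: (ind {0<..<t} s *: ap U s))"
  unfolding prim_def
  by (rule integral_cong_AE) (simp, simp, use ap_scaleR[of c U] in eventually_elim, simp)
 thus ?thesis unfolding prim_def by (simp only: integral_scaleR_right)
qed

lemma inner_prim: "inner (prim U t) e = (LL s. ind {0<..<t} s * inner (ap U s) e)"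
 unfolding prim_def
 by (subst integral_inner_left[symmetric]) (auto simp: integrable_indicator_sq)

definition intop :: "real=>(real, 'b::hilb) lp2=>(real, 'b) lp2"
 where "intop T U = mk (%t. ind {0<..<T} t *: prim U t)"

definition coint :: "real=>(real, 'b::hilb) lp2=>(real, 'b) lp2"
 where "coint T U = mk (%t. ind {0<..<T} t *: (prim U T - prim U t))"

definition expw :: "real=>real=>real=>real"
 where "expw T k t = exp (- k * max 0 (min t T))"

lemma expw_measurable [measurable]: "expw T k\<in>meas"
 unfolding expw_def[abs_def] by (rule measurable_completion) measurable

lemma Linf_if_L1_dual_bound:
 fixes lam :: "(real, 'b::hilb) lp2"
 assumes C: "C\<ge>0" and le: "!!U. inner lam U\<le>C * nprim U T"
 shows "AEL t. t\<in>{0<..<T} --> norm (ap lam t)\<le>C"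
proof -
 define E where "E = {t\<in>{0<..<T}. C < norm (ap lam t)}"
 have "{t\<in>space lebesgue. C < norm (ap lam t)}\<in>sets lebesgue" by measurable
 hence "{0<..<T}\<inter>{t\<in>space lebesgue. C < norm (ap lam t)}\<in>sets lebesgue" by (intro sets.Int) simp
 moreover have "{0<..<T}\<inter>{t\<in>space lebesgue. C < norm (ap lam t)} = E" by (auto simp: E_def)
 ultimately have Es: "E\<in>sets lebesgue" by (simp only:)
 have hm: "(ind E :: real=>real)\<in>meas" using Es by measurable
 define U where "U = mulop (ind E) lam"
 have apU: "AEL t. ap U t = ind E t *: ap lam t"
  unfolding U_def by (rule ap_mulop[OF hm, of 1]) (auto simp: ind_def)
 have i1: "inner lam U = (LL t. ind E t * (norm (ap lam t))^2)"
  unfolding inner_lp2_def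
  by (rule integral_cong_AE) (simp, use hm in simp, use apU in eventually_elim, simp add: power2_norm_eq_inner)
 have i2: "nprim U T = (LL t. ind E t * norm (ap lam t))"
  unfolding nprim_def
  by (rule integral_cong_AE) (simp, use hm in simp, use apU in eventually_elim, auto simp: ind_def E_def)
 have El: "E\<in>lmeasurable"
  by (rule fmeasurableI2[of "{0<..<T}"]) (use Es in \<open>auto simp: E_def\<close>)
 have int1: "integrable lebesgue (%t. ind E t * norm (ap lam t))" by (rule integrable_indicator_norm[OF El])
 have int2: "integrable lebesgue (%t. ind E t * (norm (ap lam t))^2)"
  using integrable_mult_indicator[OF Es integrable_norm_sq_ap[of lam]] by simp
 define p where "p t = ind E t * (norm (ap lam t))^2 - C * (ind E t * norm (ap lam t))" for t
 have pi: "integrable lebesgue p" unfolding p_def[abs_def] using int1 int2 by simp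
 have p_eq: "p t = ind E t * (norm (ap lam t) * (norm (ap lam t) - C))" for t
  by (simp add: p_def power2_eq_square algebra_simps)
 have p0: "0\<le>p t" for t
  unfolding p_eq by (cases "t\<in>E") (auto simp: E_def intro!: mult_nonneg_nonneg)
 have "integral\<^sup>L lebesgue p = inner lam U - C * nprim U T"
  unfolding p_def[abs_def] i1 i2 using int1 int2 by simp
 hence "integral\<^sup>L lebesgue p\<le>0" using le[of U] by simp
 moreover have "0\<le>integral\<^sup>L lebesgue p" using p0 by (intro integral_nonneg_AE) auto
 ultimately have "integral\<^sup>L lebesgue p = 0" by simp
 hence "AEL t. p t = 0"
  using integral_nonneg_eq_0_iff_AE[OF pi] p0 by simp
 thus ?thesis
 proof eventually_elim
  case (elim t)
  show ?case
  proof (rule impI, rule ccontr)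
   assume t: "t\<in>{0<..<T}" and "\<not> norm (ap lam t)\<le>C"
   hence "t\<in>E" "norm (ap lam t) > C" by (auto simp: E_def)
   hence "p t > 0" unfolding p_eq using C by (auto intro!: mult_pos_pos)
   thus False using elim by simp
  qed
 qed
qed

context
 fixes T :: real
 assumes T: "T > 0"
begin

lemma
 shows sq_int_intop: "sq_int (%t. ind {0<..<T} t *: prim U t)"
  and ap_intop: "AEL t. ap (intop T U) t = ind {0<..<T} t *: prim U t"
proof -
 show s: "sq_int (%t. ind {0<..<T} t *: prim U t)"
 proof (rule sq_int_bounded_on[of _ "{0<..<T}" "nprim U T"])
  show "AEL t. norm (ind {0<..<T} t *: prim U t)\<le>ind {0<..<T} t * nprim U T"
   using order_trans[OF norm_prim_le[of U] nprim_mono[of _ T U]] by (intro AE_I2) (auto simp: ind_def)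
 qed auto
 show "AEL t. ap (intop T U) t = ind {0<..<T} t *: prim U t"
  unfolding intop_def by (rule ap_mk[OF s])
qed

lemma
 shows sq_int_coint: "sq_int (%t. ind {0<..<T} t *: (prim U T - prim U t))"
  and ap_coint: "AEL t. ap (coint T U) t = ind {0<..<T} t *: (prim U T - prim U t)"
proof -
 show s: "sq_int (%t. ind {0<..<T} t *: (prim U T - prim U t))"
 proof (rule sq_int_bounded_on[of _ "{0<..<T}" "sqrt T * norm U"])
  show "AEL t. norm (ind {0<..<T} t *: (prim U T - prim U t))\<le>ind {0<..<T} t * (sqrt T * norm U)"
  proof (rule AE_I2)
   fix t
   show "norm (ind {0<..<T} t *: (prim U T - prim U t))\<le>ind {0<..<T} t * (sqrt T * norm U)"
   proof (cases "t\<in>{0<..<T}")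
    case True
    hence "norm (prim U T - prim U t)\<le>sqrt (T - t) * norm U" by (intro prim_diff_le) auto
    also have "...\<le>sqrt T * norm U" using True by (intro mult_right_mono) auto
    finally show ?thesis using True by simp
   qed simp
  qed
 qed auto
 show "AEL t. ap (coint T U) t = ind {0<..<T} t *: (prim U T - prim U t)"
  unfolding coint_def by (rule ap_mk[OF s])
qed

lemma norm_intop_le: "norm (intop T U)\<le>sqrt T * nprim U T"
proof -
 let ?g = "mk (%t. ind {0<..<T} t *: (1::real))"
 have "norm (intop T U)\<le>nprim U T * norm ?g"
  unfolding intop_def
 proof (rule norm_mk_le[OF sq_int_intop nprim_nonneg])
  have "AEL t. ap ?g t = ind {0<..<T} t *: (1::real)" by (rule ap_mk[OF sq_int_indicator]) simp
  thus "AEL t. norm (ind {0<..<T} t *: prim U t)\<le>nprim U T * norm (ap ?g t)"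
  proof eventually_elim
   case (elim t)
   show ?case using norm_prim_le[of U t] nprim_mono[of t T U] elim by (cases "t\<in>{0<..<T}") auto
  qed
 qed
 thus ?thesis using T by (simp add: mult.commute)
qed

lemma bounded_linear_intop: "bounded_linear (intop T)"
proof (rule bounded_linear_intro[where K="sqrt T * sqrt T"])
 show "intop T (U + V) = intop T U + intop T V" for U V
  by (rule lp2_eqI) (use ap_intop[of "U + V"] ap_intop[of U] ap_intop[of V] ap_add[of "intop T U" "intop T V"]
    in eventually_elim, simp add: prim_add scaleR_add_right)
 show "intop T (r *: U) = r *: intop T U" for r U
  by (rule lp2_eqI) (use ap_intop[of "r *: U"] ap_intop[of U] ap_scaleR[of r "intop T U"]
    in eventually_elim, simp add: prim_scaleR)
 show "norm (intop T U)\<le>norm U * (sqrt T * sqrt T)" for U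
 proof -
  have "sqrt T * nprim U T\<le>sqrt T * (sqrt T * norm U)"
   using nprim_le_norm[of U T] T by (intro mult_left_mono) auto
  also have "... = norm U * (sqrt T * sqrt T)" by (simp only: mult.assoc mult.commute mult.left_commute)
  finally show ?thesis by (rule order_trans[OF norm_intop_le])
 qed
qed

lemma inner_intop: "inner (intop T U) V = inner U (coint T V)"
proof -
 let ?M = "lebesgue_on {0<..<T}"
 interpret M: finite_measure ?M by (rule finite_measure_lebesgue_on) simp
 interpret P: pair_sigma_finite ?M ?M ..
 define k where "k s t = (if s < t then inner (ap U s) (ap V t) else 0)" for s t :: real
 have mU: "ap F\<in>borel_measurable ?M" for F :: "(real, 'a) lp2"
  by (rule measurable_restrict_space1) simp
 have fstm: "fst\<in>borel_measurable (?M \<Otimes>\<^sub>M ?M)" and sndm: "snd\<in>borel_measurable (?M \<Otimes>\<^sub>M ?M)"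
 proof -
  have id: "(%x. x)\<in>borel_measurable ?M"
   by (rule measurable_restrict_space1, rule measurable_completion) simp
  show "fst\<in>borel_measurable (?M \<Otimes>\<^sub>M ?M)" using measurable_compose[OF measurable_fst[of ?M ?M] id] .
  show "snd\<in>borel_measurable (?M \<Otimes>\<^sub>M ?M)" using measurable_compose[OF measurable_snd[of ?M ?M] id] .
 qed
 have Um: "(%p. ap F (fst p))\<in>borel_measurable (?M \<Otimes>\<^sub>M ?M)" and Vm: "(%p. ap F (snd p))\<in>borel_measurable (?M \<Otimes>\<^sub>M ?M)" for F :: "(real, 'a) lp2"
  by (rule measurable_compose[OF measurable_fst[of ?M ?M] mU], rule measurable_compose[OF measurable_snd[of ?M ?M] mU])
 have km: "case_prod k\<in>borel_measurable (?M \<Otimes>\<^sub>M ?M)"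
 proof -
  have "(%p. if fst p < snd p then inner (ap U (fst p)) (ap V (snd p)) else 0)\<in>borel_measurable (?M \<Otimes>\<^sub>M ?M)"
  proof (rule measurable_If)
   show "{x\<in>space (?M \<Otimes>\<^sub>M ?M). fst x < snd x}\<in>sets (?M \<Otimes>\<^sub>M ?M)"
    using borel_measurable_less[OF fstm sndm] .
  qed (use borel_measurable_inner[OF Um Vm] in auto)
  thus ?thesis by (simp add: k_def[abs_def] case_prod_beta')
 qed
 have nint: "integrable ?M (%s. norm (ap F s))" for F :: "(real, 'a) lp2"
  using integrable_indicator_norm[of "{0<..<T}" F] by (subst integrable_restrict_space) auto
 have int: "integrable (?M \<Otimes>\<^sub>M ?M) (case_prod k)"
 proof (rule Bochner_Integration.integrable_bound[OF _ km])
  show "integrable (?M \<Otimes>\<^sub>M ?M) (%p. norm (ap U (fst p)) * norm (ap V (snd p)))"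
   by (rule P.Fubini_integrable) (use Um Vm nint in \<open>auto intro!: borel_measurable_times borel_measurable_norm\<close>)
  show "AE p in ?M \<Otimes>\<^sub>M ?M. norm (case_prod k p)\<le>norm (norm (ap U (fst p)) * norm (ap V (snd p)))"
   using Cauchy_Schwarz_ineq2 by (intro AE_I2) (auto simp: k_def case_prod_beta')
 qed
 have L: "(LINT s|?M. k s t) = inner (prim U t) (ap V t)" if "t\<in>{0<..<T}" for t
 proof -
  have "(LINT s|?M. k s t) = (LL s. ind {0<..<T} s *: k s t)"
   by (rule integral_restrict_space) simp
  also have "... = (LL s. ind {0<..<t} s * inner (ap U s) (ap V t))"
   by (rule Bochner_Integration.integral_cong) (use that in \<open>auto simp: k_def ind_def\<close>)
  finally show ?thesis by (simp add: inner_prim)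
 qed
 have R: "(LINT t|?M. k s t) = inner (ap U s) (prim V T - prim V s)" if "s\<in>{0<..<T}" for s
 proof -
  have "(LINT t|?M. k s t) = (LL t. ind {0<..<T} t *: k s t)"
   by (rule integral_restrict_space) simp
  also have "... = (LL t. ind {0<..<T} t * inner (ap V t) (ap U s) - ind {0<..<s} t * inner (ap V t) (ap U s))"
  proof (rule integral_cong_AE)
   have "{s}\<in>null_sets lebesgue" by simp
   hence "AEL t. t\<notin>{s}" by (rule AE_not_in)
   thus "AEL t. ind {0<..<T} t *: k s t
     = ind {0<..<T} t * inner (ap V t) (ap U s) - ind {0<..<s} t * inner (ap V t) (ap U s)"
    by eventually_elim (use that in \<open>auto simp: k_def ind_def inner_commute\<close>)
   have ks: "k s = (%t. ind {s<..} t * inner (ap U s) (ap V t))"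
    by (auto simp: k_def fun_eq_iff ind_def)
   show "(%t. ind {0<..<T} t *: k s t)\<in>meas" unfolding ks by measurable
  qed measurable
  also have "... = inner (prim V T) (ap U s) - inner (prim V s) (ap U s)"
   unfolding inner_prim
  proof (rule Bochner_Integration.integral_diff)
   have "integrable lebesgue (%t. inner (ind {0<..<r} t *: ap V t) (ap U s))" for r :: real
    by (intro integrable_inner_left integrable_indicator_sq) auto
   thus "integrable lebesgue (%t. ind {0<..<T} t * inner (ap V t) (ap U s))"
    "integrable lebesgue (%t. ind {0<..<s} t * inner (ap V t) (ap U s))" by simp_all
  qed
  finally show ?thesis by (simp add: inner_diff_left inner_commute inner_diff_right)
 qed
 have "inner (intop T U) V = (LL t. ind {0<..<T} t *: inner (prim U t) (ap V t))"
  unfolding inner_lp2_def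
  by (rule integral_cong_AE) (simp, simp, use ap_intop[of U] in eventually_elim, simp)
 also have "... = (LINT t|?M. inner (prim U t) (ap V t))"
  by (rule integral_restrict_space[symmetric]) simp
 also have "... = (LINT t|?M. LINT s|?M. k s t)"
  by (rule Bochner_Integration.integral_cong) (use L in auto)
 also have "... = (LINT s|?M. LINT t|?M. k s t)"
  using P.Fubini_integral[OF int] .
 also have "... = (LINT s|?M. inner (ap U s) (prim V T - prim V s))"
  by (rule Bochner_Integration.integral_cong) (use R in auto)
 also have "... = (LL s. ind {0<..<T} s *: inner (ap U s) (prim V T - prim V s))"
  by (rule integral_restrict_space) simp
 also have "... = inner U (coint T V)"
  unfolding inner_lp2_def
  by (rule integral_cong_AE) (simp, simp, use ap_coint[of V] in eventually_elim, simp)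
 finally show ?thesis .
qed

lemma expw_bounds: "k\<ge>0 ==> exp (- k * T)\<le>expw T k t" "k\<ge>0 ==> expw T k t\<le>1" "0 < expw T k t"
 using T by (auto simp: expw_def intro!: mult_left_mono)

lemma weighted_bound:
 assumes k: "k > 0"
  and le: "AEL t. norm (ap V t)\<le>ind {0<..<T} t * (C * nprim U t)" and C: "C\<ge>0"
 shows "norm (mulop (expw T k) V)\<le>C * sqrt (T / (2 * k)) * norm (mulop (expw T k) U)"
proof -
 have M: "\<bar>expw T k t\<bar>\<le>1" for t using expw_bounds(2,3)[of k t] k by auto
 define n where "n = norm (mulop (expw T k) U)"
 have key: "expw T k t * nprim U t\<le>n / sqrt (2 * k)" if t: "t\<in>{0<..<T}" for t
 proof -
  define e where "e s = ind {0<..<t} s *: exp (k * s)" for s :: real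
  have em: "e\<in>meas" unfolding e_def[abs_def]
   by (rule measurable_completion) measurable
  have es: "sq_int e"
   by (rule sq_int_bounded_on[OF em, of "{0<..<t}" "exp (k * t)"]) (use k in \<open>auto simp: e_def ind_def\<close>)
  have e2: "(norm (mk e))^2\<le>exp (2 * k * t) / (2 * k)"
  proof -
   have c: "continuous_on {0..t} (%s. exp (2 * k * s))" by (intro continuous_intros)
   have "(norm (mk e))^2 = (LL s. (norm (e s))^2)" by (rule norm_mk_square[OF es])
   also have "...\<le>(LL s. ind {0..t} s *: exp (2 * k * s))"
   proof (rule integral_mono_AE)
    have "integrable lborel (%s. ind {0..t} s *: exp (2 * k * s))"
     by (rule borel_integrable_compact) (use c in auto)
    thus "integrable lebesgue (%s. ind {0..t} s *: exp (2 * k * s))"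
     by (subst integrable_completion) auto
    have "(exp (k * s))^2 = exp (2 * k * s)" for s :: real
     by (simp add: power2_eq_square exp_add[symmetric])
    thus "AEL s. (norm (e s))^2\<le>ind {0..t} s *: exp (2 * k * s)"
     by (intro AE_I2) (auto simp: e_def ind_def)
   qed (rule sq_int_integrable[OF es])
   also have "... = (LINT s|lborel. ind {0..t} s *: exp (2 * k * s))"
    by (rule integral_completion) measurable
   also have "... = exp (2 * k * t) / (2 * k) - exp (2 * k * 0) / (2 * k)"
   proof (rule integral_FTC_Icc[where F="%s. exp (2 * k * s) / (2 * k)"])
    show "((%s. exp (2 * k * s) / (2 * k)) has_vector_derivative exp (2 * k * x)) (at x within {0..t})" for x
     unfolding has_real_derivative_iff_has_vector_derivative[symmetric]
     using k by (auto intro!: derivative_eq_intros)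
   qed (use t c in auto)
   also have "...\<le>exp (2 * k * t) / (2 * k)" using k by simp
   finally show ?thesis .
  qed
  have e1: "norm (mk e)\<le>exp (k * t) / sqrt (2 * k)"
  proof (rule power2_le_imp_le)
   have "(exp (k * t) / sqrt (2 * k))^2 = exp (2 * k * t) / (2 * k)"
    using k by (simp add: power_divide power2_eq_square exp_add[symmetric])
   thus "(norm (mk e))^2\<le>(exp (k * t) / sqrt (2 * k))^2" using e2 by simp
  qed (use k in simp)
  have aw: "AEL s. ap (mulop (expw T k) U) s = expw T k s *: ap U s"
   by (rule ap_mulop[OF expw_measurable M])
  have "nprim U t = (LL s. norm (e s) * norm (ap (mulop (expw T k) U) s))"
   unfolding nprim_def
  proof (rule integral_cong_AE)
   show "(%s. norm (e s) * norm (ap (mulop (expw T k) U) s))\<in>meas"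
    using em by measurable
   show "AEL s. ind {0<..<t} s * norm (ap U s) = norm (e s) * norm (ap (mulop (expw T k) U) s)"
    using aw
   proof eventually_elim
    case (elim s)
    show ?case
    proof (cases "s\<in>{0<..<t}")
     case True
     hence "expw T k s = exp (- (k * s))" using t by (simp add: expw_def)
     hence "exp (k * s) * expw T k s = 1" by (simp add: exp_minus)
     hence "exp (k * s) * (expw T k s * norm (ap U s)) = norm (ap U s)" by (metis mult.assoc mult_1)
     thus ?thesis using True elim expw_bounds(3)[of k s] by (simp add: e_def)
    qed (simp add: e_def)
   qed
  qed simp
  also have "...\<le>norm (mk e) * norm (mk (ap (mulop (expw T k) U)))"
   by (rule lp2_Cauchy_Schwarz[OF es]) simp
  also have "...\<le>exp (k * t) / sqrt (2 * k) * n"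
   unfolding mk_ap n_def[symmetric] using e1 by (intro mult_right_mono) (auto simp: n_def)
  finally have le1: "nprim U t\<le>exp (k * t) / sqrt (2 * k) * n" .
  have "expw T k t = exp (- (k * t))" using t by (simp add: expw_def)
  hence "expw T k t * nprim U t\<le>exp (- (k * t)) * (exp (k * t) / sqrt (2 * k) * n)"
   using le1 by (simp only: mult_left_mono exp_ge_zero)
  also have "... = (exp (- (k * t)) * exp (k * t)) * (n / sqrt (2 * k))" by simp
  also have "... = n / sqrt (2 * k)" by (simp add: exp_minus)
  finally show ?thesis .
 qed
 let ?g = "mk (%t. ind {0<..<T} t *: (1::real))"
 have g: "AEL t. ap ?g t = ind {0<..<T} t *: (1::real)" by (rule ap_mk[OF sq_int_indicator]) simp
 have "norm (mulop (expw T k) V)\<le>(C * (n / sqrt (2 * k))) * norm ?g"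
  unfolding mulop_def
 proof (rule norm_mk_le[OF sq_int_mulop[OF expw_measurable M]])
  show "0\<le>C * (n / sqrt (2 * k))" using C k by (simp add: n_def)
  show "AEL t. norm (expw T k t *: ap V t)\<le>C * (n / sqrt (2 * k)) * norm (ap ?g t)"
   using le g
  proof eventually_elim
   case (elim t)
   have w: "0 < expw T k t" by (rule expw_bounds)
   show ?case
   proof (cases "t\<in>{0<..<T}")
    case True
    hence "norm (ap V t)\<le>C * nprim U t" using elim by simp
    hence "expw T k t * norm (ap V t)\<le>expw T k t * (C * nprim U t)" using w by (intro mult_left_mono) auto
    also have "... = C * (expw T k t * nprim U t)" by simp
    also have "...\<le>C * (n / sqrt (2 * k))" using key[OF True] C by (intro mult_left_mono) auto
    finally show ?thesis using True elim w by simp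
   next
    case False
    thus ?thesis using elim by simp
   qed
  qed
 qed
 also have "... = C * (n / sqrt (2 * k)) * sqrt T" using T by simp
 also have "... = C * sqrt (T / (2 * k)) * n" by (simp add: real_sqrt_divide)
 finally show ?thesis by (simp add: n_def)
qed

lemma weighted_intop:
 assumes "k > 0"
 shows "norm (mulop (expw T k) (intop T U))\<le>sqrt (T / (2 * k)) * norm (mulop (expw T k) U)"
proof -
 have "AEL t. norm (ap (intop T U) t)\<le>ind {0<..<T} t * (1 * nprim U t)"
  using ap_intop[of U] by eventually_elim (simp add: norm_prim_le ind_def)
 from weighted_bound[OF assms this] show ?thesis by simp
qed

end

section \<open>Superposition operators\<close>

definition dom2 :: "real=>('b::real_normed_vector=>'c::real_normed_vector=>'e::real_normed_vector)=>bool"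
 where "dom2 C G \<longleftrightarrow> 0\<le>C \<and> (%z. G (fst z) (snd z))\<in>borel_measurable borel \<and> (\<forall>p q. norm (G p q)\<le>C * norm q)"

text \<open>Being a pointwise limit of Lipschitz functions is inherited by superposition operators and
 implies measurability, also for functions with values in function spaces.\<close>

definition adm :: "real=>('b::real_normed_vector=>'c::real_normed_vector=>'e::real_normed_vector)=>bool"
 where "adm C G \<longleftrightarrow> 0\<le>C \<and> (\<exists>g. (\<forall>n::nat. \<exists>L\<ge>0. \<forall>p q p' q'. norm (g n p q - g n p' q')\<le>L * (norm (p - p') + norm (q - q'))) \<and>
   (\<forall>n p q. norm (g n p q)\<le>C * norm q) \<and> (\<forall>p q. (%n. g n p q) ----> G p q))"

definition nem2 :: "'d set=>('b=>'c=>'e)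
  =>('d::euclidean_space, 'b::hilb) lp2
  =>('d, 'c::hilb) lp2
  =>('d, 'e::hilb) lp2"
 where "nem2 S G a b = mk (%x. ind S x *: G (ap a x) (ap b x))"

definition nem1 :: "'d set=>('b=>'e)
  =>('d::euclidean_space, 'b::hilb) lp2
  =>('d, 'e::hilb) lp2"
 where "nem1 S g a = mk (%x. ind S x *: g (ap a x))"

definition dirder :: "('b::real_normed_vector=>'e::real_normed_vector)=>('b=>'b=>'e)=>bool"
 where "dirder g gd \<longleftrightarrow> (\<forall>p q ta. (\<forall>n::nat. 0 < ta n) --> ta ----> 0 -->
   (%n. inverse (ta n) *: (g (p + ta n *: q) - g p)) ----> gd p q)"

lemma dom2D:
 assumes "dom2 C G"
 shows "0\<le>C" "(%z. G (fst z) (snd z))\<in>borel_measurable borel" "norm (G p q)\<le>C * norm q"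
 using assms by (auto simp: dom2_def)

lemma dom2_comp:
 fixes G :: "'b::{real_normed_vector,second_countable_topology}=>'c::{real_normed_vector,second_countable_topology}=>'e::real_normed_vector"
 assumes "dom2 C G" "u\<in>borel_measurable M" "v\<in>borel_measurable M"
 shows "(%x. G (u x) (v x))\<in>borel_measurable M"
 using measurable_compose[OF borel_measurable_Pair[OF assms(2,3)] dom2D(2)[OF assms(1)]] by simp

context
 fixes S :: "'d::euclidean_space set" and C :: real
  and G :: "'b::hilb=>'c::hilb=>'e::hilb"
 assumes S: "S\<in>sets lebesgue" and G: "dom2 C G"
begin

lemma nem2_measurable: "(%x. ind S x *: G (ap a x) (ap b x))\<in>meas"
 using S by (intro borel_measurable_scaleR borel_measurable_indicator dom2_comp[OF G]) simp_all

lemma sq_int_nem2: "sq_int (%x. ind S x *: G (ap a x) (ap b x))"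
proof (rule sq_int_bound[OF nem2_measurable sq_int_ap[of b], where C=C])
 have "norm (ind S x *: G (ap a x) (ap b x))\<le>norm (G (ap a x) (ap b x))" for x by (simp add: ind_def)
 thus "AEL x. norm (ind S x *: G (ap a x) (ap b x))\<le>C * norm (ap b x)"
  by (intro AE_I2 order_trans[OF _ dom2D(3)[OF G]])
qed

lemma ap_nem2: "AEL x. ap (nem2 S G a b) x = ind S x *: G (ap a x) (ap b x)"
 unfolding nem2_def by (rule ap_mk[OF sq_int_nem2])

lemma norm_nem2_le: "norm (nem2 S G a b)\<le>C * norm b"
 unfolding nem2_def
proof (rule norm_mk_le[OF sq_int_nem2 dom2D(1)[OF G]])
 have "norm (ind S x *: G (ap a x) (ap b x))\<le>norm (G (ap a x) (ap b x))" for x by (simp add: ind_def)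
 thus "AEL x. norm (ind S x *: G (ap a x) (ap b x))\<le>C * norm (ap b x)"
  by (intro AE_I2 order_trans[OF _ dom2D(3)[OF G]])
qed

lemma bounded_linear_nem2:
 assumes lin: "!!p. linear (G p)"
 shows "bounded_linear (nem2 S G a)"
proof (rule bounded_linear_intro[where K=C])
 show "nem2 S G a (u + v) = nem2 S G a u + nem2 S G a v" for u v
  by (rule lp2_eqI) (use ap_nem2[of a "u + v"] ap_nem2[of a u] ap_nem2[of a v] ap_add[of u v]
    ap_add[of "nem2 S G a u" "nem2 S G a v"] in eventually_elim, simp add: linear_add[OF lin] scaleR_add_right)
 show "nem2 S G a (r *: u) = r *: nem2 S G a u" for r u
  by (rule lp2_eqI) (use ap_nem2[of a "r *: u"] ap_nem2[of a u] ap_scaleR[of r u]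
    ap_scaleR[of r "nem2 S G a u"] in eventually_elim, simp add: linear_scale[OF lin])
qed (use norm_nem2_le in \<open>simp add: mult.commute\<close>)

end

lemma inner_nem2:
 fixes G :: "'b::hilb=>'c::hilb=>'c"
 assumes S: "S\<in>sets lebesgue" and G: "dom2 C G" and sym: "!!p q r. inner (G p q) r = inner q (G p r)"
 shows "inner (nem2 S G a b) c = inner b (nem2 S G a c)"
 unfolding inner_lp2_def
 by (rule integral_cong_AE) (simp, simp, use ap_nem2[OF S G, of a b] ap_nem2[OF S G, of a c] in eventually_elim, simp add: sym)

lemma adm_lipschitz_dom2:
 fixes g :: "'b::{real_normed_vector,second_countable_topology}=>'c::{real_normed_vector,second_countable_topology}=>'e::real_normed_vector"
 assumes C: "0\<le>C" and L: "!!p q p' q'. norm (g p q - g p' q')\<le>L * (norm (p - p') + norm (q - q'))"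
  and le: "!!p q. norm (g p q)\<le>C * norm q"
 shows "dom2 C g"
 unfolding dom2_def
proof (intro conjI allI C le borel_measurable_continuous_onI)
 have "isCont (%z. g (fst z) (snd z)) w" for w
  unfolding isCont_def
 proof (rule LIM_zero_cancel, rule Lim_null_comparison)
  show "\<forall>\<^sub>F z in at w. norm (g (fst z) (snd z) - g (fst w) (snd w))\<le>L * (norm (fst z - fst w) + norm (snd z - snd w))"
   using L by (intro always_eventually) auto
  have "((%z. L * (norm (fst z - fst w) + norm (snd z - snd w))) \<longlongrightarrow> L * (norm (fst w - fst w) + norm (snd w - snd w))) (at w)"
   by (intro tendsto_intros)
  thus "((%z. L * (norm (fst z - fst w) + norm (snd z - snd w))) \<longlongrightarrow> 0) (at w)" by simp
 qed
 thus "continuous_on UNIV (%z. g (fst z) (snd z))" by (simp add: continuous_at_imp_continuous_on)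
qed

lemma adm_dom2:
 fixes G :: "'b::{real_normed_vector,second_countable_topology}=>'c::{real_normed_vector,second_countable_topology}=>'e::real_normed_vector"
 assumes "adm C G"
 shows "dom2 C G"
proof -
 obtain g where C: "0\<le>C" and g: "!!n::nat. \<exists>L\<ge>0. \<forall>p q p' q'. norm (g n p q - g n p' q')\<le>L * (norm (p - p') + norm (q - q'))"
  and le: "!!n p q. norm (g n p q)\<le>C * norm q" and lim: "!!p q. (%n. g n p q) ----> G p q"
  using assms unfolding adm_def by blast
 have d: "dom2 C (g n)" for n
 proof -
  obtain L where "!!p q p' q'. norm (g n p q - g n p' q')\<le>L * (norm (p - p') + norm (q - q'))"
   using g[of n] by blast
  thus ?thesis by (rule adm_lipschitz_dom2[OF C _ le])
 qed
 show ?thesis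
  unfolding dom2_def
 proof (intro conjI allI C)
  show "(%z. G (fst z) (snd z))\<in>borel_measurable borel"
   by (rule borel_measurable_LIMSEQ_metric[OF dom2D(2)[OF d]]) (rule lim)
  show "norm (G p q)\<le>C * norm q" for p q
   by (rule LIMSEQ_le_const2[OF tendsto_norm[OF lim]]) (use le in blast)
 qed
qed

lemma adm_nem2:
 fixes G :: "'b::hilb=>'c::hilb=>'e::hilb"
 assumes S: "S\<in>sets (lebesgue :: 'd::euclidean_space measure)" and G: "adm C G"
 shows "adm C (nem2 S G)"
proof -
 obtain g where C: "0\<le>C" and g: "!!n::nat. \<exists>L\<ge>0. \<forall>p q p' q'. norm (g n p q - g n p' q')\<le>L * (norm (p - p') + norm (q - q'))"
  and le: "!!n p q. norm (g n p q)\<le>C * norm q" and lim: "!!p q. (%n. g n p q) ----> G p q"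
  using G unfolding adm_def by blast
 have d: "dom2 C (g n)" for n
 proof -
  obtain L where "!!p q p' q'. norm (g n p q - g n p' q')\<le>L * (norm (p - p') + norm (q - q'))"
   using g[of n] by blast
  thus ?thesis by (rule adm_lipschitz_dom2[OF C _ le])
 qed
 show ?thesis
  unfolding adm_def
 proof (intro conjI C exI[of _ "%n. nem2 S (g n)"] allI)
  fix n
  obtain L where L: "L\<ge>0" "!!p q p' q'. norm (g n p q - g n p' q')\<le>L * (norm (p - p') + norm (q - q'))"
   using g[of n] by blast
  have "norm (nem2 S (g n) a b - nem2 S (g n) a' b')\<le>L * (norm (a - a') + norm (b - b'))" for a a' b b'
  proof -
   have "norm (nem2 S (g n) a b - nem2 S (g n) a' b')\<le>L * norm (a - a') + L * norm (b - b')"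
   proof (rule norm_ap_le2[OF L(1) L(1)])
    show "AEL x. norm (ap (nem2 S (g n) a b - nem2 S (g n) a' b') x)\<le>L * norm (ap (a - a') x) + L * norm (ap (b - b') x)"
     using ap_diff[of "nem2 S (g n) a b" "nem2 S (g n) a' b'"] ap_nem2[OF S d[of n], of a b]
      ap_nem2[OF S d[of n], of a' b'] ap_diff[of a a'] ap_diff[of b b']
    proof eventually_elim
     case (elim x)
     show ?case
      using L(2)[of "ap a x" "ap b x" "ap a' x" "ap b' x"] L(1) by (simp add: elim ind_def distrib_left)
    qed
   qed
   thus ?thesis by (simp add: distrib_left)
  qed
  thus "\<exists>L\<ge>0. \<forall>p q p' q'. norm (nem2 S (g n) p q - nem2 S (g n) p' q')\<le>L * (norm (p - p') + norm (q - q'))"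
   using L(1) by blast
 next
  show "norm (nem2 S (g n) p q)\<le>C * norm q" for n p q by (rule norm_nem2_le[OF S d])
 next
  fix a :: "('d, 'b) lp2" and b :: "('d, 'c) lp2"
  show "(%n. nem2 S (g n) a b) ----> nem2 S G a b"
   unfolding nem2_def
  proof (rule lp2_dominated_convergence(2)[OF sq_int_scaleR[OF sq_int_ap[of b], where c=C]])
   show "(%x. ind S x *: g n (ap a x) (ap b x))\<in>meas" for n
    by (rule nem2_measurable[OF S d])
   show "(%x. ind S x *: G (ap a x) (ap b x))\<in>meas"
    by (rule nem2_measurable[OF S adm_dom2[OF G]])
   show "AEL x. norm (ind S x *: g n (ap a x) (ap b x))\<le>norm (C *: ap b x)" for n
    using le[of n] C by (intro AE_I2) (auto simp: ind_def)
   show "AEL x. (%n. ind S x *: g n (ap a x) (ap b x)) ----> ind S x *: G (ap a x) (ap b x)"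
    by (intro AE_I2 tendsto_intros lim)
  qed
 qed
qed

context
 fixes S :: "'d::euclidean_space set" and L :: real
  and g :: "'b::hilb=>'e::hilb"
 assumes S: "S\<in>lmeasurable" and L: "0\<le>L" and lip: "!!p q. norm (g p - g q)\<le>L * norm (p - q)"
begin

lemma nem1_measurable: "(%x. ind S x *: g (ap a x))\<in>meas"
proof -
 have "continuous_on UNIV g"
 proof (rule lipschitz_on_continuous_on)
  show "L-lipschitz_on UNIV g" using L lip by (auto simp: lipschitz_on_def dist_norm)
 qed
 hence "(%x. g (ap a x))\<in>meas" by (rule borel_measurable_continuous_on) simp
 thus ?thesis using S by (intro borel_measurable_scaleR borel_measurable_indicator) (auto simp: fmeasurableD)
qed

lemma sq_int_nem1: "sq_int (%x. ind S x *: g (ap a x))"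
proof -
 have s: "sq_int (%x. norm (ind S x *: norm (g 0)) + norm (L *: ap a x))"
  by (intro sq_int_add sq_int_norm sq_int_scaleR sq_int_indicator S sq_int_ap)
 show ?thesis
 proof (rule sq_int_bound[OF nem1_measurable s, of _ 1], rule AE_I2)
  fix x
  have "norm (g (ap a x))\<le>norm (g 0) + L * norm (ap a x)"
   using norm_triangle_ineq[of "g (ap a x) - g 0" "g 0"] lip[of "ap a x" 0] by simp
  thus "norm (ind S x *: g (ap a x))\<le>1 * norm (norm (ind S x *: norm (g 0)) + norm (L *: ap a x))"
   using L by (auto simp: ind_def)
 qed
qed

lemma ap_nem1: "AEL x. ap (nem1 S g a) x = ind S x *: g (ap a x)"
 unfolding nem1_def by (rule ap_mk[OF sq_int_nem1])

lemma norm_nem1_diff: "norm (nem1 S g a - nem1 S g b)\<le>L * norm (a - b)"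
proof (rule norm_ap_le[OF L])
 show "AEL x. norm (ap (nem1 S g a - nem1 S g b) x)\<le>L * norm (ap (a - b) x)"
  using ap_diff[of "nem1 S g a" "nem1 S g b"] ap_nem1[of a] ap_nem1[of b] ap_diff[of a b]
 proof eventually_elim
  case (elim x)
  show ?case using lip[of "ap a x" "ap b x"] L by (simp add: elim ind_def)
 qed
qed

lemma dirder_adm:
 assumes "dirder g gd"
 shows "adm L gd"
 unfolding adm_def
proof (intro conjI L exI[of _ "%n p q. inverse (inverse (real (Suc n))) *: (g (p + inverse (real (Suc n)) *: q) - g p)"] allI)
 fix n
 let ?h = "inverse (real (Suc n))" and ?k = "real (Suc n)"
 have e: "inverse ?h = ?k" by simp
 show "\<exists>K\<ge>0. \<forall>p q p' q'. norm (inverse ?h *: (g (p + ?h *: q) - g p) - inverse ?h *: (g (p' + ?h *: q') - g p'))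
   \<le>K * (norm (p - p') + norm (q - q'))"
 proof (intro exI[of _ "2 * ?k * L"] conjI allI)
  fix p q p' q'
  have "norm ((g (p + ?h *: q) - g p) - (g (p' + ?h *: q') - g p'))
    \<le>norm (g (p + ?h *: q) - g (p' + ?h *: q')) + norm (g p - g p')"
   using norm_triangle_ineq4[of "g (p + ?h *: q) - g (p' + ?h *: q')" "g p - g p'"] by (simp add: algebra_simps)
  also have "...\<le>L * norm ((p + ?h *: q) - (p' + ?h *: q')) + L * norm (p - p')"
   by (intro add_mono lip)
  also have "...\<le>L * (norm (p - p') + norm (q - q')) + L * (norm (p - p') + norm (q - q'))"
  proof (intro add_mono mult_left_mono L)
   have "(p + ?h *: q) - (p' + ?h *: q') = (p - p') + ?h *: (q - q')" by (simp add: algebra_simps)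
   hence "norm ((p + ?h *: q) - (p' + ?h *: q'))\<le>norm (p - p') + norm (?h *: (q - q'))"
    using norm_triangle_ineq by metis
   also have "norm (?h *: (q - q'))\<le>1 * norm (q - q')"
    unfolding norm_scaleR by (intro mult_right_mono) (auto simp: inverse_le_1_iff)
   finally show "norm ((p + ?h *: q) - (p' + ?h *: q'))\<le>norm (p - p') + norm (q - q')" by simp
  qed simp
  also have "... = 2 * L * (norm (p - p') + norm (q - q'))" by simp
  finally have m: "norm ((g (p + ?h *: q) - g p) - (g (p' + ?h *: q') - g p'))\<le>2 * L * (norm (p - p') + norm (q - q'))" .
  have "norm (?k *: ((g (p + ?h *: q) - g p) - (g (p' + ?h *: q') - g p')))
    \<le>?k * (2 * L * (norm (p - p') + norm (q - q')))"
   unfolding norm_scaleR using m by (intro mult_mono) auto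
  thus "norm (inverse ?h *: (g (p + ?h *: q) - g p) - inverse ?h *: (g (p' + ?h *: q') - g p'))
   \<le>2 * ?k * L * (norm (p - p') + norm (q - q'))"
   unfolding e by (simp only: scaleR_diff_right[symmetric] mult.assoc mult.left_commute)
 qed (use L in simp)
 show "norm (inverse ?h *: (g (p + ?h *: q) - g p))\<le>L * norm q" for p q
 proof -
  have "norm (inverse ?h *: (g (p + ?h *: q) - g p))\<le>?k * (L * norm (?h *: q))"
   unfolding e norm_scaleR using lip[of "p + ?h *: q" p] by (intro mult_mono) auto
  also have "... = L * norm q" by simp
  finally show ?thesis .
 qed
next
 show "(%n. inverse (inverse (real (Suc n))) *: (g (p + inverse (real (Suc n)) *: q) - g p)) ----> gd p q" for p q
 proof -
  have "\<forall>n. 0 < inverse (real (Suc n))" by simp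
  thus ?thesis
   using assms[unfolded dirder_def, THEN spec[of _ p], THEN spec[of _ q], THEN spec[of _ "%n. inverse (real (Suc n))"]]
    LIMSEQ_inverse_real_of_nat by blast
 qed
qed

lemma dirder_nem1:
 assumes dd: "dirder g gd"
 shows "dirder (nem1 S g) (nem2 S gd)"
 unfolding dirder_def
proof (intro allI impI)
 fix a b :: "('d, 'b) lp2" and ta :: "nat=>real"
 assume pos: "\<forall>n. 0 < ta n" and lim: "ta ----> 0"
 have Ss: "S\<in>sets lebesgue" using S by (rule fmeasurableD)
 define f where "f n x = ind S x *: (inverse (ta n) *: (g (ap a x + ta n *: ap b x) - g (ap a x)))" for n x
 have "g\<in>borel_measurable borel"
 proof (rule borel_measurable_continuous_onI, rule lipschitz_on_continuous_on)
  show "L-lipschitz_on UNIV g" using L lip by (auto simp: lipschitz_on_def dist_norm)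
 qed
 hence gm [measurable]: "g\<in>borel_measurable borel" .
 have [measurable]: "S\<in>sets lebesgue" by (rule Ss)
 have fm: "f n\<in>meas" for n unfolding f_def[abs_def] by measurable
 have fb: "norm (f n x)\<le>norm (L *: ap b x)" for n x
 proof -
  have t: "0 < ta n" using pos by blast
  have "norm (inverse (ta n) *: (g (ap a x + ta n *: ap b x) - g (ap a x)))\<le>inverse (ta n) * (L * norm (ta n *: ap b x))"
   unfolding norm_scaleR using lip[of "ap a x + ta n *: ap b x" "ap a x"] t by (intro mult_mono) auto
  also have "... = norm (L *: ap b x)" using t L by simp
  finally show ?thesis by (simp add: f_def ind_def)
 qed
 have "(%n. mk (f n)) ----> mk (%x. ind S x *: gd (ap a x) (ap b x))"
 proof (rule lp2_dominated_convergence(2)[OF sq_int_scaleR[OF sq_int_ap[of b], where c=L] fm])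
  show "(%x. ind S x *: gd (ap a x) (ap b x))\<in>meas"
   by (rule nem2_measurable[OF Ss adm_dom2[OF dirder_adm[OF dd]]])
  show "AEL x. (%n. f n x) ----> ind S x *: gd (ap a x) (ap b x)"
   unfolding f_def using dd pos lim unfolding dirder_def by (intro AE_I2 tendsto_scaleR tendsto_const) blast
 qed (use fb in simp)
 moreover have "inverse (ta n) *: (nem1 S g (a + ta n *: b) - nem1 S g a) = mk (f n)" for n
 proof (rule lp2_eqI)
  have "sq_int (f n)" by (rule sq_int_bound[OF fm sq_int_scaleR[OF sq_int_ap[of b], where c=L], of _ 1]) (use fb in simp)
  from ap_mk[OF this]
  show "AEL x. ap (inverse (ta n) *: (nem1 S g (a + ta n *: b) - nem1 S g a)) x = ap (mk (f n)) x"
   using ap_scaleR[of "inverse (ta n)" "nem1 S g (a + ta n *: b) - nem1 S g a"]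
    ap_diff[of "nem1 S g (a + ta n *: b)" "nem1 S g a"] ap_nem1[of "a + ta n *: b"] ap_nem1[of a]
    ap_add[of a "ta n *: b"] ap_scaleR[of "ta n" b]
   by eventually_elim (simp add: f_def scaleR_diff_right mult.commute)
 qed
 ultimately show "(%n. inverse (ta n) *: (nem1 S g (a + ta n *: b) - nem1 S g a)) ----> nem2 S gd a b"
  unfolding nem2_def by simp
qed

end

lemma adm_multiplier:
 fixes \<theta> :: "real=>real"
 assumes M: "0\<le>M" and lip: "!!n::nat. \<exists>L\<ge>0. \<forall>p p'. \<bar>th n p - th n p'\<bar>\<le>L * \<bar>p - p'\<bar>"
  and le: "!!n p. \<bar>th n p\<bar>\<le>M" and lim: "!!p. (%n. th n p) ----> \<theta> p"
 shows "adm M (%p q. \<theta> p * q)"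
proof -
 define clip :: "nat=>real=>real" where "clip n q = max (- real n) (min (real n) q)" for n q
 have c1: "\<bar>clip n q - clip n q'\<bar>\<le>\<bar>q - q'\<bar>" and c2: "\<bar>clip n q\<bar>\<le>real n" and c3: "\<bar>clip n q\<bar>\<le>\<bar>q\<bar>" for n q q'
  by (auto simp: clip_def)
 have c4: "(%n. clip n q) ----> q" for q
 proof (rule tendsto_eventually)
  obtain N :: nat where N: "\<bar>q\<bar>\<le>real N" using real_arch_simple by blast
  show "\<forall>\<^sub>F n in sequentially. clip n q = q"
   using eventually_ge_at_top[of N]
  proof eventually_elim
   case (elim n)
   hence "\<bar>q\<bar>\<le>real n" using N by (meson of_nat_le_iff order_trans)
   thus ?case by (auto simp: clip_def)
  qed
 qed
 show ?thesis
  unfolding adm_def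
 proof (intro conjI M exI[of _ "%n p q. th n p * clip n q"] allI)
  fix n
  obtain L where L: "L\<ge>0" "!!p p'. \<bar>th n p - th n p'\<bar>\<le>L * \<bar>p - p'\<bar>" using lip by blast
  have "\<bar>th n p * clip n q - th n p' * clip n q'\<bar>\<le>(L * real n + M) * (\<bar>p - p'\<bar> + \<bar>q - q'\<bar>)" for p q p' q'
  proof -
   have "\<bar>th n p * clip n q - th n p' * clip n q'\<bar> = \<bar>(th n p - th n p') * clip n q + th n p' * (clip n q - clip n q')\<bar>"
    by (simp add: algebra_simps)
   also have "...\<le>\<bar>th n p - th n p'\<bar> * \<bar>clip n q\<bar> + \<bar>th n p'\<bar> * \<bar>clip n q - clip n q'\<bar>"
    by (metis abs_mult abs_triangle_ineq)
   also have "...\<le>(L * \<bar>p - p'\<bar>) * real n + M * \<bar>q - q'\<bar>"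
    using L c1 c2 le M by (intro add_mono mult_mono) auto
   also have "... = (L * real n) * \<bar>p - p'\<bar> + M * \<bar>q - q'\<bar>" by simp
   also have "...\<le>(L * real n + M) * \<bar>p - p'\<bar> + (L * real n + M) * \<bar>q - q'\<bar>"
    using L M by (intro add_mono mult_right_mono) auto
   finally show ?thesis by (simp add: distrib_left)
  qed
  thus "\<exists>L\<ge>0. \<forall>p q p' q'. norm (th n p * clip n q - th n p' * clip n q')\<le>L * (norm (p - p') + norm (q - q'))"
   using L M by (intro exI[of _ "L * real n + M"]) auto
  show "norm (th n p * clip n q)\<le>M * norm q" for p q
   unfolding real_norm_def abs_mult using le c3 M by (intro mult_mono) auto
 next
  show "(%n. th n p * clip n q) ----> \<theta> p * q" for p q by (intro tendsto_intros lim c4)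
 qed
qed

lemma tendsto_min_one:
 assumes "c > 0"
 shows "(%n. min 1 (real n * c)) ----> 1"
proof (rule tendsto_eventually)
 obtain N :: nat where N: "1 / c\<le>real N" using real_arch_simple by blast
 show "\<forall>\<^sub>F n in sequentially. min 1 (real n * c) = 1"
  using eventually_ge_at_top[of N]
 proof eventually_elim
  case (elim n)
  hence "1 / c\<le>real n" using N by (meson of_nat_le_iff order_trans)
  thus ?case using assms by (simp add: field_simps)
 qed
qed

lemma abs_min_one_diff: "\<bar>min 1 (real n * a) - min 1 (real n * b)\<bar>\<le>real n * \<bar>a - b\<bar>"
proof -
 have "\<bar>min 1 (real n * a) - min 1 (real n * b)\<bar>\<le>\<bar>real n * a - real n * b\<bar>" by auto
 also have "... = real n * \<bar>a - b\<bar>" by (simp add: right_diff_distrib[symmetric] abs_mult)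
 finally show ?thesis .
qed

lemma adm_pos: "adm 1 (%(p::real) (q::real). indicator {0<..} p * q)"
proof (rule adm_multiplier[where th="%n p. min 1 (real n * max 0 p)"])
 show "\<exists>L\<ge>0. \<forall>p p'. \<bar>min 1 (real n * max 0 p) - min 1 (real n * max 0 p')\<bar>\<le>L * \<bar>p - p'\<bar>" for n
 proof (intro exI[of _ "real n"] conjI allI)
  fix p p' :: real
  have "real n * \<bar>max 0 p - max 0 p'\<bar>\<le>real n * \<bar>p - p'\<bar>" by (intro mult_left_mono) auto
  thus "\<bar>min 1 (real n * max 0 p) - min 1 (real n * max 0 p')\<bar>\<le>real n * \<bar>p - p'\<bar>"
   using abs_min_one_diff order_trans by blast
 qed simp
 show "(%n. min 1 (real n * max 0 p)) ----> indicator {0<..} p" for p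
  using tendsto_min_one[of p] by (cases "p > 0") auto
qed auto

lemma adm_neg: "adm 1 (%(p::real) (q::real). ind {..<0} p * q)"
proof (rule adm_multiplier[where th="%n p. min 1 (real n * max 0 (- p))"])
 show "\<exists>L\<ge>0. \<forall>p p'. \<bar>min 1 (real n * max 0 (- p)) - min 1 (real n * max 0 (- p'))\<bar>\<le>L * \<bar>p - p'\<bar>" for n
 proof (intro exI[of _ "real n"] conjI allI)
  fix p p' :: real
  have "real n * \<bar>max 0 (- p) - max 0 (- p')\<bar>\<le>real n * \<bar>p - p'\<bar>" by (intro mult_left_mono) auto
  thus "\<bar>min 1 (real n * max 0 (- p)) - min 1 (real n * max 0 (- p'))\<bar>\<le>real n * \<bar>p - p'\<bar>"
   using abs_min_one_diff order_trans by blast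
 qed simp
 show "(%n. min 1 (real n * max 0 (- p))) ----> ind {..<0} p" for p
  using tendsto_min_one[of "- p"] by (cases "p < 0") auto
qed auto

lemma adm_point: "adm 1 (%(p::real) (q::real). ind {c} p * q)"
proof (rule adm_multiplier[where th="%n p. 1 - min 1 (real n * \<bar>p - c\<bar>)"])
 show "\<exists>L\<ge>0. \<forall>p p'. \<bar>(1 - min 1 (real n * \<bar>p - c\<bar>)) - (1 - min 1 (real n * \<bar>p' - c\<bar>))\<bar>\<le>L * \<bar>p - p'\<bar>" for n
 proof (intro exI[of _ "real n"] conjI allI)
  fix p p' :: real
  have "\<bar>(1 - min 1 (real n * \<bar>p - c\<bar>)) - (1 - min 1 (real n * \<bar>p' - c\<bar>))\<bar>
    = \<bar>min 1 (real n * \<bar>p - c\<bar>) - min 1 (real n * \<bar>p' - c\<bar>)\<bar>" by linarith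
  also have "...\<le>real n * \<bar>\<bar>p - c\<bar> - \<bar>p' - c\<bar>\<bar>" by (rule abs_min_one_diff)
  also have "...\<le>real n * \<bar>p - p'\<bar>" by (intro mult_left_mono) auto
  finally show "\<bar>(1 - min 1 (real n * \<bar>p - c\<bar>)) - (1 - min 1 (real n * \<bar>p' - c\<bar>))\<bar>\<le>real n * \<bar>p - p'\<bar>" .
 qed simp
 show "(%n. 1 - min 1 (real n * \<bar>p - c\<bar>)) ----> ind {c} p" for p
 proof (cases "p = c")
  case False
  hence "(%n. 1 - min 1 (real n * \<bar>p - c\<bar>)) ----> 1 - 1" by (intro tendsto_diff tendsto_const tendsto_min_one) auto
  thus ?thesis using False by simp
 qed simp
 have "0\<le>real n * \<bar>p - c\<bar>" for n p by simp
 thus "\<bar>1 - min 1 (real n * \<bar>p - c\<bar>)\<bar>\<le>1" for n p by (auto simp: min_def abs_if)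
qed auto

lemma adm_deriv:
 fixes f :: "real=>real"
 assumes L: "0\<le>L" and lip: "!!p q. \<bar>f p - f q\<bar>\<le>L * \<bar>p - q\<bar>" and diff: "!!v. v\<noteq>c ==> f differentiable (at v)"
 shows "adm L (%p q. (if p = c then 0 else deriv f p) * q)"
proof -
 define d where "d n p = real (Suc n) * (f (p + inverse (real (Suc n))) - f p)" for n p
 have dL: "\<bar>d n p\<bar>\<le>L" for n p
 proof -
  have "\<bar>d n p\<bar>\<le>real (Suc n) * (L * \<bar>inverse (real (Suc n))\<bar>)"
   unfolding d_def abs_mult using lip[of "p + inverse (real (Suc n))" p] by (intro mult_mono) auto
  also have "... = L" by (simp add: field_simps)
  finally show ?thesis .
 qed
 have dlip: "\<bar>d n p - d n p'\<bar>\<le>(real (Suc n) * (2 * L)) * \<bar>p - p'\<bar>" for n p p'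
 proof -
  let ?h = "inverse (real (Suc n))"
  have "\<bar>d n p - d n p'\<bar> = real (Suc n) * \<bar>(f (p + ?h) - f (p' + ?h)) - (f p - f p')\<bar>"
   unfolding d_def by (simp only: right_diff_distrib[symmetric] abs_mult abs_of_nat) (simp add: algebra_simps)
  also have "...\<le>real (Suc n) * (L * \<bar>p - p'\<bar> + L * \<bar>p - p'\<bar>)"
   using lip[of "p + ?h" "p' + ?h"] lip[of p p'] by (intro mult_left_mono) auto
  finally show ?thesis by (simp add: algebra_simps)
 qed
 have dlim: "(%n. d n p) ----> deriv f p" if "p\<noteq>c" for p
 proof -
  have "(f has_real_derivative deriv f p) (at p)"
   using diff[OF that] by (simp add: DERIV_deriv_iff_real_differentiable)
  hence "((%h. (f (p + h) - f p) / h) \<longlongrightarrow> deriv f p) (at 0)" by (simp add: DERIV_def)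
  moreover have "filterlim (%n. inverse (real (Suc n))) (at 0) sequentially"
   using LIMSEQ_inverse_real_of_nat by (simp add: filterlim_at)
  ultimately have "(%n. (f (p + inverse (real (Suc n))) - f p) / inverse (real (Suc n))) ----> deriv f p"
   by (rule filterlim_compose)
  thus ?thesis by (simp add: d_def divide_inverse mult.commute)
 qed
 show ?thesis
 proof (rule adm_multiplier[where th="%n p. d n p * min 1 (real n * \<bar>p - c\<bar>)", OF L])
  fix n
  show "\<exists>K\<ge>0. \<forall>p p'. \<bar>d n p * min 1 (real n * \<bar>p - c\<bar>) - d n p' * min 1 (real n * \<bar>p' - c\<bar>)\<bar>\<le>K * \<bar>p - p'\<bar>"
  proof (intro exI[of _ "real (Suc n) * (2 * L) + L * real n"] conjI allI)
   fix p p' :: real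
   define m m' where "m = min 1 (real n * \<bar>p - c\<bar>)" and "m' = min 1 (real n * \<bar>p' - c\<bar>)"
   have "0\<le>real n * \<bar>p - c\<bar>" by simp
   hence m: "0\<le>m" "m\<le>1" by (auto simp: m_def)
   have mm: "\<bar>m - m'\<bar>\<le>real n * \<bar>p - p'\<bar>"
   proof -
    have "\<bar>m - m'\<bar>\<le>real n * \<bar>\<bar>p - c\<bar> - \<bar>p' - c\<bar>\<bar>" unfolding m_def m'_def by (rule abs_min_one_diff)
    also have "...\<le>real n * \<bar>p - p'\<bar>" by (intro mult_left_mono) auto
    finally show ?thesis .
   qed
   have "\<bar>d n p * m - d n p' * m'\<bar> = \<bar>(d n p - d n p') * m + d n p' * (m - m')\<bar>" by (simp add: algebra_simps)
   also have "...\<le>\<bar>d n p - d n p'\<bar> * \<bar>m\<bar> + \<bar>d n p'\<bar> * \<bar>m - m'\<bar>" by (metis abs_mult abs_triangle_ineq)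
   also have "...\<le>((real (Suc n) * (2 * L)) * \<bar>p - p'\<bar>) * 1 + L * (real n * \<bar>p - p'\<bar>)"
    using dlip[of n p p'] dL[of n p'] mm m L by (intro add_mono mult_mono) auto
   finally show "\<bar>d n p * min 1 (real n * \<bar>p - c\<bar>) - d n p' * min 1 (real n * \<bar>p' - c\<bar>)\<bar>
     \<le>(real (Suc n) * (2 * L) + L * real n) * \<bar>p - p'\<bar>"
    unfolding m_def m'_def by (simp add: algebra_simps)
  qed (use L in simp)
  fix p
  have "0\<le>real n * \<bar>p - c\<bar>" by simp
  hence "\<bar>d n p\<bar> * \<bar>min 1 (real n * \<bar>p - c\<bar>)\<bar>\<le>L * 1" using dL[of n p] L by (intro mult_mono) auto
  thus "\<bar>d n p * min 1 (real n * \<bar>p - c\<bar>)\<bar>\<le>L" by (simp add: abs_mult)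
 next
  show "(%n. d n p * min 1 (real n * \<bar>p - c\<bar>)) ----> (if p = c then 0 else deriv f p)" for p
  proof (cases "p = c")
   case False
   hence "(%n. d n p * min 1 (real n * \<bar>p - c\<bar>)) ----> deriv f p * 1"
    by (intro tendsto_mult dlim tendsto_min_one) auto
   thus ?thesis using False by simp
  qed simp
 qed
qed

instance lp2 :: (euclidean_space, hilb) banach ..
instance lp2 :: (euclidean_space, hilb) hilb ..

type_synonym 'a tl2 = "(real, ('a, real) lp2) lp2"

lemma nem2_comp:
 fixes G1 :: "'b::hilb=>'e::hilb=>'f::hilb"
  and G2 :: "'b=>'c::hilb=>'e"
 assumes S: "S\<in>sets lebesgue" and G1: "dom2 C1 G1" and G2: "dom2 C2 G2"
 shows "nem2 S G1 a (nem2 S G2 a b) = nem2 S (%p q. G1 p (G2 p q)) a b"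
proof -
 have d: "dom2 (C1 * C2) (%p q. G1 p (G2 p q))"
  unfolding dom2_def
 proof (intro conjI allI)
  show "0\<le>C1 * C2" using dom2D(1)[OF G1] dom2D(1)[OF G2] by simp
  show "(%z. G1 (fst z) (G2 (fst z) (snd z)))\<in>borel_measurable borel"
   by (rule dom2_comp[OF G1 _ dom2D(2)[OF G2]]) (simp add: borel_measurable_continuous_onI continuous_on_fst)
  fix p q
  have "norm (G1 p (G2 p q))\<le>C1 * norm (G2 p q)" by (rule dom2D(3)[OF G1])
  also have "...\<le>C1 * (C2 * norm q)" by (intro mult_left_mono dom2D(3)[OF G2] dom2D(1)[OF G1])
  finally show "norm (G1 p (G2 p q))\<le>C1 * C2 * norm q" by simp
 qed
 show ?thesis
  by (rule lp2_eqI) (use ap_nem2[OF S G1, of a "nem2 S G2 a b"] ap_nem2[OF S G2, of a b] ap_nem2[OF S d, of a b]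
    in eventually_elim, simp add: ind_def)
qed

lemma nem2_plus:
 assumes S: "S\<in>sets lebesgue" and G1: "dom2 C1 G1" and G2: "dom2 C2 G2"
 shows "nem2 S G1 a b + nem2 S G2 a b = nem2 S (%p q. G1 p q + G2 p q) a b"
proof -
 have d: "dom2 (C1 + C2) (%p q. G1 p q + G2 p q)"
  unfolding dom2_def
 proof (intro conjI allI)
  show "0\<le>C1 + C2" using dom2D(1)[OF G1] dom2D(1)[OF G2] by simp
  show "(%z. G1 (fst z) (snd z) + G2 (fst z) (snd z))\<in>borel_measurable borel"
   by (intro borel_measurable_add dom2D(2)[OF G1] dom2D(2)[OF G2])
  show "norm (G1 p q + G2 p q)\<le>(C1 + C2) * norm q" for p q
   using norm_triangle_ineq[of "G1 p q" "G2 p q"] dom2D(3)[OF G1, of p q] dom2D(3)[OF G2, of p q]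
   by (simp add: distrib_right)
 qed
 show ?thesis
  by (rule lp2_eqI) (use ap_nem2[OF S G1, of a b] ap_nem2[OF S G2, of a b] ap_nem2[OF S d, of a b]
    ap_add[of "nem2 S G1 a b" "nem2 S G2 a b"] in eventually_elim, simp add: scaleR_add_right)
qed

lemma nem2_norm_mono:
 assumes S: "S\<in>sets lebesgue" and G1: "dom2 C1 G1" and G2: "dom2 C2 G2" and C: "0\<le>C"
  and le: "!!p q. norm (G1 p q)\<le>C * norm (G2 p q)"
 shows "AEL x. norm (ap (nem2 S G1 a b) x)\<le>ind S x * (C * norm (ap (nem2 S G2 a b) x))"
  and "norm (nem2 S G1 a b)\<le>C * norm (nem2 S G2 a b)"
proof -
 show "AEL x. norm (ap (nem2 S G1 a b) x)\<le>ind S x * (C * norm (ap (nem2 S G2 a b) x))"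
  using ap_nem2[OF S G1, of a b] ap_nem2[OF S G2, of a b] by eventually_elim (use le C in \<open>simp add: ind_def\<close>)
 thus "norm (nem2 S G1 a b)\<le>C * norm (nem2 S G2 a b)"
 proof (intro norm_ap_le[OF C], elim eventually_mono)
  fix x assume "norm (ap (nem2 S G1 a b) x)\<le>ind S x * (C * norm (ap (nem2 S G2 a b) x))"
  also have "...\<le>1 * (C * norm (ap (nem2 S G2 a b) x))"
   using C by (intro mult_right_mono) (auto simp: ind_def)
  finally show "norm (ap (nem2 S G1 a b) x)\<le>C * norm (ap (nem2 S G2 a b) x)" by simp
 qed
qed

lemma nem2_zero_right:
 assumes S: "S\<in>sets lebesgue" and G: "dom2 C G"
 shows "nem2 S G a 0 = 0"
 using norm_nem2_le[OF S G, of a 0] by simp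

definition maxd :: "real=>real=>real"
 where "maxd p q = (if p > 0 then q else if p < 0 then 0 else max q 0)"

lemma max_lipschitz: "norm (max p 0 - max q 0 :: real)\<le>1 * norm (p - q)"
 by auto

lemma dirder_max: "dirder (%p::real. max p 0) maxd"
 unfolding dirder_def
proof (intro allI impI)
 fix p q :: real and ta :: "nat=>real"
 assume pos: "\<forall>n. 0 < ta n" and lim: "ta ----> 0"
 have l: "(%n. p + ta n * q) ----> p + 0 * q" by (intro tendsto_intros lim)
 have "\<forall>\<^sub>F n in sequentially. inverse (ta n) *: (max (p + ta n *: q) 0 - max p 0) = maxd p q"
 proof -
  consider "p > 0" | "p < 0" | "p = 0" by linarith
  thus ?thesis
  proof cases
   case 1
   hence "\<forall>\<^sub>F n in sequentially. 0 < p + ta n * q" using l by (intro order_tendstoD) auto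
   thus ?thesis
   proof eventually_elim
    case (elim n)
    hence "max (p + ta n *: q) 0 - max p 0 = ta n * q" using 1 by simp
    thus ?case using 1 pos[rule_format, of n] by (simp add: maxd_def)
   qed
  next
   case 2
   hence "\<forall>\<^sub>F n in sequentially. p + ta n * q < 0" using l by (intro order_tendstoD) auto
   thus ?thesis by eventually_elim (use 2 in \<open>simp add: maxd_def\<close>)
  next
   case 3
   have "max (ta n * q) 0 = ta n * max q 0" for n
    using pos[rule_format, of n] by (auto simp: max_def mult_le_0_iff zero_le_mult_iff)
   thus ?thesis using 3 pos by (intro always_eventually allI) (simp add: maxd_def less_imp_neq[THEN not_sym])
  qed
 qed
 thus "(%n. inverse (ta n) *: (max (p + ta n *: q) 0 - max p 0)) ----> maxd p q"
  by (rule tendsto_eventually)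
qed

lemma ex_adjoint:
 fixes A :: "'a::{real_inner,complete_space}=>'b::real_inner"
 assumes A: "bounded_linear A"
 shows "\<exists>B. \<forall>u v. inner (A u) v = inner u (B v)"
proof -
 have "\<exists>g. \<forall>u. inner (A u) v = inner g u" for v
  by (rule riesz_representation) (rule bounded_linear_compose[OF bounded_linear_inner_left A])
 then obtain B where "!!v u. inner (A u) v = inner (B v) u" by metis
 thus ?thesis by (intro exI[of _ B]) (simp add: inner_commute)
qed

lemma nprim_add_le: "nprim (U + V) t\<le>nprim U t + nprim V t"
proof -
 have i: "integrable lebesgue (%s. ind {0<..<t} s * norm (ap W s))" for W :: "(real, 'a) lp2"
  by (rule integrable_indicator_norm) simp
 have "nprim (U + V) t\<le>(LL s. ind {0<..<t} s * norm (ap U s) + ind {0<..<t} s * norm (ap V s))"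
  unfolding nprim_def
 proof (rule integral_mono_AE)
  show "AEL s. ind {0<..<t} s * norm (ap (U + V) s)
    \<le>ind {0<..<t} s * norm (ap U s) + ind {0<..<t} s * norm (ap V s)"
   using ap_add[of U V] by eventually_elim (simp add: ind_def norm_triangle_ineq)
 qed (use i in auto)
 thus ?thesis by (simp add: nprim_def i)
qed

lemma nprim_scaleR: "nprim (c *: U) t = \<bar>c\<bar> * nprim U t"
proof -
 have "nprim (c *: U) t = (LL s. \<bar>c\<bar> * (ind {0<..<t} s * norm (ap U s)))"
  unfolding nprim_def
  by (rule integral_cong_AE) (simp, simp, use ap_scaleR[of c U] in eventually_elim, simp)
 thus ?thesis by (simp add: nprim_def)
qed

lemma nprim_mono_AE:
 assumes "AEL s. s\<in>{0<..<t} --> norm (ap U s)\<le>c * norm (ap V s)"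
 shows "nprim U t\<le>c * nprim V t"
proof -
 have i: "integrable lebesgue (%s. ind {0<..<t} s * norm (ap W s))" for W :: "(real, 'c::hilb) lp2"
  by (rule integrable_indicator_norm) simp
 have "nprim U t\<le>(LL s. c * (ind {0<..<t} s * norm (ap V s)))"
  unfolding nprim_def
 proof (rule integral_mono_AE)
  show "AEL s. ind {0<..<t} s * norm (ap U s)\<le>c * (ind {0<..<t} s * norm (ap V s))"
   using assms by eventually_elim (simp add: ind_def)
  show "integrable lebesgue (%s. ind {0<..<t} s * norm (ap U s))" by (rule integrable_indicator_norm) simp
  show "integrable lebesgue (%s. c * (ind {0<..<t} s * norm (ap V s)))"
   by (intro integrable_mult_right integrable_indicator_norm) simp
 qed
 thus ?thesis by (simp add: nprim_def)
qed

lemma inner_le_Linf_L1: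
 assumes C: "0\<le>C" and c: "0\<le>c"
  and lam: "AEL t. t\<in>{0<..<T} --> norm (ap lam t)\<le>C"
  and V: "AEL t. norm (ap V t)\<le>ind {0<..<T} t * (c * norm (ap W t))"
 shows "\<bar>inner lam V\<bar>\<le>C * c * nprim W T"
proof -
 have "\<bar>inner lam V\<bar>\<le>(LL t. \<bar>inner (ap lam t) (ap V t)\<bar>)"
  unfolding inner_lp2_def using integral_norm_bound[of lebesgue "%t. inner (ap lam t) (ap V t)"] by simp
 also have "...\<le>(LL t. C * c * (ind {0<..<T} t * norm (ap W t)))"
 proof (rule integral_mono_AE)
  show "integrable lebesgue (%t. \<bar>inner (ap lam t) (ap V t)\<bar>)"
   by (intro integrable_abs integrable_inner_sq) simp_all
  show "integrable lebesgue (%t. C * c * (ind {0<..<T} t * norm (ap W t)))"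
   by (intro integrable_mult_right integrable_indicator_norm) simp
  show "AEL t. \<bar>inner (ap lam t) (ap V t)\<bar>\<le>C * c * (ind {0<..<T} t * norm (ap W t))"
   using lam V
  proof eventually_elim
   case (elim t)
   have "\<bar>inner (ap lam t) (ap V t)\<bar>\<le>norm (ap lam t) * norm (ap V t)" by (rule Cauchy_Schwarz_ineq2)
   also have "...\<le>C * c * (ind {0<..<T} t * norm (ap W t))"
   proof (cases "t\<in>{0<..<T}")
    case True
    hence "norm (ap lam t) * norm (ap V t)\<le>C * (c * norm (ap W t))"
     using elim C by (intro mult_mono) auto
    thus ?thesis using True by simp
   qed (use elim in simp)
   finally show ?case .
  qed
 qed
 finally show ?thesis by (simp add: nprim_def)
qed

section \<open>The state equation and the first-order conditions in \<open>L^2(0,T;L^2)\<close>\<close>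

locale state_problem =
 fixes T be ep Lf LH :: real and Om :: "'d::euclidean_space set" and f :: "real=>real"
  and KE :: "('d, real) lp2=>('d, real) lp2"
  and Hc :: "(real, ('d, real) lp2) lp2=>(real, ('d, real) lp2) lp2"
 assumes T: "T > 0" and be: "be > 0" and ep: "ep > 0" and Lf: "Lf\<ge>0" and LH: "LH\<ge>0"
  and Om: "Om\<in>lmeasurable"
  and f_lip: "!!p q. \<bar>f p - f q\<bar>\<le>Lf * \<bar>p - q\<bar>"
  and KE: "bounded_linear KE"
  and Hc_lip: "!!U V. AEL t. norm (ap (Hc U - Hc V) t)\<le>ind {0<..<T} t * (LH * nprim (U - V) t)"
begin

abbreviation "I0 \<equiv> {0<..<T}"
abbreviation "N1 g \<equiv> nem1 I0 (nem1 Om g)"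
abbreviation "N2 G \<equiv> nem2 I0 (nem2 Om G)"

definition K :: "(real, ('d, real) lp2) lp2=>(real, ('d, real) lp2) lp2" where "K = ptw KE"

definition force :: "(real, ('d, real) lp2) lp2=>(real, ('d, real) lp2) lp2=>(real, ('d, real) lp2) lp2"
 where "force l Q = (- be) *: (Q - K (be *: Q + l)) - N1 f (Hc Q)"

definition step :: "(real, ('d, real) lp2) lp2=>(real, ('d, real) lp2) lp2=>(real, ('d, real) lp2) lp2"
 where "step l Q = (1 / ep) *: intop T (N1 (%p. max p 0) (force l Q))"

lemma I0: "I0\<in>lmeasurable" "I0\<in>sets lebesgue" and Oms: "Om\<in>sets lebesgue"
 using Om by (auto simp: fmeasurableD)

lemma K_linear: "bounded_linear K"
 unfolding K_def by (rule bounded_linear_ptw[OF KE])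

lemma lip1_E: "0\<le>L ==> (!!p q. norm (g p - g q)\<le>L * norm (p - q)) ==> norm (nem1 Om g a - nem1 Om g b)\<le>L * norm (a - b)"
 by (rule norm_nem1_diff[OF Om])

lemma ap_N1_diff:
 assumes "0\<le>L" "!!p q. norm (g p - g q :: real)\<le>L * norm (p - q :: real)"
 shows "AEL t. norm (ap (N1 g U - N1 g V) t)\<le>L * norm (ap (U - V) t)"
 using ap_diff[of "N1 g U" "N1 g V"] ap_nem1[OF I0(1) assms(1) lip1_E[OF assms], of U]
  ap_nem1[OF I0(1) assms(1) lip1_E[OF assms], of V] ap_diff[of U V]
proof eventually_elim
 case (elim t)
 show ?case using lip1_E[OF assms, of "ap U t" "ap V t"] assms(1) by (simp add: elim ind_def)
qed

lemma norm_N1_diff: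
 assumes "0\<le>L" "!!p q. norm (g p - g q :: real)\<le>L * norm (p - q :: real)"
 shows "norm (N1 g U - N1 g V)\<le>L * norm (U - V)"
 by (rule norm_ap_le[OF assms(1) ap_N1_diff[OF assms]])

lemma dirder_N1:
 assumes "0\<le>L" "!!p q. norm (g p - g q :: real)\<le>L * norm (p - q :: real)" "dirder g gd"
 shows "dirder (N1 g) (N2 gd)"
 by (rule dirder_nem1[OF I0(1) assms(1) lip1_E[OF assms(1,2)] dirder_nem1[OF Om assms]])

lemma dom2_E: "adm C G ==> dom2 C (nem2 Om G)"
 by (rule adm_dom2[OF adm_nem2[OF Oms]])

definition wnorm :: "real=>(real, ('d, real) lp2) lp2=>real" where "wnorm k U = norm (mulop (expw T k) U)"

lemma expw_abs: "k > 0 ==> \<bar>expw T k t\<bar>\<le>1"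
 using expw_bounds(2,3)[OF T, of k t] by auto

lemma wnorm_mono:
 assumes k: "k > 0" and C: "0\<le>C" and le: "AEL t. norm (ap U t)\<le>C * norm (ap V t)"
 shows "wnorm k U\<le>C * wnorm k V"
 unfolding wnorm_def
proof (rule norm_ap_le[OF C])
 show "AEL t. norm (ap (mulop (expw T k) U) t)\<le>C * norm (ap (mulop (expw T k) V) t)"
  using le ap_mulop[OF expw_measurable expw_abs[OF k], of U] ap_mulop[OF expw_measurable expw_abs[OF k], of V]
 proof eventually_elim
  case (elim t)
  have "0 < expw T k t" by (rule expw_bounds(3)[OF T])
  thus ?case using elim by (simp add: mult.left_commute)
 qed
qed

lemma wnorm_linear: "k > 0 ==> bounded_linear (mulop (expw T k) :: (real, ('d, real) lp2) lp2=>_)"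
 by (rule bounded_linear_mulop[OF expw_measurable expw_abs])

lemma wnorm_add: "k > 0 ==> wnorm k (U + V)\<le>wnorm k U + wnorm k V"
 unfolding wnorm_def linear_add[OF bounded_linear.linear[OF wnorm_linear]] by (rule norm_triangle_ineq)

lemma wnorm_scaleR: "k > 0 ==> wnorm k (c *: U) = \<bar>c\<bar> * wnorm k U"
 unfolding wnorm_def linear_scale[OF bounded_linear.linear[OF wnorm_linear]] by simp

lemma wnorm_minus: "k > 0 ==> wnorm k (U - V)\<le>wnorm k U + wnorm k V"
 using wnorm_add[of k U "(-1) *: V"] wnorm_scaleR[of k "-1" V] by simp

lemma wnorm_le: "k > 0 ==> wnorm k U\<le>norm U"
 unfolding wnorm_def using norm_mulop_le[OF expw_measurable expw_abs, of k U] by simp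

definition expv :: "real=>real=>real" where "expv k t = inverse (expw T k t)"

lemma expv: "expv k\<in>meas" "k > 0 ==> \<bar>expv k t\<bar>\<le>exp (k * T)"
 "expv k t * expw T k t = 1"
proof -
 show "expv k\<in>meas" unfolding expv_def[abs_def] by (intro borel_measurable_inverse expw_measurable)
 have p: "0 < expw T k t" by (rule expw_bounds(3)[OF T])
 thus "expv k t * expw T k t = 1" by (simp add: expv_def)
 assume "k > 0"
 hence "inverse (expw T k t)\<le>inverse (exp (- k * T))"
  using expw_bounds(1)[OF T, of k t] by (intro le_imp_inverse_le) auto
 thus "\<bar>expv k t\<bar>\<le>exp (k * T)" using p by (simp add: expv_def exp_minus)
qed

lemma mulop_inverse:
 assumes k: "k > 0"
 shows "mulop (expv k) (mulop (expw T k) U) = U" "mulop (expw T k) (mulop (expv k) U) = U"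
proof -
 note v = ap_mulop[OF expv(1) expv(2)[OF k]] and w = ap_mulop[OF expw_measurable expw_abs[OF k]]
 show "mulop (expv k) (mulop (expw T k) U) = U"
  by (rule lp2_eqI) (use v[of "mulop (expw T k) U"] w[of U] in eventually_elim, simp add: expv(3))
 show "mulop (expw T k) (mulop (expv k) U) = U"
 proof (rule lp2_eqI)
  have "expw T k t * expv k t = 1" for t using expv(3)[of k t] by (simp only: mult.commute)
  thus "AEL t. ap (mulop (expw T k) (mulop (expv k) U)) t = ap U t"
   using w[of "mulop (expv k) U"] v[of U] by (auto elim!: eventually_elim2)
 qed
qed

lemma norm_le_wnorm: "k > 0 ==> norm U\<le>exp (k * T) * wnorm k U"
 using norm_mulop_le[OF expv(1) expv(2), of k "mulop (expw T k) U"] mulop_inverse(1)[of k U] by (simp add: wnorm_def)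

lemma ex_contraction: "\<exists>k>0. \<forall>l Q1 Q2. wnorm k (step l Q1 - step l Q2)\<le>1/2 * wnorm k (Q1 - Q2)"
proof -
 obtain \<kappa> where \<kappa>: "\<kappa> > 0" "!!e. norm (KE e)\<le>norm e * \<kappa>" using bounded_linear.pos_bounded[OF KE] by blast
 define A where "A = be + be^2 * \<kappa> + Lf * LH"
 have A: "A > 0" using be \<kappa> Lf LH by (simp add: A_def add_pos_nonneg)
 define s where "s = min 1 (ep / (2 * A))"
 have s: "0 < s" "s\<le>1" "s\<le>ep / (2 * A)" using ep A by (auto simp: s_def)
 define k where "k = T / (2 * s^2)"
 have k: "k > 0" using T s by (simp add: k_def)
 have "T / (2 * k) = s^2" using T s by (simp add: k_def field_simps)
 hence sk: "sqrt (T / (2 * k)) = s" using s by simp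
 have "wnorm k (step l Q1 - step l Q2)\<le>1/2 * wnorm k (Q1 - Q2)" for l Q1 Q2
 proof -
  define n where "n = wnorm k (Q1 - Q2)"
  have n0: "n\<ge>0" by (simp add: n_def wnorm_def)
  have nK: "wnorm k (K U)\<le>\<kappa> * wnorm k U" for U
   by (rule wnorm_mono[OF k]) (use \<kappa> ap_ptw[OF KE, of U] in \<open>auto simp: K_def mult.commute elim!: eventually_mono\<close>)
  have nH: "wnorm k (Hc Q1 - Hc Q2)\<le>LH * s * n"
   using weighted_bound[OF T k Hc_lip LH, of Q1 Q2] by (simp add: wnorm_def n_def sk)
  have fl: "norm (f p - f q)\<le>Lf * norm (p - q)" for p q using f_lip by simp
  have nF: "wnorm k (N1 f (Hc Q1) - N1 f (Hc Q2))\<le>Lf * (LH * s * n)"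
   using wnorm_mono[OF k Lf ap_N1_diff[OF Lf fl, of "Hc Q1" "Hc Q2"]] mult_left_mono[OF nH Lf] by linarith
  have d: "force l Q1 - force l Q2 = (- be) *: (Q1 - Q2) + ((be^2) *: K (Q1 - Q2) - (N1 f (Hc Q1) - N1 f (Hc Q2)))"
  proof -
   interpret K: bounded_linear K by (rule K_linear)
   show ?thesis by (simp add: force_def K.add K.scaleR K.diff algebra_simps power2_eq_square)
  qed
  have "wnorm k (force l Q1 - force l Q2)\<le>be * n + (be^2 * (\<kappa> * n) + Lf * (LH * s * n))"
  proof -
   have "wnorm k (force l Q1 - force l Q2)\<le>wnorm k ((- be) *: (Q1 - Q2))
     + (wnorm k ((be^2) *: K (Q1 - Q2)) + wnorm k (N1 f (Hc Q1) - N1 f (Hc Q2)))"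
    unfolding d by (rule order_trans[OF wnorm_add[OF k] add_left_mono[OF wnorm_minus[OF k]]])
   also have "wnorm k ((- be) *: (Q1 - Q2)) = be * n" using be unfolding wnorm_scaleR[OF k] n_def by simp
   also have "wnorm k ((be^2) *: K (Q1 - Q2))\<le>be^2 * (\<kappa> * n)"
    unfolding wnorm_scaleR[OF k] using nK[of "Q1 - Q2"] by (simp add: n_def mult_left_mono)
   finally show ?thesis using nF by linarith
  qed
  also have "...\<le>A * n"
  proof -
   have "Lf * (LH * s * n)\<le>Lf * (LH * 1 * n)"
    using s Lf LH n0 by (intro mult_left_mono mult_right_mono) auto
   thus ?thesis by (simp add: A_def algebra_simps)
  qed
  finally have nf: "wnorm k (force l Q1 - force l Q2)\<le>A * n" .
  have nM: "wnorm k (N1 (%p. max p 0) (force l Q1) - N1 (%p. max p 0) (force l Q2))\<le>A * n"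
   using wnorm_mono[OF k zero_le_one ap_N1_diff[OF zero_le_one max_lipschitz, of "force l Q1" "force l Q2"]] nf by linarith
  interpret D: bounded_linear "intop T :: (real, ('d, real) lp2) lp2=>_" by (rule bounded_linear_intop[OF T])
  have "wnorm k (step l Q1 - step l Q2) = (1 / ep) * wnorm k (intop T (N1 (%p. max p 0) (force l Q1) - N1 (%p. max p 0) (force l Q2)))"
   using ep by (simp only: step_def scaleR_diff_right[symmetric] D.diff[symmetric] wnorm_scaleR[OF k]) simp
  also have "...\<le>(1 / ep) * (s * (A * n))"
   using weighted_intop[OF T k, of "N1 (%p. max p 0) (force l Q1) - N1 (%p. max p 0) (force l Q2)"] nM s ep
   unfolding wnorm_def[symmetric] sk
   by (intro mult_left_mono) (auto intro: order_trans mult_left_mono)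
  also have "... = (s * A / ep) * n" by simp
  also have "s * A / ep\<le>1/2" using s(3) A ep by (simp add: field_simps)
  hence "(s * A / ep) * n\<le>1/2 * n" using n0 by (rule mult_right_mono)
  finally show ?thesis by (simp add: n_def)
 qed
 thus ?thesis using k by blast
qed

lemma ex_state: "\<exists>Q. step l Q = Q"
proof -
 obtain k where k: "k > 0" and c: "!!Q1 Q2. wnorm k (step l Q1 - step l Q2)\<le>1/2 * wnorm k (Q1 - Q2)"
  using ex_contraction by blast
 define F where "F U = mulop (expw T k) (step l (mulop (expv k) U))" for U
 have "\<exists>!U. F U = U"
 proof (rule banach_fix_type[of "1/2"])
  show "\<forall>U V. dist (F U) (F V)\<le>1/2 * dist U V"
  proof (intro allI)
   fix U V
   note L = bounded_linear.linear[OF wnorm_linear[OF k]]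
   have "dist (F U) (F V) = wnorm k (step l (mulop (expv k) U) - step l (mulop (expv k) V))"
    by (simp add: F_def dist_norm wnorm_def linear_diff[OF L])
   also have "...\<le>1/2 * wnorm k (mulop (expv k) U - mulop (expv k) V)" by (rule c)
   also have "wnorm k (mulop (expv k) U - mulop (expv k) V) = dist U V"
    by (simp add: wnorm_def dist_norm linear_diff[OF L] mulop_inverse(2)[OF k])
   finally show "dist (F U) (F V)\<le>1/2 * dist U V" .
  qed
 qed auto
 then obtain U where "F U = U" by blast
 hence "mulop (expv k) (F U) = mulop (expv k) U" by simp
 hence "step l (mulop (expv k) U) = mulop (expv k) U" by (simp add: F_def mulop_inverse(1)[OF k])
 thus ?thesis by blast
qed

lemma ex_stability: "\<exists>C\<ge>0. \<forall>l Q Q'. step l Q = Q --> norm (Q - Q')\<le>C * norm (Q' - step l Q')"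
proof -
 obtain k where k: "k > 0" and c: "!!l Q1 Q2. wnorm k (step l Q1 - step l Q2)\<le>1/2 * wnorm k (Q1 - Q2)"
  using ex_contraction by blast
 have "norm (Q - Q')\<le>(exp (k * T) * 2) * norm (Q' - step l Q')" if "step l Q = Q" for l Q Q'
 proof -
  have "wnorm k (Q - Q') = wnorm k ((step l Q - step l Q') - (Q' - step l Q'))" using that by simp
  also have "...\<le>wnorm k (step l Q - step l Q') + wnorm k (Q' - step l Q')" by (rule wnorm_minus[OF k])
  also have "...\<le>1/2 * wnorm k (Q - Q') + norm (Q' - step l Q')"
   using c[of l Q Q'] wnorm_le[OF k] by (intro add_mono)
  finally have "wnorm k (Q - Q')\<le>2 * norm (Q' - step l Q')" by simp
  hence "exp (k * T) * wnorm k (Q - Q')\<le>exp (k * T) * (2 * norm (Q' - step l Q'))"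
   by (intro mult_left_mono) auto
  hence "norm (Q - Q')\<le>exp (k * T) * (2 * norm (Q' - step l Q'))"
   by (rule order_trans[OF norm_le_wnorm[OF k]])
  thus ?thesis by (simp only: mult.assoc)
 qed
 thus ?thesis by (intro exI[of _ "exp (k * T) * 2"]) auto
qed

lemma state_unique: "step l Q = Q ==> step l Q' = Q' ==> Q = Q'"
proof -
 assume Q: "step l Q = Q" "step l Q' = Q'"
 obtain C where "!!l Q Q'. step l Q = Q ==> norm (Q - Q')\<le>C * norm (Q' - step l Q')"
  using ex_stability by blast
 from this[OF Q(1), of Q'] Q(2) show "Q = Q'" by simp
qed

end

locale linearized_problem = state_problem +
 fixes fd :: "real=>real=>real" and dHc :: "'a tl2=>'a tl2"
  and Qb lb :: "'a tl2"
 assumes fd: "dirder f fd" and dHc: "bounded_linear dHc"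
  and dHc_lim: "!!h ta. (\<forall>n::nat. 0 < ta n) ==> ta ----> 0 ==>
    (%n. inverse (ta n) *: (Hc (Qb + ta n *: h) - Hc Qb)) ----> dHc h"
  and Qb: "step lb Qb = Qb"
begin

definition "zb = force lb Qb"
definition "dmax u = N2 maxd zb u"
definition "dq u = (1 / ep) *: intop T (dmax u)"
definition "df h = N2 fd (Hc Qb) h"
definition "dv u = u + be *: dq u + df (dHc (dq u))"

lemma fl: "norm (f p - f q)\<le>Lf * norm (p - q)" using f_lip by simp

lemma dmax_lim:
 assumes "\<forall>n. 0 < ta n" "ta ----> 0"
 shows "(%n. inverse (ta n) *: (N1 (%p. max p 0) (zb + ta n *: u) - N1 (%p. max p 0) zb)) ----> dmax u"
 using dirder_N1[OF zero_le_one max_lipschitz dirder_max] assms unfolding dirder_def dmax_def by blast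

lemma df_lim:
 assumes "\<forall>n. 0 < ta n" "ta ----> 0"
 shows "(%n. inverse (ta n) *: (N1 f (Hc (Qb + ta n *: h)) - N1 f (Hc Qb))) ----> df (dHc h)"
proof -
 have 1: "(%n. inverse (ta n) *: (N1 f (Hc Qb + ta n *: dHc h) - N1 f (Hc Qb))) ----> df (dHc h)"
  using dirder_N1[OF Lf fl fd] assms unfolding dirder_def df_def by blast
 have 2: "(%n. inverse (ta n) *: (N1 f (Hc (Qb + ta n *: h)) - N1 f (Hc Qb + ta n *: dHc h))) ----> 0"
 proof (rule Lim_null_comparison)
  have "(%n. Lf * norm (inverse (ta n) *: (Hc (Qb + ta n *: h) - Hc Qb) - dHc h)) ----> Lf * norm (dHc h - dHc h)"
   by (intro tendsto_intros dHc_lim assms)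
  thus "(%n. Lf * norm (inverse (ta n) *: (Hc (Qb + ta n *: h) - Hc Qb) - dHc h)) ----> 0" by simp
  have "norm (inverse (ta n) *: (N1 f (Hc (Qb + ta n *: h)) - N1 f (Hc Qb + ta n *: dHc h)))
    \<le>Lf * norm (inverse (ta n) *: (Hc (Qb + ta n *: h) - Hc Qb) - dHc h)" for n
  proof -
   have t: "0 < ta n" using assms by blast
   have "norm (inverse (ta n) *: (N1 f (Hc (Qb + ta n *: h)) - N1 f (Hc Qb + ta n *: dHc h)))
     \<le>inverse (ta n) * (Lf * norm (Hc (Qb + ta n *: h) - (Hc Qb + ta n *: dHc h)))"
    unfolding norm_scaleR using t by (intro mult_mono norm_N1_diff[OF Lf fl]) auto
   also have "Hc (Qb + ta n *: h) - (Hc Qb + ta n *: dHc h)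
     = ta n *: (inverse (ta n) *: (Hc (Qb + ta n *: h) - Hc Qb) - dHc h)"
    using t by (simp add: scaleR_diff_right)
   also have "inverse (ta n) * (Lf * norm (ta n *: (inverse (ta n) *: (Hc (Qb + ta n *: h) - Hc Qb) - dHc h)))
     = Lf * norm (inverse (ta n) *: (Hc (Qb + ta n *: h) - Hc Qb) - dHc h)"
    using t by (simp only: norm_scaleR) (simp add: field_simps)
   finally show ?thesis .
  qed
  thus "\<forall>\<^sub>F n in sequentially. norm (inverse (ta n) *: (N1 f (Hc (Qb + ta n *: h)) - N1 f (Hc Qb + ta n *: dHc h)))
    \<le>Lf * norm (inverse (ta n) *: (Hc (Qb + ta n *: h) - Hc Qb) - dHc h)"
   by (intro always_eventually) blast
 qed
 have e: "inverse (ta n) *: (N1 f (Hc (Qb + ta n *: h)) - N1 f (Hc Qb + ta n *: dHc h)) +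
   inverse (ta n) *: (N1 f (Hc Qb + ta n *: dHc h) - N1 f (Hc Qb))
   = inverse (ta n) *: (N1 f (Hc (Qb + ta n *: h)) - N1 f (Hc Qb))" for n
  by (simp add: scaleR_diff_right)
 show ?thesis using tendsto_add[OF 2 1] unfolding e by simp
qed

text \<open>The curve \<open>Qb + ta dq u\<close> solves the state equation with right-hand side \<open>lb + ta b\<close> up to a
 residual of order \<open>ta \<parallel>be K(be dq u + b) - dv u\<parallel> + o(ta)\<close>.\<close>

lemma quotient_estimate:
 "\<exists>C\<ge>0. \<forall>u b ta Q. (\<forall>n. 0 < ta n) --> ta ----> 0 --> (\<forall>n. step (lb + ta n *: b) (Q n) = Q n) -->
   (\<exists>e. e ----> 0 \<and> (\<forall>n::nat. norm (inverse (ta n) *: (Q n - Qb) - dq u)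
    \<le>C * norm (be *: K (be *: dq u + b) - dv u) + e n))"
proof -
 obtain C where C: "C\<ge>0" "!!l Q Q'. step l Q = Q ==> norm (Q - Q')\<le>C * norm (Q' - step l Q')"
  using ex_stability by blast
 interpret D: bounded_linear "intop T :: 'a tl2=>_" by (rule bounded_linear_intop[OF T])
 interpret K: bounded_linear K by (rule K_linear)
 obtain D where D: "D > 0" "!!U :: 'a tl2. norm (intop T U)\<le>norm U * D" using D.pos_bounded by blast
 define C' where "C' = C * ((1 / ep) * D)"
 have C': "C'\<ge>0" using C D ep by (simp add: C'_def)
 show ?thesis
 proof (intro exI[of _ C'] conjI allI impI C')
  fix u b and ta :: "nat=>real" and Q
  assume pos: "\<forall>n. 0 < ta n" and lim: "ta ----> 0" and Q: "\<forall>n. step (lb + ta n *: b) (Q n) = Q n"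
  define r where "r = be *: K (be *: dq u + b) - dv u"
  define s where "s n = df (dHc (dq u)) - inverse (ta n) *: (N1 f (Hc (Qb + ta n *: dq u)) - N1 f (Hc Qb))" for n
  define a where "a n = dmax u - inverse (ta n) *: (N1 (%p. max p 0) (zb + ta n *: u) - N1 (%p. max p 0) zb)" for n
  have s0: "s ----> 0" using tendsto_diff[OF tendsto_const df_lim[OF pos lim, of "dq u"], of "df (dHc (dq u))"]
   by (simp add: s_def[abs_def])
  have a0: "a ----> 0" using tendsto_diff[OF tendsto_const dmax_lim[OF pos lim, of u], of "dmax u"]
   by (simp add: a_def[abs_def])
  define e where "e n = C' * (norm (a n) + norm (s n))" for n
  have "e ----> C' * (norm (0 :: 'a tl2) + norm (0 :: 'a tl2))"
   unfolding e_def[abs_def] by (intro tendsto_intros a0 s0)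
  hence e0: "e ----> 0" by simp
  have "norm (inverse (ta n) *: (Q n - Qb) - dq u)\<le>C' * norm r + e n" for n
  proof -
   have t: "0 < ta n" using pos by blast
   define Q' where "Q' = Qb + ta n *: dq u"
   have z': "force (lb + ta n *: b) Q' = zb + ta n *: u + ta n *: (r + s n)"
   proof -
    have s': "ta n *: s n = ta n *: df (dHc (dq u)) - (N1 f (Hc Q') - N1 f (Hc Qb))"
     using t by (simp add: s_def scaleR_diff_right Q'_def)
    have "force (lb + ta n *: b) Q' - zb = ta n *: (be *: K (be *: dq u + b) - be *: dq u) - (N1 f (Hc Q') - N1 f (Hc Qb))"
     by (simp add: force_def zb_def Q'_def K.add K.scaleR algebra_simps)
    also have "... = ta n *: (r + u + df (dHc (dq u))) - (N1 f (Hc Q') - N1 f (Hc Qb))"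
     by (simp add: r_def dv_def algebra_simps)
    also have "... = ta n *: u + ta n *: r + ta n *: s n"
     unfolding s' by (simp add: algebra_simps)
    finally show ?thesis by (simp add: algebra_simps)
   qed
   have "Q' - step (lb + ta n *: b) Q' = (1 / ep) *: intop T (N1 (%p. max p 0) zb + ta n *: dmax u - N1 (%p. max p 0) (force (lb + ta n *: b) Q'))"
   proof -
    have "Qb = (1 / ep) *: intop T (N1 (%p. max p 0) zb)" using Qb by (simp add: step_def zb_def)
    hence "Q' = (1 / ep) *: intop T (N1 (%p. max p 0) zb) + ta n *: ((1 / ep) *: intop T (dmax u))"
     by (simp add: Q'_def dq_def)
    thus ?thesis
     by (simp add: step_def D.diff D.add D.scaleR scaleR_diff_right scaleR_add_right)
   qed
   hence "norm (Q' - step (lb + ta n *: b) Q') = (1 / ep) * norm (intop T (N1 (%p. max p 0) zb + ta n *: dmax u - N1 (%p. max p 0) (force (lb + ta n *: b) Q')))"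
    using ep by simp
   also have "...\<le>(1 / ep) * (norm (N1 (%p. max p 0) zb + ta n *: dmax u - N1 (%p. max p 0) (force (lb + ta n *: b) Q')) * D)"
    using ep D(2) by (intro mult_left_mono) auto
   also have "N1 (%p. max p 0) zb + ta n *: dmax u - N1 (%p. max p 0) (force (lb + ta n *: b) Q')
     = ta n *: a n + (N1 (%p. max p 0) (zb + ta n *: u) - N1 (%p. max p 0) (zb + ta n *: u + ta n *: (r + s n)))"
    using t by (simp add: a_def z' scaleR_diff_right)
   also have "(1 / ep) * (norm (ta n *: a n + (N1 (%p. max p 0) (zb + ta n *: u) - N1 (%p. max p 0) (zb + ta n *: u + ta n *: (r + s n)))) * D)
     \<le>(1 / ep) * ((ta n * (norm (a n) + norm (r + s n))) * D)"
   proof -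
    have "norm (N1 (%p. max p 0) (zb + ta n *: u) - N1 (%p. max p 0) (zb + ta n *: u + ta n *: (r + s n)))
      \<le>1 * norm ((zb + ta n *: u) - (zb + ta n *: u + ta n *: (r + s n)))"
     by (rule norm_N1_diff[OF zero_le_one max_lipschitz])
    also have "... = ta n * norm (r + s n)" using t by simp
    finally have "norm (ta n *: a n + (N1 (%p. max p 0) (zb + ta n *: u) - N1 (%p. max p 0) (zb + ta n *: u + ta n *: (r + s n))))
      \<le>ta n * norm (a n) + ta n * norm (r + s n)"
     using t by (intro order_trans[OF norm_triangle_ineq] add_mono) auto
    thus ?thesis using ep D by (intro mult_left_mono mult_right_mono) (auto simp: distrib_left)
   qed
   finally have R: "norm (Q' - step (lb + ta n *: b) Q')\<le>(1 / ep) * ((ta n * (norm (a n) + norm (r + s n))) * D)" .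
   have "norm (Q n - Q')\<le>C * ((1 / ep) * ((ta n * (norm (a n) + norm (r + s n))) * D))"
    using C(2)[of "lb + ta n *: b" "Q n" Q'] Q R C(1) by (meson mult_left_mono order_trans)
   also have "... = ta n * (C' * (norm (a n) + norm (r + s n)))" by (simp add: C'_def)
   finally have QQ: "norm (Q n - Q')\<le>ta n * (C' * (norm (a n) + norm (r + s n)))" .
   have "inverse (ta n) *: (Q n - Qb) - dq u = inverse (ta n) *: (Q n - Q')"
    using t by (simp add: Q'_def scaleR_diff_right scaleR_add_right)
   hence "norm (inverse (ta n) *: (Q n - Qb) - dq u) = inverse (ta n) * norm (Q n - Q')" using t by simp
   also have "...\<le>inverse (ta n) * (ta n * (C' * (norm (a n) + norm (r + s n))))"
    using QQ t by (intro mult_left_mono) auto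
   also have "... = C' * (norm (a n) + norm (r + s n))" using t by (simp add: field_simps)
   also have "...\<le>C' * (norm (a n) + (norm r + norm (s n)))"
    using C' by (intro mult_left_mono add_left_mono norm_triangle_ineq)
   finally show ?thesis by (simp add: e_def distrib_left)
  qed
  thus "\<exists>e. e ----> 0 \<and> (\<forall>n. norm (inverse (ta n) *: (Q n - Qb) - dq u)
    \<le>C' * norm (be *: K (be *: dq u + b) - dv u) + e n)"
   using e0 unfolding r_def by blast
 qed
qed

end

locale optimality = linearized_problem +
 fixes nf :: real and g ga lb' :: "'a tl2"
  and B :: "('a tl2 \<times> 'a tl2) set"
  and Jr :: "'a tl2=>'a tl2=>real"
  and dHs :: "'a tl2=>'a tl2"
 assumes fd_eq: "!!p q. p\<noteq>nf ==> fd p q = deriv f p * q"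
  and f_diff: "!!p. p\<noteq>nf ==> f differentiable (at p)"
  and KE_sym: "!!u v. inner (KE u) v = inner u (KE v)"
  and KE_Om: "!!e. mulop (ind Om) (KE e) = KE e"
  and dHs: "!!u v. inner (dHc u) v = inner u (dHs v)"
  and B: "subspace B"
  and Bsupp: "!!b b'. (b, b')\<in>B ==> mulop (ind {0<..<T}) (ptw (mulop (ind Om)) b) = b"
  and dens: "!!y. mulop (ind {0<..<T}) (ptw (mulop (ind Om)) y) = y ==> y\<in>closure ((%b. ptw KE (fst b)) ` B)"
  and Jr_deriv: "!!e. e > 0 ==> \<exists>d>0. \<forall>a c. norm a + norm c < d -->
    \<bar>Jr (Qb + a) (lb + c) - Jr Qb lb - (inner g a + inner ga (be *: a + c))\<bar>\<le>e * (norm a + norm c)"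
  and opt: "!!b b'. (b, b')\<in>B ==> \<exists>t0>0. \<forall>t Q. 0 < t --> t < t0 --> step (lb + t *: b) Q = Q -->
    Jr Qb lb + 1/2 * ((norm lb)^2 + (norm lb')^2)
    \<le>Jr Q (lb + t *: b) + 1/2 * ((norm (lb + t *: b))^2 + (norm (lb' + t *: b'))^2)"
begin

definition "PE = (mulop (ind Om) :: ('a, real) lp2=>_)"
definition "R U = mulop (ind I0) (ptw PE U)"

lemma indOm: "(ind Om :: 'a=>real)\<in>meas" "\<bar>ind Om x :: real\<bar>\<le>1"
 and indI: "(ind I0 :: real=>real)\<in>meas" "\<bar>ind I0 t :: real\<bar>\<le>1"
 using Oms by (auto simp: ind_def)

lemma PE: "bounded_linear PE" "inner (PE u) v = inner u (PE v)" "AEL x. ap (PE u) x = ind Om x *: ap u x"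
 unfolding PE_def by (rule bounded_linear_mulop[OF indOm] inner_mulop[OF indOm] ap_mulop[OF indOm])+

lemma PE_nem2: "dom2 C G ==> PE (nem2 Om G a b) = nem2 Om G a b"
 by (rule lp2_eqI) (use PE(3)[of "nem2 Om G a b"] ap_nem2[OF Oms, of C G a b] in
   \<open>auto elim!: eventually_elim2 simp: ind_def\<close>)

lemma ap_R: "AEL t. ap (R U) t = ind I0 t *: PE (ap U t)"
 using ap_mulop[OF indI, of "ptw PE U"] ap_ptw[OF PE(1), of U] unfolding R_def by eventually_elim simp

lemma R_linear: "bounded_linear R"
 unfolding R_def by (intro bounded_linear_compose[OF bounded_linear_mulop[OF indI]] bounded_linear_ptw PE(1))

lemma R_sym: "inner (R U) V = inner U (R V)"
proof -
 have "inner (R U) V = (LL t. inner (ap (R U) t) (ap V t))" by (rule inner_lp2_def)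
 also have "... = (LL t. inner (ap U t) (ap (R V) t))"
  by (rule integral_cong_AE) (simp, simp, use ap_R[of U] ap_R[of V] in eventually_elim, simp add: PE(2))
 finally show ?thesis by (simp add: inner_lp2_def)
qed

lemma R_N2:
 assumes "adm C G"
 shows "R (N2 G a b) = N2 G a b"
 by (rule lp2_eqI) (use ap_R[of "N2 G a b"] ap_nem2[OF I0(2) dom2_E[OF assms], of a b] in eventually_elim,
   simp add: ind_def PE_nem2[OF adm_dom2[OF assms]])

lemma R_intop:
 assumes "R U = U"
 shows "R (intop T U) = intop T U"
proof (rule lp2_eqI)
 have U: "AEL t. ap U t = ind I0 t *: PE (ap U t)" using ap_R[of U] assms by simp
 have p: "PE (prim U t) = prim U t" for t
 proof -
  have i: "integrable lebesgue (%s. ind {0<..<t} s *: ap U s)" by (rule integrable_indicator_sq) simp_all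
  have "PE (prim U t) = (LL s. PE (ind {0<..<t} s *: ap U s))"
   unfolding prim_def by (rule integral_bounded_linear[OF PE(1) i, symmetric])
  also have "... = (LL s. ind {0<..<t} s *: ap U s)"
  proof (rule integral_cong_AE)
   show "(%s. PE (ind {0<..<t} s *: ap U s))\<in>meas"
    by (rule borel_measurable_ptw_comp[OF PE(1)]) simp
   have PP: "PE (PE e) = PE e" for e
    by (rule lp2_eqI) (use PE(3)[of "PE e"] PE(3)[of e] in \<open>auto elim!: eventually_elim2 simp: ind_def\<close>)
   show "AEL s. PE (ind {0<..<t} s *: ap U s) = ind {0<..<t} s *: ap U s"
    using U
   proof eventually_elim
    case (elim s)
    interpret PE: bounded_linear PE by (rule PE(1))
    have "PE (ap U s) = ap U s" by (subst (1 2) elim) (simp add: PE.scaleR PP)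
    thus ?case by (simp add: PE.scaleR)
   qed
  qed simp
  finally show ?thesis by (simp add: prim_def)
 qed
 show "AEL t. ap (R (intop T U)) t = ap (intop T U) t"
  using ap_R[of "intop T U"] ap_intop[OF T, of U]
 proof eventually_elim
  case (elim t)
  interpret PE: bounded_linear PE by (rule PE(1))
  show ?case unfolding elim by (simp add: PE.scaleR p ind_def)
 qed
qed

lemma R_K:
 assumes "R U = U"
 shows "R (K U) = K U"
proof (rule lp2_eqI)
 have U: "AEL t. ap U t = ind I0 t *: PE (ap U t)" using ap_R[of U] assms by simp
 show "AEL t. ap (R (K U)) t = ap (K U) t"
  using ap_R[of "K U"] ap_ptw[OF KE, of U] U unfolding K_def
 proof eventually_elim
  case (elim t)
  interpret KE: bounded_linear KE by (rule KE)
  show ?case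
  proof (cases "t\<in>I0")
   case True thus ?thesis using elim(1,2) KE_Om[of "ap U t"] by (simp add: PE_def)
  next
   case False
   hence "ap U t = 0" using elim(3) by simp
   thus ?thesis using elim(1,2) False by (simp add: KE.zero)
  qed
 qed
qed

lemma adm_maxd: "adm 1 maxd"
 using dirder_adm[OF lmeasurable_ball zero_le_one max_lipschitz dirder_max] .

lemma adm_fd: "adm Lf fd"
 using dirder_adm[OF lmeasurable_ball Lf fl fd] .

lemma R_dq: "R (dq u) = dq u"
 unfolding dq_def linear_scale[OF bounded_linear.linear[OF R_linear]] dmax_def
 by (simp only: R_intop[OF R_N2[OF adm_maxd]])

lemma R_dv: "R u = u ==> R (dv u) = dv u"
 unfolding dv_def linear_add[OF bounded_linear.linear[OF R_linear]] linear_scale[OF bounded_linear.linear[OF R_linear]]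
 by (simp add: R_dq df_def R_N2[OF adm_fd])

lemma master_inequality:
 "\<exists>C\<ge>0. \<forall>u b b'. (b, b')\<in>B -->
   0\<le>inner g (dq u) + inner ga (be *: dq u + b) + inner lb b + inner lb' b'
    + C * norm (be *: K (be *: dq u + b) - dv u)"
proof -
 obtain C where C: "C\<ge>0" and est: "!!u b ta Q. (\<forall>n. 0 < ta n) ==> ta ----> 0 ==> (\<forall>n. step (lb + ta n *: b) (Q n) = Q n) ==>
   (\<exists>e. e ----> 0 \<and> (\<forall>n::nat. norm (inverse (ta n) *: (Q n - Qb) - dq u)
    \<le>C * norm (be *: K (be *: dq u + b) - dv u) + e n))"
  using quotient_estimate by blast
 define c where "c = norm g + be * norm ga"
 have c0: "c\<ge>0" using be by (simp add: c_def)
 show ?thesis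
 proof (intro exI[of _ "c * C"] conjI allI impI)
  show "0\<le>c * C" using c0 C by simp
  fix u b b' assume bB: "(b, b')\<in>B"
  define r where "r = be *: K (be *: dq u + b) - dv u"
  define L where "L = inner g (dq u) + inner ga (be *: dq u + b) + inner lb b + inner lb' b'"
  define N where "N = (norm b)^2 + (norm b')^2"
  obtain t0 where t0: "t0 > 0" and op: "!!t Q. 0 < t ==> t < t0 ==> step (lb + t *: b) Q = Q ==>
    Jr Qb lb + 1/2 * ((norm lb)^2 + (norm lb')^2)
    \<le>Jr Q (lb + t *: b) + 1/2 * ((norm (lb + t *: b))^2 + (norm (lb' + t *: b'))^2)"
   using opt[OF bB] by blast
  define ta where "ta n = t0 / 2 * inverse (real (Suc n))" for n
  have pos: "\<forall>n. 0 < ta n" using t0 by (simp add: ta_def)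
  have "ta ----> t0 / 2 * 0" unfolding ta_def[abs_def] by (intro tendsto_intros LIMSEQ_inverse_real_of_nat)
  hence lim: "ta ----> 0" by simp
  have tat0: "ta n < t0" for n
  proof -
   have "t0 / 2 * inverse (real (Suc n))\<le>t0 / 2 * 1" using t0 by (intro mult_left_mono) (auto simp: inverse_le_1_iff)
   thus ?thesis using t0 by (simp add: ta_def)
  qed
  define Q where "Q n = (SOME Q. step (lb + ta n *: b) Q = Q)" for n
  have "step (lb + ta n *: b) (Q n) = Q n" for n
   unfolding Q_def by (rule someI_ex[OF ex_state])
  hence Q: "\<forall>n. step (lb + ta n *: b) (Q n) = Q n" by blast
  obtain e where e0: "e ----> 0" and eb: "!!n. norm (inverse (ta n) *: (Q n - Qb) - dq u)\<le>C * norm r + e n"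
   using est[OF pos lim Q, of u] unfolding r_def by blast
  define x where "x n = inverse (ta n) *: (Q n - Qb)" for n
  have xq: "norm (x n - dq u)\<le>C * norm r + e n" for n using eb by (simp add: x_def)
  obtain E where E: "!!n. norm (e n)\<le>E" using convergent_imp_Bseq[OF convergentI[OF e0]] unfolding Bseq_def by blast
  define X where "X = norm (dq u) + (C * norm r + E)"
  have xX: "norm (x n)\<le>X" for n
  proof -
   have "norm (x n)\<le>norm (dq u) + norm (x n - dq u)" by (metis add.commute diff_add_cancel norm_triangle_ineq)
   moreover have "e n\<le>E" using E[of n] by simp
   ultimately show ?thesis using xq[of n] by (simp add: X_def)
  qed
  have X0: "X\<ge>0" using xX[of 0] norm_ge_zero order_trans by blast
  have eps: "0\<le>L + c * C * norm r + e' * (X + norm b)" if e': "e' > 0" for e' :: real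
  proof -
   obtain d where d: "d > 0" and dJ: "!!a c. norm a + norm c < d ==>
     \<bar>Jr (Qb + a) (lb + c) - Jr Qb lb - (inner g a + inner ga (be *: a + c))\<bar>\<le>e' * (norm a + norm c)"
    using Jr_deriv[OF e'] by blast
   have "(%n. ta n * (X + norm b)) ----> 0 * (X + norm b)" by (intro tendsto_intros lim)
   hence ev: "\<forall>\<^sub>F n in sequentially. ta n * (X + norm b) < d" using d by (intro order_tendstoD(2)) auto
   have "\<forall>\<^sub>F n in sequentially. 0\<le>L + c * (C * norm r + e n) + e' * (X + norm b) + ta n / 2 * N"
    using ev
   proof eventually_elim
    case (elim n)
    have t: "0 < ta n" using pos by blast
    have Qx: "Q n = Qb + ta n *: x n" using t by (simp add: x_def)
    have nn: "norm (ta n *: x n) + norm (ta n *: b)\<le>ta n * (X + norm b)"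
     using t xX[of n] by (simp add: distrib_left)
    have "\<bar>Jr (Q n) (lb + ta n *: b) - Jr Qb lb - (inner g (ta n *: x n) + inner ga (be *: (ta n *: x n) + ta n *: b))\<bar>
      \<le>e' * (norm (ta n *: x n) + norm (ta n *: b))"
     unfolding Qx using nn elim by (intro dJ) linarith
    also have "...\<le>e' * (ta n * (X + norm b))" using nn e' by (intro mult_left_mono) auto
    also have "inner g (ta n *: x n) + inner ga (be *: (ta n *: x n) + ta n *: b)
      = ta n * (inner g (x n) + inner ga (be *: x n + b))"
     by (simp add: inner_add_right algebra_simps)
    finally have J: "Jr (Q n) (lb + ta n *: b) - Jr Qb lb
      \<le>ta n * (inner g (x n) + inner ga (be *: x n + b)) + e' * (ta n * (X + norm b))" by linarith
    have sq: "(norm (p + ta n *: q))^2 = (norm p)^2 + 2 * ta n * inner p q + (ta n)^2 * (norm q)^2"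
     for p q :: "'a tl2"
    proof -
     have "inner (p + ta n *: q) (p + ta n *: q) = inner p p + 2 * ta n * inner p q + (ta n)^2 * inner q q"
      by (simp add: inner_add_left inner_add_right inner_commute power2_eq_square algebra_simps)
     thus ?thesis by (simp only: power2_norm_eq_inner)
    qed
    have "0\<le>ta n * (inner g (x n) + inner ga (be *: x n + b)) + e' * (ta n * (X + norm b))
      + ta n * (inner lb b + inner lb' b') + (ta n)^2 / 2 * N"
     using op[OF t tat0 Q[rule_format]] J unfolding sq N_def by (simp add: algebra_simps add_divide_distrib)
    also have "... = ta n * (inner g (x n) + inner ga (be *: x n + b) + inner lb b + inner lb' b'
      + e' * (X + norm b) + ta n / 2 * N)"
     by (simp add: algebra_simps power2_eq_square)
    finally have m: "0\<le>inner g (x n) + inner ga (be *: x n + b) + inner lb b + inner lb' b'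
      + e' * (X + norm b) + ta n / 2 * N"
     using t by (simp add: zero_le_mult_iff)
    have "inner g (x n) + inner ga (be *: x n + b) - (inner g (dq u) + inner ga (be *: dq u + b))
      = inner g (x n - dq u) + be * inner ga (x n - dq u)"
     by (simp add: inner_diff_right inner_add_right algebra_simps)
    also have "...\<le>norm g * norm (x n - dq u) + be * (norm ga * norm (x n - dq u))"
     using be by (intro add_mono mult_left_mono norm_cauchy_schwarz) auto
    also have "... = c * norm (x n - dq u)" by (simp add: c_def algebra_simps)
    also have "...\<le>c * (C * norm r + e n)" using xq c0 by (intro mult_left_mono) auto
    finally show ?case using m by (simp add: L_def)
   qed
   moreover have "(%n. L + c * (C * norm r + e n) + e' * (X + norm b) + ta n / 2 * N)
     ----> L + c * (C * norm r + 0) + e' * (X + norm b) + 0 / 2 * N"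
    by (intro tendsto_intros e0 lim) simp
   ultimately have "0\<le>L + c * (C * norm r + 0) + e' * (X + norm b) + 0 / 2 * N"
    using tendsto_lowerbound sequentially_bot by blast
   thus ?thesis by simp
  qed
  have "0\<le>L + c * C * norm r"
  proof (rule ccontr)
   assume neg: "\<not> 0\<le>L + c * C * norm r"
   define k where "k = X + norm b + 1"
   have k: "k > 0" using X0 by (simp add: k_def add_nonneg_pos)
   define s where "s = L + c * C * norm r"
   have s: "s < 0" using neg by (simp add: s_def)
   have e: "- s / (2 * k) > 0" using s k by (intro divide_pos_pos) auto
   have "0\<le>s + (- s / (2 * k)) * (X + norm b)"
    using eps[OF e] by (simp only: s_def)
   also have "...\<le>s + (- s / (2 * k)) * k"
    using e by (intro add_left_mono mult_left_mono) (auto simp: k_def)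
   also have "... = s / 2" using k by simp
   finally show False using s by simp
  qed
  thus "0\<le>inner g (dq u) + inner ga (be *: dq u + b) + inner lb b + inner lb' b'
    + c * C * norm (be *: K (be *: dq u + b) - dv u)"
   by (simp add: L_def r_def)
 qed
qed

lemma dq_zero:
 assumes "dmax u = 0"
 shows "dq u = 0"
proof -
 interpret D: bounded_linear "intop T :: 'a tl2=>_" by (rule bounded_linear_intop[OF T])
 show ?thesis by (simp add: dq_def assms D.zero)
qed

lemma df_zero: "df 0 = 0"
 unfolding df_def by (rule nem2_zero_right[OF I0(2) dom2_E[OF adm_fd]])

lemma dHc_zero: "dHc 0 = 0"
 by (rule linear_0[OF bounded_linear.linear[OF dHc]])

lemma K_sym: "inner (K U) V = inner U (K V)"
 unfolding K_def by (rule inner_ptw[OF KE KE KE_sym])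

lemma ex_lam:
 "\<exists>lam. R lam = lam \<and> (\<forall>b b'. (b, b')\<in>B --> inner (ga + be *: K lam) b + inner lb b + inner lb' b' = 0)"
proof -
 obtain C where C: "C\<ge>0" and M: "!!u b b'. (b, b')\<in>B ==>
   0\<le>inner g (dq u) + inner ga (be *: dq u + b) + inner lb b + inner lb' b'
    + C * norm (be *: K (be *: dq u + b) - dv u)"
  using master_inequality by blast
 interpret K: bounded_linear K by (rule K_linear)
 have dm0: "dmax 0 = 0" unfolding dmax_def by (rule nem2_zero_right[OF I0(2) dom2_E[OF adm_maxd]])
 have dv0: "dv 0 = 0" by (simp add: dv_def dq_zero[OF dm0] dHc_zero df_zero)
 define \<Phi> where "\<Phi> b = - (inner (ga + lb) (fst b) + inner lb' (snd b))" for b :: "'a tl2 \<times> 'a tl2"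
 have "\<exists>m. linear m \<and> (\<forall>b\<in>B. m (K (fst b)) = \<Phi> b) \<and> (\<forall>y. m y\<le>(C * be) * norm y)"
 proof (rule hahn_banach[OF _ _ B])
  show "linear \<Phi>" by (auto simp: linear_iff \<Phi>_def inner_add_right algebra_simps)
  show "linear (%b. K (fst b))" by (auto simp: linear_iff K.add K.scaleR)
  show "C * be * norm (x + y)\<le>C * be * norm x + C * be * norm y" for x y :: "'a tl2"
   using mult_left_mono[OF norm_triangle_ineq[of x y], of "C * be"] C be by (simp add: distrib_left)
  show "C * be * norm (t *: x) = t * (C * be * norm x)" if "t > 0" for t and x :: "'a tl2"
   using that by simp
  fix b assume "b\<in>B"
  hence "(fst b, snd b)\<in>B" by simp
  from M[OF this, of 0] show "\<Phi> b\<le>C * be * norm (K (fst b))"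
   using be by (simp add: dq_zero[OF dm0] dv0 \<Phi>_def inner_add_left)
 qed
 then obtain m where m: "linear m" "!!b. b\<in>B ==> m (K (fst b)) = \<Phi> b" "!!y. m y\<le>(C * be) * norm y" by blast
 have "bounded_linear m"
 proof (rule bounded_linear_intro[where K="C * be"])
  show "norm (m y)\<le>norm y * (C * be)" for y
   using m(3)[of y] m(3)[of "- y"] linear_neg[OF m(1), of y] by (simp add: mult.commute)
 qed (simp_all add: linear_add[OF m(1)] linear_scale[OF m(1)])
 then obtain w where w: "!!y. m y = inner w y" using riesz_representation by blast
 define lam where "lam = R ((1 / be) *: w)"
 have "R lam = lam"
 proof -
  have PP: "PE (PE e) = PE e" for e
   by (rule lp2_eqI) (use PE(3)[of "PE e"] PE(3)[of e] in \<open>auto elim!: eventually_elim2 simp: ind_def\<close>)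
  interpret PE: bounded_linear PE by (rule PE(1))
  have "R (R U) = R U" for U
   by (rule lp2_eqI) (use ap_R[of "R U"] ap_R[of U] in eventually_elim, simp add: PE.scaleR PP ind_def)
  thus ?thesis by (simp add: lam_def)
 qed
 moreover have "inner (ga + be *: K lam) b + inner lb b + inner lb' b' = 0" if b: "(b, b')\<in>B" for b b'
 proof -
  have Rb: "R b = b" using Bsupp[OF b] by (simp add: R_def PE_def)
  have "be * inner (K lam) b = be * inner ((1 / be) *: w) (K b)"
   by (simp only: K_sym lam_def R_sym R_K[OF Rb])
  also have "... = inner w (K b)" using be by simp
  also have "... = - (inner (ga + lb) b + inner lb' b')" using m(2)[OF b] w by (simp add: \<Phi>_def)
  finally show ?thesis by (simp add: inner_add_left)
 qed
 ultimately show ?thesis by blast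
qed

lemma variational_inequality:
 assumes lam: "R lam = lam" and E5: "!!b b'. (b, b')\<in>B ==> inner (ga + be *: K lam) b + inner lb b + inner lb' b' = 0"
 shows "0\<le>inner (g + be *: (ga + be *: K lam - lam)) (dq u) - inner lam (df (dHc (dq u))) - inner lam u"
proof -
 obtain C where C: "C\<ge>0" and M: "!!u b b'. (b, b')\<in>B ==>
   0\<le>inner g (dq u) + inner ga (be *: dq u + b) + inner lb b + inner lb' b'
    + C * norm (be *: K (be *: dq u + b) - dv u)"
  using master_inequality by blast
 interpret K: bounded_linear K by (rule K_linear)
 interpret R: bounded_linear R by (rule R_linear)
 have VI: "0\<le>inner (g + be *: (ga + be *: K lam)) (dq u) - inner lam (dv u)" if u: "R u = u" for u
 proof -
  define y where "y = (1 / be) *: (dv u - (be^2) *: K (dq u))"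
  have "R y = y" by (simp add: y_def R.scaleR R.diff R_dv[OF u] R_K[OF R_dq])
  hence "y\<in>closure ((%b. K (fst b)) ` B)" using dens[of y] by (simp add: R_def PE_def K_def)
  then obtain Yn where Yn: "!!n. Yn n\<in>(%b. K (fst b)) ` B" "Yn ----> y" unfolding closure_sequential by blast
  hence "\<forall>n. \<exists>b. (fst b, snd b)\<in>B \<and> Yn n = K (fst b)" by (metis (no_types, lifting) imageE prod.collapse)
  then obtain b where b: "!!n. (fst (b n), snd (b n))\<in>B" "!!n. Yn n = K (fst (b n))" by metis
  have bey: "be *: y = dv u - (be^2) *: K (dq u)" using be by (simp add: y_def)
  have "0\<le>inner (g + be *: ga) (dq u) - be * inner lam (Yn n) + C * norm (be *: Yn n - be *: y)" for n
  proof -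
   have e: "inner ga (fst (b n)) + inner lb (fst (b n)) + inner lb' (snd (b n)) = - be * inner lam (Yn n)"
    using E5[OF b(1)[of n]] K_sym[of lam "fst (b n)"] by (simp add: inner_add_left b(2))
   have r: "be *: K (be *: dq u + fst (b n)) - dv u = be *: Yn n - be *: y"
    unfolding bey by (simp add: K.add K.scaleR b(2) algebra_simps power2_eq_square)
   have "0\<le>inner g (dq u) + inner ga (be *: dq u + fst (b n)) + inner lb (fst (b n)) + inner lb' (snd (b n))
     + C * norm (be *: Yn n - be *: y)"
    using M[OF b(1)[of n], of u] unfolding r .
   thus ?thesis using e by (simp add: inner_add_left inner_add_right)
  qed
  moreover have "(%n. inner (g + be *: ga) (dq u) - be * inner lam (Yn n) + C * norm (be *: Yn n - be *: y))
    ----> inner (g + be *: ga) (dq u) - be * inner lam y + C * norm (be *: y - be *: y)"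
   by (intro tendsto_intros Yn(2))
  ultimately have "0\<le>inner (g + be *: ga) (dq u) - be * inner lam y + C * norm (be *: y - be *: y)"
   by (intro LIMSEQ_le_const) auto
  moreover have "be * inner lam y = inner lam (dv u) - be^2 * inner (K lam) (dq u)"
   using arg_cong[OF bey, of "inner lam"] by (simp add: inner_diff_right K_sym)
  ultimately show ?thesis by (simp add: inner_add_left power2_eq_square algebra_simps)
 qed
 have RR: "R (R U) = R U" for U
 proof -
  have PP: "PE (PE e) = PE e" for e
   by (rule lp2_eqI) (use PE(3)[of "PE e"] PE(3)[of e] in \<open>auto elim!: eventually_elim2 simp: ind_def\<close>)
  interpret PE: bounded_linear PE by (rule PE(1))
  show ?thesis
   by (rule lp2_eqI) (use ap_R[of "R U"] ap_R[of U] in eventually_elim, simp add: PE.scaleR PP ind_def)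
 qed
 have "nem2 Om maxd p (PE q) = nem2 Om maxd p q" for p q
  by (rule lp2_eqI) (use ap_nem2[OF Oms adm_dom2[OF adm_maxd], of p "PE q"] ap_nem2[OF Oms adm_dom2[OF adm_maxd], of p q] PE(3)[of q]
    in eventually_elim, simp add: ind_def)
 hence dR: "dmax (R u) = dmax u"
  unfolding dmax_def
  by (intro lp2_eqI) (use ap_nem2[OF I0(2) dom2_E[OF adm_maxd], of zb "R u"] ap_nem2[OF I0(2) dom2_E[OF adm_maxd], of zb u] ap_R[of u]
    in eventually_elim, simp add: ind_def)
 have "inner lam (R u) = inner lam u" using R_sym[of lam u] lam by simp
 thus ?thesis
  using VI[of "R u", OF RR] by (simp add: dv_def dq_def dR inner_add_left inner_add_right inner_diff_left algebra_simps)
qed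

lemma nem2_Om_comp:
 assumes "adm C1 G1" "adm C2 G2"
 shows "N2 G1 a (N2 G2 a b) = N2 (%p q. G1 p (G2 p q)) a b"
 by (simp add: nem2_comp[OF I0(2) dom2_E[OF assms(1)] dom2_E[OF assms(2)]]
   nem2_comp[OF Oms adm_dom2[OF assms(1)] adm_dom2[OF assms(2)]])

lemma N2_linear: "adm C G ==> (!!p. linear (G p)) ==> bounded_linear (N2 G a)"
 by (intro bounded_linear_nem2[OF I0(2) dom2_E] bounded_linear.linear[OF bounded_linear_nem2[OF Oms adm_dom2]])

lemma N2_sym:
 fixes G :: "real=>real=>real"
 assumes "adm C G" "!!p q r. G p q * r = q * G p r"
 shows "inner (N2 G a b) c = inner b (N2 G a c)"
 by (rule inner_nem2[OF I0(2) dom2_E[OF assms(1)] inner_nem2[OF Oms adm_dom2[OF assms(1)]]]) (simp add: inner_real_def assms(2))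

definition "Gpos = (%(p::real) (q::real). indicator {0<..} p * q)"
definition "Gneg = (%(p::real) (q::real). ind {..<0} p * q)"
definition "Gpt = (%(p::real) (q::real). ind {nf} p * q)"
definition "Gder = (%(p::real) (q::real). (if p = nf then 0 else deriv f p) * q)"

lemma adms: "adm 1 Gpos" "adm 1 Gneg" "adm 1 Gpt" "adm Lf Gder"
 unfolding Gpos_def Gneg_def Gpt_def Gder_def
 by (rule adm_pos, rule adm_neg, rule adm_point, rule adm_deriv[OF Lf f_lip f_diff])

lemma lins: "linear (Gpos p)" "linear (Gneg p)" "linear (Gpt p)" "linear (Gder p)"
 by (auto simp: linear_iff Gpos_def Gneg_def Gpt_def Gder_def algebra_simps)

lemma df_split: "df h = N2 Gder (Hc Qb) h + N2 Gpt (Hc Qb) (df h)"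
proof -
 have e: "(%p q. Gder p q + Gpt p (fd p q)) = fd"
  using fd_eq by (auto simp: fun_eq_iff Gder_def Gpt_def)
 have d: "dom2 (1 * Lf) (%p q. Gpt p (fd p q))"
 proof -
  have "norm (Gpt p (fd p q))\<le>1 * Lf * norm q" for p q
   using dom2D(3)[OF adm_dom2[OF adm_fd], of p q] Lf by (auto simp: Gpt_def ind_def)
  moreover have "(%z. Gpt (fst z) (fd (fst z) (snd z)))\<in>borel_measurable borel"
   by (rule dom2_comp[OF adm_dom2[OF adms(3)] _ dom2D(2)[OF adm_dom2[OF adm_fd]]])
    (simp add: borel_measurable_continuous_onI continuous_on_fst)
  ultimately show ?thesis using Lf by (simp add: dom2_def)
 qed
 have "nem2 Om Gder p q + nem2 Om Gpt p (nem2 Om fd p q) = nem2 Om fd p q" for p q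
  by (simp add: nem2_comp[OF Oms adm_dom2[OF adms(3)] adm_dom2[OF adm_fd]]
    nem2_plus[OF Oms adm_dom2[OF adms(4)] d] e)
 note E = this
 show ?thesis
  unfolding df_def
  by (rule lp2_eqI) (use ap_add[of "N2 Gder (Hc Qb) h" "N2 Gpt (Hc Qb) (N2 fd (Hc Qb) h)"]
    ap_nem2[OF I0(2) dom2_E[OF adms(4)], of "Hc Qb" h] ap_nem2[OF I0(2) dom2_E[OF adms(3)], of "Hc Qb" "N2 fd (Hc Qb) h"]
    ap_nem2[OF I0(2) dom2_E[OF adm_fd], of "Hc Qb" h] in eventually_elim, simp add: ind_def E)
qed

theorem multipliers:
 "\<exists>lam mu. R lam = lam \<and> R mu = mu \<and>
   (\<forall>b b'. (b, b')\<in>B --> inner (ga + be *: K lam) b + inner lb b + inner lb' b' = 0) \<and>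
   (\<exists>C. AEL t. t\<in>I0 --> norm (ap lam t)\<le>C) \<and>
   (\<exists>C. AEL t. t\<in>I0 --> norm (ap mu t)\<le>C) \<and>
   N2 Gneg zb lam = 0 \<and>
   N2 Gpos zb ((1 / ep) *: coint T (g + be *: (ga + be *: K lam - lam) - dHs mu) - lam) = 0 \<and>
   N2 Gpt (Hc Qb) (mu - N2 Gder (Hc Qb) lam) = mu - N2 Gder (Hc Qb) lam"
proof -
 obtain lam where lam: "R lam = lam" and E5: "!!b b'. (b, b')\<in>B ==> inner (ga + be *: K lam) b + inner lb b + inner lb' b' = 0"
  using ex_lam by blast
 define \<rho> where "\<rho> = g + be *: (ga + be *: K lam - lam)"
 have VI: "0\<le>inner \<rho> (dq u) - inner lam (df (dHc (dq u))) - inner lam u" for u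
  unfolding \<rho>_def by (rule variational_inequality[OF lam E5])
 obtain H0 where H0: "H0 > 0" "!!h. norm (dHc h)\<le>norm h * H0" using bounded_linear.pos_bounded[OF dHc] by blast
 define c where "c = norm \<rho> + norm lam * (Lf * H0)"
 define C1 where "C1 = c * ((1 / ep) * sqrt T)"
 have c0: "c\<ge>0" using Lf H0 by (simp add: c_def)
 have C1: "C1\<ge>0" using c0 ep T by (simp add: C1_def)
 have lamC: "AEL t. t\<in>I0 --> norm (ap lam t)\<le>C1"
 proof (rule Linf_if_L1_dual_bound[OF C1])
  fix U
  have "inner lam U\<le>inner \<rho> (dq U) - inner lam (df (dHc (dq U)))" using VI[of U] by simp
  also have "...\<le>norm \<rho> * norm (dq U) + norm lam * norm (df (dHc (dq U)))"
   using norm_cauchy_schwarz[of \<rho> "dq U"] Cauchy_Schwarz_ineq2[of lam "df (dHc (dq U))"] by linarith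
  also have "...\<le>norm \<rho> * norm (dq U) + norm lam * (Lf * (norm (dq U) * H0))"
  proof (intro add_left_mono mult_left_mono norm_ge_zero)
   have "norm (df (dHc (dq U)))\<le>Lf * norm (dHc (dq U))"
    unfolding df_def by (rule norm_nem2_le[OF I0(2) dom2_E[OF adm_fd]])
   also have "...\<le>Lf * (norm (dq U) * H0)" using H0 Lf by (intro mult_left_mono) auto
   finally show "norm (df (dHc (dq U)))\<le>Lf * (norm (dq U) * H0)" .
  qed
  also have "... = c * norm (dq U)" by (simp add: c_def algebra_simps)
  finally have 1: "inner lam U\<le>c * norm (dq U)" .
  have "norm (intop T (dmax U))\<le>sqrt T * nprim (dmax U) T" by (rule norm_intop_le[OF T])
  also have "nprim (dmax U) T\<le>1 * nprim U T"
  proof (rule nprim_mono_AE)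
   show "AEL s. s\<in>{0<..<T} --> norm (ap (dmax U) s)\<le>1 * norm (ap U s)"
    using ap_nem2[OF I0(2) dom2_E[OF adm_maxd], of zb U] unfolding dmax_def
    by eventually_elim (use dom2D(3)[OF dom2_E[OF adm_maxd]] in auto)
  qed
  finally have "norm (dq U)\<le>(1 / ep) * (sqrt T * nprim U T)"
   using ep T by (simp add: dq_def divide_right_mono mult_left_mono)
  hence "c * norm (dq U)\<le>c * ((1 / ep) * (sqrt T * nprim U T))" using c0 by (intro mult_left_mono) auto
  also have "... = C1 * nprim U T" by (simp add: C1_def)
  finally show "inner lam U\<le>C1 * nprim U T" using 1 by linarith
 qed
 have neg: "N2 Gneg zb lam = 0"
 proof -
  define u where "u = N2 Gneg zb lam"
  have "dmax u = N2 (%p q. maxd p (Gneg p q)) zb lam"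
   unfolding dmax_def u_def by (rule nem2_Om_comp[OF adm_maxd adms(2)])
  also have "(%p q. maxd p (Gneg p q)) = (%p q. 0::real)" by (auto simp: fun_eq_iff maxd_def Gneg_def)
  also have "N2 (%p q. 0::real) zb lam = 0"
  proof -
   have a: "adm 0 (%(p::real) (q::real). 0::real)" by (auto simp: adm_def intro!: exI[of _ "%n p q. 0"] exI[of _ 0])
   show ?thesis using norm_nem2_le[OF I0(2) dom2_E[OF a], of zb lam] by simp
  qed
  finally have "dq u = 0" by (rule dq_zero)
  hence "inner lam u\<le>0" using VI[of u] by (simp add: dHc_zero df_zero)
  moreover have "inner lam u = inner u u"
  proof -
   have "(%p q. Gneg p (Gneg p q)) = Gneg" by (auto simp: fun_eq_iff Gneg_def ind_def)
   hence "u = N2 Gneg zb u" unfolding u_def using nem2_Om_comp[OF adms(2) adms(2), of zb lam] by simp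
   hence "inner lam u = inner lam (N2 Gneg zb u)" by simp
   also have "... = inner u u"
    unfolding u_def by (rule N2_sym[OF adms(2), symmetric]) (simp add: Gneg_def)
   finally show ?thesis .
  qed
  ultimately have "u = 0" by (metis inner_gt_zero_iff not_less)
  thus ?thesis by (simp add: u_def)
 qed
 define P where "P = N2 Gpos zb"
 have P: "bounded_linear P" unfolding P_def by (rule N2_linear[OF adms(1) lins(1)])
 have Psym: "inner (P a) b = inner a (P b)" for a b unfolding P_def by (rule N2_sym[OF adms(1)]) (simp add: Gpos_def)
 have dP: "dmax (P u) = P u" for u
 proof -
  have "dmax (P u) = N2 (%p q. maxd p (Gpos p q)) zb u" unfolding dmax_def P_def by (rule nem2_Om_comp[OF adm_maxd adms(1)])
  also have "(%p q. maxd p (Gpos p q)) = Gpos" by (auto simp: fun_eq_iff maxd_def Gpos_def ind_def)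
  finally show ?thesis by (simp add: P_def)
 qed
 define X where "X = N2 Gpt (Hc Qb)"
 have X: "bounded_linear X" unfolding X_def by (rule N2_linear[OF adms(3) lins(3)])
 have Xsym: "inner (X a) b = inner a (X b)" for a b unfolding X_def by (rule N2_sym[OF adms(3)]) (simp add: Gpt_def)
 have XX: "X (X a) = X a" for a
 proof -
  have "(%p q. Gpt p (Gpt p q)) = Gpt" by (auto simp: fun_eq_iff Gpt_def ind_def)
  thus ?thesis unfolding X_def using nem2_Om_comp[OF adms(3) adms(3), of "Hc Qb" a] by simp
 qed
 define A where "A = N2 Gder (Hc Qb)"
 have A: "bounded_linear A" unfolding A_def by (rule N2_linear[OF adms(4) lins(4)])
 have Asym: "inner (A a) b = inner a (A b)" for a b unfolding A_def by (rule N2_sym[OF adms(4)]) (simp add: Gder_def)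
 interpret X: bounded_linear X by (rule X)
 interpret P: bounded_linear P by (rule P)
 interpret H: bounded_linear dHc by (rule dHc)
 interpret A: bounded_linear A by (rule A)
 interpret D: bounded_linear "intop T :: 'a tl2=>_" by (rule bounded_linear_intop[OF T])
 define D' where "D' U = (1 / ep) *: intop T U" for U :: "'a tl2"
 have D'lin: "linear D'" by (auto simp: linear_iff D'_def D.add D.scaleR scaleR_add_right)
 define h where "h u = dHc (D' (P u))" for u
 have hlin: "linear h" by (auto simp: linear_iff h_def P.add P.scaleR linear_add[OF D'lin] linear_scale[OF D'lin] H.add H.scaleR)
 define \<Phi> where "\<Phi> u = inner lam (P u) - inner \<rho> (D' (P u)) + inner lam (A (h u))" for u
 have \<Phi>lin: "linear \<Phi>"
  by (auto simp: linear_iff \<Phi>_def P.add P.scaleR linear_add[OF D'lin] linear_scale[OF D'lin]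
    linear_add[OF hlin] linear_scale[OF hlin] A.add A.scaleR inner_add_right algebra_simps)
 define C2 where "C2 = C1 * Lf"
 have C2: "C2\<ge>0" using C1 Lf by (simp add: C2_def)
 have "\<exists>m. linear m \<and> (\<forall>u\<in>UNIV. m (h u) = \<Phi> u) \<and> (\<forall>y. m y\<le>C2 * nprim (X y) T)"
 proof (rule hahn_banach[OF \<Phi>lin hlin subspace_UNIV])
  show "C2 * nprim (X (x + y)) T\<le>C2 * nprim (X x) T + C2 * nprim (X y) T" for x y
   using mult_left_mono[OF nprim_add_le[of "X x" "X y" T] C2] by (simp add: X.add distrib_left)
  show "C2 * nprim (X (t *: x)) T = t * (C2 * nprim (X x) T)" if "t > 0" for t x
   using that by (simp add: X.scaleR nprim_scaleR)
  fix u
  have "dq (P u) = D' (P u)" by (simp add: dq_def dP D'_def)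
  hence "0\<le>inner \<rho> (D' (P u)) - inner lam (df (h u)) - inner lam (P u)"
   using VI[of "P u"] by (simp add: h_def)
  moreover have "inner lam (df (h u)) = inner lam (A (h u)) + inner lam (X (df (h u)))"
   using arg_cong[OF df_split[of "h u"], of "inner lam"] by (simp only: A_def X_def inner_add_right)
  ultimately have "\<Phi> u\<le>- inner lam (X (df (h u)))" by (simp add: \<Phi>_def)
  also have "...\<le>\<bar>inner lam (X (df (h u)))\<bar>" by simp
  also have "...\<le>C1 * Lf * nprim (X (h u)) T"
  proof (rule inner_le_Linf_L1[OF C1 Lf lamC])
   have le: "norm (Gpt p (fd p q))\<le>Lf * norm (Gpt p q)" for p q
    using dom2D(3)[OF adm_dom2[OF adm_fd], of p q] by (auto simp: Gpt_def ind_def)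
   have d: "dom2 (1 * Lf) (%p q. Gpt p (fd p q))"
   proof -
    have "norm (Gpt p (fd p q))\<le>1 * Lf * norm q" for p q
     using dom2D(3)[OF adm_dom2[OF adm_fd], of p q] Lf by (auto simp: Gpt_def ind_def)
    moreover have "(%z. Gpt (fst z) (fd (fst z) (snd z)))\<in>borel_measurable borel"
     by (rule dom2_comp[OF adm_dom2[OF adms(3)] _ dom2D(2)[OF adm_dom2[OF adm_fd]]])
      (simp add: borel_measurable_continuous_onI continuous_on_fst)
    ultimately show ?thesis using Lf by (simp add: dom2_def)
   qed
   have le2: "norm (nem2 Om Gpt p (nem2 Om fd p q))\<le>Lf * norm (nem2 Om Gpt p q)" for p q
    using nem2_norm_mono(2)[OF Oms d adm_dom2[OF adms(3)] Lf le, of p q]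
    by (simp add: nem2_comp[OF Oms adm_dom2[OF adms(3)] adm_dom2[OF adm_fd]])
   show "AEL t. norm (ap (X (df (h u))) t)\<le>ind I0 t * (Lf * norm (ap (X (h u)) t))"
    using ap_nem2[OF I0(2) dom2_E[OF adms(3)], of "Hc Qb" "df (h u)"] ap_nem2[OF I0(2) dom2_E[OF adms(3)], of "Hc Qb" "h u"]
     ap_nem2[OF I0(2) dom2_E[OF adm_fd], of "Hc Qb" "h u"] unfolding X_def df_def
    by eventually_elim (use le2 in \<open>simp add: ind_def\<close>)
  qed
  finally show "\<Phi> u\<le>C2 * nprim (X (h u)) T" by (simp add: C2_def)
 qed
 then obtain m0 where m0: "linear m0" "!!u. m0 (h u) = \<Phi> u" "!!y. m0 y\<le>C2 * nprim (X y) T" by auto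
 have nX: "nprim (X y) T\<le>nprim y T" for y
 proof -
  have "nprim (X y) T\<le>1 * nprim y T"
  proof (rule nprim_mono_AE)
   show "AEL s. s\<in>{0<..<T} --> norm (ap (X y) s)\<le>1 * norm (ap y s)"
    using ap_nem2[OF I0(2) dom2_E[OF adms(3)], of "Hc Qb" y] unfolding X_def
    by eventually_elim (use dom2D(3)[OF dom2_E[OF adms(3)]] in auto)
  qed
  thus ?thesis by simp
 qed
 have m0le: "m0 y\<le>C2 * nprim y T" for y using m0(3)[of y] mult_left_mono[OF nX[of y] C2] by linarith
 have m0n: "m0 y\<le>C2 * (sqrt T * norm y)" for y
  using m0le[of y] mult_left_mono[OF nprim_le_norm[of y T] C2] T by simp
 have "bounded_linear m0"
 proof (rule bounded_linear_intro[where K="C2 * sqrt T"])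
  show "norm (m0 y)\<le>norm y * (C2 * sqrt T)" for y
   using m0n[of y] m0n[of "- y"] linear_neg[OF m0(1), of y] by (simp add: mult_ac)
 qed (simp_all add: linear_add[OF m0(1)] linear_scale[OF m0(1)])
 then obtain m where m: "!!y. m0 y = inner m y" using riesz_representation by blast
 have Xm: "X m = m"
 proof -
  have "inner m (y - X y)\<le>0" for y
   using m0(3)[of "y - X y"] nprim_scaleR[of 0 "0 :: 'a tl2" T] by (simp add: m X.diff XX)
  from this[of m] this[of "- m"] have "inner m (m - X m) = 0" by (simp add: linear_neg[OF X.linear_axioms] inner_diff_right)
  moreover have "inner (X m) (m - X m) = 0" by (simp add: Xsym X.diff XX)
  ultimately have "inner (m - X m) (m - X m) = 0" by (simp add: inner_diff_left)
  thus ?thesis by simp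
 qed
 have mC: "AEL t. t\<in>I0 --> norm (ap m t)\<le>C2"
  by (rule Linf_if_L1_dual_bound[OF C2]) (use m0le m in simp)
 define mu where "mu = A lam - m"
 have muA: "mu - A lam = - m" by (simp add: mu_def)
 have muC: "AEL t. t\<in>I0 --> norm (ap mu t)\<le>Lf * C1 + C2"
  using lamC mC ap_diff[of "A lam" m] ap_nem2[OF I0(2) dom2_E[OF adms(4)], of "Hc Qb" lam]
 proof eventually_elim
  case (elim t)
  show ?case
  proof
   assume t: "t\<in>I0"
   have "norm (ap mu t)\<le>norm (ap (A lam) t) + norm (ap m t)" unfolding mu_def elim(3) by (rule norm_triangle_ineq4)
   also have "norm (ap (A lam) t)\<le>Lf * norm (ap lam t)"
    using t elim(4) dom2D(3)[OF dom2_E[OF adms(4)], of "ap (Hc Qb) t" "ap lam t"] by (simp add: A_def)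
   also have "...\<le>Lf * C1" using elim(1) t Lf by (intro mult_left_mono) auto
   finally show "norm (ap mu t)\<le>Lf * C1 + C2" using elim(2) t by simp
  qed
 qed
 have Rmu: "R mu = mu"
 proof -
  interpret R: bounded_linear R by (rule R_linear)
  have "R m = m" by (subst (1 2) Xm[symmetric]) (simp only: X_def R_N2[OF adms(3)])
  thus ?thesis by (simp add: mu_def R.diff A_def R_N2[OF adms(4)])
 qed
 have "P ((1 / ep) *: coint T (\<rho> - dHs mu) - lam) = 0"
 proof -
  have "inner (P ((1 / ep) *: coint T (\<rho> - dHs mu) - lam)) u = 0" for u
  proof -
   have "inner m (h u) = \<Phi> u" using m0(2) m by simp
   hence "inner lam (P u) = inner \<rho> (D' (P u)) - inner mu (h u)"
    by (simp add: mu_def inner_diff_left Asym \<Phi>_def)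
   also have "inner mu (h u) = inner (dHs mu) (D' (P u))"
    using dHs[of "D' (P u)" mu] by (simp add: h_def inner_commute)
   also have "inner \<rho> (D' (P u)) - inner (dHs mu) (D' (P u)) = inner (D' (P u)) (\<rho> - dHs mu)"
    by (simp add: inner_diff_right inner_commute)
   also have "... = inner ((1 / ep) *: coint T (\<rho> - dHs mu)) (P u)"
   proof -
    have "inner (D' (P u)) (\<rho> - dHs mu) = (1 / ep) * inner (intop T (P u)) (\<rho> - dHs mu)" by (simp only: D'_def inner_scaleR_left)
    also have "... = (1 / ep) * inner (P u) (coint T (\<rho> - dHs mu))" by (simp only: inner_intop[OF T])
    also have "... = inner ((1 / ep) *: coint T (\<rho> - dHs mu)) (P u)" by (simp add: inner_commute)
    finally show ?thesis .
   qed
   finally show ?thesis by (simp add: Psym inner_diff_left)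
  qed
  from this[of "P ((1 / ep) *: coint T (\<rho> - dHs mu) - lam)"] show ?thesis by simp
 qed
 moreover have "X (mu - A lam) = mu - A lam" by (simp add: muA linear_neg[OF X.linear_axioms] Xm)
 ultimately show ?thesis
  using lam E5 lamC muC Rmu neg unfolding P_def X_def A_def \<rho>_def by blast
qed

end

section \<open>Bochner spaces\<close>

lemma AE_tm: "(AE t in tm T. P t) \<longleftrightarrow> (AEL t. t\<in>{0<..<T} --> P t)"
 by (rule AE_restrict_space_iff) simp

lemma integral_tm: "(LINT t|tm T. h t) = (LL t. ind {0<..<T} t *: (h t :: real))"
 by (rule integral_restrict_space) simp

lemma integrable_tm: "integrable (tm T) h \<longleftrightarrow> integrable lebesgue (%t. ind {0<..<T} t *: (h t :: real))"
 by (rule integrable_restrict_space) simp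

lemma measurable_AE_eq:
 fixes h :: "'d::euclidean_space=>'b::topological_space"
 assumes g: "g\<in>borel_measurable (lebesgue :: 'd::euclidean_space measure)" and ae: "AEL x. h x = g x"
 shows "h\<in>meas"
proof (rule measurableI)
 fix A :: "'b set" assume A: "A\<in>sets borel"
 obtain N where N: "{x. h x\<noteq>g x}\<subseteq>N" "N\<in>null_sets lebesgue"
  using ae unfolding eventually_ae_filter by auto
 have "h -` A\<inter>N\<in>sets lebesgue"
  by (rule completion.complete) (use N in auto)
 moreover have "g -` A\<in>sets lebesgue" using measurable_sets[OF g A] by simp
 moreover have "h -` A = (g -` A - N)\<union>(h -` A\<inter>N)"
 proof (rule set_eqI)
  fix x have "x\<notin>N ==> h x = g x" using N(1) by blast
  thus "x\<in>h -` A \<longleftrightarrow> x\<in>(g -` A - N)\<union>(h -` A\<inter>N)" by (cases "x\<in>N") auto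
 qed
 ultimately show "h -` A\<inter>space lebesgue\<in>sets lebesgue"
  using N(2) by (metis Int_UNIV_right null_setsD2 sets.Diff sets.Un space_completion space_lborel space_borel)
qed simp

lemma measurable_AE_limit:
 fixes h :: "'d::euclidean_space=>'b::{banach,second_countable_topology}"
 assumes g: "!!n::nat. g n\<in>borel_measurable (lebesgue :: 'd measure)" and ae: "AEL x. (%n. g n x) ----> h x"
 shows "h\<in>meas"
proof (rule measurable_AE_eq)
 show "(%x. lim (%n. g n x))\<in>meas"
  by (rule borel_measurable_lim_metric) (rule g)
 show "AEL x. h x = lim (%n. g n x)"
  using ae by eventually_elim (simp add: limI)
qed

definition wd :: "real=>(real, 'b::hilb) lp2=>(real, 'b) lp2=>bool"
 where "wd T U W \<longleftrightarrow> (\<forall>ph. test_function {0<..<T} ph -->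
   (LL t. deriv ph t *: ap U t) = - (LL t. ph t *: ap W t))"

definition multf :: "real=>(real=>real)=>bool"
 where "multf T h \<longleftrightarrow> h\<in>meas \<and> (\<exists>M. \<forall>t. \<bar>h t\<bar>\<le>M) \<and> (\<forall>t. t\<notin>{0<..<T} --> h t = 0)"

lemma multf_test:
 assumes "test_function {0<..<T} ph"
 shows "multf T ph" "multf T (deriv ph)"
proof -
 obtain M where M: "!!x. \<bar>ph x\<bar>\<le>M" "!!x. \<bar>pd 1 ph x\<bar>\<le>M"
  using test_function_bounds[OF assms, of 1] by auto
 have d: "deriv ph = (%t. pd 1 ph t)" using deriv_test_function(2)[OF assms] by (simp add: fun_eq_iff)
 show "multf T ph" unfolding multf_def using M testD(3,4)[OF assms] by blast
 have "deriv ph\<in>meas" unfolding d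
  by (rule measurable_completion) (use testD(6)[OF assms, of 1 UNIV] in \<open>simp add: borel_measurable_continuous_onI\<close>)
 thus "multf T (deriv ph)" unfolding multf_def using M testD(7)[OF assms] by (auto simp: d)
qed

lemma multf_sq_int:
 assumes "multf T h"
 shows "sq_int (%t. h t *: e)" "integrable lebesgue (%t. h t *: ap U t)"
  "inner U (mk (%t. h t *: v)) = inner (LL t. h t *: ap U t) v"
proof -
 obtain M where h: "h\<in>meas" and M: "!!t. \<bar>h t\<bar>\<le>M" and 0: "!!t. t\<notin>{0<..<T} ==> h t = 0"
  using assms unfolding multf_def by blast
 have s: "sq_int (%t. h t *: e)" for e :: "'z::hilb"
 proof (rule sq_int_bounded_on[of _ "{0<..<T}" "M * norm e"])
  show "AEL t. norm (h t *: e)\<le>ind {0<..<T} t * (M * norm e)"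
   using M 0 by (intro AE_I2) (auto simp: ind_def intro: mult_right_mono)
 qed (use h in auto)
 thus "sq_int (%t. h t *: e)" .
 have i: "integrable lebesgue (%t. h t *: ap U t)" for U :: "(real, 'z::hilb) lp2"
 proof (rule Bochner_Integration.integrable_bound)
  show "integrable lebesgue (%t. norm (h t *: (1::real)) * norm (ap U t))" by (rule integrable_norm_mult[OF s]) simp
 qed (use h in auto)
 thus "integrable lebesgue (%t. h t *: ap U t)" .
 have "inner U (mk (%t. h t *: v)) = (LL t. inner (h t *: ap U t) v)"
  unfolding inner_lp2_def
  by (rule integral_cong_AE) (simp, use h in simp, use ap_mk[OF s[of v]] in eventually_elim, simp)
 thus "inner U (mk (%t. h t *: v)) = inner (LL t. h t *: ap U t) v"
  using integral_inner_left[OF i[of U], of v] by simp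
qed

lemma prim_test:
 assumes ph: "test_function {0<..<T} ph" and t: "0\<le>t"
 shows "prim (mk (%s. deriv ph s *: e)) t = ph t *: e"
proof (cases "t = 0")
 case True
 thus ?thesis using testD(4)[OF ph, of 0] by (simp add: prim_def)
next
 case False
 with t have t: "t > 0" by simp
 have d: "deriv ph = (%t. pd 1 ph t)" using deriv_test_function(2)[OF ph] by (simp add: fun_eq_iff)
 have c: "continuous_on S (deriv ph)" for S unfolding d by (rule testD(6)[OF ph]) simp
 have "prim (mk (%s. deriv ph s *: e)) t = (LL s. (ind {0..t} s * deriv ph s) *: e)"
  unfolding prim_def
 proof (rule integral_cong_AE)
  have "AEL s. s\<notin>{0, t}" by (rule AE_not_in) simp
  thus "AEL s. ind {0<..<t} s *: ap (mk (%s. deriv ph s *: e)) s = (ind {0..t} s * deriv ph s) *: e"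
   using ap_mk[OF multf_sq_int(1)[OF multf_test(2)[OF ph], of e]] by eventually_elim (auto simp: ind_def)
  have "deriv ph\<in>meas" using multf_test(2)[OF ph] by (simp add: multf_def)
  thus "(%s. (ind {0..t} s * deriv ph s) *: e)\<in>meas" by measurable
 qed simp
 also have "... = (LINT s|lborel. (ind {0..t} s * deriv ph s) *: e)"
  by (rule integral_completion) (use borel_measurable_continuous_onI[OF c] in measurable)
 also have "... = (LINT s|lborel. ind {0..t} s *: deriv ph s) *: e"
  by (subst integral_scaleR_left[symmetric]) (use borel_integrable_compact[of "{0..t}" "deriv ph"] c in auto)
 also have "(LINT s|lborel. ind {0..t} s *: deriv ph s) = ph t - ph 0"
  using t deriv_test_function(1)[OF ph]
  by (intro integral_FTC_Icc[OF _ _ c]) (auto simp: has_real_derivative_iff_has_vector_derivative[symmetric] intro: has_field_derivative_at_within)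
 finally show ?thesis using testD(4)[OF ph, of 0] by simp
qed

lemma wd_intop:
 fixes W :: "(real, 'b::hilb) lp2"
 assumes T: "T > 0"
 shows "wd T (intop T W) W"
 unfolding wd_def
proof (intro allI impI)
 fix ph assume ph: "test_function {0<..<T} ph"
 note m = multf_sq_int[OF multf_test(1)[OF ph]] and m' = multf_sq_int[OF multf_test(2)[OF ph]]
 have "inner ((LL t. deriv ph t *: ap (intop T W) t) + (LL t. ph t *: ap W t)) e = 0" for e
 proof -
  have "coint T (mk (%s. deriv ph s *: e)) = (-1) *: mk (%s. ph s *: e)"
  proof (rule lp2_eqI, goal_cases)
   case 1 show ?case
    using ap_coint[OF T, of "mk (%s. deriv ph s *: e)"] ap_mk[OF m(1)[of e]] ap_scaleR[of "-1" "mk (%s. ph s *: e)"]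
   proof eventually_elim
    case (elim s)
    show ?case
    proof (cases "s\<in>{0<..<T}")
     case True
     thus ?thesis using elim T testD(4)[OF ph, of T] by (simp add: prim_test[OF ph])
    next
     case False
     thus ?thesis using elim testD(4)[OF ph False] by simp
    qed
   qed
  qed
  hence "inner (intop T W) (mk (%s. deriv ph s *: e)) = - inner W (mk (%s. ph s *: e))"
   using inner_intop[OF T, of W "mk (%s. deriv ph s *: e)"] by simp
  thus ?thesis unfolding m(3) m'(3) by (simp add: inner_add_left)
 qed
 from this[of "(LL t. deriv ph t *: ap (intop T W) t) + (LL t. ph t *: ap W t)"]
 have "(LL t. deriv ph t *: ap (intop T W) t) + (LL t. ph t *: ap W t) = 0" by simp
 thus "(LL t. deriv ph t *: ap (intop T W) t) = - (LL t. ph t *: ap W t)"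
  by (simp add: add_eq_0_iff2)
qed

lemma integral_mult_diff:
 assumes "multf T h"
 shows "(LL t. h t *: ap (U - V) t) = (LL t. h t *: ap U t) - (LL t. h t *: ap V t)"
proof -
 have h: "h\<in>meas" using assms by (simp add: multf_def)
 have "(LL t. h t *: ap (U - V) t) = (LL t. h t *: ap U t - h t *: ap V t)"
  by (rule integral_cong_AE) (use h in simp, use h in simp, use ap_diff[of U V] in eventually_elim, simp add: scaleR_diff_right)
 thus ?thesis
  using Bochner_Integration.integral_diff[OF multf_sq_int(2)[OF assms, of U] multf_sq_int(2)[OF assms, of V]] by simp
qed

lemma integral_mult_add_scaleR:
 assumes "multf T h"
 shows "(LL t. h t *: ap (U + c *: V) t) = (LL t. h t *: ap U t) + c *: (LL t. h t *: ap V t)"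
proof -
 have h: "h\<in>meas" using assms by (simp add: multf_def)
 have "(LL t. h t *: ap (U + c *: V) t) = (LL t. h t *: ap U t + c *: (h t *: ap V t))"
  by (rule integral_cong_AE) (use h in simp, use h in simp, use ap_add[of U "c *: V"] ap_scaleR[of c V] in eventually_elim,
    simp add: scaleR_add_right)
 also have "... = (LL t. h t *: ap U t) + (LL t. c *: (h t *: ap V t))"
  by (rule Bochner_Integration.integral_add) (intro multf_sq_int(2)[OF assms] integrable_scaleR_right)+
 finally show ?thesis by (simp only: integral_scaleR_right)
qed

lemma wd_add_scaleR:
 assumes "wd T U1 W1" "wd T U2 W2"
 shows "wd T (U1 + c *: U2) (W1 + c *: W2)"
 unfolding wd_def
proof (intro allI impI)
 fix ph assume ph: "test_function {0<..<T} ph"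
 show "(LL t. deriv ph t *: ap (U1 + c *: U2) t) = - (LL t. ph t *: ap (W1 + c *: W2) t)"
  using assms ph unfolding wd_def by (simp add: integral_mult_add_scaleR[OF multf_test(1)[OF ph]] integral_mult_add_scaleR[OF multf_test(2)[OF ph]])
qed

lemma lmeasurable_ivl [simp]: "{a<..<b::real}\<in>lmeasurable"
 by (metis box_real(1) lmeasurable_box)

lemma integrable_inner_on:
 fixes T :: real
 assumes "AEL t. t\<notin>{0<..<T} --> ap U t = 0"
 shows "integrable lebesgue (%t. inner (ap U t) e)"
proof -
 have i: "integrable lebesgue (%t. inner (ind {0<..<T} t *: ap U t) e)"
  by (intro integrable_inner_left integrable_indicator_sq) simp_all
 have ae: "AEL t. inner (ind {0<..<T} t *: ap U t) e = inner (ap U t) e"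
  using assms by eventually_elim (auto simp: ind_def)
 show ?thesis by (rule integrable_cong_AE_imp[OF i _ ae]) simp
qed

lemma wd_unique:
 fixes W1 W2 :: "(real, 'b::hilb) lp2"
 assumes W: "wd T U W1" "wd T U W2"
  and s: "AEL t. t\<notin>{0<..<T} --> ap W1 t = 0" "AEL t. t\<notin>{0<..<T} --> ap W2 t = 0"
 shows "W1 = W2"
proof -
 define Z where "Z = W1 - W2"
 have Z0: "AEL t. t\<notin>{0<..<T} --> ap Z t = 0"
  using s ap_diff[of W1 W2] unfolding Z_def by eventually_elim simp
 have "AEL t. t\<in>{0<..<T} --> ap Z t = 0"
 proof (rule AE_zero_if_inner_zero, rule AE_zero_if_test)
  fix e
  have i: "integrable lebesgue (%t. inner (ap Z t) e)" by (rule integrable_inner_on[OF Z0])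
  show "set_integrable lebesgue (cbox a b) (%t. inner (ap Z t) e)" for a b
   unfolding set_integrable_def by (rule integrable_mult_indicator[OF _ i]) simp
  fix ph assume ph: "test_function {0<..<T} ph"
  have "(LL t. ph t *: ap Z t) = 0"
  proof -
   have "(LL t. deriv ph t *: ap U t) = - (LL t. ph t *: ap W1 t)"
    "(LL t. deriv ph t *: ap U t) = - (LL t. ph t *: ap W2 t)"
    using W ph unfolding wd_def by blast+
   thus ?thesis unfolding Z_def integral_mult_diff[OF multf_test(1)[OF ph]] by simp
  qed
  hence "inner (LL t. ph t *: ap Z t) e = 0" by simp
  hence "(LL t. inner (ph t *: ap Z t) e) = 0"
   using integral_inner_left[OF multf_sq_int(2)[OF multf_test(1)[OF ph], of Z]] by simp
  thus "(LL t. inner (ap Z t) e * ph t) = 0" by (simp add: mult.commute)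
 qed simp
 hence "AEL t. ap Z t = ap (0 :: (real, 'b) lp2) t" using Z0 ap_zero[where 'a=real and 'b='b]
  by eventually_elim argo
 thus ?thesis using lp2_eqI[of Z 0] by (simp add: Z_def)
qed

lemma wd_primitive:
 fixes U W :: "(real, 'b::hilb) lp2"
 assumes T: "T > 0" and W: "wd T U W" and s: "AEL t. t\<notin>{0<..<T} --> ap U t = 0"
 shows "\<exists>e0. AEL t. t\<in>{0<..<T} --> ap U t = e0 + prim W t"
proof -
 define Z where "Z = U - intop T W"
 have Z0: "AEL t. t\<notin>{0<..<T} --> ap Z t = 0"
  using s ap_diff[of U "intop T W"] ap_intop[OF T, of W] unfolding Z_def by eventually_elim simp
 define e0 where "e0 = (1 / T) *: (LL t. ind {0<..<T} t *: ap Z t)"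
 have "AEL t. t\<in>{0<..<T} --> ap Z t - e0 = 0"
 proof (rule AE_zero_if_inner_zero)
  fix e
  have i: "integrable lebesgue (%t. inner (ap Z t) e)" by (rule integrable_inner_on[OF Z0])
  have "\<exists>c. AEL t. t\<in>{0<..<T} --> inner (ap Z t) e = c"
  proof (rule du_Bois_Reymond[OF i T])
   fix ph assume ph: "test_function {0<..<T} ph"
   have "(LL t. deriv ph t *: ap Z t) = 0"
    using W wd_intop[OF T, of W] ph unfolding Z_def integral_mult_diff[OF multf_test(2)[OF ph]] wd_def by simp
   hence "inner (LL t. deriv ph t *: ap Z t) e = 0" by simp
   hence "(LL t. inner (deriv ph t *: ap Z t) e) = 0"
    using integral_inner_left[OF multf_sq_int(2)[OF multf_test(2)[OF ph], of Z]] by simp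
   thus "(LL t. inner (ap Z t) e * deriv ph t) = 0" by (simp add: mult.commute)
  qed
  then obtain c where c: "AEL t. t\<in>{0<..<T} --> inner (ap Z t) e = c" by blast
  have "inner (LL t. ind {0<..<T} t *: ap Z t) e = (LL t. inner (ind {0<..<T} t *: ap Z t) e)"
   by (rule integral_inner_left[symmetric]) (rule integrable_indicator_sq, simp_all)
  also have "... = (LL t. ind {0<..<T} t * c)"
   by (rule integral_cong_AE) (simp, simp, use c in eventually_elim, simp add: ind_def)
  also have "... = T * c" using T by simp
  finally have e0: "inner e0 e = c" using T by (simp add: e0_def)
  thus "AEL t. t\<in>{0<..<T} --> inner (ap Z t - e0) e = 0"
   using c by eventually_elim (use e0 in \<open>simp add: inner_diff_left\<close>)
 qed
 hence "AEL t. t\<in>{0<..<T} --> ap U t = e0 + prim W t"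
  using ap_diff[of U "intop T W"] ap_intop[OF T, of W] unfolding Z_def by eventually_elim (auto simp: algebra_simps)
 thus ?thesis by blast
qed

lemma AE_interval_ex:
 fixes T :: real
 assumes "AEL t. t\<in>{0<..<T} --> P t" "0 < d" "d\<le>T"
 shows "\<exists>t\<in>{0<..<d}. P t"
proof (rule ccontr)
 assume no: "\<not> (\<exists>t\<in>{0<..<d}. P t)"
 have "AEL t. t\<notin>{0<..<d}" using assms(1)
 proof eventually_elim
  case (elim t)
  show ?case
  proof
   assume t: "t\<in>{0<..<d}"
   hence "t\<in>{0<..<T}" using assms(3) by simp
   thus False using elim no t by blast
  qed
 qed
 hence "{0<..<d}\<in>null_sets lebesgue" by (subst (asm) AE_iff_null_sets[symmetric]) auto
 hence "emeasure lebesgue {0<..<d} = 0" by auto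
 thus False using assms by simp
qed

locale rep_space =
 fixes X :: "'x nspace" and c :: "('x=>real)=>'b::hilb" and T :: real
 assumes T: "T > 0" and zero_mem: "(%x. 0)\<in>elems X"
  and add_mem: "!!u v. u\<in>elems X ==> v\<in>elems X ==> (%x. u x + v x)\<in>elems X"
  and scale_mem: "!!r u. u\<in>elems X ==> (%x. r * u x)\<in>elems X"
  and c_add: "!!u v. u\<in>elems X ==> v\<in>elems X ==> c (%x. u x + v x) = c u + c v"
  and c_scale: "!!r u. u\<in>elems X ==> c (%x. r * u x) = r *: c u"
  and nrm: "!!u. u\<in>elems X ==> nrm X u = norm (c u)"
  and closed_range: "closed (c ` elems X)"
begin

definition "V = c ` elems X"
definition "ofX v = (SOME u. u\<in>elems X \<and> c u = proj V v)"
definition "cind u = (%t. ind {0<..<T} t *: c (u t))"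
definition "toY u = mk (cind u)"
definition "ofY U = (%t. ofX (ap U t))"
definition "RY U = mulop (ind {0<..<T}) (ptw (proj V) U)"

lemma sub_mem: "u\<in>elems X ==> v\<in>elems X ==> (%x. u x - v x)\<in>elems X"
 using add_mem[of u "%x. (-1) * v x"] scale_mem[of v "-1"] by simp

lemma c_diff: "u\<in>elems X ==> v\<in>elems X ==> c (%x. u x - v x) = c u - c v"
 using c_add[of u "%x. (-1) * v x"] scale_mem[of v "-1"] c_scale[of v "-1"] by simp

lemma V: "subspace V" "closed V"
proof -
 show "closed V" unfolding V_def by (rule closed_range)
 show "subspace V" unfolding subspace_def
 proof (intro conjI ballI allI)
  show "0\<in>V" unfolding V_def using c_scale[OF zero_mem, of 0] zero_mem by (auto intro!: image_eqI[of _ _ "%x. 0"])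
  show "x + y\<in>V" if "x\<in>V" "y\<in>V" for x y using that unfolding V_def by (auto simp: c_add[symmetric] intro!: imageI add_mem)
  show "r *: x\<in>V" if "x\<in>V" for r x using that unfolding V_def by (auto simp: c_scale[symmetric] intro!: imageI scale_mem)
 qed
qed

lemma c_in_V: "u\<in>elems X ==> c u\<in>V" by (simp add: V_def)

lemma projV: "bounded_linear (proj V)" by (rule bounded_linear_proj[OF V])

lemma ofX: "ofX v\<in>elems X" "c (ofX v) = proj V v"
proof -
 have "proj V v\<in>V" by (rule proj_in[OF V])
 hence "\<exists>u. u\<in>elems X \<and> c u = proj V v" unfolding V_def by force
 from someI_ex[OF this] show "ofX v\<in>elems X" "c (ofX v) = proj V v" unfolding ofX_def by auto
qed

lemma sum_mem:
 assumes "!!k. k < m ==> y k\<in>elems X"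
 shows "(%x. \<Sum>k<m::nat. a k * y k x)\<in>elems X \<and> c (%x. \<Sum>k<m. a k * y k x) = (\<Sum>k<m. a k *: c (y k))"
 using assms
proof (induction m)
 case 0 thus ?case using zero_mem c_scale[OF zero_mem, of 0] by simp
next
 case (Suc m)
 hence "(%x. \<Sum>k<m. a k * y k x)\<in>elems X" "y m\<in>elems X" by auto
 thus ?case using Suc by (simp add: add_mem c_add scale_mem c_scale)
qed

lemma simple_int_c:
 assumes "simple_int T X s J"
 shows "s t\<in>elems X" "J\<in>elems X" "t\<notin>{0<..<T} ==> c (s t) = 0"
  "(%t. c (s t))\<in>meas" "integrable lebesgue (%t. c (s t))" "c J = (LL t. c (s t))"
proof -
 obtain m :: nat and E y where E: "!!k. k < m ==> E k\<in>sets lebesgue \<and> E k\<subseteq>{0<..<T} \<and> y k\<in>elems X"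
  and s: "s = (%t x. \<Sum>k<m. ind (E k) t * y k x)" and J: "J = (%x. \<Sum>k<m. measure lebesgue (E k) * y k x)"
  using assms unfolding simple_int_def by blast
 have El: "E k\<in>lmeasurable" if "k < m" for k
  by (rule fmeasurableI2[of "{0<..<T}"]) (use E[OF that] in auto)
 have cs: "c (s t) = (\<Sum>k<m. ind (E k) t *: c (y k))" for t
  unfolding s by (rule sum_mem[THEN conjunct2]) (use E in auto)
 show "s t\<in>elems X" unfolding s by (rule sum_mem[THEN conjunct1]) (use E in auto)
 show "J\<in>elems X" unfolding J by (rule sum_mem[THEN conjunct1]) (use E in auto)
 show "t\<notin>{0<..<T} ==> c (s t) = 0" unfolding cs
 proof (intro sum.neutral ballI)
  fix k assume "t\<notin>{0<..<T}" "k\<in>{..<m}"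
  hence "t\<notin>E k" using E by blast
  thus "ind (E k) t *: c (y k) = 0" by simp
 qed
 have i: "integrable lebesgue (%t. ind (E k) t *: c (y k))" if "k < m" for k
  using El[OF that] by (intro integrable_scaleR_left) (simp add: lmeasurable_iff_integrable)
 have "integrable lebesgue (%t. \<Sum>k<m. ind (E k) t *: c (y k))" using i by (intro Bochner_Integration.integrable_sum) auto
 thus int: "integrable lebesgue (%t. c (s t))" by (simp only: cs)
 thus "(%t. c (s t))\<in>meas" by (rule borel_measurable_integrable)
 have "(LL t. c (s t)) = (\<Sum>k<m. LL t. ind (E k) t *: c (y k))"
  unfolding cs using i by (intro Bochner_Integration.integral_sum) auto
 also have "... = (\<Sum>k<m. measure lebesgue (E k) *: c (y k))"
 proof (rule sum.cong)
  fix k assume "k\<in>{..<m}"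
  hence k: "k < m" by simp
  have "integrable lebesgue (ind (E k) :: real=>real)" using El[OF k] by (simp add: lmeasurable_iff_integrable)
  thus "(LL t. ind (E k) t *: c (y k)) = measure lebesgue (E k) *: c (y k)"
   using El[OF k] by (subst integral_scaleR_left) (auto simp: fmeasurableD)
 qed simp
 also have "... = c J" unfolding J by (rule sum_mem[THEN conjunct2, symmetric]) (use E in auto)
 finally show "c J = (LL t. c (s t))" by simp
qed

lemma simple_approx:
 assumes g: "g\<in>meas" and gV: "!!t. t\<in>{0<..<T} ==> g t\<in>V"
 shows "\<exists>s. (\<forall>n::nat. \<exists>J. simple_int T X (s n) J) \<and> (\<forall>t\<in>{0<..<T}. (%n. c (s n t)) ----> g t) \<and> (\<forall>n t. norm (c (s n t))\<le>2 * norm (g t))"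
proof -
 obtain F where F: "!!i::nat. simple_function lebesgue (F i)" "!!x. (%i. F i x) ----> g x" "!!i x. dist (F i x) 0\<le>2 * dist (g x) 0"
  using borel_measurable_implies_sequence_metric[OF g, of 0] by auto
 have "\<exists>s. (\<exists>J. simple_int T X s J) \<and> (\<forall>t. c (s t) = ind {0<..<T} t *: proj V (F i t))" for i
 proof -
  have fin: "finite (range (F i))" using F(1)[of i] by (simp add: simple_function_def)
  obtain m :: nat and e where e: "bij_betw e {..<m} (range (F i))"
   using ex_bij_betw_nat_finite[OF fin] by (auto simp: atLeast0LessThan)
  define E where "E k = F i -` {e k}\<inter>{0<..<T}" for k
  define s where "s = (%t x. \<Sum>k<m. ind (E k) t * ofX (e k) x)"
  have Em: "E k\<in>sets lebesgue" for k
   using simple_functionD(2)[OF F(1)[of i], of "{e k}"] by (simp add: E_def)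
  have si: "simple_int T X s (%x. \<Sum>k<m. measure lebesgue (E k) * ofX (e k) x)"
   unfolding simple_int_def by (rule exI[of _ m], rule exI[of _ E], rule exI[of _ "%k. ofX (e k)"])
    (use Em in \<open>auto simp: s_def E_def ofX\<close>)
  have "c (s t) = ind {0<..<T} t *: proj V (F i t)" for t
  proof -
   have "c (s t) = (\<Sum>k<m. ind (E k) t *: proj V (e k))"
    unfolding s_def using sum_mem[of m "%k. ofX (e k)" "%k. ind (E k) t"] by (simp add: ofX)
   also have "... = ind {0<..<T} t *: proj V (F i t)"
   proof -
    obtain k0 where k0: "k0 < m" "e k0 = F i t" using e by (metis bij_betw_imp_surj_on imageE lessThan_iff rangeI)
    have "(\<Sum>k<m. ind (E k) t *: proj V (e k)) = (\<Sum>k<m. if k = k0 then ind {0<..<T} t *: proj V (F i t) else 0)"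
    proof (rule sum.cong)
     fix k assume "k\<in>{..<m}"
     hence "e k = F i t \<longleftrightarrow> k = k0" using e k0 by (metis bij_betw_imp_inj_on inj_onD lessThan_iff)
     thus "ind (E k) t *: proj V (e k) = (if k = k0 then ind {0<..<T} t *: proj V (F i t) else 0)"
      by (auto simp: E_def ind_def)
    qed simp
    thus ?thesis using k0 by simp
   qed
   finally show ?thesis .
  qed
  thus ?thesis using si by blast
 qed
 then obtain s where s: "!!i. \<exists>J. simple_int T X (s i) J" "!!i t. c (s i t) = ind {0<..<T} t *: proj V (F i t)" by metis
 show ?thesis
 proof (intro exI[of _ s] conjI ballI allI s(1))
  fix t assume t: "t\<in>{0<..<T}"
  have "(%n. proj V (F n t)) ----> proj V (g t)" by (rule bounded_linear.tendsto[OF projV F(2)])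
  thus "(%n. c (s n t)) ----> g t" using t by (simp add: s(2) proj_id[OF V gV])
 next
  fix n t
  have "norm (c (s n t))\<le>norm (proj V (F n t))" by (simp add: s(2) ind_def)
  also have "...\<le>norm (F n t)" by (rule proj_norm_le[OF V])
  also have "...\<le>2 * norm (g t)" using F(3)[of n t] by simp
  finally show "norm (c (s n t))\<le>2 * norm (g t)" .
 qed
qed

lemma strongly_meas_iff:
 "strongly_meas T X u \<longleftrightarrow> (AEL t. t\<in>{0<..<T} --> u t\<in>elems X) \<and> cind u\<in>meas"
proof
 assume "strongly_meas T X u"
 then obtain s where u: "AEL t. t\<in>{0<..<T} --> u t\<in>elems X" and s: "!!n::nat. \<exists>J. simple_int T X (s n) J"
  and lim: "AEL t. t\<in>{0<..<T} --> (%n. nrm X (%x. u t x - s n t x)) ----> 0"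
  unfolding strongly_meas_def AE_tm by blast
 have sm: "(%t. c (s n t))\<in>meas" for n using s[of n] simple_int_c(4) by blast
 have "AEL t. (%n. c (s n t)) ----> cind u t"
  using u lim
 proof eventually_elim
  case (elim t)
  show ?case
  proof (cases "t\<in>{0<..<T}")
   case True
   have "nrm X (%x. u t x - s n t x) = norm (c (u t) - c (s n t))" for n
    using elim True s[of n] simple_int_c(1) by (metis nrm sub_mem c_diff)
   hence "(%n. norm (c (s n t) - c (u t))) ----> 0" using elim True by (simp add: norm_minus_commute)
   thus ?thesis using True by (simp add: cind_def LIM_zero_iff tendsto_norm_zero_iff)
  next
   case False
   hence "c (s n t) = 0" for n using s[of n] simple_int_c(3) by blast
   thus ?thesis using False by (simp add: cind_def)
  qed
 qed
 hence "cind u\<in>meas" by (rule measurable_AE_limit[OF sm])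
 thus "(AEL t. t\<in>{0<..<T} --> u t\<in>elems X) \<and> cind u\<in>meas" using u by blast
next
 assume "(AEL t. t\<in>{0<..<T} --> u t\<in>elems X) \<and> cind u\<in>meas"
 hence u: "AEL t. t\<in>{0<..<T} --> u t\<in>elems X" and m: "cind u\<in>meas" by auto
 obtain s where s: "!!n::nat. \<exists>J. simple_int T X (s n) J" and lim: "!!t. t\<in>{0<..<T} ==> (%n. c (s n t)) ----> proj V (cind u t)"
  using simple_approx[OF borel_measurable_ptw_comp[OF projV m]] proj_in[OF V] by blast
 have "AEL t. t\<in>{0<..<T} --> (%n. nrm X (%x. u t x - s n t x)) ----> 0"
  using u
 proof eventually_elim
  case (elim t)
  show ?case
  proof
   assume t: "t\<in>{0<..<T}"
   have ut: "u t\<in>elems X" using elim t by blast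
   have "proj V (cind u t) = c (u t)" using t c_in_V[OF ut] by (simp add: cind_def proj_id[OF V])
   hence "(%n. c (s n t)) ----> c (u t)" using lim[OF t] by simp
   hence "(%n. norm (c (u t) - c (s n t))) ----> norm (c (u t) - c (u t))" by (intro tendsto_intros)
   moreover have "nrm X (%x. u t x - s n t x) = norm (c (u t) - c (s n t))" for n
    using ut s[of n] simple_int_c(1) by (metis nrm sub_mem c_diff)
   ultimately show "(%n. nrm X (%x. u t x - s n t x)) ----> 0" by simp
  qed
 qed
 thus "strongly_meas T X u" unfolding strongly_meas_def AE_tm using u s by blast
qed

lemma AE_nrm:
 assumes "AEL t. t\<in>{0<..<T} --> u t\<in>elems X"
 shows "AEL t. ind {0<..<T} t *: (nrm X (u t))^2 = (norm (cind u t))^2"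
 using assms by eventually_elim (auto simp: cind_def nrm ind_def)

lemma BL2_iff: "u\<in>BL2 T X \<longleftrightarrow> (AEL t. t\<in>{0<..<T} --> u t\<in>elems X) \<and> sq_int (cind u)"
proof
 assume "u\<in>BL2 T X"
 hence u: "AEL t. t\<in>{0<..<T} --> u t\<in>elems X" and m: "cind u\<in>meas"
  and i: "integrable lebesgue (%t. ind {0<..<T} t *: (nrm X (u t))^2)"
  unfolding BL2_def strongly_meas_iff integrable_tm by auto
 have "integrable lebesgue (%t. (norm (cind u t))^2)"
  by (rule integrable_cong_AE_imp[OF i _ AE_nrm[OF u]]) (use m in measurable)
 thus "(AEL t. t\<in>{0<..<T} --> u t\<in>elems X) \<and> sq_int (cind u)" using u m by (simp add: sq_int_def)
next
 assume "(AEL t. t\<in>{0<..<T} --> u t\<in>elems X) \<and> sq_int (cind u)"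
 hence u: "AEL t. t\<in>{0<..<T} --> u t\<in>elems X" and s: "sq_int (cind u)" by auto
 have ae: "AEL t. (norm (cind u t))^2 = ind {0<..<T} t *: (nrm X (u t))^2"
  using AE_nrm[OF u] by eventually_elim simp
 have m: "(%t. (norm (cind u t))^2)\<in>meas" using sq_intD[OF s] by measurable
 have "integrable lebesgue (%t. ind {0<..<T} t *: (nrm X (u t))^2)"
  by (rule integrable_cong_AE_imp[OF sq_int_integrable[OF s] measurable_AE_eq[OF m AE_nrm[OF u]] ae])
 thus "u\<in>BL2 T X" unfolding BL2_def strongly_meas_iff integrable_tm using u sq_intD[OF s] by simp
qed

lemma BL2D: "u\<in>BL2 T X ==> AEL t. t\<in>{0<..<T} --> u t\<in>elems X" "u\<in>BL2 T X ==> sq_int (cind u)"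
 by (auto simp: BL2_iff)

lemma ap_toY: "u\<in>BL2 T X ==> AEL t. ap (toY u) t = ind {0<..<T} t *: c (u t)"
 unfolding toY_def using ap_mk[OF BL2D(2)] by (simp add: cind_def)

lemma norm_toY:
 assumes "u\<in>BL2 T X"
 shows "nrm_BL2 T X u = norm (toY u)"
proof -
 have "(LINT t|tm T. (nrm X (u t))^2) = (LL t. (norm (cind u t))^2)"
  unfolding integral_tm
 proof (rule integral_cong_AE[OF _ _ AE_nrm[OF BL2D(1)[OF assms]]])
  show m: "(%t. (norm (cind u t))^2)\<in>meas" using sq_intD[OF BL2D(2)[OF assms]] by measurable
  show "(%t. ind {0<..<T} t *: (nrm X (u t))^2)\<in>meas"
   by (rule measurable_AE_eq[OF m AE_nrm[OF BL2D(1)[OF assms]]])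
 qed
 also have "... = (norm (toY u))^2" unfolding toY_def by (rule norm_mk_square[OF BL2D(2)[OF assms], symmetric])
 finally show ?thesis by (simp add: nrm_BL2_def)
qed

lemma BL2_toYI:
 assumes "AEL t. t\<in>{0<..<T} --> u t\<in>elems X \<and> c (u t) = ap U t" "AEL t. t\<notin>{0<..<T} --> ap U t = 0"
 shows "u\<in>BL2 T X" "toY u = U"
proof -
 have ae: "AEL t. cind u t = ap U t" using assms by eventually_elim (auto simp: cind_def ind_def)
 have s: "sq_int (cind u)" by (rule sq_int_cong_AE[OF measurable_AE_eq[OF ap_measurable ae] sq_int_ap ae])
 show "u\<in>BL2 T X" unfolding BL2_iff using assms(1) s by (auto elim: eventually_mono)
 show "toY u = U" unfolding toY_def by (rule lp2_eqI) (use ap_mk[OF s] ae in eventually_elim, simp)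
qed

lemma toY_supp: "u\<in>BL2 T X ==> AEL t. t\<notin>{0<..<T} --> ap (toY u) t = 0"
 by (drule ap_toY, erule eventually_mono) simp

lemma BL2_lincomb:
 assumes u: "u\<in>BL2 T X" and v: "v\<in>BL2 T X"
 shows "(%t x. u t x + r * v t x)\<in>BL2 T X" "toY (%t x. u t x + r * v t x) = toY u + r *: toY v"
proof -
 have "AEL t. t\<in>{0<..<T} --> (%x. u t x + r * v t x)\<in>elems X \<and> c (%x. u t x + r * v t x) = ap (toY u + r *: toY v) t"
  using BL2D(1)[OF u] BL2D(1)[OF v] ap_toY[OF u] ap_toY[OF v] ap_add[of "toY u" "r *: toY v"] ap_scaleR[of r "toY v"]
  by eventually_elim (auto simp: c_add c_scale scale_mem add_mem)
 moreover have "AEL t. t\<notin>{0<..<T} --> ap (toY u + r *: toY v) t = 0"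
  using ap_toY[OF u] ap_toY[OF v] ap_add[of "toY u" "r *: toY v"] ap_scaleR[of r "toY v"] by eventually_elim auto
 ultimately show "(%t x. u t x + r * v t x)\<in>BL2 T X" "toY (%t x. u t x + r * v t x) = toY u + r *: toY v"
  using BL2_toYI[of "%t x. u t x + r * v t x"] by auto
qed

lemma BL2_diff:
 assumes "u\<in>BL2 T X" "v\<in>BL2 T X"
 shows "(%t x. u t x - v t x)\<in>BL2 T X" "toY (%t x. u t x - v t x) = toY u - toY v"
 using BL2_lincomb[OF assms, of "-1"] by auto

lemma BL2_zero: "(%t x. 0)\<in>BL2 T X" "toY (%t x. 0) = 0"
proof -
 have z: "AEL t. ap (0 :: (real, 'b) lp2) t = 0" by (rule ap_zero)
 hence "AEL t. t\<in>{0<..<T} --> (%x. 0)\<in>elems X \<and> c (%x. 0) = ap (0 :: (real, 'b) lp2) t"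
  by eventually_elim (use zero_mem c_scale[OF zero_mem, of 0] in simp)
 moreover have "AEL t. t\<notin>{0<..<T} --> ap (0 :: (real, 'b) lp2) t = 0" using z by eventually_elim simp
 ultimately show "(%t x. 0)\<in>BL2 T X" "toY (%t x. 0) = 0" using BL2_toYI[of "%t x. 0" 0] by auto
qed

lemma BL2_scale:
 assumes "v\<in>BL2 T X"
 shows "(%t x. r * v t x)\<in>BL2 T X" "toY (%t x. r * v t x) = r *: toY v"
 using BL2_lincomb[OF BL2_zero(1) assms, of r] BL2_zero(2) by auto

lemma BL2_add:
 assumes "u\<in>BL2 T X" "v\<in>BL2 T X"
 shows "(%t x. u t x + v t x)\<in>BL2 T X" "toY (%t x. u t x + v t x) = toY u + toY v"
 using BL2_lincomb[OF assms, of 1] by auto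

lemma indm: "(ind {0<..<T} :: real=>real)\<in>meas" "\<bar>ind {0<..<T} t :: real\<bar>\<le>1"
 by (auto simp: ind_def)

lemma ap_RY: "AEL t. ap (RY U) t = ind {0<..<T} t *: proj V (ap U t)"
 using ap_mulop[OF indm, of "ptw (proj V) U"] ap_ptw[OF projV, of U] unfolding RY_def by eventually_elim simp

lemma RY_linear: "bounded_linear RY"
 unfolding RY_def[abs_def] by (intro bounded_linear_compose[OF bounded_linear_mulop[OF indm]] bounded_linear_ptw projV)

lemma RY_sym: "inner (RY U) W = inner U (RY W)"
 unfolding inner_lp2_def
 by (rule integral_cong_AE) (simp, simp, use ap_RY[of U] ap_RY[of W] in eventually_elim, simp add: proj_selfadjoint[OF V])

lemma norm_RY_le: "norm (RY U)\<le>norm U"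
proof -
 have "norm (RY U)\<le>1 * norm U"
  by (rule norm_ap_le) (simp, use ap_RY[of U] in eventually_elim, simp add: ind_def proj_norm_le[OF V])
 thus ?thesis by simp
qed

lemma ofY: "ofY U\<in>BL2 T X" "toY (ofY U) = RY U"
proof -
 have "AEL t. t\<in>{0<..<T} --> ofY U t\<in>elems X \<and> c (ofY U t) = ap (RY U) t"
  using ap_RY[of U] by eventually_elim (simp add: ofY_def ofX)
 moreover have "AEL t. t\<notin>{0<..<T} --> ap (RY U) t = 0" using ap_RY[of U] by eventually_elim simp
 ultimately show "ofY U\<in>BL2 T X" "toY (ofY U) = RY U" using BL2_toYI[of "ofY U" "RY U"] by auto
qed

lemma RY_toY: "u\<in>BL2 T X ==> RY (toY u) = toY u"
 by (rule lp2_eqI) (use ap_RY[of "toY u"] ap_toY[of u] BL2D(1)[of u] in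
   \<open>auto elim!: eventually_elim2 simp: ind_def proj_id[OF V c_in_V] linear_0[OF bounded_linear.linear[OF projV]]\<close>)

lemma RY_RY: "RY (RY U) = RY U"
 using RY_toY[OF ofY(1)[of U]] by (simp add: ofY(2))

lemma RY_supp: "RY U = U ==> AEL t. t\<notin>{0<..<T} --> ap U t = 0"
 using ap_RY[of U] by (auto elim!: eventually_mono)

lemma RY_in_V: "RY U = U ==> AEL t. ap U t\<in>V"
proof -
 assume "RY U = U"
 hence "AEL t. ap U t = ind {0<..<T} t *: proj V (ap U t)" using ap_RY[of U] by simp
 thus ?thesis by eventually_elim (metis subspace_scale[OF V(1) proj_in[OF V]])
qed

lemma toY_eq_iff:
 assumes "u\<in>BL2 T X" "v\<in>BL2 T X"
 shows "toY u = toY v \<longleftrightarrow> nrm_BL2 T X (%t x. u t x - v t x) = 0"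
 using norm_toY[OF BL2_diff(1)[OF assms]] BL2_diff(2)[OF assms] by simp

lemma multf_BL2:
 assumes u: "u\<in>BL2 T X" and h: "multf T h"
 shows "(%t x. h t * u t x)\<in>BL2 T X" "AEL t. cind (%t x. h t * u t x) t = h t *: ap (toY u) t"
proof -
 obtain M where h': "h\<in>meas" "!!t. \<bar>h t\<bar>\<le>M" using h unfolding multf_def by blast
 have ae: "AEL t. ap (mulop h (toY u)) t = h t *: ap (toY u) t" by (rule ap_mulop[OF h'])
 have "AEL t. t\<in>{0<..<T} --> (%x. h t * u t x)\<in>elems X \<and> c (%x. h t * u t x) = ap (mulop h (toY u)) t"
  using ae BL2D(1)[OF u] ap_toY[OF u] by eventually_elim (auto simp: scale_mem c_scale)
 moreover have "AEL t. t\<notin>{0<..<T} --> ap (mulop h (toY u)) t = 0"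
  using ae ap_toY[OF u] by eventually_elim auto
 ultimately have b: "(%t x. h t * u t x)\<in>BL2 T X" "toY (%t x. h t * u t x) = mulop h (toY u)"
  using BL2_toYI[of "%t x. h t * u t x" "mulop h (toY u)"] by auto
 thus "(%t x. h t * u t x)\<in>BL2 T X" by simp
 show "AEL t. cind (%t x. h t * u t x) t = h t *: ap (toY u) t"
  using ap_mk[OF BL2D(2)[OF b(1)], folded toY_def] ae unfolding b(2) by eventually_elim simp
qed

lemma integral_cind_in_V:
 assumes w: "w\<in>BL2 T X"
 shows "integrable lebesgue (cind w)" "(LL t. cind w t)\<in>V"
proof -
 have "integrable lebesgue (%t. ind {0<..<T} t *: cind w t)" by (rule integrable_indicator_sq[OF BL2D(2)[OF w]]) simp
 moreover have "(%t. ind {0<..<T} t *: cind w t) = cind w" by (auto simp: cind_def ind_def fun_eq_iff)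
 ultimately show i: "integrable lebesgue (cind w)" by simp
 have "proj V (LL t. cind w t) = (LL t. proj V (cind w t))"
  by (rule integral_bounded_linear[OF projV i, symmetric])
 also have "... = (LL t. cind w t)"
 proof (rule integral_cong_AE)
  show "(%t. proj V (cind w t))\<in>meas"
   by (rule borel_measurable_ptw_comp[OF projV sq_intD[OF BL2D(2)[OF w]]])
  show "cind w\<in>meas" by (rule sq_intD[OF BL2D(2)[OF w]])
  show "AEL t. proj V (cind w t) = cind w t"
   using BL2D(1)[OF w] by eventually_elim
    (auto simp: cind_def ind_def proj_id[OF V c_in_V] linear_0[OF bounded_linear.linear[OF projV]])
 qed
 finally show "(LL t. cind w t)\<in>V" using proj_in[OF V] by metis
qed

lemma has_bochner_int_iff:
 assumes w: "w\<in>BL2 T X"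
 shows "has_bochner_int T X w I \<longleftrightarrow> I\<in>elems X \<and> c I = (LL t. cind w t)"
proof
 assume "has_bochner_int T X w I"
 then obtain s J where I: "I\<in>elems X" and s: "!!n::nat. simple_int T X (s n) (J n)"
  and ii: "!!n. integrable (tm T) (%t. nrm X (%x. w t x - s n t x))"
  and l1: "(%n. LINT t|tm T. nrm X (%x. w t x - s n t x)) ----> 0" and l2: "(%n. nrm X (%x. J n x - I x)) ----> 0"
  unfolding has_bochner_int_def by blast
 have sc: "cind (s n) = (%t. c (s n t))" for n
  using simple_int_c(3)[OF s[of n]] by (auto simp: cind_def ind_def fun_eq_iff)
 have "norm ((LL t. cind w t) - c (J n))\<le>(LINT t|tm T. nrm X (%x. w t x - s n t x))" for n
 proof -
  have "(LL t. cind w t) - c (J n) = (LL t. cind w t - c (s n t))"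
   using integral_cind_in_V(1)[OF w] simple_int_c(5,6)[OF s[of n]] by simp
  hence "norm ((LL t. cind w t) - c (J n))\<le>(LL t. norm (cind w t - c (s n t)))"
   using integral_norm_bound by metis
  also have "... = (LL t. ind {0<..<T} t *: nrm X (%x. w t x - s n t x))"
  proof (rule integral_cong_AE)
   show "(%t. norm (cind w t - c (s n t)))\<in>meas"
    using sq_intD[OF BL2D(2)[OF w]] simple_int_c(4)[OF s[of n]] by measurable
   show "(%t. ind {0<..<T} t *: nrm X (%x. w t x - s n t x))\<in>meas"
    using ii[of n] unfolding integrable_tm by (rule borel_measurable_integrable)
   show "AEL t. norm (cind w t - c (s n t)) = ind {0<..<T} t *: nrm X (%x. w t x - s n t x)"
    using BL2D(1)[OF w]
   proof eventually_elim
    case (elim t)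
    show ?case
    proof (cases "t\<in>{0<..<T}")
     case True
     thus ?thesis using elim simple_int_c(1)[OF s[of n], of t] by (simp add: cind_def nrm sub_mem c_diff)
    next
     case False
     thus ?thesis using simple_int_c(3)[OF s[of n], of t] by (simp add: cind_def)
    qed
   qed
  qed
  finally show ?thesis by (simp add: integral_tm)
 qed
 hence "(%n. norm ((LL t. cind w t) - c (J n))) ----> 0"
  by (intro Lim_null_comparison[OF _ l1] always_eventually) auto
 hence "(%n. c (J n)) ----> (LL t. cind w t)"
  by (simp add: norm_minus_commute LIM_zero_iff tendsto_norm_zero_iff)
 moreover have "nrm X (%x. J n x - I x) = norm (c (J n) - c I)" for n
  using simple_int_c(2)[OF s[of n]] I by (simp add: nrm sub_mem c_diff)
 hence "(%n. c (J n)) ----> c I" using l2 by (simp add: LIM_zero_iff tendsto_norm_zero_iff)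
 ultimately show "I\<in>elems X \<and> c I = (LL t. cind w t)" using I LIMSEQ_unique by blast
next
 assume "I\<in>elems X \<and> c I = (LL t. cind w t)"
 hence I: "I\<in>elems X" "c I = (LL t. cind w t)" by auto
 have m: "cind w\<in>meas" by (rule sq_intD[OF BL2D(2)[OF w]])
 obtain s where s: "!!n::nat. \<exists>J. simple_int T X (s n) J" and lim: "!!t. t\<in>{0<..<T} ==> (%n. c (s n t)) ----> proj V (cind w t)"
  and bd: "!!n t. norm (c (s n t))\<le>2 * norm (proj V (cind w t))"
  using simple_approx[OF borel_measurable_ptw_comp[OF projV m]] proj_in[OF V] by blast
 obtain J where J: "!!n. simple_int T X (s n) (J n)" using s by metis
 have bd': "norm (c (s n t))\<le>2 * norm (cind w t)" for n t
  using bd[of n t] proj_norm_le[OF V, of "cind w t"] by linarith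
 have lim': "AEL t. (%n. c (s n t)) ----> cind w t"
  using BL2D(1)[OF w]
 proof eventually_elim
  case (elim t)
  show ?case
  proof (cases "t\<in>{0<..<T}")
   case True
   thus ?thesis using lim[OF True] elim by (simp add: cind_def proj_id[OF V c_in_V])
  next
   case False
   thus ?thesis using simple_int_c(3)[OF J] by (simp add: cind_def)
  qed
 qed
 have iw: "integrable lebesgue (%t. norm (cind w t))" using integral_cind_in_V(1)[OF w] by simp
 have ae: "AEL t. norm (cind w t - c (s n t)) = ind {0<..<T} t *: nrm X (%x. w t x - s n t x)" for n
  using BL2D(1)[OF w]
 proof eventually_elim
  case (elim t)
  show ?case
  proof (cases "t\<in>{0<..<T}")
   case True
   thus ?thesis using elim simple_int_c(1)[OF J[of n], of t] by (simp add: cind_def nrm sub_mem c_diff)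
  next
   case False
   thus ?thesis using simple_int_c(3)[OF J[of n], of t] by (simp add: cind_def)
  qed
 qed
 have id: "integrable lebesgue (%t. norm (cind w t - c (s n t)))" for n
  using integral_cind_in_V(1)[OF w] simple_int_c(5)[OF J[of n]] by simp
 have md: "(%t. ind {0<..<T} t *: nrm X (%x. w t x - s n t x))\<in>meas" for n
  by (rule measurable_AE_eq[OF borel_measurable_integrable[OF id[of n]]]) (use ae[of n] in eventually_elim, simp)
 show "has_bochner_int T X w I"
  unfolding has_bochner_int_def
 proof (intro conjI exI[of _ s] exI[of _ J] allI I(1) J)
  show "strongly_meas T X w" using w by (simp add: BL2_def)
  show "integrable (tm T) (%t. nrm X (%x. w t x - s n t x))" for n
   unfolding integrable_tm by (rule integrable_cong_AE_imp[OF id[of n] md[of n] ae[of n]])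
  have "(%n. LL t. norm (cind w t - c (s n t))) ----> (LL t. norm (cind w t - cind w t))"
  proof (rule integral_dominated_convergence[where w="%t. 3 * norm (cind w t)"])
   show "AEL t. (%n. norm (cind w t - c (s n t))) ----> norm (cind w t - cind w t)"
    using lim' by eventually_elim (intro tendsto_intros)
   show "AEL t. norm (norm (cind w t - c (s n t)))\<le>3 * norm (cind w t)" for n
   proof (rule AE_I2)
    fix t show "norm (norm (cind w t - c (s n t)))\<le>3 * norm (cind w t)"
     using norm_triangle_ineq4[of "cind w t" "c (s n t)"] bd'[of n t] by simp
   qed
  qed (use id iw in auto)
  moreover have "(LL t. norm (cind w t - c (s n t))) = (LINT t|tm T. nrm X (%x. w t x - s n t x))" for n
   unfolding integral_tm by (rule integral_cong_AE[OF borel_measurable_integrable[OF id[of n]] md[of n] ae[of n]])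
  ultimately show "(%n. LINT t|tm T. nrm X (%x. w t x - s n t x)) ----> 0" by simp
  have "(%n. LL t. c (s n t)) ----> (LL t. cind w t)"
   by (rule integral_dominated_convergence[where w="%t. 2 * norm (cind w t)"])
    (use m simple_int_c(4)[OF J] iw lim' bd' in auto)
  hence "(%n. norm (c (J n) - c I)) ----> norm (c I - c I)"
   unfolding simple_int_c(6)[OF J] I(2) by (intro tendsto_intros)
  moreover have "nrm X (%x. J n x - I x) = norm (c (J n) - c I)" for n
   using simple_int_c(2)[OF J[of n]] I(1) by (simp add: nrm sub_mem c_diff)
  ultimately show "(%n. nrm X (%x. J n x - I x)) ----> 0" by simp
 qed
qed

lemma is_weak_dt_iff:
 assumes u: "u\<in>BL2 T X"
 shows "is_weak_dt T X u v \<longleftrightarrow> v\<in>BL2 T X \<and> wd T (toY u) (toY v)"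
proof (cases "v\<in>BL2 T X")
 case v: True
 have "(\<exists>I. has_bochner_int T X (%t x. deriv ph t * u t x) I \<and> has_bochner_int T X (%t x. - (ph t * v t x)) I)
   \<longleftrightarrow> (LL t. deriv ph t *: ap (toY u) t) = - (LL t. ph t *: ap (toY v) t)"
  if ph: "test_function {0<..<T} ph" for ph
 proof -
  note m' = multf_BL2[OF u multf_test(2)[OF ph]]
  have "multf T (%t. - ph t)" using multf_test(1)[OF ph] by (auto simp: multf_def)
  note m = multf_BL2[OF v this]
  have 1: "(LL t. cind (%t x. deriv ph t * u t x) t) = (LL t. deriv ph t *: ap (toY u) t)"
   by (rule integral_cong_AE[OF sq_intD[OF BL2D(2)[OF m'(1)]] _ m'(2)])
    (rule borel_measurable_scaleR, use multf_test(2)[OF ph] in \<open>simp_all add: multf_def\<close>)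
  have "(LL t. cind (%t x. - ph t * v t x) t) = (LL t. - ph t *: ap (toY v) t)"
   by (rule integral_cong_AE[OF sq_intD[OF BL2D(2)[OF m(1)]] _ m(2)])
    (rule borel_measurable_scaleR, use multf_test(1)[OF ph] in \<open>simp_all add: multf_def\<close>)
  hence 2: "(LL t. cind (%t x. - (ph t * v t x)) t) = - (LL t. ph t *: ap (toY v) t)" by simp
  have m1: "(%t x. - (ph t * v t x))\<in>BL2 T X" using m(1) by simp
  obtain I where I: "I\<in>elems X" "c I = (LL t. cind (%t x. deriv ph t * u t x) t)"
   using integral_cind_in_V(2)[OF m'(1)] unfolding V_def by force
  show ?thesis unfolding has_bochner_int_iff[OF m'(1)] has_bochner_int_iff[OF m1] using I 1 2 by auto
 qed
 thus ?thesis unfolding is_weak_dt_def wd_def using v by blast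
qed (simp add: is_weak_dt_def)

lemma BH1_iff: "u\<in>BH1 T X \<longleftrightarrow> u\<in>BL2 T X \<and> (\<exists>v\<in>BL2 T X. wd T (toY u) (toY v))"
 unfolding BH1_def using is_weak_dt_iff by auto

lemma weak_dt:
 assumes "u\<in>BH1 T X"
 shows "u\<in>BL2 T X" "weak_dt T X u\<in>BL2 T X" "wd T (toY u) (toY (weak_dt T X u))"
proof -
 show u: "u\<in>BL2 T X" using assms by (simp add: BH1_def)
 have "\<exists>v. is_weak_dt T X u v" using assms by (simp add: BH1_def)
 hence "is_weak_dt T X u (weak_dt T X u)" unfolding weak_dt_def by (rule someI_ex)
 thus "weak_dt T X u\<in>BL2 T X" "wd T (toY u) (toY (weak_dt T X u))" using is_weak_dt_iff[OF u] by auto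
qed

lemma BH1I:
 assumes u: "u\<in>BL2 T X" and v: "v\<in>BL2 T X" and w: "wd T (toY u) (toY v)"
 shows "u\<in>BH1 T X" "toY (weak_dt T X u) = toY v"
proof -
 show b: "u\<in>BH1 T X" using BH1_iff assms by blast
 show "toY (weak_dt T X u) = toY v"
  by (rule wd_unique[OF weak_dt(3)[OF b] w toY_supp[OF weak_dt(2)[OF b]] toY_supp[OF v]])
qed

lemma BH1_lincomb:
 assumes u: "u\<in>BH1 T X" and v: "v\<in>BH1 T X"
 shows "(%t x. u t x + r * v t x)\<in>BH1 T X"
  "toY (weak_dt T X (%t x. u t x + r * v t x)) = toY (weak_dt T X u) + r *: toY (weak_dt T X v)"
proof -
 note b = BL2_lincomb[OF weak_dt(1)[OF u] weak_dt(1)[OF v], of r] and d = BL2_lincomb[OF weak_dt(2)[OF u] weak_dt(2)[OF v], of r]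
 have "wd T (toY (%t x. u t x + r * v t x)) (toY (%t x. weak_dt T X u t x + r * weak_dt T X v t x))"
  unfolding b(2) d(2) by (rule wd_add_scaleR[OF weak_dt(3)[OF u] weak_dt(3)[OF v]])
 from BH1I[OF b(1) d(1) this] show "(%t x. u t x + r * v t x)\<in>BH1 T X"
  "toY (weak_dt T X (%t x. u t x + r * v t x)) = toY (weak_dt T X u) + r *: toY (weak_dt T X v)" by (simp_all add: d(2))
qed

lemma nrm_BH1_square: "u\<in>BH1 T X ==> (nrm_BH1 T X u)^2 = (norm (toY u))^2 + (norm (toY (weak_dt T X u)))^2"
 by (simp add: nrm_BH1_def norm_toY weak_dt)

lemma BH1_van_zero:
 assumes q: "q\<in>BH1_van 0 T X"
 shows "toY q = intop T (toY (weak_dt T X q))"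
proof -
 define W where "W = toY (weak_dt T X q)"
 have qH: "q\<in>BH1 T X" using q by (simp add: BH1_van_def)
 obtain C where C: "!!t. t\<in>{0..T} ==> C t\<in>elems X" "!!t. t\<in>{0..T} ==> ((%s. nrm X (%x. C s x - C t x)) \<longlongrightarrow> 0) (at t within {0..T})"
  and ae: "AEL t. t\<in>{0<..<T} --> nrm X (%x. q t x - C t x) = 0" and C0: "nrm X (C 0) = 0"
  using q unfolding BH1_van_def AE_tm by blast
 obtain e0 where e0: "AEL t. t\<in>{0<..<T} --> ap (toY q) t = e0 + prim W t"
  using wd_primitive[OF T weak_dt(3)[OF qH] toY_supp[OF weak_dt(1)[OF qH]]] unfolding W_def by blast
 have cC: "AEL t. t\<in>{0<..<T} --> c (C t) = e0 + prim W t"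
  using e0 ae ap_toY[OF weak_dt(1)[OF qH]] BL2D(1)[OF weak_dt(1)[OF qH]]
 proof eventually_elim
  case (elim t)
  show ?case
  proof
   assume t: "t\<in>{0<..<T}"
   hence "C t\<in>elems X" using C(1)[of t] by auto
   hence "nrm X (%x. q t x - C t x) = norm (c (q t) - c (C t))" using elim t by (simp add: nrm sub_mem c_diff)
   hence "norm (c (q t) - c (C t)) = 0" using elim t by simp
   thus "c (C t) = e0 + prim W t" using elim t by simp
  qed
 qed
 have T0: "0\<in>{0..T}" using T by simp
 have c0: "c (C 0) = 0" using C0 nrm[OF C(1)[OF T0]] by simp
 have "e0 = 0"
 proof (rule ccontr)
  assume "e0\<noteq>0"
  hence n: "norm e0 / 2 > 0" by simp
  have "\<forall>\<^sub>F s in at 0 within {0..T}. nrm X (%x. C s x - C 0 x) < norm e0 / 2"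
   using C(2)[OF T0] n by (rule order_tendstoD)
  then obtain d1 where d1: "d1 > 0" "!!s. s\<in>{0..T} ==> s\<noteq>0 ==> dist s 0 < d1 ==> nrm X (%x. C s x - C 0 x) < norm e0 / 2"
   unfolding eventually_at by blast
  have "isCont (prim W) 0" using continuous_on_prim[of UNIV W] by (simp add: continuous_on_eq_continuous_at)
  hence "\<forall>\<^sub>F s in at 0. dist (prim W s) (prim W 0) < norm e0 / 2" using n unfolding isCont_def by (rule tendstoD)
  then obtain d2 where d2: "d2 > 0" "!!s. s\<noteq>0 ==> dist s 0 < d2 ==> dist (prim W s) (prim W 0) < norm e0 / 2"
   unfolding eventually_at by blast
  define d where "d = min T (min d1 d2)"
  have d: "d > 0" "d\<le>T" using T d1 d2 by (auto simp: d_def)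
  obtain s where s: "s\<in>{0<..<d}" "c (C s) = e0 + prim W s" using AE_interval_ex[OF cC d] by blast
  have sT: "s\<in>{0..T}" "s\<noteq>0" "dist s 0 < d1" "dist s 0 < d2" using s d by (auto simp: d_def dist_real_def)
  have "nrm X (%x. C s x - C 0 x) = norm (c (C s))"
   using C(1)[OF sT(1)] C(1)[OF T0] c0 by (simp add: nrm sub_mem c_diff)
  hence "norm (e0 + prim W s) < norm e0 / 2" using d1(2)[OF sT(1,2,3)] s by simp
  moreover have "prim W 0 = 0" by (simp add: prim_def)
  hence "norm (prim W s) < norm e0 / 2" using d2(2)[OF sT(2,4)] by simp
  moreover have "norm e0\<le>norm (e0 + prim W s) + norm (prim W s)"
   using norm_triangle_ineq4[of "e0 + prim W s" "prim W s"] by simp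
  ultimately show False by linarith
 qed
 show ?thesis
  unfolding W_def[symmetric]
 proof (intro lp2_eqI)
  show "AEL t. ap (toY q) t = ap (intop T W) t"
   using e0 ap_intop[OF T, of W] toY_supp[OF weak_dt(1)[OF qH]]
  proof eventually_elim
   case (elim t)
   thus ?case by (cases "t\<in>{0<..<T}") (simp_all add: \<open>e0 = 0\<close>)
  qed
 qed
qed

lemma BH1_vanI:
 assumes U: "RY U = U" and W: "RY W = W" and wd: "wd T U W" and ta: "ta\<in>{0..T}"
  and C: "continuous_on {0..T} C" "!!t. t\<in>{0..T} ==> C t\<in>V" "C ta = 0"
  and UC: "AEL t. t\<in>{0<..<T} --> ap U t = C t"
 shows "ofY U\<in>BH1_van ta T X" "toY (weak_dt T X (ofY U)) = W"
proof -
 have b: "ofY U\<in>BH1 T X" "toY (weak_dt T X (ofY U)) = toY (ofY W)"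
  using BH1I[OF ofY(1)[of U] ofY(1)[of W]] wd U W by (auto simp: ofY(2))
 thus "toY (weak_dt T X (ofY U)) = W" by (simp add: ofY(2) W)
 have cC: "c (ofX (C t)) = C t" if "t\<in>{0..T}" for t using C(2)[OF that] by (simp add: ofX proj_id[OF V])
 have nd: "nrm X (%x. ofX (C s) x - ofX (C t) x) = norm (C s - C t)" if "s\<in>{0..T}" "t\<in>{0..T}" for s t
  using that by (simp add: nrm sub_mem c_diff ofX(1) cC)
 show "ofY U\<in>BH1_van ta T X"
  unfolding BH1_van_def AE_tm
 proof (intro CollectI conjI b(1) exI[of _ "%t. ofX (C t)"] ballI)
  fix t assume t: "t\<in>{0..T}"
  show "ofX (C t)\<in>elems X" by (rule ofX)
  have "(C \<longlongrightarrow> C t) (at t within {0..T})" using C(1) t by (simp add: continuous_on_def)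
  hence "((%s. norm (C s - C t)) \<longlongrightarrow> norm (C t - C t)) (at t within {0..T})" by (intro tendsto_intros)
  hence l: "((%s. norm (C s - C t)) \<longlongrightarrow> 0) (at t within {0..T})" by simp
  have "\<forall>\<^sub>F s in at t within {0..T}. norm (C s - C t) = nrm X (%x. ofX (C s) x - ofX (C t) x)"
   using nd[OF _ t] by (auto simp: eventually_at_filter)
  from tendsto_cong[OF this] l show "((%s. nrm X (%x. ofX (C s) x - ofX (C t) x)) \<longlongrightarrow> 0) (at t within {0..T})" by blast
 next
  show "AEL t. t\<in>{0<..<T} --> nrm X (%x. ofY U t x - ofX (C t) x) = 0"
   using UC
  proof eventually_elim
   case (elim t)
   show ?case
   proof
    assume t: "t\<in>{0<..<T}"
    hence "ofY U t = ofX (C t)" using elim by (simp add: ofY_def)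
    thus "nrm X (%x. ofY U t x - ofX (C t) x) = 0" using nd[of t t] t by simp
   qed
  qed
  show "nrm X (ofX (C ta)) = 0" using cC[OF ta] C(3) by (simp add: nrm ofX(1))
 qed
qed

lemma test_function_BH1:
 assumes ph: "test_function {0<..<T} ph" and v: "v\<in>V"
 shows "(%t x. ph t * ofX v x)\<in>BH1 T X" "toY (%t x. ph t * ofX v x) = mk (%t. ph t *: v)"
proof -
 have b: "(%t x. h t * ofX v x)\<in>BL2 T X \<and> toY (%t x. h t * ofX v x) = mk (%t. h t *: v)" if h: "multf T h" for h
 proof -
  have ae: "AEL t. ap (mk (%t. h t *: v)) t = h t *: v" by (rule ap_mk[OF multf_sq_int(1)[OF h]])
  have "AEL t. t\<in>{0<..<T} --> (%x. h t * ofX v x)\<in>elems X \<and> c (%x. h t * ofX v x) = ap (mk (%t. h t *: v)) t"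
   using ae by eventually_elim (simp add: scale_mem c_scale ofX proj_id[OF V v])
  moreover have "AEL t. t\<notin>{0<..<T} --> ap (mk (%t. h t *: v)) t = 0"
   using ae by eventually_elim (use h in \<open>simp add: multf_def\<close>)
  ultimately show ?thesis using BL2_toYI[of "%t x. h t * ofX v x" "mk (%t. h t *: v)"] by auto
 qed
 note b1 = b[OF multf_test(1)[OF ph]] and b2 = b[OF multf_test(2)[OF ph]]
 have "wd T (mk (%t. ph t *: v)) (mk (%t. deriv ph t *: v))"
 proof -
  have "mk (%t. ph t *: v) = intop T (mk (%t. deriv ph t *: v))"
  proof (rule lp2_eqI, goal_cases)
   case 1 show ?case
    using ap_mk[OF multf_sq_int(1)[OF multf_test(1)[OF ph], of v]] ap_intop[OF T, of "mk (%t. deriv ph t *: v)"]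
   proof eventually_elim
    case (elim t)
    show ?case using elim testD(4)[OF ph, of t] by (cases "t\<in>{0<..<T}") (auto simp: prim_test[OF ph])
   qed
  qed
  thus ?thesis using wd_intop[OF T, of "mk (%t. deriv ph t *: v)"] by simp
 qed
 thus "(%t x. ph t * ofX v x)\<in>BH1 T X" "toY (%t x. ph t * ofX v x) = mk (%t. ph t *: v)"
  using BH1I(1)[of "%t x. ph t * ofX v x" "%t x. deriv ph t * ofX v x"] b1 b2 by auto
qed

end

section \<open>Square integrable and weakly differentiable functions\<close>

lemma AE_lebesgue_on: "S\<in>sets lebesgue ==> (AE x in lebesgue_on S. P x) \<longleftrightarrow> (AEL x. x\<in>S --> P x)"
 by (rule AE_restrict_space_iff) simp

lemma integral_lebesgue_on:
 fixes h :: "'d::euclidean_space=>real"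
 shows "S\<in>sets lebesgue ==> (LINT x|lebesgue_on S. h x) = (LL x. ind S x * h x)"
 by (subst integral_restrict_space) simp_all

definition fib :: "'a::euclidean_space set=>('a=>real)=>('a, real) lp2"
 where "fib S u = mk (%x. ind S x *: u x)"

lemma elems_L2:
 assumes S: "S\<in>sets lebesgue"
 shows "u\<in>elems (L2 S) \<longleftrightarrow> sq_int (%x. ind S x *: u x)"
proof -
 have "u\<in>borel_measurable (lebesgue_on S) \<longleftrightarrow> (%x. ind S x *: u x)\<in>meas"
  using S by (subst borel_measurable_restrict_space_iff) simp_all
 moreover have "(%x. (ind S x * u x)^2) = (%x. ind S x *: (u x)^2)"
  by (auto simp: fun_eq_iff ind_def)
 hence "integrable (lebesgue_on S) (%x. (u x)^2) \<longleftrightarrow> integrable lebesgue (%x. (norm (ind S x *: u x))^2)"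
  using S by (subst integrable_restrict_space) (simp_all add: abs_mult power_mult_distrib)
 ultimately show ?thesis by (simp add: L2_def sq_int_def)
qed

context
 fixes S :: "'a::euclidean_space set"
 assumes S: "S\<in>sets lebesgue"
begin

lemma ap_fib: "u\<in>elems (L2 S) ==> AEL x. ap (fib S u) x = ind S x * u x"
 using ap_mk[of "%x. ind S x *: u x"] unfolding fib_def elems_L2[OF S] by simp

lemma inner_fib:
 assumes "u\<in>elems (L2 S)" "v\<in>elems (L2 S)"
 shows "(LINT x|lebesgue_on S. u x * v x) = inner (fib S u) (fib S v)"
proof -
 have m: "(%x. ind S x * u x)\<in>meas" "(%x. ind S x * v x)\<in>meas"
  using assms[unfolded elems_L2[OF S]] by (auto dest!: sq_intD)
 have "(%x. ind S x * (u x * v x)) = (%x. (ind S x * u x) * (ind S x * v x))"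
  by (auto simp: fun_eq_iff ind_def)
 hence "(LINT x|lebesgue_on S. u x * v x) = (LL x. (ind S x * u x) * (ind S x * v x))"
  by (simp add: integral_lebesgue_on[OF S])
 also have "... = inner (fib S u) (fib S v)"
  unfolding inner_lp2_def
  by (rule integral_cong_AE) (use m in measurable, use ap_fib[OF assms(1)] ap_fib[OF assms(2)] in eventually_elim, simp)
 finally show ?thesis .
qed

lemma nrm_L2:
 assumes "u\<in>elems (L2 S)"
 shows "nrm (L2 S) u = norm (fib S u)"
 using inner_fib[OF assms assms] by (simp add: L2_def norm_eq_sqrt_inner power2_eq_square)

lemma indS: "(ind S :: 'a=>real)\<in>meas" "\<bar>ind S x :: real\<bar>\<le>1"
 using S by (auto simp: ind_def)

lemma fib_eqI:
 assumes F: "mulop (ind S) F = F" and u: "AEL x. x\<in>S --> u x = ap F x"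
 shows "u\<in>elems (L2 S)" "fib S u = F"
proof -
 have ae: "AEL x. ind S x *: u x = ap F x"
  using ap_mulop[OF indS, of F] u unfolding F by eventually_elim (auto simp: ind_def)
 have s: "sq_int (%x. ind S x *: u x)"
  by (rule sq_int_cong_AE[OF measurable_AE_eq[OF ap_measurable ae] sq_int_ap ae])
 thus "u\<in>elems (L2 S)" by (simp add: elems_L2[OF S])
 show "fib S u = F" unfolding fib_def by (rule lp2_eqI) (use ap_mk[OF s] ae in eventually_elim, simp)
qed

lemma mulop_fib: "u\<in>elems (L2 S) ==> mulop (ind S) (fib S u) = fib S u"
proof (rule lp2_eqI)
 assume u: "u\<in>elems (L2 S)"
 show "AEL x. ap (mulop (ind S) (fib S u)) x = ap (fib S u) x"
  using ap_mulop[OF indS, of "fib S u"] ap_fib[OF u] by eventually_elim (auto split: split_indicator)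
qed

lemma fib_range: "fib S ` elems (L2 S) = {F. mulop (ind S) F = F}"
proof (intro equalityI subsetI)
 fix F assume "F\<in>fib S ` elems (L2 S)"
 thus "F\<in>{F. mulop (ind S) F = F}" using mulop_fib by auto
next
 fix F :: "('a, real) lp2" assume "F\<in>{F. mulop (ind S) F = F}"
 thus "F\<in>fib S ` elems (L2 S)" using fib_eqI[of F "ap F"] by (auto intro!: image_eqI[of _ _ "ap F"])
qed

lemma rep_space_L2:
 assumes T: "T > 0"
 shows "rep_space (L2 S) (fib S) T"
proof
 have l: "linear (mulop (ind S) :: ('a, real) lp2=>_)"
  by (rule bounded_linear.linear[OF bounded_linear_mulop[OF indS]])
 have zero: "sq_int (%x. ind S x *: (0::real))" by simp
 thus "(%x. 0)\<in>elems (L2 S)" by (simp add: elems_L2[OF S])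
 have lin: "(%x. u x + v x)\<in>elems (L2 S) \<and> fib S (%x. u x + v x) = fib S u + fib S v"
  if u: "u\<in>elems (L2 S)" and v: "v\<in>elems (L2 S)" for u v
 proof -
  have "mulop (ind S) (fib S u + fib S v) = fib S u + fib S v"
   by (simp only: linear_add[OF l] mulop_fib u v)
  moreover have "AEL x. x\<in>S --> u x + v x = ap (fib S u + fib S v) x"
   using ap_fib[OF u] ap_fib[OF v] ap_add[of "fib S u" "fib S v"] by eventually_elim simp
  ultimately show ?thesis using fib_eqI[of "fib S u + fib S v" "%x. u x + v x"] by simp
 qed
 have scl: "(%x. r * u x)\<in>elems (L2 S) \<and> fib S (%x. r * u x) = r *: fib S u" if u: "u\<in>elems (L2 S)" for r u
 proof -
  have "mulop (ind S) (r *: fib S u) = r *: fib S u"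
   by (simp only: linear_cmul[OF l] mulop_fib u)
  moreover have "AEL x. x\<in>S --> r * u x = ap (r *: fib S u) x"
   using ap_fib[OF u] ap_scaleR[of r "fib S u"] by eventually_elim simp
  ultimately show ?thesis using fib_eqI[of "r *: fib S u" "%x. r * u x"] by simp
 qed
 show "!!u v. u\<in>elems (L2 S) ==> v\<in>elems (L2 S) ==> (%x. u x + v x)\<in>elems (L2 S)"
  and "!!u v. u\<in>elems (L2 S) ==> v\<in>elems (L2 S) ==> fib S (%x. u x + v x) = fib S u + fib S v"
  and "!!r u. u\<in>elems (L2 S) ==> (%x. r * u x)\<in>elems (L2 S)"
  and "!!r u. u\<in>elems (L2 S) ==> fib S (%x. r * u x) = r *: fib S u"
  using lin scl by blast+
 show "closed (fib S ` elems (L2 S))"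
  unfolding fib_range
  by (intro closed_Collect_eq linear_continuous_on bounded_linear_mulop[OF indS] continuous_on_id)
qed (use T nrm_L2 in auto)

lemma proj_L2: "proj (fib S ` elems (L2 S)) = mulop (ind S)"
proof
 fix F :: "('a, real) lp2"
 interpret rep_space "L2 S" "fib S" 1 by (rule rep_space_L2) simp
 show "proj (fib S ` elems (L2 S)) F = mulop (ind S) F"
 proof (rule proj_unique[OF V[unfolded V_def]])
  have "mulop (ind S) (mulop (ind S) F) = mulop (ind S) F"
   by (rule lp2_eqI) (use ap_mulop[OF indS, of F] ap_mulop[OF indS, of "mulop (ind S) F"] in eventually_elim, auto split: split_indicator)
  thus "mulop (ind S) F\<in>fib S ` elems (L2 S)" by (simp add: fib_range)
  fix v assume "v\<in>fib S ` elems (L2 S)"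
  thus "inner (mulop (ind S) F) v = inner F v" by (simp add: fib_range inner_mulop[OF indS])
 qed
qed

end

definition tvec :: "('a::euclidean_space=>real)=>'a=>('a, real \<times> 'a) lp2"
 where "tvec ph b = mk (%x. (pd b ph x, ph x *: b))"

definition c1 :: "'a::euclidean_space set=>('a=>real)=>('a, real \<times> 'a) lp2"
 where "c1 S u = mk (%x. ind S x *: (u x, weak_grad S u x))"

definition V1 :: "'a::euclidean_space set=>('a, real \<times> 'a) lp2 set"
 where "V1 S = {F. mulop (ind S) F = F \<and> (\<forall>ph b. test_function S ph --> b\<in>Basis --> inner F (tvec ph b) = 0)}"

lemma test_function_sq:
 assumes ph: "test_function U ph" and b: "b\<in>Basis"
 shows "sq_int ph" "sq_int (%x. pd b ph x)"
proof -
 obtain M where M: "!!x. \<bar>ph x\<bar>\<le>M" "!!x. \<bar>pd b ph x\<bar>\<le>M"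
  using test_function_bounds[OF ph b] by blast
 define K where "K = closure {x. ph x\<noteq>0}"
 have "compact K" using ph by (simp add: test_function_def K_def)
 hence Kl: "K\<in>lmeasurable" by (rule lmeasurable_compact)
 have phK: "test_function K ph" using ph by (simp add: test_function_def K_def)
 have "\<bar>ph x\<bar>\<le>ind K x * M" for x
  using M(1)[of x] testD(4)[OF phK, of x] by (cases "x\<in>K") simp_all
 thus "sq_int ph"
  by (intro sq_int_bounded_on[OF testD(3)[OF ph] Kl, where C=M] AE_I2) simp
 have m: "(%x. pd b ph x)\<in>meas"
  by (rule measurable_completion) (use testD(6)[OF ph b, of UNIV] in \<open>simp add: borel_measurable_continuous_onI\<close>)
 have "\<bar>pd b ph x\<bar>\<le>ind K x * M" for x
  using M(2)[of x] testD(7)[OF phK, of x b] by (cases "x\<in>K") simp_all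
 thus "sq_int (%x. pd b ph x)"
  by (intro sq_int_bounded_on[OF m Kl, where C=M] AE_I2) simp
qed

lemma sq_int_Pair:
 assumes "sq_int f" "sq_int g"
 shows "sq_int (%x. (f x, g x))"
proof (rule sq_int_bound[where g="%x. norm (f x) + norm (g x)" and C=1])
 show "sq_int (%x. norm (f x) + norm (g x))" using assms by (intro sq_int_add sq_int_norm)
 show "(%x. (f x, g x))\<in>meas" using assms[THEN sq_intD] by measurable
 show "AEL x. norm (f x, g x)\<le>1 * norm (norm (f x) + norm (g x))"
  by (intro AE_I2) (simp add: norm_Pair sqrt_sum_squares_le_sum)
qed

lemma ap_tvec:
 assumes ph: "test_function U ph" and b: "b\<in>Basis"
 shows "AEL x. ap (tvec ph b) x = (pd b ph x, ph x *: b)"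
proof -
 have "sq_int (%x. ph x *: b)"
  by (rule sq_int_bound[OF _ test_function_sq(1)[OF ph b], of _ "norm b"]) (use testD(3)[OF ph] in auto)
 thus ?thesis unfolding tvec_def by (intro ap_mk sq_int_Pair test_function_sq(2)[OF ph b])
qed

lemma norm_fst_prod: "norm (fst z)\<le>norm z" and norm_snd_prod: "norm (snd z)\<le>norm z"
 by (cases z, simp add: norm_fst_le norm_snd_le)+

lemma inner_tvec:
 assumes ph: "test_function U ph" and b: "b\<in>Basis"
 shows "inner F (tvec ph b) = (LL x. fst (ap F x) * pd b ph x) + (LL x. inner (snd (ap F x)) b * ph x)"
  "integrable lebesgue (%x. fst (ap F x) * pd b ph x)"
  "integrable lebesgue (%x. inner (snd (ap F x)) b * ph x)"
proof -
 have f: "sq_int (%x. fst (ap F x))"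
  by (rule sq_int_bound[OF _ sq_int_ap[of F], of _ 1]) (simp_all add: norm_fst_prod[simplified] borel_measurable_ptw_comp[OF bounded_linear_fst] del: real_norm_def)
 have g: "sq_int (%x. inner (snd (ap F x)) b)"
 proof (rule sq_int_bound[OF _ sq_int_ap[of F], of _ 1])
  show "AEL x. norm (inner (snd (ap F x)) b)\<le>1 * norm (ap F x)"
  proof (rule AE_I2)
   fix x
   have "norm (inner (snd (ap F x)) b)\<le>norm (snd (ap F x)) * norm b" by (simp add: Cauchy_Schwarz_ineq2)
   also have "...\<le>norm (ap F x)" using b by (simp add: norm_snd_prod)
   finally show "norm (inner (snd (ap F x)) b)\<le>1 * norm (ap F x)" by simp
  qed
 qed (intro borel_measurable_inner borel_measurable_ptw_comp[OF bounded_linear_snd] ap_measurable borel_measurable_const)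
 show 1: "integrable lebesgue (%x. fst (ap F x) * pd b ph x)"
  using integrable_inner_sq[OF f test_function_sq(2)[OF ph b]] by simp
 show 2: "integrable lebesgue (%x. inner (snd (ap F x)) b * ph x)"
  using integrable_inner_sq[OF g test_function_sq(1)[OF ph b]] by simp
 have "inner F (tvec ph b) = (LL x. fst (ap F x) * pd b ph x + inner (snd (ap F x)) b * ph x)"
  unfolding inner_lp2_def
  by (rule integral_cong_AE)
   (simp, use 1 2 in \<open>simp add: borel_measurable_integrable\<close>, use ap_tvec[OF ph b] in eventually_elim, simp add: inner_prod_def mult.commute)
 thus "inner F (tvec ph b) = (LL x. fst (ap F x) * pd b ph x) + (LL x. inner (snd (ap F x)) b * ph x)"
  using 1 2 by simp
qed

lemma inner_fst_snd: "inner F G = inner (ptw fst F) (ptw fst G) + inner (ptw snd F) (ptw snd G)"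
 for F G :: "('d::euclidean_space, 'b::hilb \<times> 'c::hilb) lp2"
proof -
 have "inner F G = (LL x. inner (ap (ptw fst F) x) (ap (ptw fst G) x) + inner (ap (ptw snd F) x) (ap (ptw snd G) x))"
  unfolding inner_lp2_def[of F G]
  by (rule integral_cong_AE)
   (simp, simp, use ap_ptw[OF bounded_linear_fst, of F] ap_ptw[OF bounded_linear_fst, of G] ap_ptw[OF bounded_linear_snd, of F] ap_ptw[OF bounded_linear_snd, of G]
    in eventually_elim, simp add: inner_prod_def)
 thus ?thesis by (simp add: inner_lp2_def integrable_inner_sq)
qed

context
 fixes S :: "'a::euclidean_space set"
 assumes So: "open S"
begin

lemma Sl: "S\<in>sets lebesgue" using So by simp

lemma V1: "subspace (V1 S)" "closed (V1 S)"
proof -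
 have l: "linear (mulop (ind S) :: ('a, real \<times> 'a) lp2=>_)"
  by (rule bounded_linear.linear[OF bounded_linear_mulop[OF indS[OF Sl]]])
 show "subspace (V1 S)" unfolding V1_def subspace_def
  by (auto simp: linear_0[OF l] linear_add[OF l] linear_cmul[OF l] inner_add_left)
 have "V1 S = {F. mulop (ind S) F = F}\<inter>(\<Inter>(ph, b)\<in>{(ph, b). test_function S ph \<and> b\<in>Basis}. {F. inner F (tvec ph b) = 0})"
  by (auto simp: V1_def)
 moreover have "closed {F :: ('a, real \<times> 'a) lp2. mulop (ind S) F = F}"
  by (intro closed_Collect_eq linear_continuous_on bounded_linear_mulop[OF indS[OF Sl]] continuous_on_id)
 moreover have "closed {F. inner F (tvec ph b) = 0}" for ph and b :: 'a
  by (intro closed_Collect_eq continuous_intros)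
 ultimately show "closed (V1 S)" by (auto intro!: closed_Int closed_INT)
qed

lemma V1_unique:
 assumes F: "F\<in>V1 S" and G: "G\<in>V1 S" and eq: "AEL x. x\<in>S --> fst (ap F x) = fst (ap G x)"
 shows "F = G"
proof -
 define D where "D = F - G"
 have D: "D\<in>V1 S" unfolding D_def by (rule subspace_diff[OF V1(1) F G])
 have Dap: "AEL x. ap D x = ind S x *: ap D x"
  using ap_mulop[OF indS[OF Sl], of D] D by (simp add: V1_def)
 have Df: "AEL x. fst (ap D x) = 0"
  using ap_diff[of F G] eq Dap unfolding D_def[symmetric]
 proof eventually_elim
  case (elim x)
  show ?case
  proof (cases "x\<in>S")
   case True
   thus ?thesis using elim by simp
  next
   case False
   hence "ap D x = 0" using elim(3) by simp
   thus ?thesis by simp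
  qed
 qed
 have "AEL x. x\<in>S --> inner (snd (ap D x)) b = 0" if b: "b\<in>Basis" for b
 proof (rule AE_zero_if_test[OF So])
  show "set_integrable lebesgue (cbox a c) (%x. inner (snd (ap D x)) b)" for a c
  proof -
   have "integrable lebesgue (%x. inner (snd (ind (cbox a c) x *: ap D x)) b)"
    by (intro integrable_inner_left integrable_bounded_linear[OF bounded_linear_snd] integrable_indicator_sq) auto
   thus ?thesis by (simp add: set_integrable_def)
  qed
  fix ph assume ph: "test_function S ph"
  have "AEL x. fst (ap D x) * pd b ph x = 0"
   using Df by eventually_elim simp
  hence "(LL x. fst (ap D x) * pd b ph x) = 0" by (rule integral_eq_zero_AE)
  moreover have "inner D (tvec ph b) = 0" using D ph b by (simp add: V1_def)
  ultimately show "(LL x. inner (snd (ap D x)) b * ph x) = 0" using inner_tvec(1)[OF ph b, of D] by simp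
 qed
 hence "AEL x. \<forall>b\<in>Basis. x\<in>S --> inner (snd (ap D x)) b = 0" by (subst AE_ball_countable) (auto simp: countable_finite)
 hence "AEL x. ap D x = ap 0 x"
  using Df Dap ap_zero[where 'a='a and 'b="real \<times> 'a"]
 proof eventually_elim
  case (elim x)
  show ?case
  proof (cases "x\<in>S")
   case True
   hence "snd (ap D x) = 0" using elim(1) by (simp add: euclidean_all_zero_iff)
   thus ?thesis using elim by (simp add: prod_eq_iff)
  next
   case False
   hence "ap D x = 0" using elim(3) by simp
   thus ?thesis using elim by simp
  qed
 qed
 hence "D = 0" by (rule lp2_eqI)
 thus ?thesis by (simp add: D_def)
qed

lemma is_weak_grad_V1:
 assumes u: "u\<in>elems (L2 S)" and g: "is_weak_grad S u g"
 shows "mk (%x. ind S x *: (u x, g x))\<in>V1 S" "sq_int (%x. ind S x *: (u x, g x))"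
proof -
 have su: "sq_int (%x. ind S x *: u x)" using u by (simp add: elems_L2[OF Sl])
 have "sq_int (%x. ind S x *: inner (g x) b)" if "b\<in>Basis" for b
  using g that by (simp add: is_weak_grad_def elems_L2[OF Sl])
 note sb = this
 have "sq_int (%x. \<Sum>b\<in>Basis. (ind S x *: inner (g x) b) *: b)"
 proof -
  have "sq_int (%x. \<Sum>b\<in>A. (ind S x *: inner (g x) b) *: b)" if "finite A" "A\<subseteq>Basis" for A
   using that
  proof (induction A rule: finite_induct)
   case (insert b A)
   hence b: "b\<in>Basis" by simp
   have "sq_int (%x. (ind S x *: inner (g x) b) *: b)"
    by (rule sq_int_bound[OF _ sb[OF b], of _ "norm b"]) (use sq_intD[OF sb[OF b]] in auto)
   thus ?case using insert by (simp add: sq_int_add)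
  qed simp
  thus ?thesis by simp
 qed
 moreover have "(%x. \<Sum>b\<in>Basis. (ind S x *: inner (g x) b) *: b) = (%x. ind S x *: g x)"
  by (simp add: fun_eq_iff euclidean_representation flip: scaleR_scaleR scaleR_sum_right)
 ultimately have sg: "sq_int (%x. ind S x *: g x)" by simp
 show s: "sq_int (%x. ind S x *: (u x, g x))" using sq_int_Pair[OF su sg] by simp
 let ?F = "mk (%x. ind S x *: (u x, g x))"
 note a = ap_mk[OF s]
 have "mulop (ind S) ?F = ?F"
  by (rule lp2_eqI) (use ap_mulop[OF indS[OF Sl], of ?F] a in eventually_elim, auto split: split_indicator)
 moreover have "inner ?F (tvec ph b) = 0" if ph: "test_function S ph" and b: "b\<in>Basis" for ph b
 proof -
  have "(LL x. fst (ap ?F x) * pd b ph x) = (LL x. ind S x * (u x * pd b ph x))"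
  proof (rule integral_cong_AE)
   show "AEL x. fst (ap ?F x) * pd b ph x = ind S x * (u x * pd b ph x)"
    using a by eventually_elim (simp only: fst_scaleR fst_conv real_scaleR_def mult.assoc)
   hence "AEL x. ind S x * (u x * pd b ph x) = fst (ap ?F x) * pd b ph x"
    by eventually_elim (rule sym)
   thus "(%x. ind S x * (u x * pd b ph x))\<in>meas"
    by (rule measurable_AE_eq[OF borel_measurable_integrable[OF inner_tvec(2)[OF ph b, of ?F]]])
  qed (rule borel_measurable_integrable[OF inner_tvec(2)[OF ph b, of ?F]])
  moreover have "(LL x. inner (snd (ap ?F x)) b * ph x) = (LL x. ind S x * (inner (g x) b * ph x))"
  proof (rule integral_cong_AE)
   show "AEL x. inner (snd (ap ?F x)) b * ph x = ind S x * (inner (g x) b * ph x)"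
    using a by eventually_elim (simp only: snd_scaleR snd_conv inner_scaleR_left mult.assoc)
   hence "AEL x. ind S x * (inner (g x) b * ph x) = inner (snd (ap ?F x)) b * ph x"
    by eventually_elim (rule sym)
   thus "(%x. ind S x * (inner (g x) b * ph x))\<in>meas"
    by (rule measurable_AE_eq[OF borel_measurable_integrable[OF inner_tvec(3)[OF ph b, of ?F]]])
  qed (rule borel_measurable_integrable[OF inner_tvec(3)[OF ph b, of ?F]])
  ultimately show ?thesis
   using g ph b unfolding inner_tvec(1)[OF ph b] is_weak_grad_def by (simp add: integral_lebesgue_on[OF Sl])
 qed
 ultimately show "?F\<in>V1 S" by (simp add: V1_def)
qed

lemma H1_weak_grad:
 assumes "u\<in>elems (H1 S)"
 shows "u\<in>elems (L2 S)" "is_weak_grad S u (weak_grad S u)"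
 using assms someI_ex[of "is_weak_grad S u"] by (auto simp: H1_def weak_grad_def)

lemma c1_in_V1:
 assumes "u\<in>elems (H1 S)"
 shows "c1 S u\<in>V1 S" "AEL x. ap (c1 S u) x = ind S x *: (u x, weak_grad S u x)"
  "sq_int (%x. ind S x *: (u x, weak_grad S u x))"
 using is_weak_grad_V1[OF H1_weak_grad[OF assms]] ap_mk unfolding c1_def by auto

lemma c1_eqI:
 assumes F: "F\<in>V1 S" and u: "AEL x. x\<in>S --> u x = fst (ap F x)"
 shows "u\<in>elems (H1 S)" "c1 S u = F"
proof -
 have Fap: "AEL x. ap F x = ind S x *: ap F x"
  using ap_mulop[OF indS[OF Sl], of F] F by (simp add: V1_def)
 have ptl: "mulop (ind S) (ptw fst F) = ptw fst F"
  by (rule lp2_eqI) (use ap_mulop[OF indS[OF Sl], of "ptw fst F"] ap_ptw[OF bounded_linear_fst, of F] Fap in eventually_elim,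
    metis real_scaleR_def fst_scaleR)
 have "AEL x. x\<in>S --> u x = ap (ptw fst F) x" using u ap_ptw[OF bounded_linear_fst, of F] by eventually_elim simp
 hence uL: "u\<in>elems (L2 S)" by (rule fib_eqI(1)[OF Sl ptl])
 define g where "g x = snd (ap F x)" for x
 have "is_weak_grad S u g"
  unfolding is_weak_grad_def
 proof (intro ballI conjI allI impI)
  fix b :: 'a assume b: "b\<in>Basis"
  have s: "sq_int (%x. inner (g x) b)"
  proof (rule sq_int_bound[OF _ sq_int_ap[of F], of _ 1])
   show "AEL x. norm (inner (g x) b)\<le>1 * norm (ap F x)"
   proof (rule AE_I2)
    fix x
    have "norm (inner (g x) b)\<le>norm (snd (ap F x)) * norm b" by (simp add: g_def Cauchy_Schwarz_ineq2)
    also have "...\<le>norm (ap F x)" using b by (simp add: norm_snd_prod)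
    finally show "norm (inner (g x) b)\<le>1 * norm (ap F x)" by simp
   qed
  qed (unfold g_def, intro borel_measurable_inner borel_measurable_ptw_comp[OF bounded_linear_snd] ap_measurable borel_measurable_const)
  show "(%x. inner (g x) b)\<in>elems (L2 S)"
   unfolding elems_L2[OF Sl] by (rule sq_int_bound[OF _ s, of _ 1]) (use sq_intD[OF s] Sl in \<open>auto simp: ind_def\<close>)
  fix ph assume ph: "test_function S ph"
  have "(LL x. ind S x * (u x * pd b ph x)) = (LL x. fst (ap F x) * pd b ph x)"
  proof (rule integral_cong_AE)
   show ae: "AEL x. ind S x * (u x * pd b ph x) = fst (ap F x) * pd b ph x"
    using u by eventually_elim (use testD(7)[OF ph] in \<open>auto simp: ind_def\<close>)
   show "(%x. ind S x * (u x * pd b ph x))\<in>meas"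
    by (rule measurable_AE_eq[OF borel_measurable_integrable[OF inner_tvec(2)[OF ph b, of F]] ae])
  qed (rule borel_measurable_integrable[OF inner_tvec(2)[OF ph b, of F]])
  moreover have "(%x. ind S x * (inner (g x) b * ph x)) = (%x. inner (snd (ap F x)) b * ph x)"
   using testD(4)[OF ph] by (auto simp: g_def ind_def fun_eq_iff)
  moreover have "inner F (tvec ph b) = 0" using F ph b by (simp add: V1_def)
  ultimately show "(LINT x|lebesgue_on S. u x * pd b ph x) = - (LINT x|lebesgue_on S. inner (g x) b * ph x)"
   unfolding inner_tvec(1)[OF ph b] integral_lebesgue_on[OF Sl] by simp
 qed
 thus uH: "u\<in>elems (H1 S)" using uL by (auto simp: H1_def)
 show "c1 S u = F"
  by (rule V1_unique[OF c1_in_V1(1)[OF uH] F]) (use c1_in_V1(2)[OF uH] u in eventually_elim, simp)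
qed

lemma c1_range: "c1 S ` elems (H1 S) = V1 S"
proof (intro equalityI subsetI)
 fix F assume "F\<in>c1 S ` elems (H1 S)"
 thus "F\<in>V1 S" using c1_in_V1 by auto
next
 fix F assume "F\<in>V1 S"
 thus "F\<in>c1 S ` elems (H1 S)"
  using c1_eqI[of F "%x. fst (ap F x)"] by (auto intro!: image_eqI[of _ _ "%x. fst (ap F x)"])
qed

lemma ptw_fst_c1:
 assumes "u\<in>elems (H1 S)"
 shows "ptw fst (c1 S u) = fib S u"
 by (rule lp2_eqI) (use ap_ptw[OF bounded_linear_fst, of "c1 S u"] c1_in_V1(2)[OF assms] ap_fib[OF Sl H1_weak_grad(1)[OF assms]] in eventually_elim, simp)

lemma inner_weak_grad:
 assumes u: "u\<in>elems (H1 S)" and v: "v\<in>elems (H1 S)"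
 shows "(LINT x|lebesgue_on S. inner (weak_grad S u x) (weak_grad S v x)) = inner (ptw snd (c1 S u)) (ptw snd (c1 S v))"
  "laplacian S u v = - inner (ptw snd (c1 S u)) (ptw snd (c1 S v))"
proof -
 have ae: "AEL x. ind S x * inner (weak_grad S u x) (weak_grad S v x) = inner (ap (ptw snd (c1 S u)) x) (ap (ptw snd (c1 S v)) x)"
  using ap_ptw[OF bounded_linear_snd, of "c1 S u"] ap_ptw[OF bounded_linear_snd, of "c1 S v"] c1_in_V1(2)[OF u] c1_in_V1(2)[OF v]
  by eventually_elim (auto simp: ind_def)
 show "(LINT x|lebesgue_on S. inner (weak_grad S u x) (weak_grad S v x)) = inner (ptw snd (c1 S u)) (ptw snd (c1 S v))"
  unfolding inner_lp2_def integral_lebesgue_on[OF Sl]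
  by (rule integral_cong_AE[OF measurable_AE_eq[OF _ ae] _ ae]) auto
 thus "laplacian S u v = - inner (ptw snd (c1 S u)) (ptw snd (c1 S v))" by (simp add: laplacian_def)
qed

lemma nrm_H1:
 assumes u: "u\<in>elems (H1 S)"
 shows "nrm (H1 S) u = norm (c1 S u)"
proof -
 have "(LINT x|lebesgue_on S. (u x)^2) = inner (ptw fst (c1 S u)) (ptw fst (c1 S u))"
  using inner_fib[OF Sl H1_weak_grad(1)[OF u] H1_weak_grad(1)[OF u]] by (simp add: ptw_fst_c1[OF u] power2_eq_square)
 thus ?thesis
  using inner_weak_grad(1)[OF u u] by (simp add: H1_def norm_eq_sqrt_inner[of "c1 S u"] inner_fst_snd[of "c1 S u" "c1 S u"] power2_norm_eq_inner)
qed

lemma rep_space_H1: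
 assumes T: "T > 0"
 shows "rep_space (H1 S) (c1 S) T"
proof
 have lin: "(%x. u x + v x)\<in>elems (H1 S) \<and> c1 S (%x. u x + v x) = c1 S u + c1 S v"
  if u: "u\<in>elems (H1 S)" and v: "v\<in>elems (H1 S)" for u v
 proof -
  have "AEL x. x\<in>S --> u x + v x = fst (ap (c1 S u + c1 S v) x)"
   using c1_in_V1(2)[OF u] c1_in_V1(2)[OF v] ap_add[of "c1 S u" "c1 S v"] by eventually_elim simp
  thus ?thesis using c1_eqI[OF subspace_add[OF V1(1) c1_in_V1(1)[OF u] c1_in_V1(1)[OF v]], where u="%x. u x + v x"] by simp
 qed
 have scl: "(%x. r * u x)\<in>elems (H1 S) \<and> c1 S (%x. r * u x) = r *: c1 S u" if u: "u\<in>elems (H1 S)" for r u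
 proof -
  have "AEL x. x\<in>S --> r * u x = fst (ap (r *: c1 S u) x)"
   using c1_in_V1(2)[OF u] ap_scaleR[of r "c1 S u"] by eventually_elim simp
  thus ?thesis using c1_eqI[OF subspace_scale[OF V1(1) c1_in_V1(1)[OF u]], where u="%x. r * u x"] by simp
 qed
 show "!!u v. u\<in>elems (H1 S) ==> v\<in>elems (H1 S) ==> (%x. u x + v x)\<in>elems (H1 S)"
  and "!!u v. u\<in>elems (H1 S) ==> v\<in>elems (H1 S) ==> c1 S (%x. u x + v x) = c1 S u + c1 S v"
  and "!!r u. u\<in>elems (H1 S) ==> (%x. r * u x)\<in>elems (H1 S)"
  and "!!r u. u\<in>elems (H1 S) ==> c1 S (%x. r * u x) = r *: c1 S u"
  using lin scl by blast+
 have "AEL x. x\<in>S --> 0 = fst (ap (0 :: ('a, real \<times> 'a) lp2) x)"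
  using ap_zero[where 'a='a and 'b="real \<times> 'a"] by eventually_elim simp
 thus "(%x. 0)\<in>elems (H1 S)" by (rule c1_eqI[OF subspace_0[OF V1(1)]])
 show "closed (c1 S ` elems (H1 S))" by (simp add: c1_range V1(2))
qed (use T nrm_H1 in auto)

lemma test_function_H1:
 assumes ph: "test_function S ph"
 shows "\<exists>F\<in>V1 S. AEL x. fst (ap F x) = ph x"
proof -
 define g where "g x = (\<Sum>b\<in>Basis. pd b ph x *: b)" for x
 have gb: "inner (g x) b = pd b ph x" if "b\<in>Basis" for b x
  using that by (simp add: g_def inner_sum_left inner_Basis if_distrib[of "(*) _"] cong: if_cong)
 obtain b0 :: 'a where b0: "b0\<in>Basis" using nonempty_Basis by blast
 have restrict: "sq_int (%x. ind S x *: h x)" if h: "sq_int h" for h :: "'a=>real"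
  by (rule sq_int_bound[OF _ h, of _ 1]) (use sq_intD[OF h] Sl in \<open>auto simp: ind_def\<close>)
 have u: "ph\<in>elems (L2 S)" by (simp add: elems_L2[OF Sl] restrict[OF test_function_sq(1)[OF ph b0], simplified])
 have "is_weak_grad S ph g"
  unfolding is_weak_grad_def
 proof (intro ballI conjI allI impI)
  fix b :: 'a assume b: "b\<in>Basis"
  show "(%x. inner (g x) b)\<in>elems (L2 S)"
   unfolding elems_L2[OF Sl] gb[OF b] by (rule restrict[OF test_function_sq(2)[OF ph b]])
  fix \<eta> assume \<eta>: "test_function S \<eta>"
  have 1: "(LINT x|lebesgue_on S. ph x * pd b \<eta> x) = (LINT x|lborel. ph x * pd b \<eta> x)"
  proof -
   have "(%x. ind S x * (ph x * pd b \<eta> x)) = (%x. ph x * pd b \<eta> x)"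
    using testD(4)[OF ph] by (auto simp: fun_eq_iff ind_def)
   moreover have "continuous_on UNIV (%x. ph x * pd b \<eta> x)"
    by (intro continuous_intros testD(2)[OF ph] testD(6)[OF \<eta> b])
   ultimately show ?thesis
    by (simp add: integral_lebesgue_on[OF Sl] integral_completion borel_measurable_continuous_onI)
  qed
  have 2: "(LINT x|lebesgue_on S. inner (g x) b * \<eta> x) = (LINT x|lborel. pd b ph x * \<eta> x)"
  proof -
   have "(%x. ind S x * (pd b ph x * \<eta> x)) = (%x. pd b ph x * \<eta> x)"
    using testD(4)[OF \<eta>] by (auto simp: fun_eq_iff ind_def)
   moreover have "continuous_on UNIV (%x. pd b ph x * \<eta> x)"
    by (intro continuous_intros testD(2)[OF \<eta>] testD(6)[OF ph b])
   ultimately show ?thesis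
    by (simp add: gb[OF b] integral_lebesgue_on[OF Sl] integral_completion borel_measurable_continuous_onI)
  qed
  show "(LINT x|lebesgue_on S. ph x * pd b \<eta> x) = - (LINT x|lebesgue_on S. inner (g x) b * \<eta> x)"
   unfolding 1 2 by (rule test_function_ibp[OF ph \<eta> b])
 qed
 note F = is_weak_grad_V1[OF u this]
 show ?thesis
  by (rule bexI[OF _ F(1)]) (use ap_mk[OF F(2)] in eventually_elim, use testD(4)[OF ph] in \<open>auto simp: ind_def\<close>)
qed

end

section \<open>The elliptic equation\<close>

context rep_space
begin

definition dfun :: "'b=>('x=>real)=>real" where "dfun e = (%ps. inner e (c ps))"

lemma dfun_dual: "dfun e\<in>elems (dual X)"
proof -
 have "\<forall>u\<in>elems X. \<bar>inner e (c u)\<bar>\<le>norm e * nrm X u" by (auto simp: nrm Cauchy_Schwarz_ineq2)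
 thus ?thesis by (auto simp: dual_def dfun_def c_add c_scale inner_add_right)
qed

lemma nrm_dfun:
 assumes e: "e\<in>V"
 shows "nrm (dual X) (dfun e) = norm e"
proof -
 let ?A = "{\<bar>dfun e u\<bar> | u. u\<in>elems X \<and> nrm X u\<le>1}"
 have "Sup ?A = norm e"
 proof (rule cSup_eq_maximum)
  obtain u where u: "u\<in>elems X" "c u = e" using e by (auto simp: V_def)
  show "norm e\<in>?A"
  proof (cases "e = 0")
   case True
   have "nrm X (%x. 0) = 0" using nrm[OF zero_mem] c_scale[OF zero_mem, of 0] by simp
   thus ?thesis using True zero_mem by (auto simp: dfun_def intro!: exI[of _ "%x. 0"])
  next
   case False
   let ?v = "%x. inverse (norm e) * u x"
   have v: "?v\<in>elems X" "c ?v = inverse (norm e) *: e" using scale_mem[OF u(1)] c_scale[OF u(1)] u(2) by auto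
   hence "nrm X ?v\<le>1" using False by (simp add: nrm)
   moreover have "norm e = \<bar>dfun e ?v\<bar>"
    using False by (simp add: dfun_def v(2) power2_norm_eq_inner[symmetric] power2_eq_square)
   ultimately show ?thesis using v(1) by blast
  qed
  fix y assume "y\<in>?A"
  then obtain u where u: "u\<in>elems X" "nrm X u\<le>1" "y = \<bar>inner e (c u)\<bar>" by (auto simp: dfun_def)
  have "y\<le>norm e * norm (c u)" using u(3) Cauchy_Schwarz_ineq2 by simp
  also have "...\<le>norm e * 1" using u by (intro mult_left_mono) (simp_all add: nrm)
  finally show "y\<le>norm e" by simp
 qed
 thus ?thesis by (simp add: dual_def)
qed

lemma simple_int_dual:
 assumes "simple_int T X s J"
 shows "simple_int T (dual X) (%t. dfun (c (s t))) (dfun (c J))"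
proof -
 obtain m :: nat and E y where E: "!!k. k < m ==> E k\<in>sets lebesgue \<and> E k\<subseteq>{0<..<T} \<and> y k\<in>elems X"
  and s: "s = (%t x. \<Sum>k<m. ind (E k) t * y k x)" and J: "J = (%x. \<Sum>k<m. measure lebesgue (E k) * y k x)"
  using assms unfolding simple_int_def by blast
 have cs: "c (%x. \<Sum>k<m. a k * y k x) = (\<Sum>k<m. a k *: c (y k))" for a
  by (rule sum_mem[THEN conjunct2]) (use E in auto)
 show ?thesis
  unfolding simple_int_def
 proof (rule exI[of _ m], rule exI[of _ E], rule exI[of _ "%k. dfun (c (y k))"], intro conjI allI impI)
  show "(%t. dfun (c (s t))) = (%t x. \<Sum>k<m. ind (E k) t * dfun (c (y k)) x)"
   by (intro ext) (simp only: dfun_def s cs inner_sum_left inner_scaleR_left)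
  show "dfun (c J) = (%x. \<Sum>k<m. measure lebesgue (E k) * dfun (c (y k)) x)"
   by (intro ext) (simp only: dfun_def J cs inner_sum_left inner_scaleR_left)
 qed (use E dfun_dual in auto)
qed

lemma BL2_dual:
 assumes G: "RY \<Gamma> = \<Gamma>"
 shows "(%t. dfun (ap \<Gamma> t))\<in>BL2 T (dual X)"
proof -
 have gV: "AEL t. ap \<Gamma> t\<in>V" by (rule RY_in_V[OF G])
 obtain s where s: "!!n::nat. \<exists>J. simple_int T X (s n) J" and lim: "!!t. t\<in>{0<..<T} ==> (%n. c (s n t)) ----> proj V (ap \<Gamma> t)"
  using simple_approx[OF borel_measurable_ptw_comp[OF projV ap_measurable]] proj_in[OF V] by blast
 have nrmd: "nrm (dual X) (%ps. dfun a ps - dfun b ps) = norm (a - b)" if "a\<in>V" "b\<in>V" for a b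
  using nrm_dfun[OF subspace_diff[OF V(1) that]] by (simp add: dfun_def inner_diff_left)
 have sm: "strongly_meas T (dual X) (%t. dfun (ap \<Gamma> t))"
  unfolding strongly_meas_def AE_tm
 proof (intro conjI exI[of _ "%n t. dfun (c (s n t))"] allI)
  show "AEL t. t\<in>{0<..<T} --> dfun (ap \<Gamma> t)\<in>elems (dual X)" by (simp add: dfun_dual)
  show "\<exists>J. simple_int T (dual X) (%t. dfun (c (s n t))) J" for n
   using s[of n] simple_int_dual by blast
  show "AEL t. t\<in>{0<..<T} --> (%n. nrm (dual X) (%ps. dfun (ap \<Gamma> t) ps - dfun (c (s n t)) ps)) ----> 0"
   using gV
  proof eventually_elim
   case (elim t)
   show ?case
   proof
    assume t: "t\<in>{0<..<T}"
    have "c (s n t)\<in>V" for n using s[of n] simple_int_c(1) c_in_V by blast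
    hence "(%n. nrm (dual X) (%ps. dfun (ap \<Gamma> t) ps - dfun (c (s n t)) ps)) = (%n. norm (ap \<Gamma> t - c (s n t)))"
     using nrmd[OF elim] by simp
    moreover have "(%n. norm (ap \<Gamma> t - c (s n t))) ----> norm (ap \<Gamma> t - proj V (ap \<Gamma> t))"
     by (intro tendsto_intros lim[OF t])
    ultimately show "(%n. nrm (dual X) (%ps. dfun (ap \<Gamma> t) ps - dfun (c (s n t)) ps)) ----> 0"
     using proj_id[OF V elim] by simp
   qed
  qed
 qed
 have ae: "AEL t. ind {0<..<T} t *: (nrm (dual X) (dfun (ap \<Gamma> t)))^2 = (norm (ap \<Gamma> t))^2"
  using gV RY_supp[OF G] by eventually_elim (auto simp: nrm_dfun split: split_indicator)
 have ae': "AEL t. (norm (ap \<Gamma> t))^2 = ind {0<..<T} t *: (nrm (dual X) (dfun (ap \<Gamma> t)))^2"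
  using ae by eventually_elim (rule sym)
 have "integrable lebesgue (%t. ind {0<..<T} t *: (nrm (dual X) (dfun (ap \<Gamma> t)))^2)"
  by (rule integrable_cong_AE_imp[OF integrable_norm_sq_ap[of \<Gamma>] measurable_AE_eq[OF _ ae] ae']) simp
 thus ?thesis using sm by (simp add: BL2_def integrable_tm)
qed

lemma inner_toY:
 assumes v: "v\<in>BL2 T X"
 shows "(LINT t|tm T. inner (ap U t) (c (v t))) = inner U (toY v)"
proof -
 have ae: "AEL t. ind {0<..<T} t * inner (ap U t) (c (v t)) = inner (ap U t) (ap (toY v) t)"
  using ap_toY[OF v] by eventually_elim simp
 show ?thesis
  unfolding integral_tm inner_lp2_def real_scaleR_def
  by (rule integral_cong_AE[OF measurable_AE_eq[OF _ ae] _ ae]) auto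
qed

end

lemma ip_L2L2_eq:
 assumes S: "S\<in>sets lebesgue" and T: "T > 0" and u: "u\<in>BL2 T (L2 S)" and v: "v\<in>BL2 T (L2 S)"
 shows "ip_L2L2 T S u v = inner (rep_space.toY (fib S) T u) (rep_space.toY (fib S) T v)"
proof -
 interpret rep_space "L2 S" "fib S" T by (rule rep_space_L2[OF S T])
 have ae: "AEL t. ind {0<..<T} t * (LINT x|lebesgue_on S. u t x * v t x) = inner (ap (toY u) t) (ap (toY v) t)"
  using ap_toY[OF u] ap_toY[OF v] BL2D(1)[OF u] BL2D(1)[OF v]
  by eventually_elim (auto simp: inner_fib[OF S] split: split_indicator)
 show ?thesis
  unfolding ip_L2L2_def integral_tm inner_lp2_def[of "toY u"] real_scaleR_def
  by (rule integral_cong_AE[OF measurable_AE_eq[OF _ ae] _ ae]) auto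
qed

definition wsol :: "('e::{real_inner,complete_space}=>'e)=>'e set=>'e=>'e"
 where "wsol n V e = n (proj {z. n z\<in>V} (n e))"

context
 fixes m n :: "'e::{real_inner,complete_space}=>'e" and V :: "'e set"
 assumes V: "subspace V" "closed V" and n: "bounded_linear n" and mn: "m (n x) = x" "n (m x) = x"
  and sym: "inner (n x) y = inner x (n y)"
begin

lemma wsol_space: "subspace {z. n z\<in>V}" "closed {z. n z\<in>V}"
proof -
 note l = bounded_linear.linear[OF n]
 show "subspace {z. n z\<in>V}"
  using V(1) by (auto simp: subspace_def linear_0[OF l] linear_add[OF l] linear_cmul[OF l])
 have "{z. n z\<in>V} = n -` V" by auto
 thus "closed {z. n z\<in>V}"
  using continuous_closed_vimage[OF V(2), of n] linear_continuous_at[OF n] by simp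
qed

lemma wsol_in: "wsol n V e\<in>V"
 using proj_in[OF wsol_space, of "n e"] by (simp add: wsol_def)

lemma wsol_inner:
 assumes v: "v\<in>V"
 shows "inner (m (wsol n V e)) (m v) = inner e v"
proof -
 have "inner (m (wsol n V e)) (m v) = inner (n e) (m v)"
  using proj_inner[OF wsol_space, of "m v" "n e"] v by (simp add: wsol_def mn)
 thus ?thesis by (simp add: sym mn)
qed

lemma wsol_unique:
 assumes F: "F\<in>V" and eq: "!!v. v\<in>V ==> inner (m F) (m v) = inner e v"
 shows "F = wsol n V e"
proof -
 have "proj {z. n z\<in>V} (n e) = m F"
 proof (rule proj_unique[OF wsol_space])
  show "m F\<in>{z. n z\<in>V}" using F by (simp add: mn)
  fix v assume "v\<in>{z. n z\<in>V}"
  thus "inner (m F) v = inner (n e) v" using eq[of "n v"] by (simp add: mn sym)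
 qed
 thus ?thesis by (simp add: wsol_def mn)
qed

lemma wsol_linear: "bounded_linear (wsol n V)"
 unfolding wsol_def[abs_def]
 by (intro bounded_linear_compose[OF n] bounded_linear_compose[OF bounded_linear_proj[OF wsol_space]] n)

lemma wsol_sym: "inner (wsol n V e) e' = inner e (wsol n V e')"
 by (simp add: wsol_def sym proj_selfadjoint[OF wsol_space])

lemma wsol_definite:
 assumes "inner (wsol n V e) e = 0"
 shows "wsol n V e = 0"
proof -
 have "inner (m (wsol n V e)) (m (wsol n V e)) = 0" using wsol_inner[OF wsol_in] assms by (simp add: inner_commute)
 hence "m (wsol n V e) = 0" by simp
 thus ?thesis using mn(2)[of "wsol n V e"] linear_0[OF bounded_linear.linear[OF n]] by simp
qed

end

definition wt :: "real=>real=>('a::euclidean_space, real \<times> 'a) lp2=>('a, real \<times> 'a) lp2"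
 where "wt a b = ptw (%z. (a *: fst z, b *: snd z))"

definition iota :: "('a::euclidean_space, real) lp2=>('a, real \<times> 'a) lp2"
 where "iota = ptw (%r. (r, 0))"

definition sol1 :: "'a::euclidean_space set=>real=>real=>('a, real \<times> 'a) lp2=>('a, real \<times> 'a) lp2"
 where "sol1 S al be = wsol (wt (1 / sqrt be) (1 / sqrt al)) (V1 S)"

definition sol2 :: "'a::euclidean_space set=>real=>real=>('a, real) lp2=>('a, real) lp2"
 where "sol2 S al be h = ptw fst (sol1 S al be (iota h))"

lemma wt_point: "bounded_linear (%z::real \<times> 'a::euclidean_space. (a *: fst z, b *: snd z))"
 by (intro bounded_linear_Pair bounded_linear_compose[OF bounded_linear_scaleR_right] bounded_linear_fst bounded_linear_snd)

lemma wt_linear: "bounded_linear (wt a b)"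
 unfolding wt_def by (rule bounded_linear_ptw[OF wt_point])

lemma ap_wt: "AEL x. ap (wt a b F) x = (a *: fst (ap F x), b *: snd (ap F x))"
 unfolding wt_def by (rule ap_ptw[OF wt_point])

lemma wt_sym: "inner (wt a b F) G = inner F (wt a b G)"
 unfolding wt_def by (rule inner_ptw[OF wt_point wt_point]) (simp add: inner_prod_def)

lemma wt_wt: "wt a b (wt a' b' F) = wt (a * a') (b * b') F"
 by (rule lp2_eqI) (use ap_wt[of a b "wt a' b' F"] ap_wt[of a' b' F] ap_wt[of "a * a'" "b * b'" F] in eventually_elim, simp)

lemma wt_one: "wt 1 1 F = F"
 by (rule lp2_eqI) (use ap_wt[of 1 1 F] in eventually_elim, simp)

lemma ptw_wt: "ptw fst (wt a b F) = a *: ptw fst F" "ptw snd (wt a b F) = b *: ptw snd F"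
proof -
 show "ptw fst (wt a b F) = a *: ptw fst F"
  by (rule lp2_eqI) (use ap_ptw[OF bounded_linear_fst, of "wt a b F"] ap_ptw[OF bounded_linear_fst, of F] ap_wt[of a b F] ap_scaleR[of a "ptw fst F"]
    in eventually_elim, simp)
 show "ptw snd (wt a b F) = b *: ptw snd F"
  by (rule lp2_eqI) (use ap_ptw[OF bounded_linear_snd, of "wt a b F"] ap_ptw[OF bounded_linear_snd, of F] ap_wt[of a b F] ap_scaleR[of b "ptw snd F"]
    in eventually_elim, simp)
qed

lemma iota_point: "bounded_linear (%r::real. (r, 0::'a::euclidean_space))"
 by (intro bounded_linear_Pair bounded_linear_ident bounded_linear_zero)

lemma iota_linear: "bounded_linear iota"
 unfolding iota_def by (rule bounded_linear_ptw[OF iota_point])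

lemma inner_iota: "inner (iota h) F = inner h (ptw fst F)"
 unfolding iota_def by (rule inner_ptw[OF iota_point bounded_linear_fst]) (simp add: inner_prod_def)

context
 fixes S :: "'a::euclidean_space set" and al be :: real
 assumes So: "open S" and al: "al > 0" and be: "be > 0"
begin

lemma wt_inverse:
 "wt (sqrt be) (sqrt al) (wt (1 / sqrt be) (1 / sqrt al) F) = F" "wt (1 / sqrt be) (1 / sqrt al) (wt (sqrt be) (sqrt al) F) = F"
 using al be by (simp_all add: wt_wt wt_one)

lemma sol1_in: "sol1 S al be e\<in>V1 S"
 unfolding sol1_def by (rule wsol_in[OF V1[OF So] wt_linear wt_inverse wt_sym])

lemma sol1_linear: "bounded_linear (sol1 S al be)"
 unfolding sol1_def by (rule wsol_linear[OF V1[OF So] wt_linear wt_inverse wt_sym])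

lemma sol1_sym: "inner (sol1 S al be e) e' = inner e (sol1 S al be e')"
 unfolding sol1_def by (rule wsol_sym[OF V1[OF So] wt_linear wt_inverse wt_sym])

lemma inner_wt: "inner (wt (sqrt be) (sqrt al) F) (wt (sqrt be) (sqrt al) G) = be * inner (ptw fst F) (ptw fst G) + al * inner (ptw snd F) (ptw snd G)"
 unfolding inner_fst_snd[of "wt (sqrt be) (sqrt al) F"] ptw_wt using al be by (simp flip: mult.assoc)

lemma elliptic_iff:
 assumes u: "u\<in>elems (H1 S)"
 shows "(\<forall>ps\<in>elems (H1 S). - al * laplacian S u ps + be * emb S u ps = inner e (c1 S ps)) \<longleftrightarrow> c1 S u = sol1 S al be e"
proof -
 have eq: "- al * laplacian S u ps + be * emb S u ps = inner (wt (sqrt be) (sqrt al) (c1 S u)) (wt (sqrt be) (sqrt al) (c1 S ps))"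
  if "ps\<in>elems (H1 S)" for ps
  using inner_fib[OF Sl[OF So] H1_weak_grad(1)[OF So u] H1_weak_grad(1)[OF So that]]
  by (simp add: inner_wt inner_weak_grad(2)[OF So u that] emb_def ptw_fst_c1[OF So] u that)
 show ?thesis
 proof
  assume a: "\<forall>ps\<in>elems (H1 S). - al * laplacian S u ps + be * emb S u ps = inner e (c1 S ps)"
  show "c1 S u = sol1 S al be e"
   unfolding sol1_def
  proof (rule wsol_unique[OF V1[OF So] wt_linear wt_inverse wt_sym c1_in_V1(1)[OF So u]])
   fix v assume "v\<in>V1 S"
   then obtain ps where "ps\<in>elems (H1 S)" "v = c1 S ps" using c1_range[OF So] by blast
   thus "inner (wt (sqrt be) (sqrt al) (c1 S u)) (wt (sqrt be) (sqrt al) v) = inner e v" using a eq by simp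
  qed
 next
  assume a: "c1 S u = sol1 S al be e"
  show "\<forall>ps\<in>elems (H1 S). - al * laplacian S u ps + be * emb S u ps = inner e (c1 S ps)"
  proof
   fix ps assume ps: "ps\<in>elems (H1 S)"
   show "- al * laplacian S u ps + be * emb S u ps = inner e (c1 S ps)"
    unfolding eq[OF ps] a unfolding sol1_def
    by (rule wsol_inner[OF V1[OF So] wt_linear wt_inverse wt_sym c1_in_V1(1)[OF So ps]])
  qed
 qed
qed

lemma emb_iota:
 assumes u: "u\<in>elems (L2 S)" and ps: "ps\<in>elems (H1 S)"
 shows "emb S u ps = inner (iota (fib S u)) (c1 S ps)"
 using inner_fib[OF Sl[OF So] u H1_weak_grad(1)[OF So ps]] by (simp add: emb_def inner_iota ptw_fst_c1[OF So ps])

lemma sol2_linear: "bounded_linear (sol2 S al be)"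
 unfolding sol2_def[abs_def]
 by (intro bounded_linear_compose[OF bounded_linear_ptw[OF bounded_linear_fst]] bounded_linear_compose[OF sol1_linear] iota_linear)

lemma sol2_sym: "inner (sol2 S al be u) v = inner u (sol2 S al be v)"
 using sol1_sym[of "iota u" "iota v"] inner_iota[of u "sol1 S al be (iota v)"] inner_iota[of v "sol1 S al be (iota u)"]
 by (simp add: sol2_def inner_commute)

lemma V1_fst: "F\<in>V1 S ==> mulop (ind S) (ptw fst F) = ptw fst F"
proof (rule lp2_eqI)
 assume "F\<in>V1 S"
 hence "mulop (ind S) F = F" by (simp add: V1_def)
 hence F: "AEL x. ap F x = ind S x *: ap F x" using ap_mulop[OF indS[OF Sl[OF So]], of F] by simp
 show "AEL x. ap (mulop (ind S) (ptw fst F)) x = ap (ptw fst F) x"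
  using ap_mulop[OF indS[OF Sl[OF So]], of "ptw fst F"] ap_ptw[OF bounded_linear_fst, of F] F
  by eventually_elim (metis fst_scaleR)
qed

lemma sol2_Om: "mulop (ind S) (sol2 S al be h) = sol2 S al be h"
 unfolding sol2_def by (rule V1_fst[OF sol1_in])

lemma sol2_injective:
 assumes h: "mulop (ind S) h = h" and 0: "sol2 S al be h = 0"
 shows "h = 0"
proof -
 have "inner (sol1 S al be (iota h)) (iota h) = inner h (sol2 S al be h)"
  by (simp add: inner_commute[of _ "iota h"] inner_iota sol2_def)
 hence "sol1 S al be (iota h) = 0"
  using 0 unfolding sol1_def by (intro wsol_definite[OF V1[OF So] wt_linear wt_inverse wt_sym]) simp
 hence V: "inner h (ptw fst v) = 0" if "v\<in>V1 S" for v
  using wsol_inner[OF V1[OF So] wt_linear wt_inverse wt_sym that, of "iota h"]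
  unfolding sol1_def by (simp add: inner_iota linear_0[OF bounded_linear.linear[OF wt_linear]])
 have "AEL x. x\<in>S --> ap h x = 0"
 proof (rule AE_zero_if_test[OF So])
  show "set_integrable lebesgue (cbox a b) (ap h)" for a b
   unfolding set_integrable_def by (rule integrable_indicator_sq) auto
  fix ph assume ph: "test_function S ph"
  obtain F where F: "F\<in>V1 S" "AEL x. fst (ap F x) = ph x" using test_function_H1[OF So ph] by blast
  have "(LL x. ap h x * ph x) = inner h (ptw fst F)"
   unfolding inner_lp2_def
   by (rule integral_cong_AE)
    (use testD(3)[OF ph] in simp, simp, use F(2) ap_ptw[OF bounded_linear_fst, of F] in eventually_elim, simp)
  thus "(LL x. ap h x * ph x) = 0" using V[OF F(1)] by simp
 qed
 moreover have "AEL x. ap h x = ind S x * ap h x" using ap_mulop[OF indS[OF Sl[OF So]], of h] h by simp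
 ultimately have "AEL x. ap h x = ap 0 x"
  using ap_zero[where 'a='a and 'b=real]
 proof eventually_elim
  case (elim x)
  thus ?case by (cases "x\<in>S") simp_all
 qed
 thus ?thesis by (rule lp2_eqI)
qed

context
 fixes T :: real
 assumes T: "T > 0"
begin

interpretation L: rep_space "L2 S" "fib S" T by (rule rep_space_L2[OF Sl[OF So] T])
interpretation H: rep_space "H1 S" "c1 S" T by (rule rep_space_H1[OF So T])

lemma HV: "H.V = V1 S" using c1_range[OF So] by (simp add: H.V_def)

lemma sol1_RY:
 assumes E: "AEL t. t\<notin>{0<..<T} --> ap E t = 0"
 shows "H.RY (ptw (sol1 S al be) E) = ptw (sol1 S al be) E"
proof (rule lp2_eqI, goal_cases)
 case 1 show ?case
  using H.ap_RY[of "ptw (sol1 S al be) E"] ap_ptw[OF sol1_linear, of E] E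
 proof eventually_elim
  case (elim t)
  thus ?case
   by (cases "t\<in>{0<..<T}") (simp_all add: proj_id[OF V1[OF So]] HV sol1_in linear_0[OF bounded_linear.linear[OF sol1_linear]])
 qed
qed

lemma elliptic_time_iff:
 assumes ph: "ph\<in>BL2 T (H1 S)" and E: "AEL t. t\<notin>{0<..<T} --> ap E t = 0"
 shows "(AE t in tm T. \<forall>ps\<in>elems (H1 S). - al * laplacian S (ph t) ps + be * emb S (ph t) ps = inner (ap E t) (c1 S ps))
   \<longleftrightarrow> H.toY ph = ptw (sol1 S al be) E"
proof -
 have "(AE t in tm T. \<forall>ps\<in>elems (H1 S). - al * laplacian S (ph t) ps + be * emb S (ph t) ps = inner (ap E t) (c1 S ps))
   \<longleftrightarrow> (AEL t. ap (H.toY ph) t = ap (ptw (sol1 S al be) E) t)"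
  unfolding AE_tm
 proof (rule eventually_subst)
  show "AEL t. (t\<in>{0<..<T} --> (\<forall>ps\<in>elems (H1 S). - al * laplacian S (ph t) ps + be * emb S (ph t) ps = inner (ap E t) (c1 S ps)))
    \<longleftrightarrow> ap (H.toY ph) t = ap (ptw (sol1 S al be) E) t"
   using H.ap_toY[OF ph] H.BL2D(1)[OF ph] ap_ptw[OF sol1_linear, of E] E
  proof eventually_elim
   case (elim t)
   show ?case
   proof (cases "t\<in>{0<..<T}")
    case True
    thus ?thesis using elim elliptic_iff[of "ph t" "ap E t"] by simp
   next
    case False
    thus ?thesis using elim by (auto simp: linear_0[OF bounded_linear.linear[OF sol1_linear]])
   qed
  qed
 qed
 thus ?thesis by (simp add: lp2_eq_iff)
qed

end

end

section \<open>Operators and functionals on Bochner spaces\<close>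

context rep_space
begin

lemma riesz_time:
 assumes lin: "!!a h h'. h\<in>BL2 T X ==> h'\<in>BL2 T X ==> F (%t x. a * h t x + h' t x) = a * F h + F h'"
  and bd: "!!h. h\<in>BL2 T X ==> \<bar>F h\<bar>\<le>C * nrm_BL2 T X h"
 shows "\<exists>g. RY g = g \<and> (\<forall>h\<in>BL2 T X. F h = inner g (toY h))"
proof -
 have cong: "F h = F h'" if h: "h\<in>BL2 T X" "h'\<in>BL2 T X" "toY h = toY h'" for h h'
 proof -
  have "(%t x. - 1 * h t x + h' t x) = (%t x. h' t x - h t x)" by (simp add: fun_eq_iff)
  hence "F (%t x. h' t x - h t x) = F h' - F h" using lin[OF h(1,2), of "-1"] by simp
  moreover have "\<bar>F (%t x. h' t x - h t x)\<bar>\<le>C * 0"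
   using bd[OF BL2_diff(1)[OF h(2,1)]] toY_eq_iff[OF h(2,1)] h(3) by simp
  ultimately show ?thesis by simp
 qed
 define F' where "F' U = F (ofY U)" for U
 have F'_eq: "F' (toY h) = F h" if "h\<in>BL2 T X" for h
  unfolding F'_def by (rule cong) (simp_all add: ofY RY_toY that)
 have "bounded_linear F'"
 proof (rule bounded_linear_intro[where K="\<bar>C\<bar>"])
  have lc: "F' (r *: U + W) = r * F' U + F' W" for r U W
  proof -
   have l: "(%t x. r * ofY U t x + ofY W t x) = (%t x. ofY W t x + r * ofY U t x)" by (simp add: fun_eq_iff add.commute)
   have b: "(%t x. r * ofY U t x + ofY W t x)\<in>BL2 T X" "toY (%t x. r * ofY U t x + ofY W t x) = r *: RY U + RY W"
    unfolding l using BL2_lincomb[OF ofY(1)[of W] ofY(1)[of U], of r] by (auto simp: ofY(2))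
   have "F' (r *: U + W) = F (%t x. r * ofY U t x + ofY W t x)"
    unfolding F'_def using bounded_linear.linear[OF RY_linear]
    by (intro cong ofY(1) b(1)) (simp add: ofY(2) b(2) linear_add linear_scale)
   thus ?thesis by (simp add: lin ofY(1) F'_def)
  qed
  show "F' (U + W) = F' U + F' W" for U W using lc[of 1 U W] by simp
  have "F' 0 = 0" using lc[of 1 0 0] by simp
  thus "F' (r *: U) = r *: F' U" for r U using lc[of r U 0] by simp
  show "norm (F' U)\<le>norm U * \<bar>C\<bar>" for U
  proof -
   have "\<bar>F' U\<bar>\<le>C * norm (RY U)" using bd[OF ofY(1)[of U]] norm_toY[OF ofY(1)[of U]] by (simp add: F'_def ofY(2))
   also have "...\<le>\<bar>C\<bar> * norm U" by (intro mult_mono) (simp_all add: norm_RY_le)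
   finally show ?thesis by (simp add: mult.commute)
  qed
 qed
 then obtain g where g: "!!U. F' U = inner g U" using riesz_representation by blast
 show ?thesis
 proof (intro exI[of _ "RY g"] conjI ballI)
  fix h assume h: "h\<in>BL2 T X"
  have "F h = inner g (RY (toY h))" using F'_eq[OF h] g RY_toY[OF h] by simp
  thus "F h = inner (RY g) (toY h)" by (simp add: RY_sym)
 qed (rule RY_RY)
qed

lemma bounded_op_rep:
 assumes A: "bounded_op T X A"
 shows "\<exists>A'. bounded_linear A' \<and> (\<forall>u\<in>BL2 T X. A u\<in>BL2 T X \<and> toY (A u) = A' (toY u))"
proof -
 have mem: "A u\<in>BL2 T X" if "u\<in>BL2 T X" for u using A that by (simp add: bounded_op_def)
 have add: "toY (A (%t x. u t x + v t x)) = toY (A u) + toY (A v)" if u: "u\<in>BL2 T X" and v: "v\<in>BL2 T X" for u v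
 proof -
  have "nrm_BL2 T X (%t x. A (%t x. u t x + v t x) t x - (A u t x + A v t x)) = 0"
   using A u v by (simp add: bounded_op_def)
  thus ?thesis
   using toY_eq_iff[OF mem[OF BL2_add(1)[OF u v]] BL2_add(1)[OF mem[OF u] mem[OF v]]] BL2_add(2)[OF mem[OF u] mem[OF v]] by simp
 qed
 have scl: "toY (A (%t x. r * u t x)) = r *: toY (A u)" if u: "u\<in>BL2 T X" for r u
 proof -
  have "nrm_BL2 T X (%t x. A (%t x. r * u t x) t x - r * A u t x) = 0" using A u by (simp add: bounded_op_def)
  thus ?thesis
   using toY_eq_iff[OF mem[OF BL2_scale(1)[OF u]] BL2_scale(1)[OF mem[OF u]]] BL2_scale(2)[OF mem[OF u]] by simp
 qed
 obtain C where C: "!!u. u\<in>BL2 T X ==> nrm_BL2 T X (A u)\<le>C * nrm_BL2 T X u" using A unfolding bounded_op_def by blast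
 have cong: "toY (A u) = toY (A v)" if uv: "u\<in>BL2 T X" "v\<in>BL2 T X" "toY u = toY v" for u v
 proof -
  have v': "(%t x. - 1 * v t x)\<in>BL2 T X" by (rule BL2_scale(1)[OF uv(2)])
  have "toY (A (%t x. u t x + - 1 * v t x)) = toY (A u) - toY (A v)"
   using add[OF uv(1) v'] scl[OF uv(2), of "- 1"] by simp
  moreover have "norm (toY (A (%t x. u t x + - 1 * v t x)))\<le>C * norm (toY u - toY v)"
   using C[OF BL2_add(1)[OF uv(1) v']] norm_toY[OF BL2_add(1)[OF uv(1) v']] norm_toY[OF mem[OF BL2_add(1)[OF uv(1) v']]]
    BL2_add(2)[OF uv(1) v'] BL2_scale(2)[OF uv(2), of "- 1"] by simp
  ultimately show ?thesis using uv(3) by simp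
 qed
 define A' where "A' U = toY (A (ofY U))" for U
 note lR = bounded_linear.linear[OF RY_linear]
 have "bounded_linear A'"
 proof (rule bounded_linear_intro[where K="\<bar>C\<bar>"])
  show "A' (U + W) = A' U + A' W" for U W
   unfolding A'_def add[OF ofY(1) ofY(1), symmetric]
   by (rule cong) (simp_all add: ofY BL2_add linear_add[OF lR])
  show "A' (r *: U) = r *: A' U" for r U
   unfolding A'_def scl[OF ofY(1), symmetric]
   by (rule cong) (simp_all add: ofY BL2_scale linear_scale[OF lR])
  show "norm (A' U)\<le>norm U * \<bar>C\<bar>" for U
  proof -
   have "norm (A' U)\<le>C * norm (RY U)"
    using C[OF ofY(1)[of U]] norm_toY[OF ofY(1)[of U]] norm_toY[OF mem[OF ofY(1)[of U]]] by (simp add: A'_def ofY(2))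
   also have "...\<le>\<bar>C\<bar> * norm U" by (intro mult_mono) (simp_all add: norm_RY_le)
   finally show ?thesis by (simp add: mult.commute)
  qed
 qed
 moreover have "toY (A u) = A' (toY u)" if "u\<in>BL2 T X" for u
  unfolding A'_def by (rule cong) (simp_all add: that ofY RY_toY)
 ultimately show ?thesis using mem by blast
qed

lemma prim_RY:
 assumes t: "t\<le>T"
 shows "prim (RY W) t = proj V (prim W t)"
proof -
 have i: "integrable lebesgue (%s. ind {0<..<t} s *: ap W s)" by (rule integrable_indicator_sq) simp_all
 have "proj V (prim W t) = (LL s. proj V (ind {0<..<t} s *: ap W s))"
  unfolding prim_def by (rule integral_bounded_linear[OF projV i, symmetric])
 also have "... = prim (RY W) t"
  unfolding prim_def
 proof (rule integral_cong_AE)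
  show "(%s. proj V (ind {0<..<t} s *: ap W s))\<in>meas"
   by (rule borel_measurable_ptw_comp[OF projV borel_measurable_integrable[OF i]])
  show "AEL s. proj V (ind {0<..<t} s *: ap W s) = ind {0<..<t} s *: ap (RY W) s"
   using ap_RY[of W]
  proof eventually_elim
   case (elim s)
   thus ?case
    using t linear_0[OF bounded_linear.linear[OF projV]] by (cases "s\<in>{0<..<t}") simp_all
  qed
 qed simp
 finally show ?thesis by simp
qed

lemma prim_in_V: "RY W = W ==> t\<le>T ==> prim W t\<in>V"
 using prim_RY[of t W] proj_in[OF V] by metis

lemma intop_BH1_van:
 assumes W: "RY W = W"
 shows "RY (intop T W) = intop T W" "ofY (intop T W)\<in>BH1_van 0 T X" "toY (weak_dt T X (ofY (intop T W))) = W"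
proof -
 show R: "RY (intop T W) = intop T W"
 proof (rule lp2_eqI, goal_cases)
  case 1 show ?case
   using ap_RY[of "intop T W"] ap_intop[OF T, of W]
  proof eventually_elim
   case (elim t)
   thus ?case using prim_in_V[OF W, of t] by (cases "t\<in>{0<..<T}") (simp_all add: proj_id[OF V])
  qed
 qed
 have C: "continuous_on {0..T} (prim W)" "!!t. t\<in>{0..T} ==> prim W t\<in>V" "prim W 0 = 0"
  using prim_in_V[OF W] by (auto intro: continuous_on_prim) (simp add: prim_def)
 have "AEL t. t\<in>{0<..<T} --> ap (intop T W) t = prim W t"
  using ap_intop[OF T, of W] by eventually_elim simp
 from BH1_vanI[OF R W wd_intop[OF T] _ C this] T
 show "ofY (intop T W)\<in>BH1_van 0 T X" "toY (weak_dt T X (ofY (intop T W))) = W" by auto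
qed

lemma coint_BH1_van:
 assumes W: "RY W = W"
 shows "RY (coint T W) = coint T W" "ofY (coint T W)\<in>BH1_van T T X" "toY (weak_dt T X (ofY (coint T W))) = - W"
proof -
 show R: "RY (coint T W) = coint T W"
 proof (rule lp2_eqI, goal_cases)
  case 1 show ?case
   using ap_RY[of "coint T W"] ap_coint[OF T, of W]
  proof eventually_elim
   case (elim t)
   thus ?case using subspace_diff[OF V(1) prim_in_V[OF W, of T] prim_in_V[OF W, of t]]
    by (cases "t\<in>{0<..<T}") (simp_all add: proj_id[OF V])
  qed
 qed
 define c0 where "c0 = prim W T"
 define Z where "Z = mk (%t. ind {0<..<T} t *: c0)"
 have Zap: "AEL t. ap Z t = ind {0<..<T} t *: c0"
  unfolding Z_def by (rule ap_mk[OF sq_int_indicator]) simp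
 have "wd T Z 0"
  unfolding wd_def
 proof (intro allI impI)
  fix ph assume ph: "test_function {0<..<T} ph"
  have "(LL t. deriv ph t *: ap Z t) = prim (mk (%s. deriv ph s *: c0)) T"
   unfolding prim_def
  proof (rule integral_cong_AE)
   show "(%t. deriv ph t *: ap Z t)\<in>meas"
    using multf_test(2)[OF ph] by (intro borel_measurable_scaleR) (simp_all add: multf_def)
   show "AEL t. deriv ph t *: ap Z t = ind {0<..<T} t *: ap (mk (%s. deriv ph s *: c0)) t"
    using Zap ap_mk[OF multf_sq_int(1)[OF multf_test(2)[OF ph], of c0]] by eventually_elim simp
  qed simp
  also have "... = 0" using prim_test[OF ph, of T c0] T testD(4)[OF ph, of T] by simp
  also have "0 = - (LL t. ph t *: ap (0 :: (real, 'b) lp2) t)"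
  proof -
   have "AEL t. ph t *: ap (0 :: (real, 'b) lp2) t = 0"
    using ap_zero[where 'a=real and 'b='b] by eventually_elim simp
   thus ?thesis by (simp add: integral_eq_zero_AE)
  qed
  finally show "(LL t. deriv ph t *: ap Z t) = - (LL t. ph t *: ap (0 :: (real, 'b) lp2) t)" .
 qed
 from wd_add_scaleR[OF this wd_intop[OF T, of W], of "- 1"]
 have wd1: "wd T (Z + (- 1) *: intop T W) (- W)" by simp
 have "coint T W = Z + (- 1) *: intop T W"
 proof (rule lp2_eqI, goal_cases)
  case 1 show ?case
   using ap_coint[OF T, of W] ap_intop[OF T, of W] Zap ap_add[of Z "(- 1) *: intop T W"] ap_scaleR[of "- 1" "intop T W"]
   by eventually_elim (simp add: c0_def scaleR_diff_right)
 qed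
 hence wd: "wd T (coint T W) (- W)" using wd1 by simp
 have W': "RY (- W) = - W" using W linear_neg[OF bounded_linear.linear[OF RY_linear], of W] by simp
 have C: "continuous_on {0..T} (%t. prim W T - prim W t)" "!!t. t\<in>{0..T} ==> prim W T - prim W t\<in>V"
  using prim_in_V[OF W] by (auto intro!: continuous_intros continuous_on_prim subspace_diff[OF V(1)])
 have "AEL t. t\<in>{0<..<T} --> ap (coint T W) t = prim W T - prim W t"
  using ap_coint[OF T, of W] by eventually_elim simp
 from BH1_vanI[OF R W' wd _ C _ this, of T] T
 show "ofY (coint T W)\<in>BH1_van T T X" "toY (weak_dt T X (ofY (coint T W))) = - W" by auto
qed

lemma RY_coint: "RY (coint T W) = coint T (RY W)"
proof (rule lp2_eqI, goal_cases)
 case 1 show ?case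
  using ap_RY[of "coint T W"] ap_coint[OF T, of W] ap_coint[OF T, of "RY W"]
 proof eventually_elim
  case (elim t)
  thus ?case
   by (cases "t\<in>{0<..<T}") (simp_all add: prim_RY linear_diff[OF bounded_linear.linear[OF projV]])
 qed
qed

lemma BLinfI:
 assumes u: "u\<in>BL2 T X" and C: "AEL t. t\<in>{0<..<T} --> norm (ap (toY u) t)\<le>C"
 shows "u\<in>BLinf T X"
proof -
 have ae: "AEL t. ind {0<..<T} t * nrm X (u t) = norm (ap (toY u) t)"
  using ap_toY[OF u] BL2D(1)[OF u] by eventually_elim (auto simp: nrm split: split_indicator)
 have "(%t. ind {0<..<T} t * nrm X (u t))\<in>meas"
  by (rule measurable_AE_eq[OF _ ae]) simp
 hence "(%t. nrm X (u t))\<in>borel_measurable (tm T)"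
  by (subst borel_measurable_restrict_space_iff) (simp_all add: mult.commute)
 hence m: "(%t. ereal (nrm X (u t)))\<in>borel_measurable (tm T)" by simp
 have "AE t in tm T. ereal (nrm X (u t))\<le>ereal C"
  unfolding AE_tm using ae C by eventually_elim (auto split: split_indicator)
 hence "esssup (tm T) (%t. ereal (nrm X (u t)))\<le>ereal C" by (rule esssup_I[OF m])
 thus ?thesis using u by (auto simp: BLinf_def BL2_def)
qed

end

context
 fixes S :: "'a::euclidean_space set" and T :: real
 assumes S: "S\<in>lmeasurable" and T: "T > 0"
begin

lemma Ss: "S\<in>sets lebesgue" using S by simp

interpretation rep_space "L2 S" "fib S" T by (rule rep_space_L2[OF Ss T])

lemma RY_L2: "RY U = mulop (ind {0<..<T}) (ptw (mulop (ind S)) U)"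
 by (simp add: RY_def V_def proj_L2[OF Ss])

lemma AE_toY:
 assumes u: "u\<in>BL2 T (L2 S)"
 shows "AE t in tm T. AE x in lebesgue_on S. u t x = ap (ap (toY u) t) x"
 unfolding AE_tm AE_lebesgue_on[OF Ss]
 using ap_toY[OF u] BL2D(1)[OF u]
proof eventually_elim
 case (elim t)
 show ?case
 proof
  assume t: "t\<in>{0<..<T}"
  have "u t\<in>elems (L2 S)" using elim t by blast
  from ap_fib[OF Ss this] show "AEL x. x\<in>S --> u t x = ap (ap (toY u) t) x"
   by eventually_elim (use elim t in simp)
 qed
qed

lemma AE_ofY: "AE t in tm T. AE x in lebesgue_on S. ofY U t x = ap (ap U t) x"
 unfolding AE_tm AE_lebesgue_on[OF Ss]
proof (rule AE_I2, rule impI)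
 fix t
 have "fib S (ofY U t) = mulop (ind S) (ap U t)" using ofX(2)[of "ap U t"] by (simp add: ofY_def V_def proj_L2[OF Ss])
 moreover have "ofY U t\<in>elems (L2 S)" by (simp add: ofY_def ofX)
 ultimately show "AEL x. x\<in>S --> ofY U t x = ap (ap U t) x"
  using ap_fib[OF Ss, of "ofY U t"] ap_mulop[OF indS[OF Ss], of "ap U t"] by (auto elim: eventually_elim2)
qed

lemma BL2_AE:
 assumes U: "RY U = U" and ae: "AE t in tm T. AE x in lebesgue_on S. u t x = ap (ap U t) x"
 shows "u\<in>BL2 T (L2 S)" "toY u = U"
proof -
 have "AEL t. t\<in>{0<..<T} --> u t\<in>elems (L2 S) \<and> fib S (u t) = ap U t"
  using ae[unfolded AE_tm] RY_in_V[OF U]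
 proof eventually_elim
  case (elim t)
  show ?case
  proof
   assume t: "t\<in>{0<..<T}"
   have Ut: "mulop (ind S) (ap U t) = ap U t" using elim(2) by (simp add: V_def fib_range[OF Ss])
   have 2: "AEL x. x\<in>S --> u t x = ap (ap U t) x" using elim(1) t by (simp add: AE_lebesgue_on[OF Ss])
   show "u t\<in>elems (L2 S) \<and> fib S (u t) = ap U t" using fib_eqI[OF Ss Ut 2] by simp
  qed
 qed
 from BL2_toYI[OF this RY_supp[OF U]] show "u\<in>BL2 T (L2 S)" "toY u = U" by auto
qed

lemma AE_toY_eq:
 assumes "u\<in>BL2 T (L2 S)" "v\<in>BL2 T (L2 S)" "toY u = toY v"
 shows "AE t in tm T. AE x in lebesgue_on S. u t x = v t x"
 using AE_toY[OF assms(1)] AE_toY[OF assms(2)]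
proof eventually_elim
 case (elim t)
 from elim(1) elim(2) show ?case by eventually_elim (simp add: assms(3))
qed

lemma AE_nem1:
 fixes g :: "real=>real"
 assumes L: "0\<le>L" and lip: "!!p q. \<bar>g p - g q\<bar>\<le>L * \<bar>p - q\<bar>"
 defines "N \<equiv> nem1 {0<..<T} (nem1 S g)"
 shows "RY (N U) = N U" "AE t in tm T. AE x in lebesgue_on S. ap (ap (N U) t) x = g (ap (ap U t) x)"
proof -
 note a = ap_nem1[OF S L, of g, unfolded real_norm_def, OF lip]
 have l: "norm (nem1 S g A - nem1 S g B)\<le>L * norm (A - B)" for A B
  by (rule norm_nem1_diff[OF S L]) (simp add: lip)
 note b = ap_nem1[OF lmeasurable_ivl L l, of 0 T U, folded N_def]
 have m: "mulop (ind S) (nem1 S g A) = nem1 S g A" for A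
  by (rule lp2_eqI) (use a[of A] ap_mulop[OF indS[OF Ss], of "nem1 S g A"] in eventually_elim, auto split: split_indicator)
 show "RY (N U) = N U"
 proof (rule lp2_eqI, goal_cases)
  case 1 show ?case
   using ap_RY[of "N U"] b
  proof eventually_elim
   case (elim t)
   thus ?case by (cases "t\<in>{0<..<T}") (simp_all add: V_def proj_L2[OF Ss] m)
  qed
 qed
 show "AE t in tm T. AE x in lebesgue_on S. ap (ap (N U) t) x = g (ap (ap U t) x)"
  unfolding AE_tm AE_lebesgue_on[OF Ss] using b
 proof eventually_elim
  case (elim t)
  show ?case
  proof
   assume "t\<in>{0<..<T}"
   hence "ap (N U) t = nem1 S g (ap U t)" using elim by simp
   thus "AEL x. x\<in>S --> ap (ap (N U) t) x = g (ap (ap U t) x)"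
    using a[of "ap U t"] by (auto elim: eventually_mono)
  qed
 qed
qed

lemma AE_nem2:
 fixes G :: "real=>real=>real"
 assumes G: "adm C G"
 shows "AE t in tm T. AE x in lebesgue_on S. ap (ap (nem2 {0<..<T} (nem2 S G) U W) t) x = G (ap (ap U t) x) (ap (ap W t) x)"
 unfolding AE_tm AE_lebesgue_on[OF Ss]
 using ap_nem2[OF fmeasurableD[OF lmeasurable_ivl] adm_dom2[OF adm_nem2[OF Ss G]], of 0 T U W]
proof eventually_elim
 case (elim t)
 show ?case
 proof
  assume "t\<in>{0<..<T}"
  hence "ap (nem2 {0<..<T} (nem2 S G) U W) t = nem2 S G (ap U t) (ap W t)" using elim by simp
  thus "AEL x. x\<in>S --> ap (ap (nem2 {0<..<T} (nem2 S G) U W) t) x = G (ap (ap U t) x) (ap (ap W t) x)"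
   using ap_nem2[OF Ss adm_dom2[OF G], of "ap U t" "ap W t"] by (auto elim: eventually_mono)
 qed
qed

lemma AE_ap_zero: "AE t in tm T. AE x in lebesgue_on S. ap (ap (0 :: 'a tl2) t) x = 0"
 unfolding AE_tm AE_lebesgue_on[OF Ss]
 using ap_zero[where 'a=real and 'b="('a, real) lp2"]
proof eventually_elim
 case (elim t)
 show ?case using ap_zero[where 'a='a and 'b=real] elim by (auto elim: eventually_mono)
qed

lemma AE_ap_lincomb: "AE t in tm T. AE x in lebesgue_on S. ap (ap (U + r *: W) t) x = ap (ap U t) x + r * ap (ap W t) x"
 for U W :: "'a tl2"
 unfolding AE_tm AE_lebesgue_on[OF Ss]
 using ap_add[of U "r *: W"] ap_scaleR[of r W]
proof eventually_elim
 case (elim t)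
 have "AEL x. ap (ap U t + r *: ap W t) x = ap (ap U t) x + r * ap (ap W t) x"
  using ap_add[of "ap U t" "r *: ap W t"] ap_scaleR[of r "ap W t"] by eventually_elim simp
 thus ?case using elim by (auto elim: eventually_mono)
qed

lemma AE_ap_scaleR: "AE t in tm T. AE x in lebesgue_on S. ap (ap (r *: W) t) x = r * ap (ap W t) x"
 for W :: "'a tl2"
 using AE_ap_lincomb[of 0 r W] AE_ap_zero
proof eventually_elim
 case (elim t)
 from elim(1) elim(2) show ?case by eventually_elim simp
qed

end

section \<open>The control problem\<close>

locale control_problem =
 fixes T al be ep Lf LH :: real and S :: "'a::euclidean_space set" and f :: "real=>real"
  and H :: "(real=>'a=>real)=>(real=>'a=>real)"
 assumes T: "T > 0" and al: "al > 0" and be: "be > 0" and ep: "ep > 0" and Lf: "Lf\<ge>0" and LH: "LH\<ge>0"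
  and So: "open S" and Sm: "S\<in>lmeasurable"
  and f_lip: "!!p q. \<bar>f p - f q\<bar>\<le>Lf * \<bar>p - q\<bar>"
  and H_mem: "!!q. q\<in>BL2 T (L2 S) ==> H q\<in>BL2 T (L2 S)"
  and H_lip: "!!q1 q2. q1\<in>BL2 T (L2 S) ==> q2\<in>BL2 T (L2 S) ==>
   AE t in tm T. nrm (L2 S) (%x. H q1 t x - H q2 t x)
    \<le>LH * (LINT s|lebesgue_on {0<..<t}. nrm (L2 S) (%x. q1 s x - q2 s x))"
begin

lemma Ss: "S\<in>sets lebesgue" using Sm by simp

sublocale L: rep_space "L2 S" "fib S" T by (rule rep_space_L2[OF Ss T])
sublocale E: rep_space "H1 S" "c1 S" T by (rule rep_space_H1[OF So T])

definition KE :: "('a, real) lp2=>('a, real) lp2" where "KE = sol2 S al be"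
definition KY :: "'a tl2=>(real, ('a, real \<times> 'a) lp2) lp2"
 where "KY X = ptw (sol1 S al be) (ptw iota X)"
definition Hc :: "'a tl2=>'a tl2" where "Hc U = L.toY (H (L.ofY U))"

lemmas sol1_bl = sol1_linear[OF So al be]

lemma ptw_fst_linear: "bounded_linear (ptw fst :: ('d::euclidean_space, real \<times> 'a) lp2=>_)"
 by (rule bounded_linear_ptw[OF bounded_linear_fst])

lemma H_est:
 assumes q: "q1\<in>BL2 T (L2 S)" "q2\<in>BL2 T (L2 S)"
 shows "AEL t. norm (ap (L.toY (H q1) - L.toY (H q2)) t)\<le>ind {0<..<T} t * (LH * nprim (L.toY q1 - L.toY q2) t)"
proof -
 have 1: "(LINT s|lebesgue_on {0<..<t}. nrm (L2 S) (%x. q1 s x - q2 s x)) = nprim (L.toY q1 - L.toY q2) t" if t: "t\<in>{0<..<T}" for t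
 proof -
  have ae: "AEL s. ind {0<..<t} s * nrm (L2 S) (%x. q1 s x - q2 s x) = ind {0<..<t} s * norm (ap (L.toY q1 - L.toY q2) s)"
   using L.BL2D(1)[OF q(1)] L.BL2D(1)[OF q(2)] L.ap_toY[OF q(1)] L.ap_toY[OF q(2)] ap_diff[of "L.toY q1" "L.toY q2"]
  proof eventually_elim
   case (elim s)
   show ?case
   proof (cases "s\<in>{0<..<t}")
    case True
    hence "s\<in>{0<..<T}" using t by simp
    thus ?thesis using elim by (simp add: L.nrm L.sub_mem L.c_diff)
   qed simp
  qed
  show ?thesis
   unfolding integral_lebesgue_on[OF fmeasurableD[OF lmeasurable_ivl]] nprim_def
   by (rule integral_cong_AE[OF measurable_AE_eq[OF _ ae] _ ae]) simp_all
 qed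
 show ?thesis
  using H_lip[OF q, unfolded AE_tm] L.BL2D(1)[OF H_mem[OF q(1)]] L.BL2D(1)[OF H_mem[OF q(2)]]
   L.ap_toY[OF H_mem[OF q(1)]] L.ap_toY[OF H_mem[OF q(2)]] ap_diff[of "L.toY (H q1)" "L.toY (H q2)"]
 proof eventually_elim
  case (elim t)
  show ?case
  proof (cases "t\<in>{0<..<T}")
   case True
   thus ?thesis using elim 1[OF True] by (simp add: L.nrm L.sub_mem L.c_diff)
  next
   case False
   thus ?thesis using elim by simp
  qed
 qed
qed

lemma H_cong:
 assumes q: "q1\<in>BL2 T (L2 S)" "q2\<in>BL2 T (L2 S)" and eq: "L.toY q1 = L.toY q2"
 shows "L.toY (H q1) = L.toY (H q2)"
proof -
 have n0: "nprim (0 :: 'a tl2) t = 0" for t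
  using nprim_scaleR[of 0 0 t] by simp
 have "AEL t. ap (L.toY (H q1) - L.toY (H q2)) t = ap 0 t"
  using H_est[OF q] ap_zero[where 'a=real and 'b="('a, real) lp2"] unfolding eq by eventually_elim (simp add: n0)
 hence "L.toY (H q1) - L.toY (H q2) = 0" by (rule lp2_eqI)
 thus ?thesis by simp
qed

lemma Hc_toY: "q\<in>BL2 T (L2 S) ==> Hc (L.toY q) = L.toY (H q)"
 unfolding Hc_def by (rule H_cong) (simp_all add: L.ofY L.RY_toY)

lemma Hc_lip: "AEL t. norm (ap (Hc U - Hc W) t)\<le>ind {0<..<T} t * (LH * nprim (U - W) t)"
proof -
 have n: "nprim (L.RY U - L.RY W) t\<le>1 * nprim (U - W) t" for t
 proof (rule nprim_mono_AE)
  have "L.RY U - L.RY W = L.RY (U - W)" by (simp add: linear_diff[OF bounded_linear.linear[OF L.RY_linear]])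
  thus "AEL s. s\<in>{0<..<t} --> norm (ap (L.RY U - L.RY W) s)\<le>1 * norm (ap (U - W) s)"
   using L.ap_RY[of "U - W"] by (auto elim!: eventually_mono simp: proj_norm_le[OF L.V] ind_def)
 qed
 show ?thesis
  using H_est[OF L.ofY(1)[of U] L.ofY(1)[of W], unfolded L.ofY(2)]
 proof eventually_elim
  case (elim t)
  have "LH * nprim (L.RY U - L.RY W) t\<le>LH * nprim (U - W) t" using n[of t] LH by (intro mult_left_mono) simp_all
  hence "ind {0<..<T} t * (LH * nprim (L.RY U - L.RY W) t)\<le>ind {0<..<T} t * (LH * nprim (U - W) t)"
   by (rule mult_left_mono) simp
  thus ?case using elim unfolding Hc_def by linarith
 qed
qed

sublocale SP: state_problem T be ep Lf LH S f KE Hc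
 by (rule state_problem.intro) (rule T be ep Lf LH Sm f_lip sol2_linear[OF So al be, folded KE_def] Hc_lip)+

lemma KY_linear: "bounded_linear KY"
 unfolding KY_def[abs_def]
 by (intro bounded_linear_compose[OF bounded_linear_ptw[OF sol1_bl]] bounded_linear_ptw[OF iota_linear])

lemma K_KY: "ptw (ptw fst) (KY X) = SP.K X"
 unfolding SP.K_def KY_def
proof (rule lp2_eqI, goal_cases)
 case 1 show ?case
  using ap_ptw[OF ptw_fst_linear, of "ptw (sol1 S al be) (ptw iota X)"] ap_ptw[OF sol1_bl, of "ptw iota X"] ap_ptw[OF iota_linear, of X]
   ap_ptw[OF SP.KE, of X]
  by eventually_elim (simp add: KE_def sol2_def)
qed

lemma toY_fst:
 assumes ph: "ph\<in>BL2 T (H1 S)"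
 shows "ph\<in>BL2 T (L2 S)" "L.toY ph = ptw (ptw fst) (E.toY ph)"
proof -
 have a: "AEL t. ap (ptw (ptw fst) (E.toY ph)) t = ind {0<..<T} t *: ptw fst (c1 S (ph t))"
  using ap_ptw[OF ptw_fst_linear, of "E.toY ph"] E.ap_toY[OF ph]
 proof eventually_elim
  case (elim t)
  thus ?case by (simp add: linear_cmul[OF bounded_linear.linear[OF ptw_fst_linear]])
 qed
 have "AEL t. t\<in>{0<..<T} --> ph t\<in>elems (L2 S) \<and> fib S (ph t) = ap (ptw (ptw fst) (E.toY ph)) t"
  using a E.BL2D(1)[OF ph]
 proof eventually_elim
  case (elim t)
  thus ?case by (auto simp: H1_weak_grad[OF So] ptw_fst_c1[OF So])
 qed
 moreover have "AEL t. t\<notin>{0<..<T} --> ap (ptw (ptw fst) (E.toY ph)) t = 0"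
  using a by eventually_elim simp
 ultimately show "ph\<in>BL2 T (L2 S)" "L.toY ph = ptw (ptw fst) (E.toY ph)" using L.BL2_toYI by blast+
qed

lemma ap_iota_supp:
 assumes "AEL t. t\<notin>{0<..<T} --> ap X t = 0"
 shows "AEL t. t\<notin>{0<..<T} --> ap (ptw iota X) t = 0"
 using assms ap_ptw[OF iota_linear, of X] by eventually_elim (simp add: linear_0[OF bounded_linear.linear[OF iota_linear]])

lemma RY_KY: "L.RY X = X ==> E.RY (KY X) = KY X"
 unfolding KY_def by (intro sol1_RY[OF So al be T] ap_iota_supp L.RY_supp)

lemma L_lincomb: "L.RY U = U ==> L.RY W = W ==> L.RY (r *: U + W) = r *: U + W"
 by (simp add: linear_add[OF bounded_linear.linear[OF L.RY_linear]] linear_cmul[OF bounded_linear.linear[OF L.RY_linear]])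

lemma emb_pair:
 assumes q: "q\<in>BL2 T (L2 S)" and l: "l\<in>BL2 T (L2 S)"
 shows "AE t in tm T. \<forall>ps\<in>elems (H1 S). r * emb S (q t) ps + emb S (l t) ps = inner (ap (ptw iota (r *: L.toY q + L.toY l)) t) (c1 S ps)"
 unfolding AE_tm
 using L.BL2D(1)[OF q] L.BL2D(1)[OF l] L.ap_toY[OF q] L.ap_toY[OF l] ap_ptw[OF iota_linear, of "r *: L.toY q + L.toY l"]
  ap_add[of "r *: L.toY q" "L.toY l"] ap_scaleR[of r "L.toY q"]
proof eventually_elim
 case (elim t)
 show ?case
 proof (intro impI ballI)
  fix ps assume t: "t\<in>{0<..<T}" and ps: "ps\<in>elems (H1 S)"
  note li = bounded_linear.linear[OF iota_linear]
  have "ap (ptw iota (r *: L.toY q + L.toY l)) t = r *: iota (fib S (q t)) + iota (fib S (l t))"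
   using elim t by (simp add: linear_add[OF li] linear_cmul[OF li])
  thus "r * emb S (q t) ps + emb S (l t) ps = inner (ap (ptw iota (r *: L.toY q + L.toY l)) t) (c1 S ps)"
   using elim t emb_iota[OF So al be _ ps] by (simp add: inner_add_left)
 qed
qed

lemma state_equation_iff:
 assumes ph: "ph\<in>BL2 T (H1 S)" and q: "q\<in>BL2 T (L2 S)" and l: "l\<in>BL2 T (L2 S)"
 shows "(AE t in tm T. \<forall>ps\<in>elems (H1 S). - al * laplacian S (ph t) ps + be * emb S (ph t) ps = be * emb S (q t) ps + emb S (l t) ps)
  \<longleftrightarrow> E.toY ph = KY (be *: L.toY q + L.toY l)"
proof -
 let ?X = "ptw iota (be *: L.toY q + L.toY l)"
 have "(AE t in tm T. \<forall>ps\<in>elems (H1 S). - al * laplacian S (ph t) ps + be * emb S (ph t) ps = be * emb S (q t) ps + emb S (l t) ps)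
  \<longleftrightarrow> (AE t in tm T. \<forall>ps\<in>elems (H1 S). - al * laplacian S (ph t) ps + be * emb S (ph t) ps = inner (ap ?X t) (c1 S ps))"
  by (rule eventually_subst) (use emb_pair[OF q l, of be] in eventually_elim, simp)
 also have "... \<longleftrightarrow> E.toY ph = ptw (sol1 S al be) ?X"
  by (intro elliptic_time_iff[OF So al be T ph] ap_iota_supp L.RY_supp L_lincomb L.RY_toY q l)
 finally show ?thesis by (simp add: KY_def)
qed

lemma max_lip: "\<bar>max p 0 - max q 0 :: real\<bar>\<le>1 * \<bar>p - q\<bar>" by auto

lemma driving_force_AE:
 assumes ph: "ph\<in>BL2 T (H1 S)" and q: "q\<in>BL2 T (L2 S)" and eq: "E.toY ph = KY (be *: L.toY q + l)"
 shows "AE t in tm T. AE x in lebesgue_on S. driving_force be f H q ph t x = ap (ap (SP.force l (L.toY q)) t) x"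
proof -
 define K1 where "K1 = SP.K (be *: L.toY q + l)"
 define N where "N = SP.N1 f (L.toY (H q))"
 have F: "SP.force l (L.toY q) = ((0 + (- 1) *: N) + (- be) *: L.toY q) + be *: K1"
  by (simp add: SP.force_def K1_def N_def Hc_toY[OF q] scaleR_diff_right)
 have phK: "L.toY ph = K1" using toY_fst(2)[OF ph] by (simp add: eq K_KY K1_def)
 show ?thesis
  using AE_toY[OF Sm T q] AE_toY[OF Sm T toY_fst(1)[OF ph]] AE_toY[OF Sm T H_mem[OF q]]
   AE_nem1(2)[OF Sm T Lf f_lip, of "L.toY (H q)"]
   AE_ap_zero[OF Sm T] AE_ap_lincomb[OF Sm T, of 0 "- 1" N] AE_ap_lincomb[OF Sm T, of "0 + (- 1) *: N" "- be" "L.toY q"]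
   AE_ap_lincomb[OF Sm T, of "(0 + (- 1) *: N) + (- be) *: L.toY q" be K1]
  unfolding F[symmetric] phK N_def[symmetric]
 proof eventually_elim
  case (elim t)
  from elim(1) elim(2) elim(3) elim(4) elim(5) elim(6) elim(7) elim(8) show ?case
   by eventually_elim (simp add: driving_force_def algebra_simps)
 qed
qed

lemma max_AE:
 fixes Z :: "'a tl2"
 defines "W \<equiv> (1 / ep) *: SP.N1 (%p. max p 0) Z"
 shows "L.RY W = W" "AE t in tm T. AE x in lebesgue_on S. ap (ap W t) x = 1 / ep * max (ap (ap Z t) x) 0"
proof -
 note n = AE_nem1[OF Sm T zero_le_one max_lip, of Z]
 show "L.RY W = W" unfolding W_def using n(1) by (simp add: linear_cmul[OF bounded_linear.linear[OF L.RY_linear]])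
 show "AE t in tm T. AE x in lebesgue_on S. ap (ap W t) x = 1 / ep * max (ap (ap Z t) x) 0"
  using AE_ap_scaleR[OF Sm T, of "1 / ep" "SP.N1 (%p. max p 0) Z"] n(2) unfolding W_def[symmetric]
 proof eventually_elim
  case (elim t)
  from elim(1) elim(2) show ?case by eventually_elim simp
 qed
qed

lemma step_intop: "SP.step l Q = intop T ((1 / ep) *: SP.N1 (%p. max p 0) (SP.force l Q))"
 by (simp add: SP.step_def linear_cmul[OF bounded_linear.linear[OF bounded_linear_intop[OF T]]])

lemma state_forward:
 assumes st: "is_state T S al be ep f H (%t. emb S (l t)) (q, ph)" and l: "l\<in>BL2 T (L2 S)"
 shows "q\<in>BL2 T (L2 S)" "ph\<in>BL2 T (H1 S)" "E.toY ph = KY (be *: L.toY q + L.toY l)" "SP.step (L.toY l) (L.toY q) = L.toY q"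
proof -
 have van: "q\<in>BH1_van 0 T (L2 S)" and ph: "ph\<in>BL2 T (H1 S)"
  and ode: "AE t in tm T. AE x in lebesgue_on S. weak_dt T (L2 S) q t x = 1 / ep * max (driving_force be f H q ph t x) 0"
  and pde: "AE t in tm T. \<forall>ps\<in>elems (H1 S). - al * laplacian S (ph t) ps + be * emb S (ph t) ps = be * emb S (q t) ps + emb S (l t) ps"
  using st by (auto simp: is_state_def)
 have qH: "q\<in>BH1 T (L2 S)" using van by (simp add: BH1_van_def)
 show q: "q\<in>BL2 T (L2 S)" by (rule L.weak_dt(1)[OF qH])
 show "ph\<in>BL2 T (H1 S)" by (rule ph)
 show eq: "E.toY ph = KY (be *: L.toY q + L.toY l)" using pde state_equation_iff[OF ph q l] by blast
 let ?F = "SP.force (L.toY l) (L.toY q)"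
 let ?W = "(1 / ep) *: SP.N1 (%p. max p 0) ?F"
 have "AE t in tm T. AE x in lebesgue_on S. weak_dt T (L2 S) q t x = ap (ap ?W t) x"
  using ode driving_force_AE[OF ph q eq] max_AE(2)[of ?F]
 proof eventually_elim
  case (elim t)
  from elim(1) elim(2) elim(3) show ?case by eventually_elim simp
 qed
 hence "L.toY (weak_dt T (L2 S) q) = ?W" by (rule BL2_AE(2)[OF Sm T max_AE(1)])
 thus "SP.step (L.toY l) (L.toY q) = L.toY q" using L.BH1_van_zero[OF van] by (simp only: step_intop)
qed

lemma state_backward:
 assumes Q: "SP.step (L.toY l) Q = Q" and l: "l\<in>BL2 T (L2 S)"
 shows "is_state T S al be ep f H (%t. emb S (l t)) (L.ofY Q, E.ofY (KY (be *: Q + L.toY l)))"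
proof -
 let ?F = "SP.force (L.toY l) Q"
 let ?W = "(1 / ep) *: SP.N1 (%p. max p 0) ?F"
 let ?q = "L.ofY Q" and ?ph = "E.ofY (KY (be *: Q + L.toY l))"
 have QW: "Q = intop T ?W" using Q step_intop by metis
 note i = L.intop_BH1_van[OF max_AE(1)[of ?F], folded QW]
 have q: "?q\<in>BL2 T (L2 S)" "L.toY ?q = Q" using L.ofY[of Q] i(1) by auto
 have ph: "?ph\<in>BL2 T (H1 S)" by (rule E.ofY)
 have eq: "E.toY ?ph = KY (be *: L.toY ?q + L.toY l)"
  unfolding E.ofY(2) q(2) by (intro RY_KY L_lincomb i(1) L.RY_toY l)
 have "AE t in tm T. AE x in lebesgue_on S. weak_dt T (L2 S) ?q t x = 1 / ep * max (driving_force be f H ?q ?ph t x) 0"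
 proof -
  have "?q\<in>BH1 T (L2 S)" using i(2) by (simp add: BH1_van_def)
  hence "weak_dt T (L2 S) ?q\<in>BL2 T (L2 S)" by (rule L.weak_dt(2))
  from AE_toY[OF Sm T this] driving_force_AE[OF ph q(1) eq] max_AE(2)[of ?F] show ?thesis
   unfolding i(3) q(2)
  proof eventually_elim
   case (elim t)
   from elim(1) elim(2) elim(3) show ?case by eventually_elim simp
  qed
 qed
 moreover have "AE t in tm T. \<forall>ps\<in>elems (H1 S). - al * laplacian S (?ph t) ps + be * emb S (?ph t) ps = be * emb S (?q t) ps + emb S (l t) ps"
  using state_equation_iff[OF ph q(1) l] eq by blast
 ultimately show ?thesis using i(2) ph by (simp add: is_state_def)
qed

lemma solution_op_state:
 assumes l: "l\<in>BL2 T (L2 S)"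
 shows "is_state T S al be ep f H (%t. emb S (l t)) (solution_op T S al be ep f H (%t. emb S (l t)))"
proof -
 obtain Q where "SP.step (L.toY l) Q = Q" using SP.ex_state by blast
 from state_backward[OF this l] show ?thesis unfolding solution_op_def by (rule someI)
qed

definition controls :: "('a tl2 \<times> 'a tl2) set"
 where "controls = {(L.toY dl, L.toY (weak_dt T (L2 S) dl)) | dl. dl\<in>BH1 T (L2 S)}"

lemma zero_BH1: "(%t x. 0)\<in>BH1 T (L2 S)" "L.toY (weak_dt T (L2 S) (%t x. 0)) = 0"
proof -
 have "wd T (intop T (0 :: 'a tl2)) 0" by (rule wd_intop[OF T])
 hence "wd T (L.toY (%t x. 0)) (L.toY (%t x. 0))"
  by (simp add: L.BL2_zero(2) linear_0[OF bounded_linear.linear[OF bounded_linear_intop[OF T]]])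
 from L.BH1I[OF L.BL2_zero(1) L.BL2_zero(1) this]
 show "(%t x. 0)\<in>BH1 T (L2 S)" "L.toY (weak_dt T (L2 S) (%t x. 0)) = 0" by (simp_all add: L.BL2_zero(2))
qed

lemma controls_lincomb:
 assumes "p\<in>controls" "p'\<in>controls"
 shows "p + r *: p'\<in>controls"
proof -
 obtain dl dl' where d: "dl\<in>BH1 T (L2 S)" "p = (L.toY dl, L.toY (weak_dt T (L2 S) dl))"
  "dl'\<in>BH1 T (L2 S)" "p' = (L.toY dl', L.toY (weak_dt T (L2 S) dl'))"
  using assms by (auto simp: controls_def)
 have "p + r *: p' = (L.toY (%t x. dl t x + r * dl' t x), L.toY (weak_dt T (L2 S) (%t x. dl t x + r * dl' t x)))"
  using d L.BH1_lincomb(2)[OF d(1,3), of r] L.BL2_lincomb(2)[OF L.weak_dt(1)[OF d(1)] L.weak_dt(1)[OF d(3)], of r] by simp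
 thus ?thesis using L.BH1_lincomb(1)[OF d(1,3), of r] by (auto simp: controls_def)
qed

lemma subspace_controls: "subspace controls"
proof -
 have 0: "0\<in>controls"
  using zero_BH1 L.BL2_zero(2) by (auto simp: controls_def zero_prod_def intro!: exI[of _ "%t x. 0"])
 show ?thesis unfolding subspace_def
 proof (intro conjI ballI allI 0)
  show "p + p'\<in>controls" if "p\<in>controls" "p'\<in>controls" for p p' using controls_lincomb[OF that, of 1] by simp
  show "r *: p\<in>controls" if "p\<in>controls" for r p using controls_lincomb[OF 0 that, of r] by simp
 qed
qed

lemma KE_props: "inner (KE u) v = inner u (KE v)" "mulop (ind S) (KE e) = KE e"
 "mulop (ind S) h = h ==> KE h = 0 ==> h = 0"
 unfolding KE_def using sol2_sym[OF So al be] sol2_Om[OF So al be] sol2_injective[OF So al be] by auto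

lemma RY_K: "L.RY X = X ==> L.RY (ptw KE X) = ptw KE X"
proof (rule lp2_eqI)
 assume X: "L.RY X = X"
 show "AEL t. ap (L.RY (ptw KE X)) t = ap (ptw KE X) t"
  using L.ap_RY[of "ptw KE X"] ap_ptw[OF SP.KE, of X] L.RY_supp[OF X]
 proof eventually_elim
  case (elim t)
  thus ?case
   by (cases "t\<in>{0<..<T}") (simp_all add: L.V_def proj_L2[OF Ss] KE_props(2) linear_0[OF bounded_linear.linear[OF SP.KE]])
 qed
qed

lemma controls_dense:
 assumes y: "L.RY y = y"
 shows "y\<in>closure ((%p. ptw KE (fst p)) ` controls)"
proof (rule in_closure_if_orthogonal_trivial[where R="{y. L.RY y = y}"])
 note lR = bounded_linear.linear[OF L.RY_linear]
 note lK = bounded_linear.linear[OF bounded_linear_ptw[OF SP.KE, where 'd=real]]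
 show "subspace ((%p. ptw KE (fst p)) ` controls)"
  by (intro linear_subspace_image subspace_controls bounded_linear.linear bounded_linear_compose[OF bounded_linear_ptw[OF SP.KE]] bounded_linear_fst)
 show "(%p. ptw KE (fst p)) ` controls\<subseteq>{y. L.RY y = y}"
  by (auto simp: controls_def intro!: RY_K L.RY_toY L.weak_dt(1))
 show "subspace {y. L.RY y = y}" by (auto simp: subspace_def linear_0[OF lR] linear_add[OF lR] linear_cmul[OF lR])
 show "closed {y. L.RY y = y}"
  by (intro closed_Collect_eq linear_continuous_on L.RY_linear continuous_on_id)
 show "y\<in>{y. L.RY y = y}" using y by simp
 fix u assume "u\<in>{y. L.RY y = y}" and orth: "!!s. s\<in>(%p. ptw KE (fst p)) ` controls ==> inner u s = 0"
 hence u: "L.RY u = u" by simp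
 define W where "W = ptw KE u"
 have W: "L.RY W = W" unfolding W_def by (rule RY_K[OF u])
 have orthW: "inner W (L.toY dl) = 0" if "dl\<in>BH1 T (L2 S)" for dl
 proof -
  have "ptw KE (L.toY dl)\<in>(%p. ptw KE (fst p)) ` controls" using that by (force simp: controls_def)
  hence "inner u (ptw KE (L.toY dl)) = 0" by (rule orth)
  thus ?thesis using inner_ptw[OF SP.KE SP.KE KE_props(1), of u "L.toY dl"] by (simp add: W_def)
 qed
 have "(LL t. ph t *: ap W t) = 0" if ph: "test_function {0<..<T} ph" for ph
 proof -
  note m = multf_sq_int[OF multf_test(1)[OF ph]]
  have "inner (LL t. ph t *: ap W t) e = 0" for e
  proof -
   have "L.RY (mk (%t. ph t *: e)) = mk (%t. ph t *: proj L.V e)"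
   proof (rule lp2_eqI, goal_cases)
    case 1 show ?case
     using L.ap_RY[of "mk (%t. ph t *: e)"] ap_mk[OF m(1)[of e]] ap_mk[OF m(1)[of "proj L.V e"]]
    proof eventually_elim
     case (elim t)
     thus ?case using testD(4)[OF ph, of t]
      by (cases "t\<in>{0<..<T}") (simp_all add: linear_cmul[OF bounded_linear.linear[OF L.projV]])
    qed
   qed
   moreover have "inner W (mk (%t. ph t *: proj L.V e)) = 0"
    using orthW L.test_function_BH1[OF ph proj_in[OF L.V]] by metis
   ultimately have "inner W (mk (%t. ph t *: e)) = 0" using L.RY_sym[of W "mk (%t. ph t *: e)"] W by simp
   thus ?thesis using m(3)[of W e] by simp
  qed
  from this[of "LL t. ph t *: ap W t"] show ?thesis by simp
 qed
 moreover have "(LL t. h t *: ap (0 :: 'a tl2) t) = 0" for h :: "real=>real"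
 proof (rule integral_eq_zero_AE)
  show "AEL t. h t *: ap (0 :: 'a tl2) t = 0"
   using ap_zero[where 'a=real and 'b="('a, real) lp2"] by eventually_elim simp
 qed
 ultimately have wds: "wd T 0 W" "wd T 0 (0 :: 'a tl2)" by (simp_all add: wd_def)
 have "L.RY 0 = 0" by (simp add: linear_0[OF lR])
 hence "W = 0" by (rule wd_unique[OF wds L.RY_supp[OF W] L.RY_supp])
 have "AEL t. ap u t = ap 0 t"
  using ap_ptw[OF SP.KE, of u] ap_zero[where 'a=real and 'b="('a, real) lp2"] L.RY_in_V[OF u] unfolding W_def[symmetric] \<open>W = 0\<close>
 proof eventually_elim
  case (elim t)
  have "mulop (ind S) (ap u t) = ap u t" using elim(3) by (simp add: L.V_def fib_range[OF Ss])
  thus ?case using KE_props(3) elim by simp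
 qed
 thus "u = 0" by (rule lp2_eqI)
qed

end

lemma ex_dirder:
 assumes ns: "nonsmooth_function f nf"
 shows "\<exists>fd. dirder f fd \<and> (\<forall>p q. p\<noteq>nf --> fd p q = deriv f p * q)"
proof -
 have "\<forall>v h. \<exists>l. ((%ta. (f (v + ta * h) - f v) / ta) \<longlongrightarrow> l) (at_right 0)" using ns by (simp add: nonsmooth_function_def)
 then obtain fd where fd: "!!v h. ((%ta. (f (v + ta * h) - f v) / ta) \<longlongrightarrow> fd v h) (at_right 0)" by metis
 have "dirder f fd"
  unfolding dirder_def
 proof (intro allI impI)
  fix p q :: real and ta :: "nat=>real" assume ta: "\<forall>n. 0 < ta n" "ta ----> 0"
  have "filterlim ta (at_right 0) sequentially"
   unfolding filterlim_at using ta by (auto intro!: always_eventually) (metis less_irrefl)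
  from filterlim_compose[OF fd this] show "(%n. inverse (ta n) *: (f (p + ta n *: q) - f p)) ----> fd p q"
   by (simp add: divide_inverse mult.commute)
 qed
 moreover have "fd p q = deriv f p * q" if "p\<noteq>nf" for p q
 proof -
  have "f differentiable (at p)" using ns that by (simp add: nonsmooth_function_def)
  hence "DERIV f p :> deriv f p" by (simp add: DERIV_deriv_iff_real_differentiable)
  hence "DERIV f (p + 0 * q) :> deriv f p" by simp
  moreover have "DERIV (%ta. p + ta * q) 0 :> q" by (auto intro!: derivative_eq_intros)
  ultimately have "DERIV (%ta. f (p + ta * q)) 0 :> deriv f p * q" by (rule DERIV_chain2)
  hence "((%ta. (f (p + ta * q) - f p) / ta) \<longlongrightarrow> deriv f p * q) (at 0)" by (simp add: DERIV_def)
  hence "((%ta. (f (p + ta * q) - f p) / ta) \<longlongrightarrow> deriv f p * q) (at_right 0)" by (rule filterlim_mono) (auto simp: at_le)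
  with fd[of p q] show ?thesis by (intro tendsto_unique[OF trivial_limit_at_right_real])
 qed
 ultimately show ?thesis by blast
qed

context control_problem
begin

lemma gateaux_representation:
 assumes g: "gateaux_deriv T (L2 S) H dH" and q: "qb\<in>BL2 T (L2 S)"
 shows "\<exists>A. bounded_linear A \<and> (\<forall>u\<in>BL2 T (L2 S). dH qb u\<in>BL2 T (L2 S) \<and> L.toY (dH qb u) = A (L.toY u)) \<and>
   (\<forall>h ta. (\<forall>n::nat. 0 < ta n) --> ta ----> 0 -->
    (%n. inverse (ta n) *: (Hc (L.toY qb + ta n *: h) - Hc (L.toY qb))) ----> A h)"
proof -
 have "bounded_op T (L2 S) (dH qb)" using g q by (simp add: gateaux_deriv_def)
 then obtain A where A: "bounded_linear A" "!!u. u\<in>BL2 T (L2 S) ==> dH qb u\<in>BL2 T (L2 S)"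
  "!!u. u\<in>BL2 T (L2 S) ==> L.toY (dH qb u) = A (L.toY u)"
  using L.bounded_op_rep by blast
 show ?thesis
 proof (intro exI[of _ "%U. A (L.RY U)"] conjI ballI allI impI)
  show "bounded_linear (%U. A (L.RY U))" by (rule bounded_linear_compose[OF A(1) L.RY_linear])
  show "dH qb u\<in>BL2 T (L2 S)" "L.toY (dH qb u) = A (L.RY (L.toY u))" if "u\<in>BL2 T (L2 S)" for u
   using A(2,3)[OF that] by (simp_all add: L.RY_toY[OF that])
  fix h0 :: "'a tl2" and ta :: "nat=>real" assume ta: "\<forall>n. 0 < ta n" "ta ----> 0"
  define h where "h = L.ofY h0"
  have h: "h\<in>BL2 T (L2 S)" "L.toY h = L.RY h0" by (simp_all add: h_def L.ofY)
  have lim: "((%ta. nrm_BL2 T (L2 S) (%t x. (H (%t x. qb t x + ta * h t x) t x - H qb t x) / ta - dH qb h t x)) \<longlongrightarrow> 0) (at 0)"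
   using g q h(1) by (simp add: gateaux_deriv_def)
  have eq: "nrm_BL2 T (L2 S) (%t x. (H (%t x. qb t x + r * h t x) t x - H qb t x) / r - dH qb h t x)
   = norm (inverse r *: (Hc (L.toY qb + r *: h0) - Hc (L.toY qb)) - A (L.RY h0))" for r
  proof -
   note c = L.BL2_lincomb[OF q h(1), of r]
   note d = L.BL2_scale[OF L.BL2_diff(1)[OF H_mem[OF c(1)] H_mem[OF q]], of "inverse r"]
   have "L.toY (H (%t x. qb t x + r * h t x)) = Hc (L.toY qb + r *: h0)"
    unfolding Hc_def
    by (rule H_cong[OF c(1) L.ofY(1)])
     (simp add: c(2) h(2) L.ofY(2) linear_add[OF bounded_linear.linear[OF L.RY_linear]] linear_cmul[OF bounded_linear.linear[OF L.RY_linear]] L.RY_toY[OF q])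
   hence "L.toY (%t x. inverse r * (H (%t x. qb t x + r * h t x) t x - H qb t x) - dH qb h t x)
     = inverse r *: (Hc (L.toY qb + r *: h0) - Hc (L.toY qb)) - A (L.RY h0)"
    using L.BL2_diff(2)[OF d(1) A(2)[OF h(1)]] d(2) L.BL2_diff(2)[OF H_mem[OF c(1)] H_mem[OF q]] A(3)[OF h(1)] h(2) Hc_toY[OF q] by simp
   thus ?thesis
    using L.norm_toY[OF L.BL2_diff(1)[OF d(1) A(2)[OF h(1)]]] by (simp add: divide_inverse mult.commute)
  qed
  have "filterlim ta (at 0) sequentially"
   unfolding filterlim_at using ta by (auto intro!: always_eventually simp: less_imp_neq[symmetric])
  from filterlim_compose[OF lim this]
  have "(%n. norm (inverse (ta n) *: (Hc (L.toY qb + ta n *: h0) - Hc (L.toY qb)) - A (L.RY h0))) ----> 0"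
   unfolding eq .
  thus "(%n. inverse (ta n) *: (Hc (L.toY qb + ta n *: h0) - Hc (L.toY qb))) ----> A (L.RY h0)"
   by (simp add: LIM_zero_iff tendsto_norm_zero_iff)
 qed
qed

lemma hilbert_adjoint_toY:
 assumes mem: "!!u. u\<in>BL2 T (L2 S) ==> D u\<in>BL2 T (L2 S)" and A: "!!u. u\<in>BL2 T (L2 S) ==> L.toY (D u) = A (L.toY u)"
  and adj: "!!U W. inner (A U) W = inner U (As W)" and v: "v\<in>BL2 T (L2 S)"
 shows "hilbert_adjoint T S D v\<in>BL2 T (L2 S)" "L.toY (hilbert_adjoint T S D v) = L.RY (As (L.toY v))"
proof -
 have ip: "ip_L2L2 T S (D u) v = inner (L.toY u) (As (L.toY v))" if "u\<in>BL2 T (L2 S)" for u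
  by (simp add: ip_L2L2_eq[OF Ss T mem[OF that] v] A[OF that] adj)
 let ?P = "%w. w\<in>BL2 T (L2 S) \<and> (\<forall>u\<in>BL2 T (L2 S). ip_L2L2 T S (D u) v = ip_L2L2 T S u w)"
 have "?P (L.ofY (As (L.toY v)))"
 proof (intro conjI ballI L.ofY)
  fix u assume u: "u\<in>BL2 T (L2 S)"
  show "ip_L2L2 T S (D u) v = ip_L2L2 T S u (L.ofY (As (L.toY v)))"
   unfolding ip[OF u] ip_L2L2_eq[OF Ss T u L.ofY(1)] L.ofY(2) by (metis L.RY_sym L.RY_toY[OF u])
 qed
 hence P: "?P (hilbert_adjoint T S D v)" unfolding hilbert_adjoint_def by (rule someI[of ?P])
 thus m: "hilbert_adjoint T S D v\<in>BL2 T (L2 S)" by simp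
 define Z where "Z = L.toY (hilbert_adjoint T S D v) - L.RY (As (L.toY v))"
 have "inner U Z = 0" for U
 proof -
  have "inner (L.RY U) (L.toY (hilbert_adjoint T S D v)) = inner (L.RY U) (As (L.toY v))"
   using P ip[OF L.ofY(1)[of U]] ip_L2L2_eq[OF Ss T L.ofY(1)[of U] m] L.ofY[of U] by simp
  hence "inner (L.RY U) (L.toY (hilbert_adjoint T S D v)) = inner U (L.RY (As (L.toY v)))" by (simp add: L.RY_sym)
  moreover have "inner (L.RY U) (L.toY (hilbert_adjoint T S D v)) = inner U (L.toY (hilbert_adjoint T S D v))"
   by (simp add: L.RY_sym L.RY_toY[OF m])
  ultimately show ?thesis by (simp add: Z_def inner_diff_right)
 qed
 from this[of Z] show "L.toY (hilbert_adjoint T S D v) = L.RY (As (L.toY v))" by (simp add: Z_def)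
qed

lemma objective_cong:
 assumes fr: "cont_frechet T (L2 S) (H1 S) j dj"
  and q: "q\<in>BL2 T (L2 S)" "q'\<in>BL2 T (L2 S)" "L.toY q = L.toY q'"
  and ph: "ph\<in>BL2 T (H1 S)" "ph'\<in>BL2 T (H1 S)" "E.toY ph = E.toY ph'"
 shows "j q ph = j q' ph'"
proof -
 let ?h = "%t x. q' t x - q t x" and ?ps = "%t x. ph' t x - ph t x"
 have h: "?h\<in>BL2 T (L2 S)" "nrm_BL2 T (L2 S) ?h = 0" using L.BL2_diff[OF q(2,1)] L.toY_eq_iff[OF q(2,1)] q(3) by auto
 have ps: "?ps\<in>BL2 T (H1 S)" "nrm_BL2 T (H1 S) ?ps = 0" using E.BL2_diff[OF ph(2,1)] E.toY_eq_iff[OF ph(2,1)] ph(3) by auto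
 note D = bspec[OF bspec[OF fr[unfolded cont_frechet_def] q(1)] ph(1)]
 obtain C where C: "\<bar>dj q ph ?h ?ps\<bar>\<le>C * (nrm_BL2 T (L2 S) ?h + nrm_BL2 T (H1 S) ?ps)"
  using D[THEN conjunct2, THEN conjunct1] h(1) ps(1) by blast
 obtain d where d: "d > 0" "\<forall>h\<in>BL2 T (L2 S). \<forall>ps\<in>BL2 T (H1 S). nrm_BL2 T (L2 S) h + nrm_BL2 T (H1 S) ps < d -->
    \<bar>j (%t x. q t x + h t x) (%t y. ph t y + ps t y) - j q ph - dj q ph h ps\<bar>
     \<le>1 * (nrm_BL2 T (L2 S) h + nrm_BL2 T (H1 S) ps)"
  using mp[OF spec[OF D[THEN conjunct2, THEN conjunct2, THEN conjunct1], of 1] zero_less_one] by blast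
 have "(%t x. q t x + ?h t x) = q'" "(%t x. ph t x + ?ps t x) = ph'" by (simp_all add: fun_eq_iff)
 thus ?thesis using C d(1) d(2)[rule_format, OF h(1) ps(1)] by (simp add: h(2) ps(2))
qed

lemma derivative_representation:
 assumes fr: "cont_frechet T (L2 S) (H1 S) j dj" and qb: "qb\<in>BL2 T (L2 S)" and \<phi>b: "\<phi>b\<in>BL2 T (H1 S)"
 shows "\<exists>g \<gamma>. L.RY g = g \<and> E.RY \<gamma> = \<gamma> \<and>
  (\<forall>h\<in>BL2 T (L2 S). \<forall>ps\<in>BL2 T (H1 S). dj qb \<phi>b h ps = inner g (L.toY h) + inner \<gamma> (E.toY ps))"
proof -
 note D = bspec[OF bspec[OF fr[unfolded cont_frechet_def] qb] \<phi>b]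
 have lin: "dj qb \<phi>b (%t x. a * h t x + h' t x) (%t y. a * ps t y + ps' t y) = a * dj qb \<phi>b h ps + dj qb \<phi>b h' ps'"
  if "h\<in>BL2 T (L2 S)" "h'\<in>BL2 T (L2 S)" "ps\<in>BL2 T (H1 S)" "ps'\<in>BL2 T (H1 S)" for a h h' ps ps'
  using D[THEN conjunct1] that by blast
 obtain C where C: "!!h ps. h\<in>BL2 T (L2 S) ==> ps\<in>BL2 T (H1 S) ==> \<bar>dj qb \<phi>b h ps\<bar>\<le>C * (nrm_BL2 T (L2 S) h + nrm_BL2 T (H1 S) ps)"
  using D[THEN conjunct2, THEN conjunct1] by blast
 have n0: "nrm_BL2 T (L2 S) (%t x. 0) = 0" "nrm_BL2 T (H1 S) (%t x. 0) = 0"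
  using L.norm_toY[OF L.BL2_zero(1)] E.norm_toY[OF E.BL2_zero(1)] by (simp_all add: L.BL2_zero(2) E.BL2_zero(2))
 have "\<exists>g. L.RY g = g \<and> (\<forall>h\<in>BL2 T (L2 S). dj qb \<phi>b h (%t x. 0) = inner g (L.toY h))"
 proof (rule L.riesz_time[where C=C])
  show "dj qb \<phi>b (%t x. a * h t x + h' t x) (%t x. 0) = a * dj qb \<phi>b h (%t x. 0) + dj qb \<phi>b h' (%t x. 0)"
   if "h\<in>BL2 T (L2 S)" "h'\<in>BL2 T (L2 S)" for a h h'
   using lin[OF that E.BL2_zero(1) E.BL2_zero(1), of a] by simp
  show "\<bar>dj qb \<phi>b h (%t x. 0)\<bar>\<le>C * nrm_BL2 T (L2 S) h" if "h\<in>BL2 T (L2 S)" for h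
   using C[OF that E.BL2_zero(1)] by (simp add: n0)
 qed
 then obtain g where g: "L.RY g = g" "!!h. h\<in>BL2 T (L2 S) ==> dj qb \<phi>b h (%t x. 0) = inner g (L.toY h)" by blast
 have "\<exists>\<gamma>. E.RY \<gamma> = \<gamma> \<and> (\<forall>ps\<in>BL2 T (H1 S). dj qb \<phi>b (%t x. 0) ps = inner \<gamma> (E.toY ps))"
 proof (rule E.riesz_time[where C=C])
  show "dj qb \<phi>b (%t x. 0) (%t x. a * h t x + h' t x) = a * dj qb \<phi>b (%t x. 0) h + dj qb \<phi>b (%t x. 0) h'"
   if "h\<in>BL2 T (H1 S)" "h'\<in>BL2 T (H1 S)" for a h h'
   using lin[OF L.BL2_zero(1) L.BL2_zero(1) that, of a] by simp
  show "\<bar>dj qb \<phi>b (%t x. 0) h\<bar>\<le>C * nrm_BL2 T (H1 S) h" if "h\<in>BL2 T (H1 S)" for h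
   using C[OF L.BL2_zero(1) that] by (simp add: n0)
 qed
 then obtain \<gamma> where \<gamma>: "E.RY \<gamma> = \<gamma>" "!!ps. ps\<in>BL2 T (H1 S) ==> dj qb \<phi>b (%t x. 0) ps = inner \<gamma> (E.toY ps)" by blast
 have "dj qb \<phi>b h ps = inner g (L.toY h) + inner \<gamma> (E.toY ps)" if h: "h\<in>BL2 T (L2 S)" and ps: "ps\<in>BL2 T (H1 S)" for h ps
  using lin[OF h L.BL2_zero(1) E.BL2_zero(1) ps, of 1] g(2)[OF h] \<gamma>(2)[OF ps] by simp
 thus ?thesis using g(1) \<gamma>(1) by blast
qed

definition reduced :: "((real=>'a=>real)=>(real=>'a=>real)=>real)=>'a tl2=>'a tl2=>real"
 where "reduced j U l = j (L.ofY U) (E.ofY (KY (be *: U + l)))"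

lemma reduced_eq:
 assumes fr: "cont_frechet T (L2 S) (H1 S) j dj" and q: "q\<in>BL2 T (L2 S)" and ph: "ph\<in>BL2 T (H1 S)"
  and U: "L.RY U = L.toY q" and X: "E.RY (KY (be *: U + l)) = E.toY ph"
 shows "reduced j U l = j q ph"
 unfolding reduced_def by (rule objective_cong[OF fr]) (simp_all add: L.ofY E.ofY q ph U X)

definition adj :: "(real, ('a, real \<times> 'a) lp2) lp2=>'a tl2"
 where "adj \<gamma> = ptw (ptw fst) (ptw (sol1 S al be) \<gamma>)"

lemma inner_KY: "inner \<gamma> (KY X) = inner (adj \<gamma>) X"
proof -
 have "inner \<gamma> (KY X) = inner (ptw (sol1 S al be) \<gamma>) (ptw iota X)"
  unfolding KY_def by (rule inner_ptw[OF sol1_bl sol1_bl, symmetric]) (rule sol1_sym[OF So al be])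
 also have "... = inner (adj \<gamma>) X"
  unfolding adj_def by (rule inner_ptw[OF ptw_fst_linear iota_linear, symmetric]) (metis inner_iota inner_commute)
 finally show ?thesis .
qed

lemma reduced_derivative:
 assumes fr: "cont_frechet T (L2 S) (H1 S) j dj" and qb: "qb\<in>BL2 T (L2 S)" and \<phi>b: "\<phi>b\<in>BL2 T (H1 S)"
  and g: "L.RY g = g" and \<gamma>: "E.RY \<gamma> = \<gamma>"
  and dj: "!!h ps. h\<in>BL2 T (L2 S) ==> ps\<in>BL2 T (H1 S) ==> dj qb \<phi>b h ps = inner g (L.toY h) + inner \<gamma> (E.toY ps)"
  and eq: "E.toY \<phi>b = KY (be *: L.toY qb + l)" and e: "e > 0"
 shows "\<exists>d>0. \<forall>a c. norm a + norm c < d -->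
   \<bar>reduced j (L.toY qb + a) (l + c) - reduced j (L.toY qb) l - (inner g a + inner (adj \<gamma>) (be *: a + c))\<bar>\<le>e * (norm a + norm c)"
proof -
 obtain \<kappa> where \<kappa>: "\<kappa> > 0" "!!X. norm (KY X)\<le>norm X * \<kappa>" using bounded_linear.pos_bounded[OF KY_linear] by blast
 define M where "M = 1 + (be + 1) * \<kappa>"
 have M: "M > 0" using \<kappa>(1) be by (simp add: M_def add_pos_pos)
 hence "e / M > 0" using e by simp
 from mp[OF spec[OF bspec[OF bspec[OF fr[unfolded cont_frechet_def] qb] \<phi>b, THEN conjunct2, THEN conjunct2, THEN conjunct1], of "e / M"] this]
 obtain d where d: "d > 0" "\<forall>h\<in>BL2 T (L2 S). \<forall>ps\<in>BL2 T (H1 S). nrm_BL2 T (L2 S) h + nrm_BL2 T (H1 S) ps < d -->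
    \<bar>j (%t x. qb t x + h t x) (%t y. \<phi>b t y + ps t y) - j qb \<phi>b - dj qb \<phi>b h ps\<bar>
     \<le>(e / M) * (nrm_BL2 T (L2 S) h + nrm_BL2 T (H1 S) ps)" by blast
 show ?thesis
 proof (intro exI[of _ "d / M"] conjI allI impI)
  show "d / M > 0" using d(1) M by simp
  fix a c :: "'a tl2" assume ac: "norm a + norm c < d / M"
  define h where "h = L.ofY a"
  define X where "X = be *: a + c"
  define ps where "ps = E.ofY (KY X)"
  have h: "h\<in>BL2 T (L2 S)" "L.toY h = L.RY a" and ps: "ps\<in>BL2 T (H1 S)" "E.toY ps = E.RY (KY X)"
   by (simp_all add: h_def ps_def L.ofY E.ofY)
  have nX: "norm X\<le>be * norm a + norm c" unfolding X_def using norm_triangle_ineq[of "be *: a" c] be by simp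
  have "nrm_BL2 T (L2 S) h + nrm_BL2 T (H1 S) ps = norm (L.RY a) + norm (E.RY (KY X))"
   using L.norm_toY[OF h(1)] E.norm_toY[OF ps(1)] h(2) ps(2) by simp
  also have "...\<le>norm a + norm X * \<kappa>"
   using L.norm_RY_le[of a] E.norm_RY_le[of "KY X"] \<kappa>(2)[of X] by linarith
  also have "...\<le>norm a + (be * norm a + norm c) * \<kappa>" using nX \<kappa>(1) by (simp add: mult_right_mono)
  also have "...\<le>M * (norm a + norm c)"
  proof -
   have "0\<le>norm c + be * norm c * \<kappa> + norm a * \<kappa>" using be \<kappa>(1) by simp
   thus ?thesis by (simp add: M_def algebra_simps)
  qed
  finally have n: "nrm_BL2 T (L2 S) h + nrm_BL2 T (H1 S) ps\<le>M * (norm a + norm c)" .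
  also have "M * (norm a + norm c) < d" using ac M by (simp add: field_simps)
  finally have "\<bar>j (%t x. qb t x + h t x) (%t y. \<phi>b t y + ps t y) - j qb \<phi>b - dj qb \<phi>b h ps\<bar>
     \<le>(e / M) * (nrm_BL2 T (L2 S) h + nrm_BL2 T (H1 S) ps)" by (rule d(2)[rule_format, OF h(1) ps(1)])
  also have "...\<le>(e / M) * (M * (norm a + norm c))" using n e M by (intro mult_left_mono) simp_all
  also have "... = e * (norm a + norm c)" using M by simp
  finally have b: "\<bar>j (%t x. qb t x + h t x) (%t y. \<phi>b t y + ps t y) - j qb \<phi>b - dj qb \<phi>b h ps\<bar>\<le>e * (norm a + norm c)" .
  have lE: "linear E.RY" "linear KY" "linear L.RY" using bounded_linear.linear E.RY_linear KY_linear L.RY_linear by blast+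
  have r1: "reduced j (L.toY qb + a) (l + c) = j (%t x. qb t x + h t x) (%t y. \<phi>b t y + ps t y)"
  proof (rule reduced_eq[OF fr L.BL2_add(1)[OF qb h(1)] E.BL2_add(1)[OF \<phi>b ps(1)]])
   show "L.RY (L.toY qb + a) = L.toY (%t x. qb t x + h t x)"
    by (simp add: L.BL2_add(2)[OF qb h(1)] linear_add[OF lE(3)] L.RY_toY[OF qb] h(2))
   have "be *: (L.toY qb + a) + (l + c) = (be *: L.toY qb + l) + X" by (simp add: X_def scaleR_add_right algebra_simps)
   hence "KY (be *: (L.toY qb + a) + (l + c)) = E.toY \<phi>b + KY X" by (simp only: linear_add[OF lE(2)] eq)
   thus "E.RY (KY (be *: (L.toY qb + a) + (l + c))) = E.toY (%t y. \<phi>b t y + ps t y)"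
    by (simp add: E.BL2_add(2)[OF \<phi>b ps(1)] linear_add[OF lE(1)] E.RY_toY[OF \<phi>b] ps(2))
  qed
  have r0: "reduced j (L.toY qb) l = j qb \<phi>b"
   by (rule reduced_eq[OF fr qb \<phi>b]) (simp_all add: L.RY_toY[OF qb] E.RY_toY[OF \<phi>b] eq[symmetric])
  have "inner g (L.RY a) = inner g a" using L.RY_sym[of g a] g by simp
  moreover have "inner \<gamma> (E.RY (KY X)) = inner (adj \<gamma>) X" using E.RY_sym[of \<gamma> "KY X"] \<gamma> inner_KY[of \<gamma> X] by simp
  ultimately have "dj qb \<phi>b h ps = inner g a + inner (adj \<gamma>) (be *: a + c)"
   using dj[OF h(1) ps(1)] h(2) ps(2) by (simp add: X_def)
  thus "\<bar>reduced j (L.toY qb + a) (l + c) - reduced j (L.toY qb) l - (inner g a + inner (adj \<gamma>) (be *: a + c))\<bar>\<le>e * (norm a + norm c)"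
   using b r1 r0 by simp
 qed
qed

lemma objective_solution:
 assumes fr: "cont_frechet T (L2 S) (H1 S) j dj" and l: "l\<in>BH1 T (L2 S)" and Q: "SP.step (L.toY l) Q = Q"
 shows "objective T S j (solution_op T S al be ep f H (%t. emb S (l t))) l
  = reduced j Q (L.toY l) + 1 / 2 * ((norm (L.toY l))^2 + (norm (L.toY (weak_dt T (L2 S) l)))^2)"
proof -
 note l2 = L.weak_dt(1)[OF l]
 obtain q ph where s: "solution_op T S al be ep f H (%t. emb S (l t)) = (q, ph)" by fastforce
 note st = state_forward[OF solution_op_state[OF l2, unfolded s] l2]
 have tq: "L.toY q = Q" by (rule SP.state_unique[OF st(4) Q])
 have e: "KY (be *: Q + L.toY l) = E.toY ph" using st(3) tq by simp
 have "reduced j Q (L.toY l) = j q ph"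
  by (rule reduced_eq[OF fr st(1,2)]) (use L.RY_toY[OF st(1)] tq in \<open>simp_all add: e E.RY_toY[OF st(2)]\<close>)
 thus ?thesis by (simp add: objective_def s L.nrm_BH1_square[OF l])
qed

lemma reduced_optimality:
 assumes fr: "cont_frechet T (L2 S) (H1 S) j dj" and lo: "local_optimum T S al be ep f H j lb"
  and Qb: "SP.step (L.toY lb) Qb = Qb" and b: "(b, b')\<in>controls"
 shows "\<exists>t0>0. \<forall>t Q. 0 < t --> t < t0 --> SP.step (L.toY lb + t *: b) Q = Q -->
    reduced j Qb (L.toY lb) + 1/2 * ((norm (L.toY lb))^2 + (norm (L.toY (weak_dt T (L2 S) lb)))^2)
    \<le>reduced j Q (L.toY lb + t *: b) + 1/2 * ((norm (L.toY lb + t *: b))^2 + (norm (L.toY (weak_dt T (L2 S) lb) + t *: b'))^2)"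
proof -
 have lb: "lb\<in>BH1 T (L2 S)" using lo by (simp add: local_optimum_def)
 obtain r where r: "r > 0" "!!l. l\<in>BH1 T (L2 S) ==> nrm_BH1 T (L2 S) (%t x. l t x - lb t x) < r ==>
    objective T S j (solution_op T S al be ep f H (%t. emb S (lb t))) lb\<le>objective T S j (solution_op T S al be ep f H (%t. emb S (l t))) l"
  using lo unfolding local_optimum_def by blast
 obtain dl where dl: "dl\<in>BH1 T (L2 S)" "b = L.toY dl" "b' = L.toY (weak_dt T (L2 S) dl)" using b by (auto simp: controls_def)
 define m where "m = 1 + nrm_BH1 T (L2 S) dl"
 have m: "m\<ge>1" by (simp add: m_def nrm_BH1_def)
 show ?thesis
 proof (intro exI[of _ "r / m"] conjI allI impI)
  show "r / m > 0" using r m by simp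
  fix t Q assume t: "0 < t" "t < r / m" and Q: "SP.step (L.toY lb + t *: b) Q = Q"
  define l where "l = (%s x. lb s x + t * dl s x)"
  have l: "l\<in>BH1 T (L2 S)" "L.toY l = L.toY lb + t *: b" "L.toY (weak_dt T (L2 S) l) = L.toY (weak_dt T (L2 S) lb) + t *: b'"
   using L.BH1_lincomb[OF lb dl(1), of t] L.BL2_lincomb(2)[OF L.weak_dt(1)[OF lb] L.weak_dt(1)[OF dl(1)], of t] dl by (simp_all add: l_def)
  have "(%s x. l s x - lb s x) = (%s x. 0 + t * dl s x)" by (simp add: l_def)
  moreover have "nrm_BH1 T (L2 S) (%s x. 0 + t * dl s x) = t * nrm_BH1 T (L2 S) dl"
  proof (rule power2_eq_imp_eq)
   have "(nrm_BH1 T (L2 S) (%s x. 0 + t * dl s x))^2 = (norm (t *: L.toY dl))^2 + (norm (t *: L.toY (weak_dt T (L2 S) dl)))^2"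
    using L.nrm_BH1_square[OF L.BH1_lincomb(1)[OF zero_BH1(1) dl(1), of t]] L.BH1_lincomb(2)[OF zero_BH1(1) dl(1), of t]
     L.BL2_lincomb(2)[OF L.BL2_zero(1) L.weak_dt(1)[OF dl(1)], of t] by (simp add: zero_BH1(2) L.BL2_zero(2))
   also have "... = (t * nrm_BH1 T (L2 S) dl)^2" by (simp add: power_mult_distrib L.nrm_BH1_square[OF dl(1)] distrib_left)
   finally show "(nrm_BH1 T (L2 S) (%s x. 0 + t * dl s x))^2 = (t * nrm_BH1 T (L2 S) dl)^2" .
  qed (use t in \<open>simp_all add: nrm_BH1_def\<close>)
  moreover have "t * nrm_BH1 T (L2 S) dl < r"
  proof -
   have "t * nrm_BH1 T (L2 S) dl\<le>t * m" using t by (simp add: m_def)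
   also have "... < r" using t m by (simp add: field_simps)
   finally show ?thesis .
  qed
  ultimately have "nrm_BH1 T (L2 S) (%s x. l s x - lb s x) < r" by simp
  from r(2)[OF l(1) this] objective_solution[OF fr lb Qb] objective_solution[OF fr l(1), of Q] Q
  show "reduced j Qb (L.toY lb) + 1/2 * ((norm (L.toY lb))^2 + (norm (L.toY (weak_dt T (L2 S) lb)))^2)
    \<le>reduced j Q (L.toY lb + t *: b) + 1/2 * ((norm (L.toY lb + t *: b))^2 + (norm (L.toY (weak_dt T (L2 S) lb) + t *: b'))^2)"
   by (simp add: l(2,3))
 qed
qed

end

lemma (in control_problem) optimality_system:
 assumes dH: "gateaux_deriv T (L2 S) H dH" and ns: "nonsmooth_function f nf"
  and fr: "cont_frechet T (L2 S) (H1 S) j dj" and lo: "local_optimum T S al be ep f H j lb"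
  and st: "is_state T S al be ep f H (%t. emb S (lb t)) (qb, \<phi>b)" and zb: "zb = driving_force be f H qb \<phi>b"
 shows "\<exists>\<xi>\<in>BH1_van T T (L2 S). \<exists>w\<in>BL2 T (H1 S). \<exists>lam\<in>BLinf T (L2 S). \<exists>\<mu>\<in>BLinf T (L2 S).
  (\<exists>g. represents_L2L2 T S g (%h. dj qb \<phi>b h (%t x. 0)) \<and>
    (AE t in tm T. AE x in lebesgue_on S.
     - weak_dt T (L2 S) \<xi> t x - be * (w t x - lam t x) + hilbert_adjoint T S (dH qb) \<mu> t x = g t x)) \<and>
  (\<exists>G. represents_L2H1 T S G (%ps. dj qb \<phi>b (%t x. 0) ps) \<and>
    (AE t in tm T. \<forall>ps\<in>elems (H1 S).
     - al * laplacian S (w t) ps + be * emb S (%x. w t x - lam t x) ps = G t ps)) \<and>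
  (AE t in tm T. AE x in lebesgue_on S. zb t x\<noteq>0 -->
    lam t x = 1 / ep * ind {(t, x). zb t x > 0} (t, x) * \<xi> t x) \<and>
  (AE t in tm T. AE x in lebesgue_on S. H qb t x\<noteq>nf --> \<mu> t x = deriv f (H qb t x) * lam t x) \<and>
  (\<forall>dll\<in>BH1 T (L2 S). ip_L2L2 T S w dll + ip_H1L2 T S lb dll = 0)"
proof -
 have lb: "lb\<in>BH1 T (L2 S)" using lo by (simp add: local_optimum_def)
 note lb2 = L.weak_dt(1)[OF lb]
 note state = state_forward[OF st lb2]
 note qb = state(1) and \<phi>b = state(2)
 obtain A where A: "bounded_linear A" "!!u. u\<in>BL2 T (L2 S) ==> dH qb u\<in>BL2 T (L2 S)"
   "!!u. u\<in>BL2 T (L2 S) ==> L.toY (dH qb u) = A (L.toY u)"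
  and Alim: "!!h ta. (\<forall>n::nat. 0 < ta n) ==> ta ----> 0 ==>
    (%n. inverse (ta n) *: (Hc (L.toY qb + ta n *: h) - Hc (L.toY qb))) ----> A h"
  using gateaux_representation[OF dH qb] by blast
 obtain As where As: "!!u v. inner (A u) v = inner u (As v)" using ex_adjoint[OF A(1)] by blast
 obtain fd where fd: "dirder f fd" "!!p q. p\<noteq>nf ==> fd p q = deriv f p * q" using ex_dirder[OF ns] by blast
 obtain g \<gamma> where g: "L.RY g = g" and \<gamma>: "E.RY \<gamma> = \<gamma>"
  and djr: "!!h ps. h\<in>BL2 T (L2 S) ==> ps\<in>BL2 T (H1 S) ==> dj qb \<phi>b h ps = inner g (L.toY h) + inner \<gamma> (E.toY ps)"
  using derivative_representation[OF fr qb \<phi>b] by blast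
 have R_eq: "mulop (ind {0<..<T}) (ptw (mulop (ind S)) U) = L.RY U" for U :: "'a tl2"
  by (rule RY_L2[OF Sm T, symmetric])
 have lin: "linearized_problem T be ep Lf LH S f KE Hc fd A (L.toY qb) (L.toY lb)"
  by (rule linearized_problem.intro[OF SP.state_problem_axioms], rule linearized_problem_axioms.intro)
   (rule fd(1) A(1) Alim state(4); assumption?)+
 have fdiff: "p\<noteq>nf ==> f differentiable at p" for p using ns by (simp add: nonsmooth_function_def)
 have "(b, b')\<in>controls ==> L.RY b = b" for b b' by (auto simp: controls_def intro: L.RY_toY L.weak_dt(1))
 note ctl = this[folded R_eq] and dense = controls_dense[folded R_eq]
 interpret O: optimality T be ep Lf LH S f KE Hc fd A "L.toY qb" "L.toY lb" nf g "adj \<gamma>" "L.toY (weak_dt T (L2 S) lb)" controls "reduced j" As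
  by (rule optimality.intro[OF lin], rule optimality_axioms.intro)
   (rule fd(2) fdiff KE_props As subspace_controls ctl dense reduced_derivative[OF fr qb \<phi>b g \<gamma> djr state(3)]
     reduced_optimality[OF fr lo state(4)]; assumption?)+
 have OR: "O.R U = L.RY U" for U by (simp add: O.R_def O.PE_def R_eq)
 obtain lam mu where lam: "L.RY lam = lam" and mu: "L.RY mu = mu"
  and grad: "!!b b'. (b, b')\<in>controls ==> inner (adj \<gamma> + be *: SP.K lam) b + inner (L.toY lb) b + inner (L.toY (weak_dt T (L2 S) lb)) b' = 0"
  and lamC: "\<exists>C. AEL t. t\<in>{0<..<T} --> norm (ap lam t)\<le>C"
  and muC: "\<exists>C. AEL t. t\<in>{0<..<T} --> norm (ap mu t)\<le>C"
  and neg: "SP.N2 O.Gneg O.zb lam = 0"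
  and pos: "SP.N2 O.Gpos O.zb ((1 / ep) *: coint T (g + be *: (adj \<gamma> + be *: SP.K lam - lam) - As mu) - lam) = 0"
  and pt: "SP.N2 O.Gpt (Hc (L.toY qb)) (mu - SP.N2 O.Gder (Hc (L.toY qb)) lam) = mu - SP.N2 O.Gder (Hc (L.toY qb)) lam"
  using O.multipliers unfolding OR by blast
 define \<Gamma> where "\<Gamma> = \<gamma> + be *: ptw iota lam"
 define W where "W = ptw (sol1 S al be) \<Gamma>"
 define w where "w = E.ofY W"
 define lamf where "lamf = L.ofY lam"
 define muf where "muf = L.ofY mu"
 define Wl where "Wl = adj \<gamma> + be *: SP.K lam"
 have \<Gamma>0: "AEL t. t\<notin>{0<..<T} --> ap \<Gamma> t = 0"
  using E.RY_supp[OF \<gamma>] ap_iota_supp[OF L.RY_supp[OF lam]] ap_add[of \<gamma> "be *: ptw iota lam"] ap_scaleR[of be "ptw iota lam"]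
  unfolding \<Gamma>_def by eventually_elim simp
 have w: "w\<in>BL2 T (H1 S)" "E.toY w = W" using E.ofY[of W] sol1_RY[OF So al be T \<Gamma>0] by (simp_all add: w_def W_def)
 note lS = bounded_linear.linear[OF bounded_linear_ptw[OF sol1_bl]] and lF = bounded_linear.linear[OF bounded_linear_ptw[OF ptw_fst_linear]]
 have "ptw (ptw fst) W = Wl"
  by (simp add: W_def \<Gamma>_def Wl_def adj_def linear_add[OF lS] linear_cmul[OF lS] linear_add[OF lF] linear_cmul[OF lF] K_KY[symmetric] KY_def)
 hence wL: "w\<in>BL2 T (L2 S)" "L.toY w = Wl" using toY_fst[OF w(1)] by (simp_all add: w(2))
 have lamf: "lamf\<in>BL2 T (L2 S)" "L.toY lamf = lam" and muf: "muf\<in>BL2 T (L2 S)" "L.toY muf = mu"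
  using L.ofY[of lam] L.ofY[of mu] by (simp_all add: lamf_def muf_def lam mu)
 define gf where "gf = L.ofY g"
 have gf: "gf\<in>BL2 T (L2 S)" "L.toY gf = g" using L.ofY[of g] by (simp_all add: gf_def g)
 let ?ad = "hilbert_adjoint T S (dH qb) muf"
 have ad: "?ad\<in>BL2 T (L2 S)" "L.toY ?ad = L.RY (As mu)"
  using hilbert_adjoint_toY[of "dH qb" A As muf] A(2,3) As muf by auto
 define \<rho> where "\<rho> = (g + be *: (Wl + (- 1) *: lam)) + (- 1) *: L.RY (As mu)"
 define \<rho>0 where "\<rho>0 = g + be *: (Wl - lam) - As mu"
 note lR = bounded_linear.linear[OF L.RY_linear]
 have RWl: "L.RY Wl = Wl" using L.RY_toY[OF wL(1)] wL(2) by simp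
 have R\<rho>0: "L.RY \<rho>0 = \<rho>"
  by (simp add: \<rho>0_def \<rho>_def linear_add[OF lR] linear_diff[OF lR] linear_cmul[OF lR] RWl lam g)
 have R\<rho>: "L.RY \<rho> = \<rho>" using L.RY_RY[of \<rho>0] R\<rho>0 by simp
 define \<xi> where "\<xi> = L.ofY (coint T \<rho>)"
 note \<xi>van = L.coint_BH1_van[OF R\<rho>, folded \<xi>_def]
 have \<xi>H: "\<xi>\<in>BH1 T (L2 S)" using \<xi>van(2) by (simp add: BH1_van_def)

 have c1: "represents_L2L2 T S gf (%h. dj qb \<phi>b h (%t x. 0))"
  unfolding represents_L2L2_def using djr[OF _ E.BL2_zero(1)] gf
  by (simp add: ip_L2L2_eq[OF Ss T gf(1)] E.BL2_zero(2))
 have e1: "AE t in tm T. AE x in lebesgue_on S. - weak_dt T (L2 S) \<xi> t x - be * (w t x - lamf t x) + ?ad t x = gf t x"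
 proof -
  note b1 = L.BL2_lincomb[OF wL(1) lamf(1), of "- 1"]
  note b2 = L.BL2_lincomb[OF gf(1) b1(1), of be]
  note b3 = L.BL2_lincomb[OF b2(1) ad(1), of "- 1"]
  note b4 = L.BL2_scale[OF L.weak_dt(2)[OF \<xi>H], of "- 1"]
  have "L.toY (%t x. gf t x + be * (w t x + - 1 * lamf t x) + - 1 * ?ad t x) = L.toY (%t x. - 1 * weak_dt T (L2 S) \<xi> t x)"
   by (subst b3(2), subst b2(2), subst b1(2), subst b4(2), simp only: \<xi>van(3) gf(2) wL(2) lamf(2) ad(2))
    (simp add: \<rho>_def)
  from AE_toY_eq[OF Sm T b3(1) b4(1) this] show ?thesis
  proof eventually_elim
   case (elim t)
   thus ?case by eventually_elim (simp add: algebra_simps)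
  qed
 qed
 have c2: "represents_L2H1 T S (%t. E.dfun (ap \<gamma> t)) (%ps. dj qb \<phi>b (%t x. 0) ps)"
  unfolding represents_L2H1_def using E.BL2_dual[OF \<gamma>] djr[OF L.BL2_zero(1)] E.inner_toY[of _ \<gamma>]
  by (simp add: L.BL2_zero(2) E.dfun_def)
 have e2: "AE t in tm T. \<forall>ps\<in>elems (H1 S). - al * laplacian S (w t) ps + be * emb S (%x. w t x - lamf t x) ps = E.dfun (ap \<gamma> t) ps"
 proof -
  have "AE t in tm T. \<forall>ps\<in>elems (H1 S). - al * laplacian S (w t) ps + be * emb S (w t) ps = inner (ap \<Gamma> t) (c1 S ps)"
   using elliptic_time_iff[OF So al be T w(1) \<Gamma>0] w(2) by (simp add: W_def)
  thus ?thesis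
   unfolding AE_tm
   using L.BL2D(1)[OF lamf(1)] L.BL2D(1)[OF wL(1)] L.ap_toY[OF lamf(1)] ap_add[of \<gamma> "be *: ptw iota lam"] ap_scaleR[of be "ptw iota lam"] ap_ptw[OF iota_linear, of lam]
  proof eventually_elim
   case (elim t)
   show ?case
   proof (intro impI ballI)
    fix ps assume t: "t\<in>{0<..<T}" and ps: "ps\<in>elems (H1 S)"
    note li = bounded_linear.linear[OF iota_linear]
    have m: "lamf t\<in>elems (L2 S)" "w t\<in>elems (L2 S)" using elim t by auto
    have 1: "- al * laplacian S (w t) ps + be * emb S (w t) ps = inner (ap \<Gamma> t) (c1 S ps)" using elim(1) t ps by blast
    have 2: "ap \<Gamma> t = ap \<gamma> t + be *: iota (fib S (lamf t))" using elim t by (simp add: \<Gamma>_def lamf(2))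
    have 3: "emb S (%x. w t x - lamf t x) ps = emb S (w t) ps - emb S (lamf t) ps"
     using emb_iota[OF So al be _ ps] m by (simp add: L.sub_mem L.c_diff linear_diff[OF li] inner_diff_left)
    show "- al * laplacian S (w t) ps + be * emb S (%x. w t x - lamf t x) ps = E.dfun (ap \<gamma> t) ps"
     using 1 emb_iota[OF So al be m(1) ps] by (simp add: 2 3 E.dfun_def inner_add_left right_diff_distrib)
   qed
  qed
 qed
 have a_lam: "AE t in tm T. AE x in lebesgue_on S. lamf t x = ap (ap lam t) x"
  using AE_toY[OF Sm T lamf(1)] by (simp add: lamf(2))
 have e3: "AE t in tm T. AE x in lebesgue_on S. zb t x\<noteq>0 --> lamf t x = 1 / ep * ind {(t, x). zb t x > 0} (t, x) * \<xi> t x"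
 proof -
  define X where "X = (1 / ep) *: coint T \<rho>0"
  have z: "AE t in tm T. AE x in lebesgue_on S. zb t x = ap (ap O.zb t) x"
   using driving_force_AE[OF \<phi>b qb state(3)] by (simp add: zb O.zb_def)
  have p: "SP.N2 O.Gpos O.zb (X + (- 1) *: lam) = 0" using pos by (simp add: X_def \<rho>0_def Wl_def)
  have "L.toY \<xi> = L.RY (coint T \<rho>0)" by (simp add: \<xi>_def L.ofY L.RY_coint R\<rho>0 \<xi>van(1) R\<rho>)
  hence \<xi>1: "AE t in tm T. AE x in lebesgue_on S. \<xi> t x = ap (ap (L.RY (coint T \<rho>0)) t) x"
   using AE_toY[OF Sm T L.weak_dt(1)[OF \<xi>H]] by simp
  have \<xi>2: "AE t in tm T. AE x in lebesgue_on S. L.ofY (coint T \<rho>0) t x = ap (ap (L.RY (coint T \<rho>0)) t) x"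
   using AE_toY[OF Sm T L.ofY(1)[of "coint T \<rho>0"]] by (simp add: L.ofY(2))
  show ?thesis
   using z a_lam \<xi>1 \<xi>2 AE_ofY[OF Sm T, of "coint T \<rho>0"] AE_ap_scaleR[OF Sm T, of "1 / ep" "coint T \<rho>0", folded X_def]
    AE_ap_lincomb[OF Sm T, of X "- 1" lam] AE_nem2[OF Sm T O.adms(1), of O.zb "X + (- 1) *: lam", unfolded p]
    AE_nem2[OF Sm T O.adms(2), of O.zb lam, unfolded neg] AE_ap_zero[OF Sm T]
  proof eventually_elim
   case (elim t)
   from elim(1) elim(2) elim(3) elim(4) elim(5) elim(6) elim(7) elim(8) elim(9) elim(10) show ?case
   proof eventually_elim
    case (elim x)
    show ?case
    proof
     assume "zb t x\<noteq>0"
     then consider "zb t x > 0" | "zb t x < 0" by linarith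
     thus "lamf t x = 1 / ep * ind {(t, x). zb t x > 0} (t, x) * \<xi> t x"
     proof cases
      case 1
      hence "ap (ap (X + (- 1) *: lam) t) x = 0" using elim(1,8,10) by (simp add: O.Gpos_def)
      hence "ap (ap lam t) x = ap (ap X t) x" using elim(7) by linarith
      thus ?thesis using 1 elim(2,3,4,5,6) by simp
     next
      case 2
      hence "ap (ap lam t) x = 0" using elim(1,9,10) by (simp add: O.Gneg_def)
      thus ?thesis using 2 elim(2) by simp
     qed
    qed
   qed
  qed
 qed
 have e4: "AE t in tm T. AE x in lebesgue_on S. H qb t x\<noteq>nf --> muf t x = deriv f (H qb t x) * lamf t x"
 proof -
  define N where "N = SP.N2 O.Gder (L.toY (H qb)) lam"
  have Y: "SP.N2 O.Gpt (L.toY (H qb)) (mu + (- 1) *: N) = mu + (- 1) *: N" using pt by (simp add: N_def Hc_toY[OF qb])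
  have a_mu: "AE t in tm T. AE x in lebesgue_on S. muf t x = ap (ap mu t) x"
   using AE_toY[OF Sm T muf(1)] by (simp add: muf(2))
  show ?thesis
   using AE_toY[OF Sm T H_mem[OF qb]] a_lam a_mu AE_nem2[OF Sm T O.adms(3), of "L.toY (H qb)" "mu + (- 1) *: N", unfolded Y]
    AE_nem2[OF Sm T O.adms(4), of "L.toY (H qb)" lam, folded N_def] AE_ap_lincomb[OF Sm T, of mu "- 1" N]
  proof eventually_elim
   case (elim t)
   from elim(1) elim(2) elim(3) elim(4) elim(5) elim(6) show ?case
   proof eventually_elim
    case (elim x)
    show ?case
    proof
     assume n: "H qb t x\<noteq>nf"
     hence "ap (ap (mu + (- 1) *: N) t) x = 0" using elim(1,4) by (simp add: O.Gpt_def)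
     hence "ap (ap mu t) x = ap (ap N t) x" using elim(6) by linarith
     thus "muf t x = deriv f (H qb t x) * lamf t x" using elim(1,2,3,5) n by (simp add: O.Gder_def)
    qed
   qed
  qed
 qed
 have e5: "ip_L2L2 T S w dl + ip_H1L2 T S lb dl = 0" if dl: "dl\<in>BH1 T (L2 S)" for dl
 proof -
  have "(L.toY dl, L.toY (weak_dt T (L2 S) dl))\<in>controls" using dl by (auto simp: controls_def)
  from grad[OF this] show ?thesis
   by (simp add: ip_H1L2_def ip_L2L2_eq[OF Ss T] wL L.weak_dt[OF dl] L.weak_dt[OF lb] Wl_def)
 qed
 have lI: "lamf\<in>BLinf T (L2 S)" and mI: "muf\<in>BLinf T (L2 S)"
  using lamC muC L.BLinfI[OF lamf(1)] L.BLinfI[OF muf(1)] by (auto simp: lamf(2) muf(2))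
 show ?thesis
  by (rule bexI[OF _ \<xi>van(2)], rule bexI[OF _ w(1)], rule bexI[OF _ lI], rule bexI[OF _ mI])
   (intro conjI ballI exI[of _ gf] exI[of _ "%t. E.dfun (ap \<gamma> t)"] c1 e1 c2 e2 e3 e4 e5)
qed

theorem proposition3p10:
  fixes T \<alpha> \<beta> \<epsilon> nf :: real
    and \<Omega> :: "(real ^ 'n) set"
    and f :: "real \<Rightarrow> real"
    and H :: "(real \<Rightarrow> real ^ 'n \<Rightarrow> real) \<Rightarrow> (real \<Rightarrow> real ^ 'n \<Rightarrow> real)"
    and dH :: "(real \<Rightarrow> real ^ 'n \<Rightarrow> real) \<Rightarrow> (real \<Rightarrow> real ^ 'n \<Rightarrow> real) \<Rightarrow> (real \<Rightarrow> real ^ 'n \<Rightarrow> real)"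
    and j :: "(real \<Rightarrow> real ^ 'n \<Rightarrow> real) \<Rightarrow> (real \<Rightarrow> real ^ 'n \<Rightarrow> real) \<Rightarrow> real"
    and dj :: "(real \<Rightarrow> real ^ 'n \<Rightarrow> real) \<Rightarrow> (real \<Rightarrow> real ^ 'n \<Rightarrow> real) \<Rightarrow>
               (real \<Rightarrow> real ^ 'n \<Rightarrow> real) \<Rightarrow> (real \<Rightarrow> real ^ 'n \<Rightarrow> real) \<Rightarrow> real"
    and lb qb \<phi>b zb :: "real \<Rightarrow> real ^ 'n \<Rightarrow> real"
  assumes "CARD('n) \<in> {2, 3}"
    and "T > 0" and "\<alpha> > 0" and "\<beta> > 0" and "\<epsilon> > 0"
    and "bounded \<Omega>" and "lipschitz_domain \<Omega>"
    and "history_operator T \<Omega> H dH"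
    and "nonsmooth_function f nf"
    and "cont_frechet T (L2 \<Omega>) (H1 \<Omega>) j dj"
    and "local_optimum T \<Omega> \<alpha> \<beta> \<epsilon> f H j lb"
    and "is_state T \<Omega> \<alpha> \<beta> \<epsilon> f H (\<lambda>t. emb \<Omega> (lb t)) (qb, \<phi>b)"
    and "zb = driving_force \<beta> f H qb \<phi>b"
  shows "\<exists>\<xi>\<in>BH1_van T T (L2 \<Omega>). \<exists>w\<in>BL2 T (H1 \<Omega>). \<exists>lam\<in>BLinf T (L2 \<Omega>). \<exists>\<mu>\<in>BLinf T (L2 \<Omega>).
    (\<exists>g. represents_L2L2 T \<Omega> g (\<lambda>h. dj qb \<phi>b h (\<lambda>t x. 0)) \<and>
       (AE t in tm T. AE x in lebesgue_on \<Omega>.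
          - weak_dt T (L2 \<Omega>) \<xi> t x - \<beta> * (w t x - lam t x) + hilbert_adjoint T \<Omega> (dH qb) \<mu> t x
            = g t x)) \<and>
    (\<exists>G. represents_L2H1 T \<Omega> G (\<lambda>\<psi>. dj qb \<phi>b (\<lambda>t x. 0) \<psi>) \<and>
       (AE t in tm T. \<forall>\<psi>\<in>elems (H1 \<Omega>).
          - \<alpha> * laplacian \<Omega> (w t) \<psi> + \<beta> * emb \<Omega> (\<lambda>x. w t x - lam t x) \<psi> = G t \<psi>)) \<and>
    (AE t in tm T. AE x in lebesgue_on \<Omega>. zb t x \<noteq> 0 \<longrightarrow>
       lam t x = 1 / \<epsilon> * indicator {(t, x). zb t x > 0} (t, x) * \<xi> t x) \<and>
    (AE t in tm T. AE x in lebesgue_on \<Omega>. H qb t x \<noteq> nf \<longrightarrow>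
       \<mu> t x = deriv f (H qb t x) * lam t x) \<and>
    (\<forall>\<delta>l\<in>BH1 T (L2 \<Omega>). ip_L2L2 T \<Omega> w \<delta>l + ip_H1L2 T \<Omega> lb \<delta>l = 0)"
proof -
 have So: "open \<Omega>" using assms(7) by (simp add: lipschitz_domain_def)
 have Sm: "\<Omega>\<in>lmeasurable" by (rule lmeasurable_open[OF assms(6) So])
 obtain Lf where Lf: "Lf > 0" "Lf-lipschitz_on UNIV f" using assms(9) unfolding nonsmooth_function_def by blast
 have X: "L2 \<Omega>\<in>{L2 \<Omega>, Linf \<Omega>}" by simp
 note hist = bspec[OF assms(8)[unfolded history_operator_def, THEN conjunct1] X]
 obtain LH where LH: "LH > 0" "\<forall>q1\<in>BL2 T (L2 \<Omega>). \<forall>q2\<in>BL2 T (L2 \<Omega>). AE t in tm T.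
      nrm (L2 \<Omega>) (%x. H q1 t x - H q2 t x)\<le>LH * (LINT s|lebesgue_on {0<..<t}. nrm (L2 \<Omega>) (%x. q1 s x - q2 s x))"
  using hist by blast
 interpret control_problem T \<alpha> \<beta> \<epsilon> Lf LH \<Omega> f H
 proof (rule control_problem.intro)
  show "\<bar>f p - f q\<bar>\<le>Lf * \<bar>p - q\<bar>" for p q using lipschitz_onD[OF Lf(2), of p q] by (simp add: dist_real_def)
  show "H q\<in>BL2 T (L2 \<Omega>)" if "q\<in>BL2 T (L2 \<Omega>)" for q using hist that by blast
  show "AE t in tm T. nrm (L2 \<Omega>) (%x. H q1 t x - H q2 t x)\<le>LH * (LINT s|lebesgue_on {0<..<t}. nrm (L2 \<Omega>) (%x. q1 s x - q2 s x))"
   if "q1\<in>BL2 T (L2 \<Omega>)" "q2\<in>BL2 T (L2 \<Omega>)" for q1 q2 using LH(2) that by blast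
 qed (use assms So Sm Lf(1) LH(1) in auto)
 have "gateaux_deriv T (L2 \<Omega>) H dH" using assms(8) by (simp add: history_operator_def)
 from optimality_system[OF this assms(9-13)] show ?thesis .
qed

end
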